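(* Let $\mathrm{VBun}_{\mathrm{Dfg}}:\mathrm{Dfg}^{\mathrm{op}}\to\mathrm{Cat}_{\mathrm L}$ be the pseudo-functor which assigns to a diffeological space its category of diffeological vector bundles and to a morphism the pullback functor. (1) There are a strict functor $\iota^*\mathrm{VBun}_{str}:\mathrm{Dfg}^{\mathrm{op}}\to\mathrm{Cat}_{\mathrm L}$, given by $$(\iota^*\mathrm{VBun}_{str})(X)=\mathrm{holim}^{\mathrm{Cat}_{\mathrm L}}\big((\mathrm{Cart}_{/X})^{\mathrm{op}}\to\mathrm{Cart}^{\mathrm{op}}\xrightarrow{\mathrm{VBun}_{triv}}\mathrm{Cat}_{\mathrm L}\big),$$ and an objectwise equivalence of pseudo-functors $\mathrm{Dfg}^{\mathrm{op}}\to\mathrm{Cat}_{\mathrm L}$ $$\mathcal A:\iota^*\mathrm{VBun}_{str}\xrightarrow{\ \sim\ }\mathrm{VBun}_{\mathrm{Dfg}}.$$ (2) Diffeological vector bundles satisfy descent along subductions of diffeological spaces: for each subduction $\pi:Y\to X$, the canonical functor from $\mathrm{VBun}_{\mathrm{Dfg}}(X)$ to the descent category of $\mathrm{VBun}_{\mathrm{Dfg}}$ along $\pi$ is an equivalence.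
   Context: Universes $\mathrm S\in\mathrm L$ (small, large sets); $\mathrm{Cat}_{\mathrm L}$ is the (2-)category of large categories. $\mathrm{Cart}$ is the small category of submanifolds of $\mathbb R^\infty$ diffeomorphic to some $\mathbb R^n$, with smooth maps. A family $\{\iota_i:c_i\to c\}_{i\in I}$ is a covering in $\tau_{dgop}$ (a differentiably good open covering) if the $\iota_i$ are open embeddings that jointly cover $c$ and every non-empty finite intersection of the $\iota_i(c_i)$ is a cartesian space (diffeomorphic to some $\mathbb R^n$). A diffeological space is a small concrete sheaf on $(\mathrm{Cart},\tau_{dgop})$: a sheaf $X:\mathrm{Cart}^{\mathrm{op}}\to\mathrm{Set}_{\mathrm S}$ such that $X(c)\to\mathrm{Set}_{\mathrm S}(c,X( * ))$ is injective for all $c$, where $*=\mathbb R^0$; so $X$ is a set $X( * )$ (also denoted $X$) with specified plots $c\to X( * )$. $\mathrm{Dfg}$ is the full subcategory of $\widehat{\mathrm{Cart}}=\mathrm{Fun}(\mathrm{Cart}^{\mathrm{op}},\mathrm{Set}_{\mathrm S})$ on diffeological spaces, with inclusion $\iota$. A subduction is a morphism $\pi:Y\to X$ in $\mathrm{Dfg}$ such that for each plot $\varphi:c\to X$ there are a covering $\{f_j:c_j\to c\}$ in $\tau_{dgop}$ and plots $\varphi_j:c_j\to Y$ with $\pi\varphi_j=\varphi f_j$. A diffeological (complex) vector bundle on $X$ is a morphism $\pi:E\to X$ in $\mathrm{Dfg}$ with a $\mathbb C$-vector space structure on each fibre $E_{|x}=\pi^{-1}(\{x\})$, such that for each plot $\varphi:c\to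 X$ there are $k\in\mathbb N_0$ (the rank) and an isomorphism of diffeological spaces $\Phi:c\times\mathbb C^k\to c\times_XE$ over $c$ whose restriction $\mathbb C^k\to E_{|\varphi(y)}$ is linear for every $y\in c$. Morphisms are morphisms of diffeological spaces over $X$ that are fibrewise linear. For $f:X'\to X$, $f^*E=X'\times_XE$. $\mathrm{VBun}_{triv}:\mathrm{Cart}^{\mathrm{op}}\to\mathrm{Cat}_{\mathrm L}$ is the strict functor with objects of $\mathrm{VBun}_{triv}(c)$ the numbers $n\in\mathbb N_0$, morphisms $n\to m$ the smooth maps $c\to\mathrm{Mat}(m\times n,\mathbb C)$ (composition is pointwise matrix multiplication), and pullback by precomposition. $\mathrm{Cart}_{/X}$ is the category of plots of $X$; the homotopy limit is taken in the canonical model structure on $\mathrm{Cat}_{\mathrm L}$. Concretely, an object is a pair $(n,h)$ of ranks $n(\varphi)\in\mathbb N_0$ for each plot $\varphi$ and, for each morphism $f:\varphi_0\to\varphi_1$ of plots ($\varphi_0:c_0\to X$), a smooth map $h_f:c_0\to\mathrm{GL}(n(\varphi_0),\mathbb C)$ (with $n(\varphi_0)=n(\varphi_1)$), compatible with identities and composition; morphisms are families of smooth matrix-valued functions, indexed by plots, intertwining the $h_f$. The descent category of $\mathrm{VBun}_{\mathrm{Dfg}}$ along $\pi:Y\to X$ has objects vector bundles $E$ on $Y$ with an isomorphism between the two pullbacks to $Y\times_XY$ satisfying the cocycle condition on $Y\times_XY\times_XY$, and morphisms the compatible bundle morphisms. *)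

theory Defs
  imports "HOL-Analysis.Analysis" "HOL-Analysis.Finite_Function_Topology"
    "Jordan_Normal_Form.VS_Connect"
begin

section \<open>Categories, functors, equivalences\<close>

text \<open>Composition is written in the order \<open>Cmp C x y z g f\<close> for \<open>f : x \<rightarrow> y\<close> and \<open>g : y \<rightarrow> z\<close>. The
  objects are passed along because the same raw element may be a morphism between several pairs of
  objects (for instance, a function between carriers).\<close>

record ('o, 'm) category =
  Obj :: "'o set"
  Hom :: "'o \<Rightarrow> 'o \<Rightarrow> 'm set"
  Id :: "'o \<Rightarrow> 'm"
  Cmp :: "'o \<Rightarrow> 'o \<Rightarrow> 'o \<Rightarrow> 'm \<Rightarrow> 'm \<Rightarrow> 'm"

definition is_category :: "('o, 'm) category \<Rightarrow> bool" where
  "is_category C \<longleftrightarrow>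
     (\<forall>x\<in>Obj C. Id C x \<in> Hom C x x) \<and>
     (\<forall>x\<in>Obj C. \<forall>y\<in>Obj C. \<forall>z\<in>Obj C. \<forall>f\<in>Hom C x y. \<forall>g\<in>Hom C y z. Cmp C x y z g f \<in> Hom C x z) \<and>
     (\<forall>x\<in>Obj C. \<forall>y\<in>Obj C. \<forall>f\<in>Hom C x y.
        Cmp C x x y f (Id C x) = f \<and> Cmp C x y y (Id C y) f = f) \<and>
     (\<forall>w\<in>Obj C. \<forall>x\<in>Obj C. \<forall>y\<in>Obj C. \<forall>z\<in>Obj C. \<forall>f\<in>Hom C w x. \<forall>g\<in>Hom C x y. \<forall>h\<in>Hom C y z.
        Cmp C w x z (Cmp C x y z h g) f = Cmp C w y z h (Cmp C w x y g f))"

definition inverse_arrows :: "('o, 'm) category \<Rightarrow> 'o \<Rightarrow> 'o \<Rightarrow> 'm \<Rightarrow> 'm \<Rightarrow> bool" where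
  "inverse_arrows C x y f g \<longleftrightarrow> f \<in> Hom C x y \<and> g \<in> Hom C y x \<and>
     Cmp C x y x g f = Id C x \<and> Cmp C y x y f g = Id C y"

definition Iso :: "('o, 'm) category \<Rightarrow> 'o \<Rightarrow> 'o \<Rightarrow> 'm set" where
  "Iso C x y = {f. \<exists>g. inverse_arrows C x y f g}"

definition Inv :: "('o, 'm) category \<Rightarrow> 'o \<Rightarrow> 'o \<Rightarrow> 'm \<Rightarrow> 'm" where
  "Inv C x y f = (THE g. inverse_arrows C x y f g)"

definition arrows :: "('o, 'm) category \<Rightarrow> ('o \<times> 'o \<times> 'm) set" where
  "arrows C = {(x, y, f). x \<in> Obj C \<and> y \<in> Obj C \<and> f \<in> Hom C x y}"

record ('o, 'm, 'p, 'n) func =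
  FO :: "'o \<Rightarrow> 'p"
  FM :: "'o \<Rightarrow> 'o \<Rightarrow> 'm \<Rightarrow> 'n"

definition is_functor ::
    "('o, 'm) category \<Rightarrow> ('p, 'n) category \<Rightarrow> ('o, 'm, 'p, 'n) func \<Rightarrow> bool" where
  "is_functor C D F \<longleftrightarrow> is_category C \<and> is_category D \<and>
     (\<forall>x\<in>Obj C. FO F x \<in> Obj D) \<and>
     (\<forall>x\<in>Obj C. \<forall>y\<in>Obj C. \<forall>f\<in>Hom C x y. FM F x y f \<in> Hom D (FO F x) (FO F y)) \<and>
     (\<forall>x\<in>Obj C. FM F x x (Id C x) = Id D (FO F x)) \<and>
     (\<forall>x\<in>Obj C. \<forall>y\<in>Obj C. \<forall>z\<in>Obj C. \<forall>f\<in>Hom C x y. \<forall>g\<in>Hom C y z.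
        FM F x z (Cmp C x y z g f) =
        Cmp D (FO F x) (FO F y) (FO F z) (FM F y z g) (FM F x y f))"

definition id_func :: "('o, 'm, 'o, 'm) func" where
  "id_func = \<lparr> FO = \<lambda>x. x, FM = \<lambda>x y f. f \<rparr>"

definition comp_func ::
    "('p, 'n, 'q, 'k) func \<Rightarrow> ('o, 'm, 'p, 'n) func \<Rightarrow> ('o, 'm, 'q, 'k) func" where
  "comp_func G F = \<lparr> FO = \<lambda>x. FO G (FO F x), FM = \<lambda>x y f. FM G (FO F x) (FO F y) (FM F x y f) \<rparr>"

definition natural_iso ::
    "('o, 'm) category \<Rightarrow> ('p, 'n) category \<Rightarrow> ('o, 'm, 'p, 'n) func \<Rightarrow> ('o, 'm, 'p, 'n) func \<Rightarrow>
     ('o \<Rightarrow> 'n) \<Rightarrow> bool" where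
  "natural_iso C D F G \<eta> \<longleftrightarrow>
     (\<forall>x\<in>Obj C. \<eta> x \<in> Iso D (FO F x) (FO G x)) \<and>
     (\<forall>x\<in>Obj C. \<forall>y\<in>Obj C. \<forall>f\<in>Hom C x y.
        Cmp D (FO F x) (FO F y) (FO G y) (\<eta> y) (FM F x y f) =
        Cmp D (FO F x) (FO G x) (FO G y) (FM G x y f) (\<eta> x))"

definition is_equivalence ::
    "('o, 'm) category \<Rightarrow> ('p, 'n) category \<Rightarrow> ('o, 'm, 'p, 'n) func \<Rightarrow> bool" where
  "is_equivalence C D F \<longleftrightarrow> is_functor C D F \<and>
     (\<exists>G \<eta> \<epsilon>. is_functor D C G \<and>
        natural_iso C C id_func (comp_func G F) \<eta> \<and>
        natural_iso D D (comp_func F G) id_func \<epsilon>)"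

section \<open>Category-valued strict functors and pseudo-functors\<close>

text \<open>The data of a contravariant assignment of categories: for \<open>f : a \<rightarrow> b\<close>, the functor
  \<open>Res F a b f\<close> goes from \<open>Val F b\<close> to \<open>Val F a\<close>.\<close>

record ('a, 'f, 'o, 'm) diagram =
  Val :: "'a \<Rightarrow> ('o, 'm) category"
  Res :: "'a \<Rightarrow> 'a \<Rightarrow> 'f \<Rightarrow> ('o, 'm, 'o, 'm) func"

definition strict_functor_op :: "('a, 'f) category \<Rightarrow> ('a, 'f, 'o, 'm) diagram \<Rightarrow> bool" where
  "strict_functor_op C D \<longleftrightarrow> is_category C \<and>
     (\<forall>a\<in>Obj C. is_category (Val D a)) \<and>
     (\<forall>a\<in>Obj C. \<forall>b\<in>Obj C. \<forall>f\<in>Hom C a b. is_functor (Val D b) (Val D a) (Res D a b f)) \<and>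
     (\<forall>a\<in>Obj C. \<forall>x\<in>Obj (Val D a).
        FO (Res D a a (Id C a)) x = x \<and>
        (\<forall>y\<in>Obj (Val D a). \<forall>u\<in>Hom (Val D a) x y. FM (Res D a a (Id C a)) x y u = u)) \<and>
     (\<forall>a\<in>Obj C. \<forall>b\<in>Obj C. \<forall>c\<in>Obj C. \<forall>f\<in>Hom C a b. \<forall>g\<in>Hom C b c. \<forall>x\<in>Obj (Val D c).
        FO (Res D a c (Cmp C a b c g f)) x = FO (comp_func (Res D a b f) (Res D b c g)) x \<and>
        (\<forall>y\<in>Obj (Val D c). \<forall>u\<in>Hom (Val D c) x y.
           FM (Res D a c (Cmp C a b c g f)) x y u =
           FM (comp_func (Res D a b f) (Res D b c g)) x y u))"

text \<open>The coherence isomorphisms of a pseudo-functor are \<open>Unt F a x : x \<rightarrow> id\<^sub>a\<^sup>* x\<close> and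
  \<open>Cmb F a b c f g x : f\<^sup>* (g\<^sup>* x) \<rightarrow> (g \<circ> f)\<^sup>* x\<close> for \<open>f : a \<rightarrow> b\<close> and \<open>g : b \<rightarrow> c\<close>.\<close>

record ('a, 'f, 'o, 'm) pseudo = "('a, 'f, 'o, 'm) diagram" +
  Unt :: "'a \<Rightarrow> 'o \<Rightarrow> 'm"
  Cmb :: "'a \<Rightarrow> 'a \<Rightarrow> 'a \<Rightarrow> 'f \<Rightarrow> 'f \<Rightarrow> 'o \<Rightarrow> 'm"

definition pseudofunctor_op :: "('a, 'f) category \<Rightarrow> ('a, 'f, 'o, 'm) pseudo \<Rightarrow> bool" where
  "pseudofunctor_op C F \<longleftrightarrow> is_category C \<and>
     (\<forall>a\<in>Obj C. is_category (Val F a)) \<and>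
     (\<forall>a\<in>Obj C. \<forall>b\<in>Obj C. \<forall>f\<in>Hom C a b. is_functor (Val F b) (Val F a) (Res F a b f)) \<and>
     (\<forall>a\<in>Obj C. natural_iso (Val F a) (Val F a) id_func (Res F a a (Id C a)) (Unt F a)) \<and>
     (\<forall>a\<in>Obj C. \<forall>b\<in>Obj C. \<forall>c\<in>Obj C. \<forall>f\<in>Hom C a b. \<forall>g\<in>Hom C b c.
        natural_iso (Val F c) (Val F a) (comp_func (Res F a b f) (Res F b c g))
          (Res F a c (Cmp C a b c g f)) (Cmb F a b c f g)) \<and>
     (\<forall>a\<in>Obj C. \<forall>b\<in>Obj C. \<forall>f\<in>Hom C a b. \<forall>x\<in>Obj (Val F b).
        let fx = FO (Res F a b f) x in
        Cmp (Val F a) fx (FO (Res F a a (Id C a)) fx) fx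
          (Cmb F a a b (Id C a) f x) (Unt F a fx) = Id (Val F a) fx) \<and>
     (\<forall>a\<in>Obj C. \<forall>b\<in>Obj C. \<forall>f\<in>Hom C a b. \<forall>x\<in>Obj (Val F b).
        let fx = FO (Res F a b f) x; ix = FO (Res F b b (Id C b)) x in
        Cmp (Val F a) fx (FO (Res F a b f) ix) fx
          (Cmb F a b b f (Id C b) x) (FM (Res F a b f) x ix (Unt F b x)) = Id (Val F a) fx) \<and>
     (\<forall>a\<in>Obj C. \<forall>b\<in>Obj C. \<forall>c\<in>Obj C. \<forall>d\<in>Obj C.
        \<forall>f\<in>Hom C a b. \<forall>g\<in>Hom C b c. \<forall>h\<in>Hom C c d. \<forall>x\<in>Obj (Val F d).
        let hx = FO (Res F c d h) x;
            ghx = FO (Res F b c g) hx;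
            hgx = FO (Res F b d (Cmp C b c d h g)) x;
            fghx = FO (Res F a b f) ghx;
            all = FO (Res F a d (Cmp C a b d (Cmp C b c d h g) f)) x
        in
        Cmp (Val F a) fghx (FO (Res F a b f) hgx) all
          (Cmb F a b d f (Cmp C b c d h g) x)
          (FM (Res F a b f) ghx hgx (Cmb F b c d g h x))
        = Cmp (Val F a) fghx (FO (Res F a c (Cmp C a b c g f)) hx) all
          (Cmb F a c d (Cmp C a b c g f) h x)
          (Cmb F a b c f g hx))"

definition as_pseudo :: "('a, 'f, 'o, 'm) diagram \<Rightarrow> ('a, 'f, 'o, 'm) pseudo" where
  "as_pseudo D = \<lparr> Val = Val D, Res = Res D,
     Unt = \<lambda>a x. Id (Val D a) x,
     Cmb = \<lambda>a b c f g x. Id (Val D a) (FO (Res D a b f) (FO (Res D b c g) x)) \<rparr>"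

text \<open>Morphisms of pseudo-functors (pseudo-natural transformations): functors \<open>Cpt A a\<close> together with
  natural isomorphisms \<open>Sq A a b f x : f\<^sup>* (A\<^sub>b x) \<rightarrow> A\<^sub>a (f\<^sup>* x)\<close> for \<open>f : a \<rightarrow> b\<close>.\<close>

record ('a, 'f, 'o, 'm, 'p, 'n) pseudo_trans =
  Cpt :: "'a \<Rightarrow> ('o, 'm, 'p, 'n) func"
  Sq :: "'a \<Rightarrow> 'a \<Rightarrow> 'f \<Rightarrow> 'o \<Rightarrow> 'n"

definition pseudonatural_op ::
    "('a, 'f) category \<Rightarrow> ('a, 'f, 'o, 'm) pseudo \<Rightarrow> ('a, 'f, 'p, 'n) pseudo \<Rightarrow>
     ('a, 'f, 'o, 'm, 'p, 'n) pseudo_trans \<Rightarrow> bool" where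
  "pseudonatural_op C F G A \<longleftrightarrow> pseudofunctor_op C F \<and> pseudofunctor_op C G \<and>
     (\<forall>a\<in>Obj C. is_functor (Val F a) (Val G a) (Cpt A a)) \<and>
     (\<forall>a\<in>Obj C. \<forall>b\<in>Obj C. \<forall>f\<in>Hom C a b.
        natural_iso (Val F b) (Val G a)
          (comp_func (Res G a b f) (Cpt A b)) (comp_func (Cpt A a) (Res F a b f)) (Sq A a b f)) \<and>
     (\<forall>a\<in>Obj C. \<forall>x\<in>Obj (Val F a).
        let Ax = FO (Cpt A a) x; ix = FO (Res F a a (Id C a)) x in
        Cmp (Val G a) Ax (FO (Res G a a (Id C a)) Ax) (FO (Cpt A a) ix)
          (Sq A a a (Id C a) x) (Unt G a Ax)
        = FM (Cpt A a) x ix (Unt F a x)) \<and>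
     (\<forall>a\<in>Obj C. \<forall>b\<in>Obj C. \<forall>c\<in>Obj C. \<forall>f\<in>Hom C a b. \<forall>g\<in>Hom C b c. \<forall>x\<in>Obj (Val F c).
        let Ax = FO (Cpt A c) x;
            gx = FO (Res F b c g) x;
            fgx = FO (Res F a b f) gx;
            gf = Cmp C a b c g f;
            gfx = FO (Res F a c gf) x;
            gAx = FO (Res G b c g) Ax;
            fgAx = FO (Res G a b f) gAx;
            Agx = FO (Cpt A b) gx
        in
        Cmp (Val G a) fgAx (FO (Res G a c gf) Ax) (FO (Cpt A a) gfx)
          (Sq A a c gf x) (Cmb G a b c f g Ax)
        = Cmp (Val G a) fgAx (FO (Cpt A a) fgx) (FO (Cpt A a) gfx)
            (FM (Cpt A a) fgx gfx (Cmb F a b c f g x))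
            (Cmp (Val G a) fgAx (FO (Res G a b f) Agx) (FO (Cpt A a) fgx)
               (Sq A a b f gx)
               (FM (Res G a b f) gAx Agx (Sq A b c g x))))"

definition objectwise_equivalence_op ::
    "('a, 'f) category \<Rightarrow> ('a, 'f, 'o, 'm) pseudo \<Rightarrow> ('a, 'f, 'p, 'n) pseudo \<Rightarrow>
     ('a, 'f, 'o, 'm, 'p, 'n) pseudo_trans \<Rightarrow> bool" where
  "objectwise_equivalence_op C F G A \<longleftrightarrow> pseudonatural_op C F G A \<and>
     (\<forall>a\<in>Obj C. is_equivalence (Val F a) (Val G a) (Cpt A a))"

definition reindex ::
    "('i, 'k, 'a, 'f) func \<Rightarrow> ('a, 'f, 'o, 'm) diagram \<Rightarrow> ('i, 'k, 'o, 'm) diagram" where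
  "reindex P D = \<lparr> Val = \<lambda>i. Val D (FO P i), Res = \<lambda>i j f. Res D (FO P i) (FO P j) (FM P i j f) \<rparr>"

text \<open>The homotopy limit, in the canonical model structure on categories, of a strict functor
  \<open>J\<^sup>o\<^sup>p \<rightarrow> Cat\<close>: objects are families \<open>x\<^sub>a\<close> with coherent isomorphisms \<open>h\<^sub>f : x\<^sub>a \<rightarrow> f\<^sup>* x\<^sub>b\<close> for
  \<open>f : a \<rightarrow> b\<close> in \<open>J\<close>. All families are taken to be undefined off their index sets, so that equality of
  objects and morphisms is the intended one.\<close>

definition holim_obj ::
    "('i, 'k) category \<Rightarrow> ('i, 'k, 'o, 'm) diagram \<Rightarrow> (('i \<Rightarrow> 'o) \<times> ('i \<times> 'i \<times> 'k \<Rightarrow> 'm)) set" where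
  "holim_obj J D = {(x, h). x \<in> (\<Pi>\<^sub>E a\<in>Obj J. Obj (Val D a)) \<and> h \<in> extensional (arrows J) \<and>
     (\<forall>(a, b, f)\<in>arrows J. h (a, b, f) \<in> Iso (Val D a) (x a) (FO (Res D a b f) (x b))) \<and>
     (\<forall>a\<in>Obj J. h (a, a, Id J a) = Id (Val D a) (x a)) \<and>
     (\<forall>a\<in>Obj J. \<forall>b\<in>Obj J. \<forall>c\<in>Obj J. \<forall>f\<in>Hom J a b. \<forall>g\<in>Hom J b c.
        h (a, c, Cmp J a b c g f) =
        Cmp (Val D a) (x a) (FO (Res D a b f) (x b)) (FO (Res D a b f) (FO (Res D b c g) (x c)))
          (FM (Res D a b f) (x b) (FO (Res D b c g) (x c)) (h (b, c, g)))
          (h (a, b, f)))}"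

definition holim_hom ::
    "('i, 'k) category \<Rightarrow> ('i, 'k, 'o, 'm) diagram \<Rightarrow>
     ('i \<Rightarrow> 'o) \<times> ('i \<times> 'i \<times> 'k \<Rightarrow> 'm) \<Rightarrow> ('i \<Rightarrow> 'o) \<times> ('i \<times> 'i \<times> 'k \<Rightarrow> 'm) \<Rightarrow> ('i \<Rightarrow> 'm) set" where
  "holim_hom J D = (\<lambda>(x, h) (y, k).
     {u. u \<in> (\<Pi>\<^sub>E a\<in>Obj J. Hom (Val D a) (x a) (y a)) \<and>
       (\<forall>(a, b, f)\<in>arrows J.
          Cmp (Val D a) (x a) (y a) (FO (Res D a b f) (y b)) (k (a, b, f)) (u a) =
          Cmp (Val D a) (x a) (FO (Res D a b f) (x b)) (FO (Res D a b f) (y b))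
            (FM (Res D a b f) (x b) (y b) (u b)) (h (a, b, f)))})"

definition holim ::
    "('i, 'k) category \<Rightarrow> ('i, 'k, 'o, 'm) diagram \<Rightarrow>
     (('i \<Rightarrow> 'o) \<times> ('i \<times> 'i \<times> 'k \<Rightarrow> 'm), 'i \<Rightarrow> 'm) category" where
  "holim J D = \<lparr>
     Obj = holim_obj J D,
     Hom = holim_hom J D,
     Id = \<lambda>(x, h). \<lambda>a\<in>Obj J. Id (Val D a) (x a),
     Cmp = \<lambda>(x, h) (y, k) (z, l) v u. \<lambda>a\<in>Obj J. Cmp (Val D a) (x a) (y a) (z a) (v a) (u a) \<rparr>"

text \<open>The functor \<open>holim J D \<rightarrow> holim J' (reindex P D)\<close> induced by \<open>P : J' \<rightarrow> J\<close>.\<close>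

definition holim_restrict ::
    "('j, 'l) category \<Rightarrow> ('j, 'l, 'i, 'k) func \<Rightarrow>
     (('i \<Rightarrow> 'o) \<times> ('i \<times> 'i \<times> 'k \<Rightarrow> 'm), 'i \<Rightarrow> 'm, ('j \<Rightarrow> 'o) \<times> ('j \<times> 'j \<times> 'l \<Rightarrow> 'm), 'j \<Rightarrow> 'm) func" where
  "holim_restrict J' P = \<lparr>
     FO = \<lambda>(x, h). (\<lambda>a\<in>Obj J'. x (FO P a),
                    \<lambda>(a, b, f)\<in>arrows J'. h (FO P a, FO P b, FM P a b f)),
     FM = \<lambda>_ _ u. \<lambda>a\<in>Obj J'. u (FO P a) \<rparr>"

section \<open>Smooth maps between subsets of \<open>\<real>\<^sup>\<infinity>\<close>\<close>

text \<open>\<open>\<real>\<^sup>\<infinity>\<close> is the space of finitely supported real sequences with the colimit topology of the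
  subspaces \<open>\<real>\<^sup>n\<close>. This is not the library topology of \<^typ>\<open>nat \<Rightarrow>\<^sub>0 real\<close>, which comes from the
  sum norm; on each \<open>\<real>\<^sup>n\<close> the two agree.\<close>

type_synonym rinf = "nat \<Rightarrow>\<^sub>0 real"

definition RN :: "nat \<Rightarrow> rinf set" where
  "RN n = {x. \<forall>i\<ge>n. Poly_Mapping.lookup x i = 0}"

definition rinf_open :: "rinf set \<Rightarrow> bool" where
  "rinf_open U \<longleftrightarrow> (\<forall>n. openin (top_of_set (RN n)) (U \<inter> RN n))"

definition Rinf :: "rinf topology" where
  "Rinf = topology rinf_open"

lemma istopology_rinf_open: "istopology rinf_open"
proof -
  have "rinf_open (S \<inter> T)" if "rinf_open S" "rinf_open T" for S T
  proof -
    have "S \<inter> T \<inter> RN n = (S \<inter> RN n) \<inter> (T \<inter> RN n)" for n by blast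
    with that show ?thesis unfolding rinf_open_def by (metis openin_Int)
  qed
  moreover have "rinf_open (\<Union>\<K>)" if "\<forall>K\<in>\<K>. rinf_open K" for \<K>
  proof -
    have "\<Union>\<K> \<inter> RN n = \<Union>((\<lambda>K. K \<inter> RN n) ` \<K>)" for n by blast
    with that show ?thesis unfolding rinf_open_def by (metis (no_types, lifting) imageE openin_Union)
  qed
  ultimately show ?thesis unfolding istopology_def by blast
qed

lemma openin_Rinf: "openin Rinf U \<longleftrightarrow> rinf_open U"
  using istopology_rinf_open by (simp add: Rinf_def topology_inverse')

definition has_partial :: "(rinf \<Rightarrow> real) \<Rightarrow> nat \<Rightarrow> rinf \<Rightarrow> real \<Rightarrow> bool" where
  "has_partial F i x d \<longleftrightarrow>
     ((\<lambda>t. F (x + Poly_Mapping.single i t)) has_real_derivative d) (at 0)"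

primrec Ck_on :: "nat \<Rightarrow> rinf set \<Rightarrow> (rinf \<Rightarrow> real) \<Rightarrow> bool" where
  "Ck_on 0 V F \<longleftrightarrow> (\<forall>n. continuous_on (V \<inter> RN n) F)"
| "Ck_on (Suc k) V F \<longleftrightarrow> (\<forall>n. continuous_on (V \<inter> RN n) F) \<and>
     (\<exists>D. \<forall>i. (\<forall>x\<in>V. has_partial F i x (D i x)) \<and> Ck_on k V (D i))"

text \<open>A function on an arbitrary subset of \<open>\<real>\<^sup>\<infinity>\<close> is smooth if it extends locally to a smooth
  function on an open set; a subset is a submanifold diffeomorphic to \<open>\<real>\<^sup>n\<close> if it is diffeomorphic
  to \<open>\<real>\<^sup>n\<close> in this sense (as in Milnor's and Guillemin and Pollack's textbooks).\<close>

definition smooth_fun :: "rinf set \<Rightarrow> (rinf \<Rightarrow> real) \<Rightarrow> bool" where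
  "smooth_fun A f \<longleftrightarrow>
     (\<forall>x\<in>A. \<exists>V F. openin Rinf V \<and> x \<in> V \<and> (\<forall>k. Ck_on k V F) \<and> (\<forall>y\<in>A \<inter> V. F y = f y))"

definition smooth_cfun :: "rinf set \<Rightarrow> (rinf \<Rightarrow> complex) \<Rightarrow> bool" where
  "smooth_cfun A f \<longleftrightarrow> smooth_fun A (\<lambda>x. Re (f x)) \<and> smooth_fun A (\<lambda>x. Im (f x))"

definition smooth_map :: "rinf set \<Rightarrow> rinf set \<Rightarrow> (rinf \<Rightarrow> rinf) \<Rightarrow> bool" where
  "smooth_map A B f \<longleftrightarrow>
     continuous_map (subtopology Rinf A) (subtopology Rinf B) f \<and>
     (\<forall>i. smooth_fun A (\<lambda>x. Poly_Mapping.lookup (f x) i))"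

definition diffeo :: "rinf set \<Rightarrow> rinf set \<Rightarrow> (rinf \<Rightarrow> rinf) \<Rightarrow> bool" where
  "diffeo A B f \<longleftrightarrow> smooth_map A B f \<and>
     (\<exists>g. smooth_map B A g \<and> (\<forall>x\<in>A. g (f x) = x) \<and> (\<forall>y\<in>B. f (g y) = y))"

section \<open>The site of cartesian spaces\<close>

text \<open>Here and below, maps are taken to be undefined off their domain.\<close>

definition Cart :: "(rinf set, rinf \<Rightarrow> rinf) category" where
  "Cart = \<lparr>
     Obj = {c. \<exists>n e. diffeo (RN n) c e},
     Hom = \<lambda>c d. {f. f \<in> extensional c \<and> smooth_map c d f},
     Id = \<lambda>c. \<lambda>x\<in>c. x,
     Cmp = \<lambda>c d e g f. compose c g f \<rparr>"

definition open_embedding :: "rinf set \<Rightarrow> rinf set \<Rightarrow> (rinf \<Rightarrow> rinf) \<Rightarrow> bool" where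
  "open_embedding c' c f \<longleftrightarrow> f \<in> Hom Cart c' c \<and>
     openin (subtopology Rinf c) (f ` c') \<and> diffeo c' (f ` c') f"

text \<open>A family \<open>\<iota>\<^sub>i : c\<^sub>i \<rightarrow> c\<close> is represented by the set of the pairs \<open>(c\<^sub>i, \<iota>\<^sub>i)\<close>.\<close>

definition dgop_covering :: "rinf set \<Rightarrow> (rinf set \<times> (rinf \<Rightarrow> rinf)) set \<Rightarrow> bool" where
  "dgop_covering c K \<longleftrightarrow> c \<in> Obj Cart \<and>
     (\<forall>(c', f)\<in>K. c' \<in> Obj Cart \<and> open_embedding c' c f) \<and>
     (\<Union>(c', f)\<in>K. f ` c') = c \<and>
     (\<forall>F. F \<subseteq> K \<and> finite F \<and> F \<noteq> {} \<and> (\<Inter>(c', f)\<in>F. f ` c') \<noteq> {} \<longrightarrow>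
        (\<Inter>(c', f)\<in>F. f ` c') \<in> Obj Cart)"

section \<open>Diffeological spaces\<close>

text \<open>A concrete sheaf on cartesian spaces, presented as its set of points together with, for each
  cartesian space \<open>c\<close>, the set of those maps \<open>c \<rightarrow> X\<close> that are plots.\<close>

record 'a dfl =
  pts :: "'a set"
  plots :: "rinf set \<Rightarrow> (rinf \<Rightarrow> 'a) set"

definition diffeological_space :: "'a dfl \<Rightarrow> bool" where
  "diffeological_space X \<longleftrightarrow>
     (\<forall>c. c \<notin> Obj Cart \<longrightarrow> plots X c = {}) \<and>
     (\<forall>c\<in>Obj Cart. plots X c \<subseteq> c \<rightarrow>\<^sub>E pts X) \<and>
     plots X (RN 0) = RN 0 \<rightarrow>\<^sub>E pts X \<and>
     (\<forall>c\<in>Obj Cart. \<forall>c'\<in>Obj Cart. \<forall>f\<in>Hom Cart c' c. \<forall>\<phi>\<in>plots X c. compose c' \<phi> f \<in> plots X c') \<and>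
     (\<forall>c K. \<forall>\<phi>\<in>c \<rightarrow>\<^sub>E pts X. dgop_covering c K \<and>
        (\<forall>(c', f)\<in>K. compose c' \<phi> f \<in> plots X c') \<longrightarrow> \<phi> \<in> plots X c)"

definition dfl_hom :: "'a dfl \<Rightarrow> 'b dfl \<Rightarrow> ('a \<Rightarrow> 'b) set" where
  "dfl_hom X Y = {f \<in> pts X \<rightarrow>\<^sub>E pts Y. \<forall>c\<in>Obj Cart. \<forall>\<phi>\<in>plots X c. compose c f \<phi> \<in> plots Y c}"

definition dfl_iso :: "'a dfl \<Rightarrow> 'b dfl \<Rightarrow> ('a \<Rightarrow> 'b) set" where
  "dfl_iso X Y = {f \<in> dfl_hom X Y.
     \<exists>g\<in>dfl_hom Y X. (\<forall>x\<in>pts X. g (f x) = x) \<and> (\<forall>y\<in>pts Y. f (g y) = y)}"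

definition cart_space :: "rinf set \<Rightarrow> rinf dfl" where
  "cart_space c = \<lparr> pts = c, plots = \<lambda>c'. if c' \<in> Obj Cart then Hom Cart c' c else {} \<rparr>"

definition complex_space :: "nat \<Rightarrow> complex Matrix.vec dfl" where
  "complex_space k = \<lparr> pts = carrier_vec k,
     plots = \<lambda>c. if c \<in> Obj Cart
       then {v \<in> c \<rightarrow>\<^sub>E carrier_vec k. \<forall>i<k. smooth_cfun c (\<lambda>y. vec_index (v y) i)} else {} \<rparr>"

text \<open>The fibre product of \<open>f : A \<rightarrow> X\<close> and \<open>g : B \<rightarrow> X\<close>, with points encoded by an injective pairing
  \<open>p\<close> (either \<^const>\<open>Pair\<close>, or the pairing of the universe below).\<close>

definition fibre_prod ::
    "('a \<Rightarrow> 'b \<Rightarrow> 'c) \<Rightarrow> 'a dfl \<Rightarrow> 'b dfl \<Rightarrow> ('a \<Rightarrow> 'x) \<Rightarrow> ('b \<Rightarrow> 'x) \<Rightarrow> 'c dfl" where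
  "fibre_prod p A B f g = \<lparr>
     pts = {p a b | a b. a \<in> pts A \<and> b \<in> pts B \<and> f a = g b},
     plots = \<lambda>c. {(\<lambda>y\<in>c. p (\<alpha> y) (\<beta> y)) | \<alpha> \<beta>.
       \<alpha> \<in> plots A c \<and> \<beta> \<in> plots B c \<and> (\<forall>y\<in>c. f (\<alpha> y) = g (\<beta> y))} \<rparr>"

definition dfl_prod :: "'a dfl \<Rightarrow> 'b dfl \<Rightarrow> ('a \<times> 'b) dfl" where
  "dfl_prod A B = fibre_prod Pair A B (\<lambda>_. ()) (\<lambda>_. ())"

section \<open>A universe of small sets\<close>

text \<open>The small sets are subsets of a type \<open>'u\<close>, closed under subsets, images, small unions and
  (via the pairing \<^term>\<open>upair\<close>) products, one of them having the cardinality of the continuum.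
  Every Grothendieck universe with an infinite element gives an instance (\<open>'u\<close> its elements, \<^term>\<open>small A\<close>
  if \<open>A\<close> is the extent of an element, Kuratowski pairs); closure under power sets beyond the
  existence of the continuum is not required. Large sets and categories are arbitrary ones on
  types built over \<open>'u\<close>.\<close>

class universe =
  fixes small :: "'a set \<Rightarrow> bool"
    and upair :: "'a \<Rightarrow> 'a \<Rightarrow> 'a"
  assumes small_subset: "small A \<Longrightarrow> B \<subseteq> A \<Longrightarrow> small B"
    and small_image: "small A \<Longrightarrow> small (f ` A)"
    and small_UN: "small A \<Longrightarrow> (\<And>a. a \<in> A \<Longrightarrow> small (S a)) \<Longrightarrow> small (\<Union>a\<in>A. S a)"
    and upair_inject: "upair a b = upair a' b' \<longleftrightarrow> a = a' \<and> b = b'"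
    and small_continuum: "\<exists>f :: real \<Rightarrow> 'a. inj f \<and> small (range f)"

lemma real_pairing_exists: "\<exists>p :: real \<times> real \<Rightarrow> real. inj p"
proof -
  have "ordIso2 (card_of ((UNIV :: real set) \<times> (UNIV :: real set))) (card_of (UNIV :: real set))"
    by (rule card_of_Times_same_infinite) (simp add: infinite_UNIV_char_0)
  then show ?thesis
    unfolding card_of_ordIso[symmetric] bij_betw_def by auto
qed

text \<open>An instance, showing that the class is inhabited.\<close>

instantiation real :: universe
begin

definition small_real :: "real set \<Rightarrow> bool" where
  "small_real A = True"

definition upair_real :: "real \<Rightarrow> real \<Rightarrow> real" where
  "upair_real a b = (SOME p :: real \<times> real \<Rightarrow> real. inj p) (a, b)"

instance
proof
  fix a b a' b' :: real
  have "inj (SOME p :: real \<times> real \<Rightarrow> real. inj p)"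
    using real_pairing_exists by (rule someI_ex)
  then show "upair a b = upair a' b' \<longleftrightarrow> a = a' \<and> b = b'"
    unfolding upair_real_def by (simp add: inj_eq)
next
  show "\<exists>f :: real \<Rightarrow> real. inj f \<and> small (range f)"
    by (rule exI[of _ id]) (simp add: small_real_def)
qed (simp_all add: small_real_def)

end

definition ufst :: "'u::universe \<Rightarrow> 'u" where
  "ufst z = (THE a. \<exists>b. z = upair a b)"

definition usnd :: "'u::universe \<Rightarrow> 'u" where
  "usnd z = (THE b. \<exists>a. z = upair a b)"

definition Dfg :: "('u::universe dfl, 'u \<Rightarrow> 'u) category" where
  "Dfg = \<lparr>
     Obj = {X. diffeological_space X \<and> small (pts X)},
     Hom = dfl_hom,
     Id = \<lambda>X. \<lambda>x\<in>pts X. x,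
     Cmp = \<lambda>X Y Z g f. compose (pts X) g f \<rparr>"

definition subduction :: "'u::universe dfl \<Rightarrow> 'u dfl \<Rightarrow> ('u \<Rightarrow> 'u) \<Rightarrow> bool" where
  "subduction Y X \<pi> \<longleftrightarrow> Y \<in> Obj Dfg \<and> X \<in> Obj Dfg \<and> \<pi> \<in> Hom Dfg Y X \<and>
     (\<forall>c\<in>Obj Cart. \<forall>\<phi>\<in>plots X c. \<exists>K. dgop_covering c K \<and>
        (\<forall>(c', f)\<in>K. \<exists>\<psi>\<in>plots Y c'. compose c' \<pi> \<psi> = compose c' \<phi> f))"

section \<open>Diffeological vector bundles\<close>

record 'u vbundle =
  tot :: "'u dfl"
  prj :: "'u \<Rightarrow> 'u"
  vadd :: "'u \<Rightarrow> 'u \<Rightarrow> 'u"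
  vsmult :: "complex \<Rightarrow> 'u \<Rightarrow> 'u"
  vzero :: "'u \<Rightarrow> 'u"

text \<open>The fields \<open>mult\<close> and \<open>one\<close> are irrelevant leftovers of the library's record for modules.\<close>

definition fibre :: "'u vbundle \<Rightarrow> 'u \<Rightarrow> (complex, 'u) module" where
  "fibre E x = \<lparr> carrier = {e \<in> pts (tot E). prj E e = x},
     mult = undefined, one = undefined,
     zero = vzero E x, add = vadd E, smult = vsmult E \<rparr>"

definition vector_bundle :: "'u::universe dfl \<Rightarrow> 'u vbundle \<Rightarrow> bool" where
  "vector_bundle X E \<longleftrightarrow> X \<in> Obj Dfg \<and> tot E \<in> Obj Dfg \<and> prj E \<in> Hom Dfg (tot E) X \<and>
     (\<forall>x\<in>pts X. vectorspace class_ring (fibre E x)) \<and>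
     (\<forall>c\<in>Obj Cart. \<forall>\<phi>\<in>plots X c. \<exists>k.
        \<exists>\<Phi>\<in>dfl_iso (dfl_prod (cart_space c) (complex_space k))
                (fibre_prod Pair (cart_space c) (tot E) \<phi> (prj E)).
          (\<forall>y\<in>c. \<forall>v\<in>carrier_vec k. fst (\<Phi> (y, v)) = y) \<and>
          (\<forall>y\<in>c. (\<lambda>v. snd (\<Phi> (y, v))) \<in>
             module_hom class_ring (module_vec TYPE(complex) k) (fibre E (\<phi> y))))"

definition bundle_hom :: "'u::universe dfl \<Rightarrow> 'u vbundle \<Rightarrow> 'u vbundle \<Rightarrow> ('u \<Rightarrow> 'u) set" where
  "bundle_hom X E E' = {u \<in> Hom Dfg (tot E) (tot E').
     (\<forall>e\<in>pts (tot E). prj E' (u e) = prj E e) \<and>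
     (\<forall>x\<in>pts X. u \<in> module_hom class_ring (fibre E x) (fibre E' x))}"

definition VBun_cat :: "'u::universe dfl \<Rightarrow> ('u vbundle, 'u \<Rightarrow> 'u) category" where
  "VBun_cat X = \<lparr>
     Obj = {E. vector_bundle X E},
     Hom = bundle_hom X,
     Id = \<lambda>E. \<lambda>e\<in>pts (tot E). e,
     Cmp = \<lambda>E E' E'' v u. compose (pts (tot E)) v u \<rparr>"

text \<open>Points of \<open>f\<^sup>*E = X' \<times>\<^sub>X E\<close> are \<open>upair x' e\<close> with \<open>f x' = prj E e\<close>.\<close>

definition pb_space :: "'u::universe dfl \<Rightarrow> ('u \<Rightarrow> 'u) \<Rightarrow> 'u vbundle \<Rightarrow> 'u dfl" where
  "pb_space X' f E = fibre_prod upair X' (tot E) f (prj E)"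

definition pb_bundle :: "'u::universe dfl \<Rightarrow> ('u \<Rightarrow> 'u) \<Rightarrow> 'u vbundle \<Rightarrow> 'u vbundle" where
  "pb_bundle X' f E = \<lparr>
     tot = pb_space X' f E,
     prj = \<lambda>z\<in>pts (pb_space X' f E). ufst z,
     vadd = \<lambda>z w. upair (ufst z) (vadd E (usnd z) (usnd w)),
     vsmult = \<lambda>a z. upair (ufst z) (vsmult E a (usnd z)),
     vzero = \<lambda>x'. upair x' (vzero E (f x')) \<rparr>"

definition pb_func ::
    "'u::universe dfl \<Rightarrow> ('u \<Rightarrow> 'u) \<Rightarrow> ('u vbundle, 'u \<Rightarrow> 'u, 'u vbundle, 'u \<Rightarrow> 'u) func" where
  "pb_func X' f = \<lparr>
     FO = pb_bundle X' f,
     FM = \<lambda>E E' u. \<lambda>z\<in>pts (pb_space X' f E). upair (ufst z) (u (usnd z)) \<rparr>"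

definition VBun_Dfg :: "('u::universe dfl, 'u \<Rightarrow> 'u, 'u vbundle, 'u \<Rightarrow> 'u) pseudo" where
  "VBun_Dfg = \<lparr>
     Val = VBun_cat,
     Res = \<lambda>X' X f. pb_func X' f,
     Unt = \<lambda>X E. \<lambda>e\<in>pts (tot E). upair (prj E e) e,
     Cmb = \<lambda>X'' X' X g f E. \<lambda>z\<in>pts (pb_space X'' g (pb_bundle X' f E)).
             upair (ufst z) (usnd (usnd z)) \<rparr>"

section \<open>The strict model\<close>

definition VBun_triv_cat :: "rinf set \<Rightarrow> (nat, rinf \<Rightarrow> complex mat) category" where
  "VBun_triv_cat c = \<lparr>
     Obj = UNIV,
     Hom = \<lambda>n m. {M \<in> c \<rightarrow>\<^sub>E carrier_mat m n.
             \<forall>i<m. \<forall>j<n. smooth_cfun c (\<lambda>y. index_mat (M y) (i, j))},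
     Id = \<lambda>n. \<lambda>y\<in>c. 1\<^sub>m n,
     Cmp = \<lambda>n m l N M. \<lambda>y\<in>c. N y * M y \<rparr>"

definition VBun_triv :: "(rinf set, rinf \<Rightarrow> rinf, nat, rinf \<Rightarrow> complex mat) diagram" where
  "VBun_triv = \<lparr>
     Val = VBun_triv_cat,
     Res = \<lambda>c' c f. \<lparr> FO = \<lambda>n. n, FM = \<lambda>n m M. compose c' M f \<rparr> \<rparr>"

definition plot_cat :: "'a dfl \<Rightarrow> (rinf set \<times> (rinf \<Rightarrow> 'a), rinf \<Rightarrow> rinf) category" where
  "plot_cat X = \<lparr>
     Obj = {(c, \<phi>). c \<in> Obj Cart \<and> \<phi> \<in> plots X c},
     Hom = \<lambda>(c0, \<phi>0) (c1, \<phi>1). {f \<in> Hom Cart c0 c1. compose c0 \<phi>1 f = \<phi>0},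
     Id = \<lambda>(c, \<phi>). Id Cart c,
     Cmp = \<lambda>(c0, _) (c1, _) (c2, _) g f. Cmp Cart c0 c1 c2 g f \<rparr>"

definition plot_dom ::
    "(rinf set \<times> (rinf \<Rightarrow> 'a), rinf \<Rightarrow> rinf, rinf set, rinf \<Rightarrow> rinf) func" where
  "plot_dom = \<lparr> FO = fst, FM = \<lambda>_ _ f. f \<rparr>"

definition plot_push :: "('a \<Rightarrow> 'b) \<Rightarrow>
    (rinf set \<times> (rinf \<Rightarrow> 'a), rinf \<Rightarrow> rinf, rinf set \<times> (rinf \<Rightarrow> 'b), rinf \<Rightarrow> rinf) func" where
  "plot_push g = \<lparr> FO = \<lambda>(c, \<phi>). (c, compose c g \<phi>), FM = \<lambda>_ _ f. f \<rparr>"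

type_synonym 'u plot = "rinf set \<times> (rinf \<Rightarrow> 'u)"

type_synonym 'u str_obj =
  "('u plot \<Rightarrow> nat) \<times> ('u plot \<times> 'u plot \<times> (rinf \<Rightarrow> rinf) \<Rightarrow> (rinf \<Rightarrow> complex mat))"

type_synonym 'u str_mor = "'u plot \<Rightarrow> (rinf \<Rightarrow> complex mat)"

definition VBun_str :: "('u::universe dfl, 'u \<Rightarrow> 'u, 'u str_obj, 'u str_mor) diagram" where
  "VBun_str = \<lparr>
     Val = \<lambda>X. holim (plot_cat X) (reindex plot_dom VBun_triv),
     Res = \<lambda>X' X g. holim_restrict (plot_cat X') (plot_push g) \<rparr>"

section \<open>Descent\<close>

definition fib2 :: "'u::universe dfl \<Rightarrow> ('u \<Rightarrow> 'u) \<Rightarrow> 'u dfl" where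
  "fib2 Y \<pi> = fibre_prod upair Y Y \<pi> \<pi>"

text \<open>Points of the triple fibre product are \<open>upair (upair y\<^sub>1 y\<^sub>2) y\<^sub>3\<close>.\<close>

definition fib3 :: "'u::universe dfl \<Rightarrow> ('u \<Rightarrow> 'u) \<Rightarrow> 'u dfl" where
  "fib3 Y \<pi> = fibre_prod upair (fib2 Y \<pi>) Y (\<lambda>z. \<pi> (usnd z)) \<pi>"

definition pr1 :: "'u::universe dfl \<Rightarrow> ('u \<Rightarrow> 'u) \<Rightarrow> 'u \<Rightarrow> 'u" where
  "pr1 Y \<pi> = (\<lambda>z\<in>pts (fib2 Y \<pi>). ufst z)"

definition pr2 :: "'u::universe dfl \<Rightarrow> ('u \<Rightarrow> 'u) \<Rightarrow> 'u \<Rightarrow> 'u" where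
  "pr2 Y \<pi> = (\<lambda>z\<in>pts (fib2 Y \<pi>). usnd z)"

definition pr12 :: "'u::universe dfl \<Rightarrow> ('u \<Rightarrow> 'u) \<Rightarrow> 'u \<Rightarrow> 'u" where
  "pr12 Y \<pi> = (\<lambda>t\<in>pts (fib3 Y \<pi>). ufst t)"

definition pr23 :: "'u::universe dfl \<Rightarrow> ('u \<Rightarrow> 'u) \<Rightarrow> 'u \<Rightarrow> 'u" where
  "pr23 Y \<pi> = (\<lambda>t\<in>pts (fib3 Y \<pi>). upair (usnd (ufst t)) (usnd t))"

definition pr13 :: "'u::universe dfl \<Rightarrow> ('u \<Rightarrow> 'u) \<Rightarrow> 'u \<Rightarrow> 'u" where
  "pr13 Y \<pi> = (\<lambda>t\<in>pts (fib3 Y \<pi>). upair (ufst (ufst t)) (usnd t))"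

text \<open>For \<open>r : Y\<^sub>3 \<rightarrow> Y\<^sub>2\<close> and \<open>\<alpha> : pr\<^sub>1\<^sup>* E \<rightarrow> pr\<^sub>2\<^sup>* E\<close>, the morphism \<open>r\<^sup>* \<alpha>\<close>, transported along the
  coherence isomorphisms to a morphism \<open>(pr\<^sub>1 \<circ> r)\<^sup>* E \<rightarrow> (pr\<^sub>2 \<circ> r)\<^sup>* E\<close>.\<close>

definition pulled_gluing ::
    "('u::universe dfl, 'u \<Rightarrow> 'u, 'o, 'm) pseudo \<Rightarrow> 'u dfl \<Rightarrow> ('u \<Rightarrow> 'u) \<Rightarrow> ('u \<Rightarrow> 'u) \<Rightarrow> 'o \<Rightarrow> 'm \<Rightarrow> 'm" where
  "pulled_gluing F Y \<pi> r E \<alpha> =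
    (let Y2 = fib2 Y \<pi>; Y3 = fib3 Y \<pi>; C = Val F Y3; p1 = pr1 Y \<pi>; p2 = pr2 Y \<pi>;
         E1 = FO (Res F Y2 Y p1) E; E2 = FO (Res F Y2 Y p2) E;
         rE1 = FO (Res F Y3 Y2 r) E1; rE2 = FO (Res F Y3 Y2 r) E2;
         D1 = FO (Res F Y3 Y (Cmp Dfg Y3 Y2 Y p1 r)) E;
         D2 = FO (Res F Y3 Y (Cmp Dfg Y3 Y2 Y p2 r)) E
     in Cmp C D1 rE2 D2 (Cmb F Y3 Y2 Y r p2 E)
          (Cmp C D1 rE1 rE2 (FM (Res F Y3 Y2 r) E1 E2 \<alpha>)
             (Inv C rE1 D1 (Cmb F Y3 Y2 Y r p1 E))))"

text \<open>In the cocycle condition, \<open>q\<^sub>1, q\<^sub>2, q\<^sub>3\<close> are the three projections to \<open>Y\<close>; one has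
  \<open>q\<^sub>1 = pr\<^sub>1 \<circ> pr\<^sub>1\<^sub>2 = pr\<^sub>1 \<circ> pr\<^sub>1\<^sub>3\<close>, \<open>q\<^sub>2 = pr\<^sub>2 \<circ> pr\<^sub>1\<^sub>2 = pr\<^sub>1 \<circ> pr\<^sub>2\<^sub>3\<close> and
  \<open>q\<^sub>3 = pr\<^sub>2 \<circ> pr\<^sub>2\<^sub>3 = pr\<^sub>2 \<circ> pr\<^sub>1\<^sub>3\<close>.\<close>

definition descent_obj ::
    "('u::universe dfl, 'u \<Rightarrow> 'u, 'o, 'm) pseudo \<Rightarrow> 'u dfl \<Rightarrow> ('u \<Rightarrow> 'u) \<Rightarrow> ('o \<times> 'm) set" where
  "descent_obj F Y \<pi> = {(E, \<alpha>).
    let Y2 = fib2 Y \<pi>; Y3 = fib3 Y \<pi>;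
        q1 = Cmp Dfg Y3 Y2 Y (pr1 Y \<pi>) (pr12 Y \<pi>);
        q2 = Cmp Dfg Y3 Y2 Y (pr2 Y \<pi>) (pr12 Y \<pi>);
        q3 = Cmp Dfg Y3 Y2 Y (pr2 Y \<pi>) (pr23 Y \<pi>)
    in E \<in> Obj (Val F Y) \<and>
       \<alpha> \<in> Iso (Val F Y2) (FO (Res F Y2 Y (pr1 Y \<pi>)) E) (FO (Res F Y2 Y (pr2 Y \<pi>)) E) \<and>
       pulled_gluing F Y \<pi> (pr13 Y \<pi>) E \<alpha> =
       Cmp (Val F Y3) (FO (Res F Y3 Y q1) E) (FO (Res F Y3 Y q2) E) (FO (Res F Y3 Y q3) E)
         (pulled_gluing F Y \<pi> (pr23 Y \<pi>) E \<alpha>)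
         (pulled_gluing F Y \<pi> (pr12 Y \<pi>) E \<alpha>)}"

definition descent_hom ::
    "('u::universe dfl, 'u \<Rightarrow> 'u, 'o, 'm) pseudo \<Rightarrow> 'u dfl \<Rightarrow> ('u \<Rightarrow> 'u) \<Rightarrow>
     'o \<times> 'm \<Rightarrow> 'o \<times> 'm \<Rightarrow> 'm set" where
  "descent_hom F Y \<pi> = (\<lambda>(E, \<alpha>) (E', \<alpha>').
    let Y2 = fib2 Y \<pi>; P1 = Res F Y2 Y (pr1 Y \<pi>); P2 = Res F Y2 Y (pr2 Y \<pi>) in
    {u \<in> Hom (Val F Y) E E'.
       Cmp (Val F Y2) (FO P1 E) (FO P1 E') (FO P2 E') \<alpha>' (FM P1 E E' u) =
       Cmp (Val F Y2) (FO P1 E) (FO P2 E) (FO P2 E') (FM P2 E E' u) \<alpha>})"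

definition descent_cat ::
    "('u::universe dfl, 'u \<Rightarrow> 'u, 'o, 'm) pseudo \<Rightarrow> 'u dfl \<Rightarrow> ('u \<Rightarrow> 'u) \<Rightarrow> ('o \<times> 'm, 'm) category" where
  "descent_cat F Y \<pi> = \<lparr>
     Obj = descent_obj F Y \<pi>,
     Hom = descent_hom F Y \<pi>,
     Id = \<lambda>(E, \<alpha>). Id (Val F Y) E,
     Cmp = \<lambda>(E, _) (E', _) (E'', _) v u. Cmp (Val F Y) E E' E'' v u \<rparr>"

text \<open>The canonical functor sends \<open>E\<close> to \<open>\<pi>\<^sup>*E\<close> with the composite of the coherence isomorphisms
  \<open>pr\<^sub>1\<^sup>* \<pi>\<^sup>* E \<rightarrow> (\<pi> \<circ> pr\<^sub>1)\<^sup>* E = (\<pi> \<circ> pr\<^sub>2)\<^sup>* E \<rightarrow> pr\<^sub>2\<^sup>* \<pi>\<^sup>* E\<close>.\<close>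

definition descent_functor ::
    "('u::universe dfl, 'u \<Rightarrow> 'u, 'o, 'm) pseudo \<Rightarrow> 'u dfl \<Rightarrow> 'u dfl \<Rightarrow> ('u \<Rightarrow> 'u) \<Rightarrow>
     ('o, 'm, 'o \<times> 'm, 'm) func" where
  "descent_functor F Y X \<pi> =
    (let Y2 = fib2 Y \<pi>; C = Val F Y2; p1 = pr1 Y \<pi>; p2 = pr2 Y \<pi>; P = Res F Y X \<pi> in
     \<lparr> FO = \<lambda>E.
         (FO P E,
          let E1 = FO (Res F Y2 Y p1) (FO P E); E2 = FO (Res F Y2 Y p2) (FO P E);
              D = FO (Res F Y2 X (Cmp Dfg Y2 Y X \<pi> p1)) E
          in Cmp C E1 D E2 (Inv C E2 D (Cmb F Y2 Y X p2 \<pi> E)) (Cmb F Y2 Y X p1 \<pi> E)),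
       FM = \<lambda>E E' u. FM P E E' u \<rparr>)"

end

theory Submission
 imports Defs
begin

text \<open>Everything is expressed through frames. A frame of \<open>E\<close> along a map \<open>\<phi> : U \<rightarrow> X\<close> is a family of linear
isomorphisms \<open>s\<^sub>y : \<complex>\<^sup>k \<rightarrow> E\<^sub>\<phi>\<^sub>(\<^sub>y\<^sub>)\<close> such that the plots of \<open>E\<close> lying over plots of \<open>U\<close> are exactly the
combinations \<open>y \<mapsto> s\<^sub>y (v y)\<close> with \<open>v\<close> smooth (\<open>trivialises\<close>). A family of vector spaces is a bundle iff
every plot of the base has a frame (\<open>vector_bundle_iff\<close>); two frames along one plot differ by a smooth
invertible matrix (\<open>transition_matrix\<close>); a fibrewise map that is a smooth matrix in frames is a morphism
(\<open>frames_bundle_hom\<close>), and one that carries frames to frames is an isomorphism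
(\<open>frames_inverse_arrows\<close>).

For the comparison with the strict model, view a point \<open>x\<close> as a plot \<open>\<real>\<^sup>0 \<rightarrow> X\<close>. A strict object
\<open>(n, h)\<close> has the rank \<open>n x\<close> there, and for \<open>y\<close> in the domain of a plot \<open>\<phi>\<close> the morphism of plots that
includes \<open>y\<close> gives an invertible matrix \<open>h\<close>. The associated bundle has the fibre \<open>\<complex>\<^sup>n\<^sup>x\<close>
at \<open>x\<close>, and the inverses of these matrices are a frame along \<open>\<phi>\<close>. In these frames a bundle morphism is
a family of smooth matrices, and being well defined means that the family intertwines the cocycles; so
the functor is fully faithful. Choosing a frame of a given bundle along each plot, the transition
matrices form a strict object that is sent to the given bundle (\<open>str_ess_surj\<close>). All this is
compatible with pullback because points and frames are (\<open>str_trans_objectwise_equivalence\<close>).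

For descent along \<open>\<pi> : Y \<rightarrow> X\<close>, a gluing of \<open>E\<close> is the same as a transport of the vectors of \<open>E\<close> between
fibres over points with the same image in \<open>X\<close>, and the cocycle condition says that transports compose
(\<open>descent_obj_iff\<close>). Choose for each \<open>x\<close> a point \<open>sec x\<close> over it. The descended bundle has the fibre
\<open>E\<^bsub>sec x\<^esub>\<close> at \<open>x\<close>; a map into it is a plot if all its transports to points that vary smoothly
in \<open>Y\<close> are plots of \<open>E\<close>. Where a plot of \<open>X\<close> lifts to \<open>Y\<close>, a frame of \<open>E\<close> along the lift is transported
to a frame (\<open>desc_frame\<close>), and a subduction provides such lifts locally.

This only gives frames on small pieces of the domain \<open>c\<close> of a plot, whereas a bundle needs one on all of
\<open>c\<close>. Hence the analytic core: locally trivial bundles on cartesian spaces are trivial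
(\<open>locally_trivial_imp_trivial\<close>). The usual proof by parallel transport needs a connection. Here two
frames over boxes with a common slab are instead merged by extending their transition matrix \<open>g\<close> as
\<open>g \<circ> r\<close>, where \<open>r\<close> is a smooth map into the slab which is the identity on one side
(\<open>merge_trivialisations\<close>); bisection reaches every compact box, and the same trick with a soft clamp
makes frames on larger and larger cubes agree.\<close>

section \<open>Coordinates on \<open>\<real>\<^sup>\<infinity>\<close>\<close>

abbreviation coord :: "rinf => nat => real" where
 "coord \<equiv> Poly_Mapping.lookup"

abbreviation axis_pt :: "nat => real => rinf" where
 "axis_pt \<equiv> Poly_Mapping.single"

lemma norm_rinf: "norm (x::rinf) = (\<Sum>i\<in>Poly_Mapping.keys x. \<bar>coord x i\<bar>)"
 by (simp add: norm_poly_mapping_def dist_poly_mapping_def)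

lemma norm_axis_pt [simp]: "norm (axis_pt i t) = \<bar>t\<bar>"
 by (simp add: norm_rinf)

lemma abs_coord_le_norm: "\<bar>coord x i\<bar> \<le> norm x"
proof (cases "i \<in> Poly_Mapping.keys x")
 case True
 then show ?thesis unfolding norm_rinf
  by (intro member_le_sum) auto
next
 case False
 then show ?thesis by (simp add: in_keys_iff)
qed

lemma coord_scaleR [simp]: "coord (r *\<^sub>R x) i = r * coord x i"
proof -
 have "finite {i. r * coord x i \<noteq> 0}"
  by (rule finite_subset[OF _ finite_keys[of x]]) (auto simp: in_keys_iff)
 then show ?thesis
  by (simp add: scaleR_poly_mapping_def)
qed

lemma coord_sum: "coord (\<Sum>j\<in>J. f j) i = (\<Sum>j\<in>J. coord (f j) i)"
 by (induction J rule: infinite_finite_induct) (auto simp: lookup_add)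

lemma bounded_linear_coord: "bounded_linear (\<lambda>x. coord x i)"
 by (rule bounded_linear_intro[where K=1]) (auto simp: lookup_add abs_coord_le_norm)

lemma bounded_linear_axis_pt: "bounded_linear (axis_pt i)"
proof (rule bounded_linear_intro[where K=1])
 fix s t r :: real
 show "axis_pt i (s + t) = axis_pt i s + axis_pt i t"
  by (rule poly_mapping_eqI) (simp add: lookup_single lookup_add when_def)
 show "axis_pt i (r *\<^sub>R t) = r *\<^sub>R axis_pt i t"
  by (rule poly_mapping_eqI) (simp add: lookup_single when_def)
qed simp

lemmas continuous_on_coord [continuous_intros] =
 bounded_linear.continuous_on[OF bounded_linear_coord]
lemmas continuous_on_axis_pt [continuous_intros] =
 bounded_linear.continuous_on[OF bounded_linear_axis_pt]

lemma RN_mono: "m \<le> n ==> RN m \<subseteq> RN n"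
 by (auto simp: RN_def)

lemma ex_RN: "\<exists>n. x \<in> RN n"
proof -
 obtain n where "\<forall>i\<in>Poly_Mapping.keys x. i < n"
  by (meson finite_keys finite_nat_set_iff_bounded)
 then have "coord x i = 0" if "n \<le> i" for i
  using that in_keys_iff[of i x] by (metis not_less)
 then have "x \<in> RN n" by (simp add: RN_def)
 then show ?thesis ..
qed

lemma coord_axis_sum: "coord (\<Sum>j<n. axis_pt j (f j)) i = (if i < n then f i else 0)"
 by (simp add: coord_sum lookup_single when_def)

lemma axis_sum_in_RN: "(\<Sum>j<n. axis_pt j (f j)) \<in> RN n"
 by (simp add: RN_def coord_axis_sum)

lemma RN_expand: "x \<in> RN n ==> x = (\<Sum>j<n. axis_pt j (coord x j))"
 by (rule poly_mapping_eqI) (auto simp: coord_axis_sum RN_def)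

lemma RN_eqI: "x \<in> RN n ==> y \<in> RN n ==> (\<And>i. i < n ==> coord x i = coord y i) ==> x = y"
 by (rule poly_mapping_eqI, rename_tac i, case_tac "i < n") (auto simp: RN_def)

lemma norm_RN_le: "x \<in> RN n ==> norm x \<le> (\<Sum>j<n. \<bar>coord x j\<bar>)"
proof -
 assume "x \<in> RN n"
 then have "norm x = norm (\<Sum>j<n. axis_pt j (coord x j))" using RN_expand by simp
 also have "\<dots> \<le> (\<Sum>j<n. norm (axis_pt j (coord x j)))" by (rule norm_sum)
 finally show ?thesis by simp
qed

lemma add_RN: "x \<in> RN n ==> y \<in> RN n ==> x + y \<in> RN n"
 by (auto simp: RN_def lookup_add)

lemma axis_pt_RN: "i < n ==> axis_pt i t \<in> RN n"
 by (auto simp: RN_def lookup_single when_def)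

lemma zero_RN: "0 \<in> RN n"
 by (auto simp: RN_def)

lemma RN_0: "RN 0 = {0}"
 by (auto simp: RN_def intro: poly_mapping_eqI)

section \<open>The topology\<close>

lemma topspace_Rinf [simp]: "topspace Rinf = UNIV"
proof -
 have "openin Rinf UNIV" by (simp add: openin_Rinf rinf_open_def)
 then show ?thesis using openin_subset by blast
qed

lemma open_imp_openin_Rinf: "open V ==> openin Rinf V"
 by (auto simp: openin_Rinf rinf_open_def openin_open Int_commute)

lemma openin_Rinf_RN: "openin Rinf V ==> openin (top_of_set (RN n)) (V \<inter> RN n)"
 by (simp add: openin_Rinf rinf_open_def)

text \<open>On subsets of a fixed \<open>\<real>\<^sup>n\<close> the colimit topology agrees with the norm topology, so the library's
metric topology applies there.\<close>

lemma subtopology_Rinf_eq: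
 assumes "A \<subseteq> RN n"
 shows "subtopology Rinf A = top_of_set A"
proof -
 have "openin (subtopology Rinf A) T \<longleftrightarrow> openin (top_of_set A) T" for T
 proof
  assume "openin (subtopology Rinf A) T"
  then obtain V where V: "openin Rinf V" "T = V \<inter> A" by (auto simp: openin_subtopology)
  then obtain O' where "open O'" "V \<inter> RN n = RN n \<inter> O'"
   using openin_Rinf_RN[of V n] by (auto simp: openin_open)
  then have "T = A \<inter> O'" using V assms by blast
  then show "openin (top_of_set A) T" using \<open>open O'\<close> by (auto simp: openin_open)
 next
  assume "openin (top_of_set A) T"
  then show "openin (subtopology Rinf A) T"
   by (auto simp: openin_open openin_subtopology Int_commute dest: open_imp_openin_Rinf)
 qed
 then show ?thesis by (simp add: topology_eq)
qed

lemma openin_Rinf_preimage: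
 assumes V: "openin Rinf V" and cont: "\<And>n. continuous_on (V \<inter> RN n) F"
  and F: "\<And>x. x \<in> V ==> F x \<in> RN m" and W: "openin Rinf W"
 shows "openin Rinf {x \<in> V. F x \<in> W}"
 unfolding openin_Rinf rinf_open_def
proof
 fix n
 have "openin (top_of_set (V \<inter> RN n)) ((V \<inter> RN n) \<inter> F -` (W \<inter> RN m))"
  by (rule continuous_openin_preimage[OF cont _ openin_Rinf_RN[OF W]]) (use F in auto)
 moreover have "(V \<inter> RN n) \<inter> F -` (W \<inter> RN m) = {x \<in> V. F x \<in> W} \<inter> RN n"
  using F by auto
 ultimately show "openin (top_of_set (RN n)) ({x \<in> V. F x \<in> W} \<inter> RN n)"
  using openin_trans[OF _ openin_Rinf_RN[OF V]] by metis
qed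

lemma eventually_in_open_axis:
 assumes "openin Rinf V" "x \<in> V"
 shows "eventually (\<lambda>t. x + axis_pt i t \<in> V) (nhds 0)"
proof -
 obtain n where "x \<in> RN n" using ex_RN by blast
 define m where "m = max n (Suc i)"
 have x: "x \<in> RN m" using \<open>x \<in> RN n\<close> RN_mono[of n m] by (auto simp: m_def)
 have a: "axis_pt i t \<in> RN m" for t by (rule axis_pt_RN) (simp add: m_def)
 obtain O' where O': "open O'" "V \<inter> RN m = RN m \<inter> O'"
  using openin_Rinf_RN[OF assms(1), of m] by (auto simp: openin_open)
 have "continuous_on UNIV (\<lambda>t. x + axis_pt i t)"
  by (intro continuous_intros)
 then have "open ((\<lambda>t. x + axis_pt i t) -` O')"
  using O'(1) by (simp add: open_vimage)
 moreover have "0 \<in> (\<lambda>t. x + axis_pt i t) -` O'"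
  using O' x assms by auto
 ultimately have "eventually (\<lambda>t. t \<in> (\<lambda>t. x + axis_pt i t) -` O') (nhds 0)"
  by (rule eventually_nhds_in_open)
 then show ?thesis
  by eventually_elim (use O' add_RN[OF x a] in auto)
qed

section \<open>Partial derivatives and functions of class \<open>C\<^sup>k\<close>\<close>

lemma has_partial_const: "has_partial (\<lambda>_. c) i x 0"
 by (simp add: has_partial_def)

lemma has_partial_coord: "has_partial (\<lambda>x. coord x j) i x (if i = j then 1 else 0)"
 by (auto simp: has_partial_def lookup_add lookup_single when_def intro!: derivative_eq_intros)

lemma has_partial_add:
 "has_partial F i x d ==> has_partial G i x e ==> has_partial (\<lambda>x. F x + G x) i x (d + e)"
 unfolding has_partial_def by (rule DERIV_add)

lemma has_partial_mult:
 assumes "has_partial F i x d" "has_partial G i x e"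
 shows "has_partial (\<lambda>x. F x * G x) i x (d * G x + e * F x)"
 using DERIV_mult[OF assms[unfolded has_partial_def]] by (simp add: has_partial_def)

lemma has_partial_chain1:
 assumes "has_partial F i x d" "(f has_real_derivative f') (at (F x))"
 shows "has_partial (\<lambda>x. f (F x)) i x (d * f')"
proof -
 have "((\<lambda>t. f (F (x + axis_pt i t))) has_real_derivative f' * d) (at 0)"
  by (rule DERIV_chain2[of f f' "\<lambda>t. F (x + axis_pt i t)"])
   (use assms in "auto simp: has_partial_def")
 then show ?thesis by (simp add: has_partial_def mult.commute)
qed

lemma has_partial_cong:
 assumes "openin Rinf V" "x \<in> V" "\<And>y. y \<in> V ==> F y = G y" "has_partial F i x d"
 shows "has_partial G i x d"
proof -
 have ev: "eventually (\<lambda>t. F (x + axis_pt i t) = G (x + axis_pt i t)) (nhds 0)"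
  using eventually_in_open_axis[OF assms(1,2), of i] by eventually_elim (rule assms(3))
 have "((\<lambda>t. F (x + axis_pt i t)) has_real_derivative d) (at 0) \<longleftrightarrow>
    ((\<lambda>t. G (x + axis_pt i t)) has_real_derivative d) (at 0)"
  by (rule DERIV_cong_ev[OF refl ev refl])
 then show ?thesis using assms(4) by (simp add: has_partial_def)
qed

lemma Ck_cont: "Ck_on k V F ==> continuous_on (V \<inter> RN n) F"
 by (cases k) auto

lemma Ck_Suc_D: "Ck_on (Suc k) V F ==> Ck_on k V F"
proof (induction k arbitrary: F)
 case (Suc k)
 then obtain D where D: "\<forall>i. (\<forall>x\<in>V. has_partial F i x (D i x)) \<and> Ck_on (Suc k) V (D i)"
  by (metis Ck_on.simps(2))
 then have "\<forall>i. (\<forall>x\<in>V. has_partial F i x (D i x)) \<and> Ck_on k V (D i)"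
  using Suc.IH by blast
 then show ?case using Suc.prems Ck_cont[OF Suc.prems] by auto
qed auto

lemma Ck_subset: "Ck_on k V F ==> U \<subseteq> V ==> Ck_on k U F"
proof (induction k arbitrary: F)
 case 0
 then show ?case by (auto intro: continuous_on_subset)
next
 case (Suc k)
 then obtain D where D: "\<forall>i. (\<forall>x\<in>V. has_partial F i x (D i x)) \<and> Ck_on k V (D i)"
  by (metis Ck_on.simps(2))
 then have "\<forall>i. (\<forall>x\<in>U. has_partial F i x (D i x)) \<and> Ck_on k U (D i)"
  using Suc.IH Suc.prems(2) by blast
 moreover have "\<forall>n. continuous_on (U \<inter> RN n) F"
  using Ck_cont[OF Suc.prems(1)] continuous_on_subset Suc.prems(2) by (metis Int_mono order_refl)
 ultimately show ?case by auto
qed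

lemma Ck_SucI:
 assumes "\<And>n. continuous_on (V \<inter> RN n) F"
  "\<And>i x. x \<in> V ==> has_partial F i x (D i x)" "\<And>i. Ck_on k V (D i)"
 shows "Ck_on (Suc k) V F"
 unfolding Ck_on.simps(2) using assms by blast

lemma Ck_const: "Ck_on k V (\<lambda>_. c)"
proof (induction k arbitrary: c)
 case (Suc k)
 show ?case by (rule Ck_SucI[where D="\<lambda>_ _. 0"]) (auto simp: has_partial_const Suc)
qed auto

lemma Ck_coord: "Ck_on k V (\<lambda>x. coord x j)"
proof (cases k)
 case (Suc k)
 show ?thesis unfolding Suc
  by (rule Ck_SucI[where D="\<lambda>i _. if i = j then 1 else 0"])
   (rule has_partial_coord Ck_const continuous_intros)+
qed (auto intro!: continuous_intros)

lemma Ck_add: "Ck_on k V F ==> Ck_on k V G ==> Ck_on k V (\<lambda>x. F x + G x)"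
proof (induction k arbitrary: F G)
 case (Suc k)
 from Suc.prems obtain D E where
  "\<forall>i. (\<forall>x\<in>V. has_partial F i x (D i x)) \<and> Ck_on k V (D i)"
  "\<forall>i. (\<forall>x\<in>V. has_partial G i x (E i x)) \<and> Ck_on k V (E i)"
  by (metis Ck_on.simps(2))
 then show ?case
  using Ck_cont[OF Suc.prems(1)] Ck_cont[OF Suc.prems(2)]
  by (intro Ck_SucI[where D="\<lambda>i x. D i x + E i x"])
   (auto intro!: has_partial_add Suc.IH continuous_intros)
qed (auto intro!: continuous_intros)

lemma Ck_mult: "Ck_on k V F ==> Ck_on k V G ==> Ck_on k V (\<lambda>x. F x * G x)"
proof (induction k arbitrary: F G)
 case (Suc k)
 from Suc.prems obtain D E where
  "\<forall>i. (\<forall>x\<in>V. has_partial F i x (D i x)) \<and> Ck_on k V (D i)"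
  "\<forall>i. (\<forall>x\<in>V. has_partial G i x (E i x)) \<and> Ck_on k V (E i)"
  by (metis Ck_on.simps(2))
 then show ?case
  using Ck_cont[OF Suc.prems(1)] Ck_cont[OF Suc.prems(2)]
   Ck_Suc_D[OF Suc.prems(1)] Ck_Suc_D[OF Suc.prems(2)]
  by (intro Ck_SucI[where D="\<lambda>i x. D i x * G x + E i x * F x"])
   (auto intro!: has_partial_mult Suc.IH Ck_add continuous_intros)
qed (auto intro!: continuous_intros)

lemma Ck_sum: "finite J ==> (\<And>j. j \<in> J ==> Ck_on k V (F j)) ==> Ck_on k V (\<lambda>x. \<Sum>j\<in>J. F j x)"
 by (induction J rule: finite_induct) (auto intro: Ck_const Ck_add)

text \<open>The order of differentiability enters only through the composite \<open>f' \<circ> F\<close>; for \<open>exp\<close>, \<open>inverse\<close> and \<open>ln\<close>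
the derivative \<open>f'\<close> is built from \<open>f\<close> itself, so that an induction on \<open>k\<close> closes up.\<close>

lemma Ck_chain1:
 assumes "Ck_on (Suc k) V F" "\<And>x. x \<in> V ==> (f has_real_derivative f' (F x)) (at (F x))"
  "Ck_on k V (\<lambda>x. f' (F x))"
 shows "Ck_on (Suc k) V (\<lambda>x. f (F x))"
proof -
 from assms(1) obtain D where D: "\<forall>i. (\<forall>x\<in>V. has_partial F i x (D i x)) \<and> Ck_on k V (D i)"
  by auto
 show ?thesis
 proof (rule Ck_SucI[where D="\<lambda>i x. D i x * f' (F x)"])
  show "continuous_on (V \<inter> RN n) (\<lambda>x. f (F x))" for n
  proof (rule continuous_on_compose2[OF _ Ck_cont[OF assms(1)], where t="F ` V" and g=f])
   show "continuous_on (F ` V) f"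
    using assms(2) by (intro continuous_at_imp_continuous_on) (auto dest: DERIV_isCont)
  qed auto
  show "has_partial (\<lambda>x. f (F x)) i x (D i x * f' (F x))" if "x \<in> V" for i x
   using D assms(2) that by (intro has_partial_chain1) blast+
  show "Ck_on k V (\<lambda>x. D i x * f' (F x))" for i
   using D assms(3) by (intro Ck_mult) blast+
 qed
qed

lemma Ck_exp: "Ck_on k V F ==> Ck_on k V (\<lambda>x. exp (F x))"
proof (induction k)
 case (Suc k)
 show ?case
  by (rule Ck_chain1[OF Suc.prems, where f'=exp]) (auto intro: DERIV_exp Suc.IH Ck_Suc_D[OF Suc.prems])
qed (auto intro!: continuous_intros)

lemma Ck_inverse: "Ck_on k V F ==> (\<And>x. x \<in> V ==> F x \<noteq> 0) ==> Ck_on k V (\<lambda>x. inverse (F x))"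
proof (induction k)
 case (Suc k)
 have i: "Ck_on k V (\<lambda>x. inverse (F x))"
  by (rule Suc.IH[OF Ck_Suc_D[OF Suc.prems(1)] Suc.prems(2)])
 show ?case
 proof (rule Ck_chain1[OF Suc.prems(1), where f'="\<lambda>u. (-1) * (inverse u * inverse u)"])
  show "(inverse has_real_derivative - 1 * (inverse (F x) * inverse (F x))) (at (F x))" if "x \<in> V" for x
   using DERIV_inverse[OF Suc.prems(2)[OF that]] by (simp add: power2_eq_square numeral_2_eq_2)
  show "Ck_on k V (\<lambda>x. - 1 * (inverse (F x) * inverse (F x)))"
   by (intro Ck_mult Ck_const i)
 qed
qed (auto intro!: continuous_intros)

lemma Ck_ln: "Ck_on k V F ==> (\<And>x. x \<in> V ==> F x > 0) ==> Ck_on k V (\<lambda>x. ln (F x))"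
proof (induction k)
 case 0
 show ?case using 0 by (auto intro!: continuous_intros) (metis IntD1 less_irrefl)+
next
 case (Suc k)
 show ?case
  by (rule Ck_chain1[OF Suc.prems(1), where f'=inverse])
   (use Suc.prems(2) in "auto simp: less_imp_neq[symmetric] intro!: DERIV_ln Ck_inverse Ck_Suc_D[OF Suc.prems(1)]")
qed

text \<open>The functions \<open>p(1/u) e\<^sup>-\<^sup>1\<^sup>/\<^sup>u\<close>, extended by zero to \<open>u \<le> 0\<close>. Admitting all polynomials \<open>p\<close> makes the
family closed under derivatives, which gives smoothness at once.\<close>

definition flat :: "real poly => real => real" where
 "flat p u = (if u \<le> 0 then 0 else poly p (1 / u) * exp (- (1 / u)))"

definition flat_deriv :: "real poly => real poly" where
 "flat_deriv p = [:0, 0, 1:] * (p - pderiv p)"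

lemma poly_exp_minus_tendsto_0: "((\<lambda>w. poly p w * exp (- w)) \<longlongrightarrow> (0::real)) at_top"
proof -
 have "((\<lambda>w. \<Sum>i\<le>degree p. coeff p i * (w ^ i / exp w)) \<longlongrightarrow> (\<Sum>i\<le>degree p. coeff p i * 0)) at_top"
  by (intro tendsto_intros tendsto_power_div_exp_0)
 then show ?thesis
  by (simp add: poly_altdef sum_distrib_right exp_minus divide_inverse mult.assoc)
qed

lemma DERIV_flat: "(flat p has_real_derivative flat (flat_deriv p) u) (at u)"
proof -
 consider "u < 0" | "u > 0" | "u = 0" by linarith
 then show ?thesis
 proof cases
  case 1
  have ev: "eventually (\<lambda>v. flat p v = 0) (nhds u)"
   by (rule eventually_mono[OF eventually_nhds_in_open[of "{..<0}" u]]) (use 1 in "auto simp: flat_def")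
  have "(flat p has_real_derivative 0) (at u)"
   using DERIV_cong_ev[OF refl ev refl, of 0] by simp
  then show ?thesis using 1 by (simp add: flat_def[of _ u])
 next
  case 2
  have ev: "eventually (\<lambda>v. flat p v = poly p (1 / v) * exp (- (1 / v))) (nhds u)"
   by (rule eventually_mono[OF eventually_nhds_in_open[of "{0<..}" u]]) (use 2 in "auto simp: flat_def")
  have "((\<lambda>v. poly p (1 / v) * exp (- (1 / v))) has_real_derivative flat (flat_deriv p) u) (at u)"
  proof -
   have i: "((\<lambda>v. 1 / v) has_real_derivative - (1 / u ^ 2)) (at u)"
    using DERIV_inverse[of u UNIV] 2 by (simp add: inverse_eq_divide power2_eq_square)
   have p: "((\<lambda>v. poly p (1 / v)) has_real_derivative poly (pderiv p) (1 / u) * - (1 / u ^ 2)) (at u)"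
    by (rule DERIV_chain2[OF poly_DERIV i])
   have e: "((\<lambda>v. exp (- (1 / v))) has_real_derivative exp (- (1 / u)) * (1 / u ^ 2)) (at u)"
    using DERIV_chain2[OF DERIV_exp DERIV_minus[OF i]] by simp
   show ?thesis
    using DERIV_mult[OF p e] 2
    by (simp add: flat_def flat_deriv_def algebra_simps power2_eq_square)
  qed
  then show ?thesis using DERIV_cong_ev[OF refl ev refl] by simp
 next
  case 3
  have "((\<lambda>h. flat p h / h) \<longlongrightarrow> 0) (at_right 0)"
  proof -
   have "((\<lambda>h. poly (pCons 0 p) (inverse h) * exp (- inverse h)) \<longlongrightarrow> 0) (at_right 0)"
    by (rule filterlim_compose[OF poly_exp_minus_tendsto_0 filterlim_inverse_at_top_right])
   moreover have "eventually (\<lambda>h. poly (pCons 0 p) (inverse h) * exp (- inverse h) = flat p h / h) (at_right 0)"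
    using eventually_at_right_less[of "0::real"]
    by eventually_elim (simp add: flat_def field_simps)
   ultimately show ?thesis by (rule Lim_transform_eventually)
  qed
  moreover have "((\<lambda>h. flat p h / h) \<longlongrightarrow> 0) (at_left 0)"
  proof -
   have "eventually (\<lambda>h. 0 = flat p h / h) (at_left 0)"
    by (simp add: eventually_at_filter flat_def)
   then show ?thesis using tendsto_const by (rule Lim_transform_eventually[rotated])
  qed
  ultimately have "((\<lambda>h. flat p h / h) \<longlongrightarrow> 0) (at 0)"
   by (simp add: filterlim_split_at)
  then show ?thesis using 3 by (simp add: DERIV_def flat_def)
 qed
qed

lemma Ck_flat: "Ck_on k V F ==> Ck_on k V (\<lambda>x. flat p (F x))"
proof (induction k arbitrary: p)
 case 0
 have "continuous_on UNIV (flat p)"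
  by (intro continuous_at_imp_continuous_on ballI DERIV_isCont[OF DERIV_flat])
 then show ?case using 0 by (auto intro: continuous_on_compose2[of UNIV "flat p"])
next
 case (Suc k)
 show ?case
  by (rule Ck_chain1[OF Suc.prems, where f'="flat (flat_deriv p)"])
   (auto intro: DERIV_flat Suc.IH Ck_Suc_D[OF Suc.prems])
qed

section \<open>The chain rule\<close>

text \<open>The mean value theorem along one coordinate axis, in a form without case distinction on the sign of \<open>h\<close>.\<close>

lemma mean_value_axis:
 assumes in_W: "\<And>r. \<bar>r\<bar> \<le> \<bar>h\<bar> ==> x + axis_pt j r \<in> W"
  and D: "\<And>y. y \<in> W ==> has_partial G j y (D y)"
 shows "\<exists>s. \<bar>s\<bar> \<le> \<bar>h\<bar> \<and> G (x + axis_pt j h) - G x = h * D (x + axis_pt j s)"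
proof -
 have deriv: "((\<lambda>r. G (x + axis_pt j r)) has_real_derivative D (x + axis_pt j r)) (at r)"
  if "\<bar>r\<bar> \<le> \<bar>h\<bar>" for r
 proof -
  have "((\<lambda>t. G (x + axis_pt j r + axis_pt j t)) has_real_derivative D (x + axis_pt j r)) (at 0)"
   using D[OF in_W[OF that]] by (simp add: has_partial_def)
  then have "((\<lambda>t. G (x + axis_pt j (t + r))) has_real_derivative D (x + axis_pt j r)) (at 0)"
   by (simp add: single_add add_ac)
  then show ?thesis using DERIV_shift[of "\<lambda>r. G (x + axis_pt j r)" _ 0 r] by simp
 qed
 consider "h = 0" | "h > 0" | "h < 0" by linarith
 then show ?thesis
 proof cases
  case 1
  then show ?thesis by (intro exI[of _ 0]) simp
 next
  case 2
  obtain z where "0 < z" "z < h" "G (x + axis_pt j h) - G (x + axis_pt j 0) = (h - 0) * D (x + axis_pt j z)"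
   using MVT2[of 0 h "\<lambda>r. G (x + axis_pt j r)" "\<lambda>r. D (x + axis_pt j r)"] deriv 2 by auto
  then show ?thesis by (intro exI[of _ z]) simp
 next
  case 3
  obtain z where "h < z" "z < 0" "G (x + axis_pt j 0) - G (x + axis_pt j h) = (0 - h) * D (x + axis_pt j z)"
   using MVT2[of h 0 "\<lambda>r. G (x + axis_pt j r)" "\<lambda>r. D (x + axis_pt j r)"] deriv 3 by auto
  then show ?thesis by (intro exI[of _ z]) (simp add: algebra_simps)
 qed
qed

text \<open>Only partial derivatives are available, so a curve is followed one coordinate at a time: the increment
of \<open>G\<close> is a telescoping sum over the axes, each term is evaluated by the mean value theorem, and the
continuity of the partial derivatives moves all of them to the base point.\<close>

lemma DERIV_along_curve:
 assumes W: "openin Rinf W"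
  and cont: "\<And>j. j < m ==> continuous_on (W \<inter> RN m) (D j)"
  and D: "\<And>j x. j < m ==> x \<in> W ==> has_partial G j x (D j x)"
  and a: "\<gamma> 0 \<in> W" and \<gamma>: "\<And>t. \<gamma> t \<in> RN m"
  and d: "\<And>j. j < m ==> ((\<lambda>t. coord (\<gamma> t) j) has_real_derivative d j) (at 0)"
 shows "((\<lambda>t. G (\<gamma> t)) has_real_derivative (\<Sum>j<m. D j (\<gamma> 0) * d j)) (at 0)"
proof -
 define a where "a = \<gamma> 0"
 have aW: "a \<in> W" and aRN: "a \<in> RN m" using \<open>\<gamma> 0 \<in> W\<close> \<gamma> by (auto simp: a_def)
 obtain S where S: "open S" "W \<inter> RN m = RN m \<inter> S"
  using openin_Rinf_RN[OF W, of m] by (auto simp: openin_open)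
 have aS: "a \<in> S" using S aW aRN by auto
 define h where "h j t = coord (\<gamma> t) j - coord a j" for j t
 define p where "p j t = a + (\<Sum>i<j. axis_pt i (h i t))" for j t
 have h_lim: "(h j \<longlongrightarrow> 0) (at 0)" if "j < m" for j
 proof -
  have "((\<lambda>t. coord (\<gamma> t) j) \<longlongrightarrow> coord (\<gamma> 0) j) (at 0)"
   using DERIV_isCont[OF d[OF that]] by (simp add: isCont_def)
  then show ?thesis unfolding h_def a_def by (rule LIM_zero)
 qed
 have axis_lim: "((\<lambda>t. axis_pt i (f t)) \<longlongrightarrow> 0) (at 0)" if "(f \<longlongrightarrow> 0) (at (0::real))" for i f
  using bounded_linear.tendsto[OF bounded_linear_axis_pt that, of i] by simp
 have p_lim: "(p j \<longlongrightarrow> a) (at 0)" if "j \<le> m" for j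
 proof -
  have "((\<lambda>t. a + (\<Sum>i<j. axis_pt i (h i t))) \<longlongrightarrow> a + (\<Sum>i<j. 0)) (at 0)"
   by (intro tendsto_intros axis_lim h_lim) (use that in auto)
  then show ?thesis by (simp add: p_def[abs_def])
 qed
 have p_RN: "p j t \<in> RN m" if "j \<le> m" for j t
  using aRN RN_mono[OF that] axis_sum_in_RN[of "\<lambda>i. h i t" j] by (auto simp: p_def intro!: add_RN)
 have main: "((\<lambda>t. G (p j t)) has_real_derivative (\<Sum>i<j. D i a * d i)) (at 0)" if "j \<le> m" for j
  using that
 proof (induction j)
  case 0
  then show ?case by (simp add: p_def)
 next
  case (Suc j)
  then have j: "j < m" by simp
  define B where "B t = G (p j t + axis_pt j (h j t)) - G (p j t)" for t
  define good where "good t s \<longleftrightarrow> \<bar>s\<bar> \<le> \<bar>h j t\<bar> \<and> B t = h j t * D j (p j t + axis_pt j s)" for t s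
  define s where "s t = (if \<exists>s. good t s then SOME s. good t s else 0)" for t
  have s: "\<bar>s t\<bar> \<le> \<bar>h j t\<bar>" for t
   using someI_ex[of "good t"] by (auto simp: s_def good_def)
  have s_lim: "(s \<longlongrightarrow> 0) (at 0)"
   by (rule Lim_null_comparison[OF _ tendsto_rabs_zero[OF h_lim[OF j]]]) (simp add: s)
  obtain \<delta> where \<delta>: "\<delta> > 0" "ball a \<delta> \<subseteq> S" using S(1) aS by (meson openE)
  have segment: "p j t + axis_pt j r \<in> W \<inter> RN m" if "dist (p j t) a < \<delta> / 2" "\<bar>h j t\<bar> < \<delta> / 2" "\<bar>r\<bar> \<le> \<bar>h j t\<bar>" for t r
  proof -
   have "dist (p j t + axis_pt j r) a \<le> dist (p j t) a + norm (axis_pt j r)"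
    by (metis (no_types, lifting) add.commute add_diff_cancel_right' dist_commute dist_norm dist_triangle2 add_diff_cancel_left' norm_minus_commute)
   then have "dist (p j t + axis_pt j r) a < \<delta>" using that by simp
   then have "p j t + axis_pt j r \<in> S" using \<delta> by (auto simp: dist_commute)
   moreover have "p j t + axis_pt j r \<in> RN m"
    using p_RN axis_pt_RN j by (auto intro!: add_RN)
   ultimately show ?thesis using S by auto
  qed
  have ev1: "eventually (\<lambda>t. dist (p j t) a < \<delta> / 2) (at 0)"
   using p_lim[of j] j \<delta> by (intro tendstoD) auto
  have ev2: "eventually (\<lambda>t. \<bar>h j t\<bar> < \<delta> / 2) (at 0)"
   using tendstoD[OF h_lim[OF j], of "\<delta> / 2"] \<delta> by (simp add: dist_real_def)
  have ev: "eventually (\<lambda>t. good t (s t) \<and> p j t + axis_pt j (s t) \<in> W \<inter> RN m) (at 0)"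
   using ev1 ev2
  proof eventually_elim
   case (elim t)
   have "\<exists>s. good t s"
    unfolding good_def B_def
    by (rule mean_value_axis[where W=W]) (use segment[OF elim] D[OF j] in auto)
   then have "good t (s t)" by (auto simp: s_def intro: someI_ex)
   then show ?case using segment[OF elim s] by simp
  qed
  have "((\<lambda>t. p j t + axis_pt j (s t)) \<longlongrightarrow> a + 0) (at 0)"
   by (intro tendsto_intros p_lim axis_lim s_lim) (use j in auto)
  then have "((\<lambda>t. D j (p j t + axis_pt j (s t))) \<longlongrightarrow> D j a) (at 0)"
   by (intro continuous_on_tendsto_compose[OF cont[OF j]])
    (use aW aRN ev in "auto elim: eventually_mono")
  moreover have "((\<lambda>t. h j t / t) \<longlongrightarrow> d j) (at 0)"
   using d[OF j] by (simp add: DERIV_def h_def a_def)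
  ultimately have "((\<lambda>t. D j (p j t + axis_pt j (s t)) * (h j t / t)) \<longlongrightarrow> D j a * d j) (at 0)"
   by (intro tendsto_mult)
  moreover have "eventually (\<lambda>t. D j (p j t + axis_pt j (s t)) * (h j t / t) = B t / t) (at 0)"
   using ev by eventually_elim (simp add: good_def)
  ultimately have "((\<lambda>t. B t / t) \<longlongrightarrow> D j a * d j) (at 0)"
   by (rule Lim_transform_eventually)
  moreover have "h j 0 = 0" by (simp add: h_def a_def)
  ultimately have "(B has_real_derivative D j a * d j) (at 0)"
   by (simp add: DERIV_def B_def)
  from DERIV_add[OF Suc.IH this] j
  have "((\<lambda>t. G (p j t) + B t) has_real_derivative (\<Sum>i<Suc j. D i a * d i)) (at 0)" by simp
  moreover have "G (p j t) + B t = G (p (Suc j) t)" for t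
   by (simp add: B_def p_def add.assoc)
  ultimately show ?case by simp
 qed
 have "p m t = \<gamma> t" for t
 proof (rule RN_eqI[OF p_RN \<gamma>])
  fix i assume "i < m"
  then show "coord (p m t) i = coord (\<gamma> t) i"
   by (simp add: p_def lookup_add coord_axis_sum h_def)
 qed simp
 then show ?thesis using main[of m] by (simp add: a_def)
qed

lemma continuous_on_axis_sum:
 "(\<And>j. j < m ==> continuous_on S (F j)) ==> continuous_on S (\<lambda>x. \<Sum>j<m. axis_pt j (F j x))"
 by (intro continuous_on_sum continuous_on_axis_pt) auto

text \<open>The chain rule, by induction on \<open>k\<close>: the partial derivatives of the composite are sums of products of
composites of lower order.\<close>

lemma Ck_compose:
 assumes V: "openin Rinf V" and W: "openin Rinf W"
  and F: "\<And>j. j < m ==> Ck_on k V (F j)"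
  and VW: "\<And>x. x \<in> V ==> (\<Sum>j<m. axis_pt j (F j x)) \<in> W"
  and G: "Ck_on k W G"
 shows "Ck_on k V (\<lambda>x. G (\<Sum>j<m. axis_pt j (F j x)))"
 using F G
proof (induction k arbitrary: G)
 case 0
 have "continuous_on (V \<inter> RN n) (\<lambda>x. G (\<Sum>j<m. axis_pt j (F j x)))" for n
  by (rule continuous_on_compose2[OF Ck_cont[OF 0(2), of m]])
   (use 0(1) VW axis_sum_in_RN in "auto intro!: continuous_on_axis_sum")
 then show ?case by simp
next
 case (Suc k)
 let ?f = "\<lambda>x. \<Sum>j<m. axis_pt j (F j x)"
 have "\<forall>j\<in>{..<m}. \<exists>E. \<forall>i. (\<forall>x\<in>V. has_partial (F j) i x (E i x)) \<and> Ck_on k V (E i)"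
  using Suc.prems(1) by auto
 then obtain E where E: "\<And>j i x. j < m ==> x \<in> V ==> has_partial (F j) i x (E j i x)"
  "\<And>j i. j < m ==> Ck_on k V (E j i)" by (metis lessThan_iff)
 from Suc.prems(2) obtain D where D: "\<And>j y. y \<in> W ==> has_partial G j y (D j y)"
  "\<And>j. Ck_on k W (D j)" by auto
 show ?case
 proof (rule Ck_SucI[where D="\<lambda>i x. \<Sum>j<m. D j (?f x) * E j i x"])
  show "continuous_on (V \<inter> RN n) (\<lambda>x. G (?f x))" for n
   by (rule continuous_on_compose2[OF Ck_cont[OF Suc.prems(2), of m]])
    (use VW axis_sum_in_RN in "auto intro!: continuous_on_axis_sum Ck_cont[OF Suc.prems(1)]")
  show "has_partial (\<lambda>x. G (?f x)) i x (\<Sum>j<m. D j (?f x) * E j i x)" if "x \<in> V" for i x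
  proof -
   have "((\<lambda>t. G (?f (x + axis_pt i t))) has_real_derivative
     (\<Sum>j<m. D j (?f (x + axis_pt i 0)) * E j i x)) (at 0)"
   proof (rule DERIV_along_curve[OF W])
    fix j assume j: "j < m"
    show "((\<lambda>t. coord (?f (x + axis_pt i t)) j) has_real_derivative E j i x) (at 0)"
     using E(1)[OF j that, of i] j by (simp add: coord_axis_sum has_partial_def)
   qed (use D(1) Ck_cont[OF D(2)] VW that axis_sum_in_RN in auto)
   then show ?thesis by (simp add: has_partial_def)
  qed
  show "Ck_on k V (\<lambda>x. \<Sum>j<m. D j (?f x) * E j i x)" for i
   by (intro Ck_sum Ck_mult Suc.IH[OF Ck_Suc_D[OF Suc.prems(1)] D(2)] E(2)) auto
 qed
qed

section \<open>Smooth functions on subsets\<close>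

lemma smooth_fun_cong:
 assumes "\<And>x. x \<in> A ==> f x = g x" "smooth_fun A f"
 shows "smooth_fun A g"
proof -
 have "(\<forall>y\<in>A \<inter> V. F y = f y) \<longleftrightarrow> (\<forall>y\<in>A \<inter> V. F y = g y)" for V F
  using assms(1) by (intro ball_cong) auto
 then show ?thesis using assms(2) by (simp only: smooth_fun_def)
qed

lemma smooth_fun_subset:
 assumes "smooth_fun B f" "A \<subseteq> B"
 shows "smooth_fun A f"
 unfolding smooth_fun_def
proof
 fix x assume "x \<in> A"
 then have "x \<in> B" using assms(2) by blast
 with assms(1) obtain V F where "openin Rinf V" "x \<in> V" "\<forall>k. Ck_on k V F" "\<forall>y\<in>B \<inter> V. F y = f y"
  using bspec[OF assms(1)[unfolded smooth_fun_def] \<open>x \<in> B\<close>] by (elim exE conjE) (rule that)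
 then show "\<exists>V F. openin Rinf V \<and> x \<in> V \<and> (\<forall>k. Ck_on k V F) \<and> (\<forall>y\<in>A \<inter> V. F y = f y)"
  using assms(2) by (intro exI[of _ V] exI[of _ F]) auto
qed

lemma smooth_fun_local:
 assumes "\<And>x. x \<in> A ==> \<exists>V. openin Rinf V \<and> x \<in> V \<and> smooth_fun (A \<inter> V) f"
 shows "smooth_fun A f"
 unfolding smooth_fun_def
proof
 fix x assume x: "x \<in> A"
 obtain V where V: "openin Rinf V" "x \<in> V" "smooth_fun (A \<inter> V) f" using assms[OF x] by auto
 then obtain U F where U: "openin Rinf U" "x \<in> U" "\<And>k. Ck_on k U F" "\<And>y. y \<in> A \<inter> V \<inter> U ==> F y = f y"
  using x unfolding smooth_fun_def by (metis IntI)
 show "\<exists>V F. openin Rinf V \<and> x \<in> V \<and> (\<forall>k. Ck_on k V F) \<and> (\<forall>y\<in>A \<inter> V. F y = f y)"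
  by (rule exI[of _ "V \<inter> U"], rule exI[of _ F])
   (use V U Ck_subset[OF U(3), of "V \<inter> U"] in auto)
qed

lemma smooth_funI_Ck: "openin Rinf V ==> A \<subseteq> V ==> (\<And>k. Ck_on k V F) ==> smooth_fun A F"
 unfolding smooth_fun_def by (intro ballI exI[of _ V] exI[of _ F]) auto

lemma openin_Rinf_UNIV [simp]: "openin Rinf UNIV"
 using openin_topspace[of Rinf] by simp

lemma smooth_fun_const [intro]: "smooth_fun A (\<lambda>_. c)"
 by (rule smooth_funI_Ck[of UNIV]) (auto intro: Ck_const)

lemma smooth_fun_coord [intro]: "smooth_fun A (\<lambda>x. coord x i)"
 by (rule smooth_funI_Ck[of UNIV]) (auto intro: Ck_coord)

text \<open>Smoothness on a subset is witnessed by extensions on neighbourhoods that depend on the coordinate. For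
a map into \<open>\<real>\<^sup>m\<close> these are finitely many, so one neighbourhood serves them all and can be shrunk so
that the extended map stays in a given open set.\<close>

lemma local_extension_RN:
 assumes f: "\<And>i. i < m ==> smooth_fun A (\<lambda>x. coord (f x) i)"
  and RN: "\<And>x. x \<in> A ==> f x \<in> RN m" and x: "x \<in> A" and W: "openin Rinf W" "f x \<in> W"
 obtains V F where "openin Rinf V" "x \<in> V" "\<And>j k. j < m ==> Ck_on k V (F j)"
  "\<And>y. y \<in> V ==> (\<Sum>j<m. axis_pt j (F j y)) \<in> W"
  "\<And>y. y \<in> A \<inter> V ==> (\<Sum>j<m. axis_pt j (F j y)) = f y"
proof -
 have "\<forall>i\<in>{..<m}. \<exists>V F. openin Rinf V \<and> x \<in> V \<and> (\<forall>k. Ck_on k V F) \<and> (\<forall>y\<in>A \<inter> V. F y = coord (f y) i)"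
  using f x unfolding smooth_fun_def by blast
 then obtain V F where V: "\<And>i. i < m ==> openin Rinf (V i)" "\<And>i. i < m ==> x \<in> V i"
   "\<And>i k. i < m ==> Ck_on k (V i) (F i)" "\<And>i y. i < m ==> y \<in> A \<inter> V i ==> F i y = coord (f y) i"
  by (metis lessThan_iff)
 define V0 where "V0 = \<Inter>(insert UNIV (V ` {..<m}))"
 have V0: "openin Rinf V0" unfolding V0_def by (rule openin_Inter) (use V in auto)
 have xV0: "x \<in> V0" using V by (auto simp: V0_def)
 have sub: "V0 \<subseteq> V i" if "i < m" for i using that by (auto simp: V0_def)
 define G where "G y = (\<Sum>j<m. axis_pt j (F j y))" for y
 have eq: "G y = f y" if "y \<in> A \<inter> V0" for y
 proof (rule RN_eqI[of _ m])
  show "f y \<in> RN m" using RN that by auto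
  show "coord (G y) i = coord (f y) i" if i: "i < m" for i
   using V(4)[OF i, of y] sub[OF i] \<open>y \<in> A \<inter> V0\<close> i by (auto simp: G_def coord_axis_sum)
 qed (simp add: G_def axis_sum_in_RN)
 define V1 where "V1 = {y \<in> V0. G y \<in> W}"
 have "openin Rinf V1" unfolding V1_def
 proof (rule openin_Rinf_preimage[OF V0 _ _ W(1)])
  show "continuous_on (V0 \<inter> RN n) G" for n
   unfolding G_def by (intro continuous_on_axis_sum Ck_cont Ck_subset[OF V(3) sub])
  show "G y \<in> RN m" for y by (simp add: G_def axis_sum_in_RN)
 qed
 moreover have "x \<in> V1" using xV0 eq x W by (auto simp: V1_def)
 moreover have "Ck_on k V1 (F j)" if "j < m" for j k
  by (rule Ck_subset[OF V(3)[OF that]]) (use sub[OF that] in "auto simp: V1_def")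
 ultimately show ?thesis
  by (rule that) (use eq in "auto simp: V1_def G_def")
qed

lemma smooth_fun_compose_RN:
 assumes g: "smooth_fun B g" and f: "\<And>i. i < m ==> smooth_fun A (\<lambda>x. coord (f x) i)"
  and B: "\<And>x. x \<in> A ==> f x \<in> B" and RN: "\<And>x. x \<in> A ==> f x \<in> RN m"
 shows "smooth_fun A (\<lambda>x. g (f x))"
 unfolding smooth_fun_def
proof
 fix x assume x: "x \<in> A"
 obtain W G where W: "openin Rinf W" "f x \<in> W" "\<And>k. Ck_on k W G" "\<And>y. y \<in> B \<inter> W ==> G y = g y"
  using bspec[OF g[unfolded smooth_fun_def] B[OF x]] by blast
 show "\<exists>V F. openin Rinf V \<and> x \<in> V \<and> (\<forall>k. Ck_on k V F) \<and> (\<forall>y\<in>A \<inter> V. F y = g (f y))"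
 proof (rule local_extension_RN[OF f RN x W(1,2)])
  fix V F
  assume V: "openin Rinf V" "x \<in> V" "\<And>j k. j < m ==> Ck_on k V (F j)"
   "\<And>y. y \<in> V ==> (\<Sum>j<m. axis_pt j (F j y)) \<in> W"
   "\<And>y. y \<in> A \<inter> V ==> (\<Sum>j<m. axis_pt j (F j y)) = f y"
  show ?thesis
  proof (intro exI conjI allI ballI)
   show "Ck_on k V (\<lambda>x. G (\<Sum>j<m. axis_pt j (F j x)))" for k
    by (rule Ck_compose[OF V(1) W(1) V(3) V(4) W(3)])
   fix y assume y: "y \<in> A \<inter> V"
   then have "f y \<in> B \<inter> W" using V(4)[of y] V(5)[OF y] B by simp
   then show "G (\<Sum>j<m. axis_pt j (F j y)) = g (f y)" using W(4) V(5)[OF y] by simp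
  qed (use V in simp_all)
 qed
qed

lemma smooth_fun_compose1:
 assumes h: "smooth_fun B (\<lambda>z. h (coord z 0))" and f: "smooth_fun A f"
  and B: "\<And>x. x \<in> A ==> axis_pt 0 (f x) \<in> B"
 shows "smooth_fun A (\<lambda>x. h (f x))"
proof -
 have "smooth_fun A (\<lambda>x. h (coord (axis_pt 0 (f x)) 0))"
  by (rule smooth_fun_compose_RN[OF h, where m=1]) (use f B in "auto intro: axis_pt_RN")
 then show ?thesis by simp
qed

lemma smooth_fun_compose2:
 assumes h: "\<And>k. Ck_on k UNIV (\<lambda>z. h (coord z 0) (coord z 1))" and f: "smooth_fun A f" and g: "smooth_fun A g"
 shows "smooth_fun A (\<lambda>x. h (f x) (g x))"
proof -
 let ?p = "\<lambda>x. axis_pt 0 (f x) + axis_pt 1 (g x)"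
 have c: "coord (?p x) i = (if i = 0 then f x else if i = 1 then g x else 0)" for x i
  by (simp add: lookup_add lookup_single when_def)
 have "smooth_fun A (\<lambda>x. h (coord (?p x) 0) (coord (?p x) 1))"
 proof (rule smooth_fun_compose_RN[where m=2 and B=UNIV and g="\<lambda>z. h (coord z 0) (coord z 1)"])
  show "smooth_fun A (\<lambda>x. coord (?p x) i)" for i
   unfolding c using f g by (cases "i = 0"; cases "i = 1") auto
  show "?p x \<in> RN 2" for x by (auto intro!: add_RN axis_pt_RN)
 qed (use smooth_funI_Ck[of UNIV UNIV] h in auto)
 then show ?thesis unfolding c by simp
qed

lemma smooth_fun_add [intro]: "smooth_fun A f ==> smooth_fun A g ==> smooth_fun A (\<lambda>x. f x + g x)"
 by (rule smooth_fun_compose2[of "(+)"]) (auto intro: Ck_add Ck_coord)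

lemma smooth_fun_mult [intro]: "smooth_fun A f ==> smooth_fun A g ==> smooth_fun A (\<lambda>x. f x * g x)"
 by (rule smooth_fun_compose2[of "(*)"]) (auto intro: Ck_mult Ck_coord)

lemma smooth_fun_uminus [intro]: "smooth_fun A f ==> smooth_fun A (\<lambda>x. - f x)"
 using smooth_fun_mult[OF smooth_fun_const[of A "-1"], of f] by simp

lemma smooth_fun_diff [intro]: "smooth_fun A f ==> smooth_fun A g ==> smooth_fun A (\<lambda>x. f x - g x)"
 using smooth_fun_add[OF _ smooth_fun_uminus, of A f g] by simp

lemma smooth_fun_exp [intro]: "smooth_fun A f ==> smooth_fun A (\<lambda>x. exp (f x))"
 by (rule smooth_fun_compose1[of UNIV exp]) (auto intro!: smooth_funI_Ck[of UNIV] Ck_exp Ck_coord)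

lemma smooth_fun_flat [intro]: "smooth_fun A f ==> smooth_fun A (\<lambda>x. flat p (f x))"
 by (rule smooth_fun_compose1[of UNIV "flat p"]) (auto intro!: smooth_funI_Ck[of UNIV] Ck_flat Ck_coord)

lemma openin_coord_pos: "openin Rinf {z. coord z i > 0}"
 by (intro open_imp_openin_Rinf open_Collect_less continuous_intros)

lemma smooth_fun_ln [intro]: "smooth_fun A f ==> (\<And>x. x \<in> A ==> f x > 0) ==> smooth_fun A (\<lambda>x. ln (f x))"
 by (rule smooth_fun_compose1[of "{z. coord z 0 > 0}" ln])
  (auto intro!: smooth_funI_Ck[OF openin_coord_pos] Ck_ln Ck_coord)

lemma smooth_fun_inverse [intro]:
 "smooth_fun A f ==> (\<And>x. x \<in> A ==> f x > 0) ==> smooth_fun A (\<lambda>x. inverse (f x))"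
 by (rule smooth_fun_compose1[of "{z. coord z 0 > 0}" inverse])
  (auto intro!: smooth_funI_Ck[OF openin_coord_pos] Ck_inverse Ck_coord)

section \<open>Smooth maps\<close>

lemma smooth_map_image: "smooth_map A B f ==> x \<in> A ==> f x \<in> B"
 unfolding smooth_map_def continuous_map_def by auto

lemma smooth_map_coord: "smooth_map A B f ==> smooth_fun A (\<lambda>x. coord (f x) i)"
 by (simp add: smooth_map_def)

lemma smooth_map_preimage:
 assumes "smooth_map A B f" "openin Rinf W"
 obtains V where "openin Rinf V" "\<And>x. x \<in> A ==> x \<in> V \<longleftrightarrow> f x \<in> W"
proof -
 have "openin (subtopology Rinf B) (B \<inter> W)"
  using assms(2) by (auto simp: openin_subtopology)
 then have "openin (subtopology Rinf A) {x \<in> topspace (subtopology Rinf A). f x \<in> B \<inter> W}"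
  using assms(1) unfolding smooth_map_def continuous_map_def by blast
 then obtain V where "openin Rinf V" "{x \<in> A. f x \<in> B \<inter> W} = V \<inter> A"
  by (auto simp: openin_subtopology)
 then show ?thesis using smooth_map_image[OF assms(1)] by (intro that[of V]) auto
qed

lemma smooth_mapI:
 assumes "\<And>x. x \<in> A ==> f x \<in> B" "\<And>i. smooth_fun A (\<lambda>x. coord (f x) i)"
  "\<And>x W. x \<in> A ==> openin Rinf W ==> f x \<in> W ==> \<exists>V. openin Rinf V \<and> x \<in> V \<and> (\<forall>y\<in>A \<inter> V. f y \<in> W)"
 shows "smooth_map A B f"
proof -
 have "openin (subtopology Rinf A) {x \<in> A. f x \<in> U}" if U: "openin (subtopology Rinf B) U" for U
 proof -
  obtain W where W: "openin Rinf W" "U = W \<inter> B" using U by (auto simp: openin_subtopology)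
  show ?thesis
  proof (subst openin_subopen, intro ballI)
   fix x assume x: "x \<in> {x \<in> A. f x \<in> U}"
   then obtain V where V: "openin Rinf V" "x \<in> V" "\<forall>y\<in>A \<inter> V. f y \<in> W"
    using assms(3)[of x W] W by auto
   have "openin (subtopology Rinf A) (V \<inter> A)" using V(1) by (auto simp: openin_subtopology)
   moreover have "V \<inter> A \<subseteq> {x \<in> A. f x \<in> U}" using V assms(1) W by auto
   ultimately show "\<exists>T. openin (subtopology Rinf A) T \<and> x \<in> T \<and> T \<subseteq> {x \<in> A. f x \<in> U}"
    using x V by blast
  qed
 qed
 then show ?thesis using assms(1,2) by (auto simp: smooth_map_def continuous_map_def)
qed

lemma smooth_mapI_RN:
 assumes "\<And>x. x \<in> A ==> f x \<in> B" "\<And>x. x \<in> A ==> f x \<in> RN m"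
  "\<And>i. i < m ==> smooth_fun A (\<lambda>x. coord (f x) i)"
 shows "smooth_map A B f"
proof (rule smooth_mapI[OF assms(1)])
 show "smooth_fun A (\<lambda>x. coord (f x) i)" for i
 proof (cases "i < m")
  case False
  then have "coord (f x) i = 0" if "x \<in> A" for x using assms(2)[OF that] by (auto simp: RN_def)
  then show ?thesis by (intro smooth_fun_cong[OF _ smooth_fun_const[of A 0]]) auto
 qed (rule assms(3))
 fix x W assume x: "x \<in> A" and W: "openin Rinf W" "f x \<in> W"
 show "\<exists>V. openin Rinf V \<and> x \<in> V \<and> (\<forall>y\<in>A \<inter> V. f y \<in> W)"
 proof (rule local_extension_RN[OF assms(3,2) x W])
  fix V F assume V: "openin Rinf V" "x \<in> V" "\<And>y. y \<in> V ==> (\<Sum>j<m. axis_pt j (F j y)) \<in> W"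
   "\<And>y. y \<in> A \<inter> V ==> (\<Sum>j<m. axis_pt j (F j y)) = f y"
  then show ?thesis by (intro exI[of _ V]) force
 qed
qed

lemma smooth_map_id: "A \<subseteq> B ==> smooth_map A B (\<lambda>x. x)"
 by (rule smooth_mapI) auto

lemma smooth_map_subset:
 assumes "smooth_map A B f" "A' \<subseteq> A" "\<And>x. x \<in> A' ==> f x \<in> B'"
 shows "smooth_map A' B' f"
proof (rule smooth_mapI[OF assms(3)])
 show "smooth_fun A' (\<lambda>x. coord (f x) i)" for i
  by (rule smooth_fun_subset[OF smooth_map_coord[OF assms(1)] assms(2)])
 fix x W assume x: "x \<in> A'" and W: "openin Rinf W" "f x \<in> W"
 obtain V where "openin Rinf V" "\<And>x. x \<in> A ==> x \<in> V \<longleftrightarrow> f x \<in> W"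
  by (rule smooth_map_preimage[OF assms(1) W(1)]) blast
 then show "\<exists>V. openin Rinf V \<and> x \<in> V \<and> (\<forall>y\<in>A' \<inter> V. f y \<in> W)"
  using x W assms(2) by (intro exI[of _ V]) auto
qed

lemma smooth_map_cong:
 assumes "\<And>x. x \<in> A ==> f x = g x" "smooth_map A B f"
 shows "smooth_map A B g"
proof (rule smooth_mapI)
 show "g x \<in> B" if "x \<in> A" for x using smooth_map_image[OF assms(2) that] assms(1)[OF that] by simp
 show "smooth_fun A (\<lambda>x. coord (g x) i)" for i
  by (rule smooth_fun_cong[OF _ smooth_map_coord[OF assms(2)]]) (simp add: assms(1))
 fix x W assume x: "x \<in> A" and W: "openin Rinf W" "g x \<in> W"
 obtain V where "openin Rinf V" "\<And>x. x \<in> A ==> x \<in> V \<longleftrightarrow> f x \<in> W"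
  by (rule smooth_map_preimage[OF assms(2) W(1)]) blast
 then show "\<exists>V. openin Rinf V \<and> x \<in> V \<and> (\<forall>y\<in>A \<inter> V. g y \<in> W)"
  using x W assms(1) by (intro exI[of _ V]) auto
qed

text \<open>The chain rule needs maps with finitely many coordinates, while a target is a subset of \<open>\<real>\<^sup>\<infinity>\<close>. This is
the property of a domain that reduces the second situation to the first locally.\<close>

definition locally_bounded_source :: "rinf set => bool" where
 "locally_bounded_source A \<longleftrightarrow> (\<forall>f B. smooth_map A B f -->
   (\<forall>x\<in>A. \<exists>V m. openin Rinf V \<and> x \<in> V \<and> (\<forall>y\<in>A \<inter> V. f y \<in> RN m)))"

lemma locally_bounded_sourceD:
 assumes "locally_bounded_source A" "smooth_map A B f" "x \<in> A"
 shows "\<exists>V m. openin Rinf V \<and> x \<in> V \<and> (\<forall>y\<in>A \<inter> V. f y \<in> RN m)"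
 by (rule assms(1)[unfolded locally_bounded_source_def, rule_format, OF assms(2,3)])

text \<open>The reason is first countability of \<open>\<real>\<^sup>n\<close>. If the property fails at \<open>x\<close>, there are points \<open>y\<^sub>k \<rightarrow> x\<close> whose
images leave every \<open>\<real>\<^sup>m\<close>. The set of these images meets each \<open>\<real>\<^sup>m\<close> in a finite set, hence is closed in
the colimit topology, and it misses \<open>f x\<close>; this contradicts continuity.\<close>

lemma locally_bounded_source_RN:
 assumes A: "A \<subseteq> RN n"
 shows "locally_bounded_source A"
 unfolding locally_bounded_source_def
proof (intro allI impI ballI)
 fix f B x assume f: "smooth_map A B f" and x: "x \<in> A"
 obtain N where N: "f x \<in> RN N" using ex_RN by blast
 show "\<exists>V m. openin Rinf V \<and> x \<in> V \<and> (\<forall>y\<in>A \<inter> V. f y \<in> RN m)"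
 proof (rule ccontr)
  assume no: "\<not> ?thesis"
  have "\<exists>y. y \<in> A \<and> dist y x < inverse (Suc k) \<and> f y \<notin> RN (max k N)" for k
  proof (rule ccontr)
   assume "\<not> (\<exists>y. y \<in> A \<and> dist y x < inverse (Suc k) \<and> f y \<notin> RN (max k N))"
   then have "\<forall>y\<in>A \<inter> ball x (inverse (Suc k)). f y \<in> RN (max k N)" by (auto simp: dist_commute)
   moreover have "openin Rinf (ball x (inverse (Suc k)))" by (intro open_imp_openin_Rinf) simp
   moreover have "x \<in> ball x (inverse (Suc k))" by simp
   ultimately show False using no by blast
  qed
  then have "\<forall>k. \<exists>y. y \<in> A \<and> dist y x < inverse (Suc k) \<and> f y \<notin> RN (max k N)" by blast
  then obtain y where y: "\<And>k. y k \<in> A" "\<And>k. dist (y k) x < inverse (Suc k)" "\<And>k. f (y k) \<notin> RN (max k N)"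
   by (elim choice[THEN exE]) blast
  define S where "S = range (\<lambda>k. f (y k))"
  have "openin Rinf (- S)" unfolding openin_Rinf rinf_open_def
  proof
   fix m
   have "f (y k) \<notin> RN m" if "m \<le> k" for k
    using y(3)[of k] RN_mono[OF max.coboundedI1[OF that, of N]] by auto
   then have "S \<inter> RN m \<subseteq> (\<lambda>k. f (y k)) ` {..<m}" by (force simp: S_def not_less[symmetric])
   then have "finite (S \<inter> RN m)" by (rule finite_subset) simp
   then have "open (- (S \<inter> RN m))" by (intro open_Compl finite_imp_closed)
   then show "openin (top_of_set (RN m)) (- S \<inter> RN m)"
    unfolding openin_open by (intro exI[of _ "- (S \<inter> RN m)"]) auto
  qed
  then obtain V where V: "openin Rinf V" "\<And>x. x \<in> A ==> x \<in> V \<longleftrightarrow> f x \<in> - S"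
   by (rule smooth_map_preimage[OF f]) blast
  have "f x \<noteq> f (y k)" for k using N y(3)[of k] RN_mono[of N "max k N"] by auto
  then have "x \<in> V" using V(2)[OF x] by (auto simp: S_def)
  have "openin (subtopology Rinf A) (V \<inter> A)" using V(1) by (auto simp: openin_subtopology)
  then have "openin (top_of_set A) (V \<inter> A)" by (simp only: subtopology_Rinf_eq[OF A])
  then obtain O' where O': "open O'" "V \<inter> A = A \<inter> O'" by (auto simp: openin_open)
  then have "x \<in> O'" using \<open>x \<in> V\<close> x by auto
  then obtain e where e: "e > 0" "ball x e \<subseteq> O'" using O'(1) by (meson openE)
  obtain k where "inverse (real (Suc k)) < e" using reals_Archimedean[OF e(1)] by auto
  then have "dist (y k) x < e" by (rule less_trans[OF y(2)])
  then have "y k \<in> O'" using e(2) by (auto simp: dist_commute)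
  then have "y k \<in> V" using O'(2) y(1) by blast
  then show False using V(2)[OF y(1)] by (auto simp: S_def)
 qed
qed

lemma smooth_fun_compose:
 assumes A: "locally_bounded_source A" and f: "smooth_map A B f" and g: "smooth_fun B g"
 shows "smooth_fun A (\<lambda>x. g (f x))"
proof (rule smooth_fun_local)
 fix x assume x: "x \<in> A"
 obtain V m where V: "openin Rinf V" "x \<in> V" "\<forall>y\<in>A \<inter> V. f y \<in> RN m"
  using locally_bounded_sourceD[OF A f x] by (elim exE conjE)
 have "smooth_fun (A \<inter> V) (\<lambda>x. g (f x))"
  by (rule smooth_fun_compose_RN[OF g smooth_fun_subset[OF smooth_map_coord[OF f]], where m=m])
   (use V smooth_map_image[OF f] in auto)
 then show "\<exists>V. openin Rinf V \<and> x \<in> V \<and> smooth_fun (A \<inter> V) (\<lambda>x. g (f x))"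
  using V by blast
qed

lemma smooth_map_compose:
 assumes A: "locally_bounded_source A" and f: "smooth_map A B f" and g: "smooth_map B C g"
 shows "smooth_map A C (\<lambda>x. g (f x))"
proof (rule smooth_mapI)
 show "g (f x) \<in> C" if "x \<in> A" for x
  by (rule smooth_map_image[OF g smooth_map_image[OF f that]])
 show "smooth_fun A (\<lambda>x. coord (g (f x)) i)" for i
  by (rule smooth_fun_compose[OF A f smooth_map_coord[OF g]])
 fix x W assume x: "x \<in> A" and W: "openin Rinf W" "g (f x) \<in> W"
 obtain U where U: "openin Rinf U" "\<And>x. x \<in> B ==> x \<in> U \<longleftrightarrow> g x \<in> W"
  by (rule smooth_map_preimage[OF g W(1)]) blast
 obtain V where V: "openin Rinf V" "\<And>x. x \<in> A ==> x \<in> V \<longleftrightarrow> f x \<in> U"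
  by (rule smooth_map_preimage[OF f U(1)]) blast
 show "\<exists>V. openin Rinf V \<and> x \<in> V \<and> (\<forall>y\<in>A \<inter> V. g (f y) \<in> W)"
  using x W U V smooth_map_image[OF f] by (intro exI[of _ V]) auto
qed

lemma locally_bounded_source_transfer:
 assumes A': "locally_bounded_source A'" and e: "smooth_map A' A e" and e': "smooth_map A A' e'"
  and inv: "\<And>y. y \<in> A ==> e (e' y) = y"
 shows "locally_bounded_source A"
 unfolding locally_bounded_source_def
proof (intro allI impI ballI)
 fix f B x assume f: "smooth_map A B f" and x: "x \<in> A"
 have "smooth_map A' B (\<lambda>x. f (e x))" by (rule smooth_map_compose[OF A' e f])
 from locally_bounded_sourceD[OF A' this smooth_map_image[OF e' x]]
 obtain V m where V: "openin Rinf V" "e' x \<in> V" "\<forall>y\<in>A' \<inter> V. f (e y) \<in> RN m"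
  by (elim exE conjE)
 obtain U where U: "openin Rinf U" "\<And>x. x \<in> A ==> x \<in> U \<longleftrightarrow> e' x \<in> V"
  by (rule smooth_map_preimage[OF e' V(1)]) blast
 have "f y \<in> RN m" if "y \<in> A \<inter> U" for y
 proof -
  have "e' y \<in> A' \<inter> V" using that U(2)[of y] smooth_map_image[OF e', of y] by simp
  then have "f (e (e' y)) \<in> RN m" using V(3) by blast
  then show ?thesis using inv[of y] that by simp
 qed
 then show "\<exists>V m. openin Rinf V \<and> x \<in> V \<and> (\<forall>y\<in>A \<inter> V. f y \<in> RN m)"
  using U V x by (intro exI[of _ U] exI[of _ m]) auto
qed

section \<open>Cartesian spaces\<close>

lemma Obj_Cart_iff: "c \<in> Obj Cart \<longleftrightarrow> (\<exists>n e. diffeo (RN n) c e)"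
 by (simp add: Cart_def)

lemma Hom_Cart_iff: "f \<in> Hom Cart c d \<longleftrightarrow> f \<in> extensional c \<and> smooth_map c d f"
 by (simp add: Cart_def)

lemma Cart_locally_bounded: "c \<in> Obj Cart ==> locally_bounded_source c"
 unfolding Obj_Cart_iff diffeo_def
 by (elim exE conjE) (rule locally_bounded_source_transfer[OF locally_bounded_source_RN[OF subset_refl]], blast+)

lemma diffeo_compose:
 assumes "diffeo A B f" "diffeo B C g" "locally_bounded_source A"
 shows "diffeo A C (\<lambda>x. g (f x))"
proof -
 obtain f' where f': "smooth_map B A f'" "\<forall>x\<in>A. f' (f x) = x" "\<forall>y\<in>B. f (f' y) = y"
  and f: "smooth_map A B f" using assms(1) unfolding diffeo_def by (elim exE conjE)
 obtain g' where g': "smooth_map C B g'" "\<forall>x\<in>B. g' (g x) = x" "\<forall>y\<in>C. g (g' y) = y"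
  and g: "smooth_map B C g" using assms(2) unfolding diffeo_def by (elim exE conjE)
 have B: "locally_bounded_source B"
  by (rule locally_bounded_source_transfer[OF assms(3) f f'(1)]) (use f' in blast)
 have C: "locally_bounded_source C"
  by (rule locally_bounded_source_transfer[OF B g g'(1)]) (use g' in blast)
 show ?thesis unfolding diffeo_def
  using smooth_map_compose[OF assms(3) f g] smooth_map_compose[OF C g'(1) f'(1)]
   f' g' smooth_map_image[OF f] smooth_map_image[OF g'(1)]
  by (intro conjI exI[of _ "\<lambda>x. f' (g' x)"]) auto
qed

lemma diffeo_id: "diffeo A A (\<lambda>x. x)"
 unfolding diffeo_def using smooth_map_id[of A A] by auto

lemma RN_in_Cart [simp]: "RN n \<in> Obj Cart"
 unfolding Obj_Cart_iff by (intro exI) (rule diffeo_id)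

lemma Cart_diffeo: "c \<in> Obj Cart ==> diffeo c c' e ==> c' \<in> Obj Cart"
 unfolding Obj_Cart_iff
 by (elim exE) (intro exI, erule diffeo_compose, assumption, rule locally_bounded_source_RN[OF subset_refl])

lemma diffeo_image: "diffeo A B f ==> f ` A = B"
proof -
 assume "diffeo A B f"
 then obtain g where g: "smooth_map B A g" "\<forall>y\<in>B. f (g y) = y" and f: "smooth_map A B f"
  unfolding diffeo_def by blast
 show ?thesis
 proof (intro equalityI subsetI)
  fix y assume "y \<in> B"
  then show "y \<in> f ` A" using g smooth_map_image[OF g(1)] by (intro image_eqI[of _ _ "g y"]) auto
 qed (use smooth_map_image[OF f] in auto)
qed

lemma diffeo_subset:
 assumes "diffeo A B f" "A' \<subseteq> A"
 shows "diffeo A' (f ` A') f"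
proof -
 obtain g where g: "smooth_map B A g" "\<forall>x\<in>A. g (f x) = x" and f: "smooth_map A B f"
  using assms(1) unfolding diffeo_def by blast
 have "smooth_map A' (f ` A') f" by (rule smooth_map_subset[OF f assms(2)]) auto
 moreover have "smooth_map (f ` A') A' g"
  by (rule smooth_map_subset[OF g(1)]) (use g(2) assms(2) smooth_map_image[OF f] in auto)
 moreover have "g (f x) = x" if "x \<in> A'" for x using g(2) assms(2) that by blast
 ultimately show ?thesis unfolding diffeo_def by (intro conjI exI[of _ g]) auto
qed

section \<open>Boxes\<close>

definition obox :: "nat => (nat => real) => (nat => real) => rinf set" where
 "obox n a b = {x \<in> RN n. \<forall>i<n. a i < coord x i \<and> coord x i < b i}"

lemma obox_RN: "obox n a b \<subseteq> RN n" by (auto simp: obox_def)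

lemma openin_obox: "openin (top_of_set (RN n)) (obox n a b)"
proof -
 have "open {x. a i < coord x i \<and> coord x i < b i}" for i
  by (intro open_Collect_conj open_Collect_less continuous_intros)
 then have "open (\<Inter>i\<in>{..<n}. {x. a i < coord x i \<and> coord x i < b i})" by blast
 moreover have "obox n a b = RN n \<inter> (\<Inter>i\<in>{..<n}. {x. a i < coord x i \<and> coord x i < b i})"
  by (auto simp: obox_def)
 ultimately show ?thesis by (auto simp: openin_open)
qed

lemma obox_Int: "obox n a b \<inter> obox n a' b' = obox n (\<lambda>i. max (a i) (a' i)) (\<lambda>i. min (b i) (b' i))"
 by (auto simp: obox_def)

lemma obox_nonempty: "obox n a b \<noteq> {} \<longleftrightarrow> (\<forall>i<n. a i < b i)"
proof
 assume "\<forall>i<n. a i < b i"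
 then have "(\<Sum>i<n. axis_pt i ((a i + b i) / 2)) \<in> obox n a b"
  by (auto simp: obox_def coord_axis_sum axis_sum_in_RN field_simps)
 then show "obox n a b \<noteq> {}" by blast
qed (force simp: obox_def)

text \<open>Coordinatewise, the logistic function identifies \<open>\<real>\<close> with a bounded interval.\<close>

lemma obox_in_Cart:
 assumes "obox n a b \<noteq> {}"
 shows "obox n a b \<in> Obj Cart"
proof -
 have ab: "a i < b i" if "i < n" for i using assms that by (simp add: obox_nonempty)
 define e where "e x = (\<Sum>i<n. axis_pt i (a i + (b i - a i) * inverse (1 + exp (- coord x i))))" for x
 define g where "g y = (\<Sum>i<n. axis_pt i (ln (coord y i - a i) - ln (b i - coord y i)))" for y
 have pos: "1 + exp t > 0" for t :: real by (simp add: add_pos_pos)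
 have e1: "smooth_map (RN n) (obox n a b) e"
 proof (rule smooth_mapI_RN)
  show "e x \<in> obox n a b" for x
  proof -
   have "0 < (b i - a i) * inverse (1 + exp (- coord x i))"
    "(b i - a i) * inverse (1 + exp (- coord x i)) < (b i - a i) * 1" if "i < n" for i
    using ab[OF that] pos by (auto intro!: mult_strict_left_mono simp: inverse_less_1_iff add_pos_pos)
   then show ?thesis by (fastforce simp: obox_def e_def axis_sum_in_RN coord_axis_sum)
  qed
  then show "e x \<in> RN n" for x using obox_RN by blast
  show "smooth_fun (RN n) (\<lambda>x. coord (e x) i)" if "i < n" for i
   using that by (simp add: e_def coord_axis_sum)
    (intro smooth_fun_add smooth_fun_mult smooth_fun_const smooth_fun_inverse smooth_fun_exp smooth_fun_uminus smooth_fun_coord pos)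
 qed
 have g1: "smooth_map (obox n a b) (RN n) g"
 proof (rule smooth_mapI_RN)
  show "g y \<in> RN n" "g y \<in> RN n" for y by (auto simp: g_def axis_sum_in_RN)
  show "smooth_fun (obox n a b) (\<lambda>y. coord (g y) i)" if "i < n" for i
   using that by (simp add: g_def coord_axis_sum)
    (intro smooth_fun_diff smooth_fun_ln smooth_fun_const smooth_fun_coord, auto simp: obox_def)
 qed
 have "g (e x) = x" if "x \<in> RN n" for x
 proof (rule RN_eqI[OF _ that])
  fix i assume i: "i < n"
  define u where "u = exp (- coord x i)"
  have u: "u > 0" by (simp add: u_def)
  have 1: "a i + (b i - a i) * inverse (1 + u) - a i = (b i - a i) * inverse (1 + u)" by simp
  have 2: "b i - (a i + (b i - a i) * inverse (1 + u)) = (b i - a i) * (u * inverse (1 + u))"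
   using u by (simp add: field_simps)
  have "ln (a i + (b i - a i) * inverse (1 + u) - a i) - ln (b i - (a i + (b i - a i) * inverse (1 + u))) = - ln u"
   unfolding 1 2 using u ab[OF i] by (simp add: ln_mult)
  then show "coord (g (e x)) i = coord x i"
   using i by (simp add: g_def e_def coord_axis_sum u_def)
 qed (simp add: g_def axis_sum_in_RN)
 moreover have "e (g y) = y" if y: "y \<in> obox n a b" for y
 proof (rule RN_eqI)
  show "y \<in> RN n" using y obox_RN by blast
  fix i assume i: "i < n"
  have p: "coord y i - a i > 0" "b i - coord y i > 0" using y i by (auto simp: obox_def)
  have "exp (- (ln (coord y i - a i) - ln (b i - coord y i))) = (b i - coord y i) / (coord y i - a i)"
   using p by (simp add: exp_diff)
  moreover have "a i + (b i - a i) * inverse (1 + (b i - coord y i) / (coord y i - a i)) = coord y i"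
   using p ab[OF i] by (simp add: field_simps)
  ultimately have "a i + (b i - a i) * inverse (1 + exp (- (ln (coord y i - a i) - ln (b i - coord y i)))) = coord y i"
   by (simp only:)
  then show "coord (e (g y)) i = coord y i"
   using i by (simp add: g_def e_def coord_axis_sum)
 qed (simp add: e_def axis_sum_in_RN)
 ultimately have "diffeo (RN n) (obox n a b) e"
  unfolding diffeo_def using e1 g1 by blast
 then show ?thesis by (auto simp: Obj_Cart_iff)
qed

lemma obox_neighbourhood:
 assumes "openin (top_of_set (RN n)) U" "x \<in> U"
 obtains r where "r > 0" "obox n (\<lambda>i. coord x i - r) (\<lambda>i. coord x i + r) \<subseteq> U"
proof -
 obtain S where S: "open S" "U = RN n \<inter> S" using assms(1) by (auto simp: openin_open)
 then have x: "x \<in> RN n" "x \<in> S" using assms(2) by auto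
 obtain e where e: "e > 0" "ball x e \<subseteq> S" using S(1) x(2) by (meson openE)
 define r where "r = e / (real n + 1)"
 have "obox n (\<lambda>i. coord x i - r) (\<lambda>i. coord x i + r) \<subseteq> U"
 proof
  fix y assume y: "y \<in> obox n (\<lambda>i. coord x i - r) (\<lambda>i. coord x i + r)"
  have yx: "y - x \<in> RN n" using y x(1) by (auto simp: obox_def RN_def lookup_minus)
  have "norm (y - x) \<le> (\<Sum>j<n. \<bar>coord (y - x) j\<bar>)" by (rule norm_RN_le[OF yx])
  also have "\<dots> \<le> (\<Sum>j<n. r)"
   using y by (intro sum_mono) (auto simp: obox_def lookup_minus abs_le_iff less_imp_le algebra_simps)
  also have "\<dots> = real n * r" by simp
  also have "\<dots> < e" using e(1) by (simp add: r_def field_simps)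
  finally have "y \<in> ball x e" by (simp add: dist_norm norm_minus_commute)
  then show "y \<in> U" using y e(2) S(2) by (auto simp: obox_def)
 qed
 moreover have "r > 0" using e(1) by (simp add: r_def)
 ultimately show ?thesis using that by blast
qed

section \<open>Good open coverings\<close>

lemma obox_finite_Int:
 assumes "finite \<B>" "\<B> \<noteq> {}" "\<And>B. B \<in> \<B> ==> \<exists>a b. B = obox n a b"
 shows "\<exists>a b. \<Inter>\<B> = obox n a b"
 using assms
proof (induction \<B> rule: finite_ne_induct)
 case (insert B \<B>)
 then obtain a b a' b' where "B = obox n a b" "\<Inter>\<B> = obox n a' b'" by (meson insertCI)
 then have "\<Inter>(insert B \<B>) = obox n (\<lambda>i. max (a i) (a' i)) (\<lambda>i. min (b i) (b' i))"
  by (simp add: obox_Int)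
 then show ?case by blast
qed auto

lemma diffeo_open_image:
 assumes "diffeo A B f" "openin (subtopology Rinf A) U"
 shows "openin (subtopology Rinf B) (f ` U)"
proof -
 obtain g where g: "smooth_map B A g" "\<forall>x\<in>A. g (f x) = x" "\<forall>y\<in>B. f (g y) = y" and f: "smooth_map A B f"
  using assms(1) unfolding diffeo_def by blast
 obtain W where W: "openin Rinf W" "U = W \<inter> A" using assms(2) by (auto simp: openin_subtopology)
 obtain V where V: "openin Rinf V" "\<And>x. x \<in> B ==> x \<in> V \<longleftrightarrow> g x \<in> W"
  by (rule smooth_map_preimage[OF g(1) W(1)]) blast
 have "f ` U = V \<inter> B"
 proof (intro equalityI subsetI)
  fix y assume "y \<in> V \<inter> B"
  then have "g y \<in> U" "y = f (g y)" using V(2) g(3) W(2) smooth_map_image[OF g(1)] by auto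
  then show "y \<in> f ` U" by blast
 qed (use V W g(2) smooth_map_image[OF f] in auto)
 then show ?thesis using V(1) by (auto simp: openin_subtopology)
qed

text \<open>Transport the boxes that are small with respect to \<open>\<U>\<close> along a chart. Finite intersections of boxes are
boxes, and these are cartesian, so the covering is good.\<close>

lemma dgop_refinement:
 assumes c: "c \<in> Obj Cart" and open_U: "\<And>U. U \<in> \<U> ==> openin (subtopology Rinf c) U"
  and cover: "\<And>x. x \<in> c ==> \<exists>U\<in>\<U>. x \<in> U"
 obtains K where "dgop_covering c K" "\<And>c' f. (c', f) \<in> K ==> f = (\<lambda>x\<in>c'. x) \<and> c' \<subseteq> c \<and> (\<exists>U\<in>\<U>. c' \<subseteq> U)"
proof -
 obtain n e where e: "diffeo (RN n) c e" using c by (auto simp: Obj_Cart_iff)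
 have inj: "inj_on e (RN n)" using e unfolding diffeo_def by (metis inj_on_inverseI)
 define \<B> where "\<B> = {B. (\<exists>a b. B = obox n a b) \<and> B \<noteq> {} \<and> (\<exists>U\<in>\<U>. e ` B \<subseteq> U)}"
 define K where "K = (\<lambda>B. (e ` B, \<lambda>x\<in>e ` B. x)) ` \<B>"
 have sub: "B \<subseteq> RN n" if "B \<in> \<B>" for B using that obox_RN by (auto simp: \<B>_def)
 have eB: "e ` B \<in> Obj Cart" if "B \<subseteq> RN n" "B \<noteq> {}" "\<exists>a b. B = obox n a b" for B
  using Cart_diffeo[OF _ diffeo_subset[OF e that(1)]] obox_in_Cart that by blast
 have image: "e ` RN n = c" by (rule diffeo_image[OF e])
 have emb: "open_embedding (e ` B) c (\<lambda>x\<in>e ` B. x)" if "B \<in> \<B>" for B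
 proof -
  have s: "e ` B \<subseteq> c" using image sub[OF that] by blast
  have "smooth_map (e ` B) c (\<lambda>x\<in>e ` B. x)"
   by (rule smooth_map_cong[OF _ smooth_map_id[OF s]]) simp
  moreover have "openin (subtopology Rinf c) (e ` B)"
   by (rule diffeo_open_image[OF e])
    (use that openin_obox in "auto simp: subtopology_Rinf_eq[OF subset_refl] \<B>_def")
  moreover have i: "smooth_map (e ` B) (e ` B) (\<lambda>x\<in>e ` B. x)"
   by (rule smooth_map_cong[OF _ smooth_map_id[OF subset_refl]]) simp
  then have "diffeo (e ` B) (e ` B) (\<lambda>x\<in>e ` B. x)"
   unfolding diffeo_def by (intro conjI exI[of _ "\<lambda>x\<in>e ` B. x"]) auto
  ultimately show ?thesis by (simp add: open_embedding_def Hom_Cart_iff)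
 qed
 have "dgop_covering c K"
  unfolding dgop_covering_def
 proof (intro conjI allI impI)
  show "\<forall>(c', f)\<in>K. c' \<in> Obj Cart \<and> open_embedding c' c f"
   using emb eB sub by (auto simp: K_def) (auto simp: \<B>_def)
  have "\<exists>B\<in>\<B>. x \<in> e ` B" if x: "x \<in> c" for x
  proof -
   obtain z where z: "z \<in> RN n" "x = e z" using image x by blast
   obtain U where U: "U \<in> \<U>" "x \<in> U" using cover[OF x] by blast
   have e': "smooth_map (RN n) c e" using e by (simp add: diffeo_def)
   obtain W where W: "openin Rinf W" "U = W \<inter> c" using open_U[OF U(1)] by (auto simp: openin_subtopology)
   obtain V where V: "openin Rinf V" "\<And>y. y \<in> RN n ==> y \<in> V \<longleftrightarrow> e y \<in> W"
    by (rule smooth_map_preimage[OF e' W(1)]) blast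
   obtain r where r: "r > 0" "obox n (\<lambda>i. coord z i - r) (\<lambda>i. coord z i + r) \<subseteq> V \<inter> RN n"
    by (rule obox_neighbourhood[OF openin_Rinf_RN[OF V(1)], of z n]) (use V(2)[OF z(1)] z U W in auto)
   let ?B = "obox n (\<lambda>i. coord z i - r) (\<lambda>i. coord z i + r)"
   have zB: "z \<in> ?B" using z(1) r(1) by (simp add: obox_def)
   have "e ` ?B \<subseteq> U"
   proof
    fix w assume "w \<in> e ` ?B"
    then obtain y where y: "y \<in> V \<inter> RN n" "w = e y" using r(2) by blast
    then show "w \<in> U" using V(2) W(2) smooth_map_image[OF e'] by auto
   qed
   then have "?B \<in> \<B>" using U(1) zB by (auto simp: \<B>_def)
   then show ?thesis using zB z(2) by blast
  qed
  then have "c \<subseteq> (\<Union>B\<in>\<B>. e ` B)" by (intro subsetI) (simp add: Bex_def)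
  moreover have "e ` B \<subseteq> c" if "B \<in> \<B>" for B using image_mono[OF sub[OF that], of e] by (simp only: image)
  ultimately have "(\<Union>B\<in>\<B>. e ` B) = c" by (simp add: subset_antisym UN_least)
  then show "(\<Union>(c', f)\<in>K. f ` c') = c" by (simp add: K_def)
  fix F assume F: "F \<subseteq> K \<and> finite F \<and> F \<noteq> {} \<and> (\<Inter>(c', f)\<in>F. f ` c') \<noteq> {}"
  then have "finite F" "F \<subseteq> (\<lambda>B. (e ` B, \<lambda>x\<in>e ` B. x)) ` \<B>" unfolding K_def by blast+
  then obtain \<C> where C: "\<C> \<subseteq> \<B>" "finite \<C>" "F = (\<lambda>B. (e ` B, \<lambda>x\<in>e ` B. x)) ` \<C>"
   using finite_subset_image[of F "\<lambda>B. (e ` B, \<lambda>x\<in>e ` B. x)" \<B>] by (elim exE conjE impE meta_impE) (assumption | simp)+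
  have ne: "\<C> \<noteq> {}" using F C by auto
  have "(\<Inter>(c', f)\<in>F. f ` c') = (\<Inter>B\<in>\<C>. e ` B)" by (simp add: C(3))
  also have "\<dots> = e ` \<Inter>\<C>"
  proof -
   obtain B where "B \<in> \<C>" using ne by blast
   moreover have "\<forall>B\<in>\<C>. B \<subseteq> RN n" using C(1) sub by blast
   ultimately show ?thesis using image_INT[OF inj, of \<C> "\<lambda>B. B" B] by simp
  qed
  finally have eq: "(\<Inter>(c', f)\<in>F. f ` c') = e ` \<Inter>\<C>" .
  have "\<exists>a b. \<Inter>\<C> = obox n a b"
   by (rule obox_finite_Int[OF C(2) ne]) (use C(1) in "auto simp: \<B>_def")
  moreover have "\<Inter>\<C> \<noteq> {}" using F eq by auto
  ultimately show "(\<Inter>(c', f)\<in>F. f ` c') \<in> Obj Cart"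
   unfolding eq by (intro eB) (auto dest: subsetD[OF obox_RN])
 qed (rule c)
 moreover have "f = (\<lambda>x\<in>c'. x) \<and> c' \<subseteq> c \<and> (\<exists>U\<in>\<U>. c' \<subseteq> U)" if c'f: "(c', f) \<in> K" for c' f
 proof -
  obtain B where B: "B \<in> \<B>" "c' = e ` B" "f = (\<lambda>x\<in>e ` B. x)" using c'f by (auto simp: K_def)
  then show ?thesis using image_mono[OF sub[OF B(1)], of e] image by (auto simp: \<B>_def)
 qed
 ultimately show ?thesis by (rule that)
qed

section \<open>Smooth vectors and matrices\<close>

lemma smooth_cfun_const [intro]: "smooth_cfun A (\<lambda>_. z)"
 by (auto simp: smooth_cfun_def)

lemma smooth_cfun_add [intro]: "smooth_cfun A f ==> smooth_cfun A g ==> smooth_cfun A (\<lambda>x. f x + g x)"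
 by (auto simp: smooth_cfun_def)

lemma smooth_cfun_mult [intro]: "smooth_cfun A f ==> smooth_cfun A g ==> smooth_cfun A (\<lambda>x. f x * g x)"
 by (auto simp: smooth_cfun_def)

lemma smooth_cfun_sum:
 "finite J ==> (\<And>j. j \<in> J ==> smooth_cfun A (f j)) ==> smooth_cfun A (\<lambda>x. \<Sum>j\<in>J. f j x)"
 by (induction J rule: finite_induct) auto

lemma smooth_cfun_cong:
 assumes "\<And>x. x \<in> A ==> f x = g x" "smooth_cfun A f"
 shows "smooth_cfun A g"
 using assms(2) smooth_fun_cong[of A "\<lambda>x. Re (f x)" "\<lambda>x. Re (g x)"]
  smooth_fun_cong[of A "\<lambda>x. Im (f x)" "\<lambda>x. Im (g x)"] assms(1)
 by (simp add: smooth_cfun_def)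

lemma smooth_cfun_subset: "smooth_cfun B f ==> A \<subseteq> B ==> smooth_cfun A f"
 unfolding smooth_cfun_def by (blast intro: smooth_fun_subset)

lemma smooth_cfun_compose:
 "locally_bounded_source A ==> smooth_map A B f ==> smooth_cfun B g ==> smooth_cfun A (\<lambda>x. g (f x))"
 unfolding smooth_cfun_def by (auto intro: smooth_fun_compose[where B=B])

lemma smooth_cfun_local:
 assumes "\<And>x. x \<in> A ==> \<exists>V. openin Rinf V \<and> x \<in> V \<and> smooth_cfun (A \<inter> V) f"
 shows "smooth_cfun A f"
 unfolding smooth_cfun_def
 by (intro conjI smooth_fun_local) (use assms in \<open>unfold smooth_cfun_def, blast\<close>)+

definition smooth_vec :: "rinf set => nat => (rinf => complex Matrix.vec) => bool" where
 "smooth_vec A k v \<longleftrightarrow> (\<forall>y\<in>A. v y \<in> carrier_vec k) \<and> (\<forall>i<k. smooth_cfun A (\<lambda>y. vec_index (v y) i))"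

definition smooth_mat :: "rinf set => nat => nat => (rinf => complex mat) => bool" where
 "smooth_mat A m n M \<longleftrightarrow> (\<forall>y\<in>A. M y \<in> carrier_mat m n) \<and>
   (\<forall>i<m. \<forall>j<n. smooth_cfun A (\<lambda>y. index_mat (M y) (i, j)))"

lemma index_mat_vec:
 assumes "A \<in> carrier_mat m n" "v \<in> carrier_vec n" "i < m"
 shows "vec_index (A *\<^sub>v v) i = (\<Sum>j<n. index_mat A (i, j) * vec_index v j)"
 using assms by (auto simp: scalar_prod_def atLeast0LessThan intro!: sum.cong)

lemma index_mat_mat:
 assumes "A \<in> carrier_mat m n" "B \<in> carrier_mat n l" "i < m" "j < l"
 shows "index_mat (A * B) (i, j) = (\<Sum>p<n. index_mat A (i, p) * index_mat B (p, j))"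
 using assms by (auto simp: scalar_prod_def atLeast0LessThan intro!: sum.cong)

lemma smooth_mat_vec:
 assumes "smooth_mat A m n M" "smooth_vec A n v"
 shows "smooth_vec A m (\<lambda>y. M y *\<^sub>v v y)"
 unfolding smooth_vec_def
proof (intro conjI ballI allI impI)
 fix i assume i: "i < m"
 have "smooth_cfun A (\<lambda>y. \<Sum>j<n. index_mat (M y) (i, j) * vec_index (v y) j)"
  using assms i by (intro smooth_cfun_sum smooth_cfun_mult) (auto simp: smooth_mat_def smooth_vec_def)
 then show "smooth_cfun A (\<lambda>y. vec_index (M y *\<^sub>v v y) i)"
  by (rule smooth_cfun_cong[rotated], intro index_mat_vec[symmetric])
   (use assms i in "auto simp: smooth_mat_def smooth_vec_def")
qed (use assms in "auto simp: smooth_mat_def smooth_vec_def")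

lemma smooth_mat_mult:
 assumes "smooth_mat A m n M" "smooth_mat A n l N"
 shows "smooth_mat A m l (\<lambda>y. M y * N y)"
 unfolding smooth_mat_def
proof (intro conjI ballI allI impI)
 fix i j assume i: "i < m" and j: "j < l"
 have "smooth_cfun A (\<lambda>y. \<Sum>p<n. index_mat (M y) (i, p) * index_mat (N y) (p, j))"
  using assms i j by (intro smooth_cfun_sum smooth_cfun_mult) (auto simp: smooth_mat_def)
 then show "smooth_cfun A (\<lambda>y. index_mat (M y * N y) (i, j))"
  by (rule smooth_cfun_cong[rotated], intro index_mat_mat[symmetric])
   (use assms i j in "auto simp: smooth_mat_def")
qed (use assms in "auto simp: smooth_mat_def")

lemma smooth_mat_one: "smooth_mat A n n (\<lambda>_. 1\<^sub>m n)"
 by (auto simp: smooth_mat_def)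

lemma smooth_vec_const: "v \<in> carrier_vec k ==> smooth_vec A k (\<lambda>_. v)"
 by (auto simp: smooth_vec_def)

lemma smooth_vec_cong: "(\<And>x. x \<in> A ==> f x = g x) ==> smooth_vec A k f ==> smooth_vec A k g"
 by (auto simp: smooth_vec_def intro: smooth_cfun_cong[of A "\<lambda>y. vec_index (f y) _"])

lemma smooth_mat_cong: "(\<And>x. x \<in> A ==> f x = g x) ==> smooth_mat A m n f ==> smooth_mat A m n g"
 by (auto simp: smooth_mat_def intro: smooth_cfun_cong[of A "\<lambda>y. index_mat (f y) _"])

lemma smooth_vec_subset: "smooth_vec B k v ==> A \<subseteq> B ==> smooth_vec A k v"
 by (auto simp: smooth_vec_def intro: smooth_cfun_subset)

lemma smooth_vec_compose:
 assumes "locally_bounded_source A" "smooth_map A B f" "smooth_vec B k v"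
 shows "smooth_vec A k (\<lambda>x. v (f x))"
 using assms(3) smooth_map_image[OF assms(2)]
 by (auto simp: smooth_vec_def intro: smooth_cfun_compose[OF assms(1,2)])

lemma smooth_mat_compose:
 assumes "locally_bounded_source A" "smooth_map A B f" "smooth_mat B m n M"
 shows "smooth_mat A m n (\<lambda>x. M (f x))"
 using assms(3) smooth_map_image[OF assms(2)]
 by (auto simp: smooth_mat_def intro: smooth_cfun_compose[OF assms(1,2)])

lemma smooth_vec_local:
 assumes "\<And>x. x \<in> A ==> \<exists>V. openin Rinf V \<and> x \<in> V \<and> smooth_vec (A \<inter> V) k v"
 shows "smooth_vec A k v"
 unfolding smooth_vec_def
proof (intro conjI ballI allI impI)
 show "v y \<in> carrier_vec k" if "y \<in> A" for y using assms[OF that] that by (auto simp: smooth_vec_def)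
 fix i assume "i < k"
 then show "smooth_cfun A (\<lambda>y. vec_index (v y) i)"
  by (intro smooth_cfun_local) (use assms in \<open>unfold smooth_vec_def, blast\<close>)
qed

section \<open>Linear maps\<close>

abbreviation cvec :: "nat => (complex, complex Matrix.vec) module" where
 "cvec k \<equiv> module_vec TYPE(complex) k"

abbreviation linear_maps :: "(complex, 'a) module => (complex, 'b) module => ('a => 'b) set" where
 "linear_maps M N \<equiv> module_hom class_ring M N"

lemma linear_maps_iff:
 "f \<in> linear_maps M N \<longleftrightarrow> f \<in> carrier M \<rightarrow> carrier N \<and>
   (\<forall>a\<in>carrier M. \<forall>b\<in>carrier M. f (a \<oplus>\<^bsub>M\<^esub> b) = f a \<oplus>\<^bsub>N\<^esub> f b) \<and>
   (\<forall>r. \<forall>a\<in>carrier M. f (r \<odot>\<^bsub>M\<^esub> a) = r \<odot>\<^bsub>N\<^esub> f a)"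
 by (auto simp: module_hom_def class_ring_simps)

lemma linear_maps_compose:
 "f \<in> linear_maps M N ==> g \<in> linear_maps N P ==> (\<lambda>x. g (f x)) \<in> linear_maps M P"
 unfolding linear_maps_iff by (auto simp: Pi_iff)

lemma linear_maps_cong:
 assumes "\<And>a. a \<in> carrier M ==> f a = g a" "f \<in> linear_maps M N"
  "\<And>a b. a \<in> carrier M ==> b \<in> carrier M ==> a \<oplus>\<^bsub>M\<^esub> b \<in> carrier M"
  "\<And>r a. a \<in> carrier M ==> r \<odot>\<^bsub>M\<^esub> a \<in> carrier M"
 shows "g \<in> linear_maps M N"
 using assms(2) unfolding linear_maps_iff by (auto simp: Pi_iff assms(1)[symmetric] assms(3,4))

lemma linear_maps_inverse:
 assumes f: "f \<in> linear_maps M N" and g: "\<And>b. b \<in> carrier N ==> g b \<in> carrier M \<and> f (g b) = b"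
  and gf: "\<And>a. a \<in> carrier M ==> g (f a) = a"
  and cl: "\<And>a b. a \<in> carrier M ==> b \<in> carrier M ==> a \<oplus>\<^bsub>M\<^esub> b \<in> carrier M"
   "\<And>r a. a \<in> carrier M ==> r \<odot>\<^bsub>M\<^esub> a \<in> carrier M"
 shows "g \<in> linear_maps N M"
 unfolding linear_maps_iff
proof (intro conjI ballI allI)
 fix a b assume "a \<in> carrier N" "b \<in> carrier N"
 then have "a \<oplus>\<^bsub>N\<^esub> b = f (g a \<oplus>\<^bsub>M\<^esub> g b)" "g a \<oplus>\<^bsub>M\<^esub> g b \<in> carrier M"
  using f g cl by (auto simp: linear_maps_iff)
 then show "g (a \<oplus>\<^bsub>N\<^esub> b) = g a \<oplus>\<^bsub>M\<^esub> g b" using gf by simp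
next
 fix r a assume "a \<in> carrier N"
 then have "r \<odot>\<^bsub>N\<^esub> a = f (r \<odot>\<^bsub>M\<^esub> g a)" "r \<odot>\<^bsub>M\<^esub> g a \<in> carrier M"
  using f g cl by (auto simp: linear_maps_iff)
 then show "g (r \<odot>\<^bsub>N\<^esub> a) = r \<odot>\<^bsub>M\<^esub> g a" using gf by simp
qed (use g in auto)

lemma cvec_closed: "a \<in> carrier (cvec k) ==> b \<in> carrier (cvec k) ==> a \<oplus>\<^bsub>cvec k\<^esub> b \<in> carrier (cvec k)"
 "a \<in> carrier (cvec k) ==> r \<odot>\<^bsub>cvec k\<^esub> a \<in> carrier (cvec k)"
 by (auto simp: module_vec_simps)

lemma carrier_cvec [simp]: "carrier (cvec k) = carrier_vec k"
 by (simp add: module_vec_simps)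

lemma mat_vec_linear: "A \<in> carrier_mat m n ==> (\<lambda>v. A *\<^sub>v v) \<in> linear_maps (cvec n) (cvec m)"
 by (auto simp: linear_maps_iff module_vec_simps mult_add_distrib_mat_vec mult_mat_vec)

definition matrix_of :: "nat => nat => (complex Matrix.vec => complex Matrix.vec) => complex mat" where
 "matrix_of m n T = mat m n (\<lambda>(i, j). vec_index (T (unit_vec n j)) i)"

lemma matrix_of_carrier [simp]: "matrix_of m n T \<in> carrier_mat m n"
 by (simp add: matrix_of_def)

text \<open>A linear map \<open>\<complex>\<^sup>n \<rightarrow> \<complex>\<^sup>m\<close> is its matrix, by expanding a vector in the standard basis one coordinate at
a time.\<close>

lemma matrix_of_mult:
 assumes T: "T \<in> linear_maps (cvec n) (cvec m)" and v: "v \<in> carrier_vec n"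
 shows "matrix_of m n T *\<^sub>v v = T v"
proof -
 define w where "w p = Matrix.vec n (\<lambda>i. if i < p then vec_index v i else 0)" for p
 have T_add: "T (a + b) = T a + T b" if "a \<in> carrier_vec n" "b \<in> carrier_vec n" for a b
  using T that by (simp add: linear_maps_iff module_vec_simps)
 have T_smult: "T (r \<cdot>\<^sub>v a) = r \<cdot>\<^sub>v T a" if "a \<in> carrier_vec n" for a r
  using T that by (simp add: linear_maps_iff module_vec_simps)
 have T_car: "T a \<in> carrier_vec m" if "a \<in> carrier_vec n" for a
  using T that by (auto simp: linear_maps_iff module_vec_simps)
 have "T (w p) = Matrix.vec m (\<lambda>i. \<Sum>j<p. vec_index (T (unit_vec n j)) i * vec_index v j)" if "p \<le> n" for p
  using that
 proof (induction p)
  case 0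
  have "w 0 = 0 \<cdot>\<^sub>v 0\<^sub>v n" by (auto simp: w_def)
  then have "T (w 0) = 0 \<cdot>\<^sub>v T (0\<^sub>v n)" by (simp add: T_smult)
  then show ?case using T_car[of "0\<^sub>v n"] by auto
 next
  case (Suc p)
  have "w (Suc p) = w p + vec_index v p \<cdot>\<^sub>v unit_vec n p"
   using Suc.prems by (intro eq_vecI) (auto simp: w_def less_Suc_eq)
  then have "T (w (Suc p)) = T (w p) + vec_index v p \<cdot>\<^sub>v T (unit_vec n p)"
   by (simp add: T_add T_smult w_def)
  then show ?case using Suc T_car[of "unit_vec n p"] by (intro eq_vecI) (auto simp: mult.commute)
 qed
 from this[of n] have "T (w n) = Matrix.vec m (\<lambda>i. \<Sum>j<n. vec_index (T (unit_vec n j)) i * vec_index v j)" by simp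
 moreover have "w n = v" using v by (auto simp: w_def)
 ultimately show ?thesis
  using v by (intro eq_vecI) (auto simp: index_mat_vec[OF matrix_of_carrier v] simp del: index_mult_mat_vec, simp_all add: matrix_of_def)
qed

lemma mat_eq_vecI:
 fixes A B :: "complex mat"
 assumes "A \<in> carrier_mat m n" "B \<in> carrier_mat m n" "\<And>v. v \<in> carrier_vec n ==> A *\<^sub>v v = B *\<^sub>v v"
 shows "A = B"
proof (rule eq_matI)
 fix i j assume ij: "i < dim_row B" "j < dim_col B"
 then have i: "i < m" and j: "j < n" using assms(2) by auto
 have "vec_index (M *\<^sub>v unit_vec n j) i = index_mat M (i, j)" if "M \<in> carrier_mat m n" for M :: "complex mat"
  using index_mat_vec[OF that _ i, of "unit_vec n j"] j by (simp add: if_distrib cong: if_cong)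
 from this[OF assms(1)] this[OF assms(2)] show "index_mat A (i, j) = index_mat B (i, j)" using assms(3)[of "unit_vec n j"] by simp
qed (use assms in auto)

section \<open>Plots\<close>

lemma diffeological_spaceD:
 assumes "diffeological_space X"
 shows "\<forall>c. c \<notin> Obj Cart --> plots X c = {}" "\<forall>c\<in>Obj Cart. plots X c \<subseteq> c \<rightarrow>\<^sub>E pts X"
  "plots X (RN 0) = RN 0 \<rightarrow>\<^sub>E pts X"
  "\<forall>c\<in>Obj Cart. \<forall>c'\<in>Obj Cart. \<forall>f\<in>Hom Cart c' c. \<forall>\<phi>\<in>plots X c. compose c' \<phi> f \<in> plots X c'"
  "\<forall>c K. \<forall>\<phi>\<in>c \<rightarrow>\<^sub>E pts X. dgop_covering c K \<and>
    (\<forall>(c', f)\<in>K. compose c' \<phi> f \<in> plots X c') --> \<phi> \<in> plots X c"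
 using assms unfolding diffeological_space_def by - (elim conjE, assumption)+

lemma dgop_coveringD:
 assumes "dgop_covering c K"
 shows "c \<in> Obj Cart" "(c', f) \<in> K ==> c' \<in> Obj Cart" "(c', f) \<in> K ==> open_embedding c' c f"
  "x \<in> c ==> \<exists>c' f. (c', f) \<in> K \<and> x \<in> f ` c'"
proof -
 have 1: "\<forall>(c', f)\<in>K. c' \<in> Obj Cart \<and> open_embedding c' c f" and 2: "(\<Union>(c', f)\<in>K. f ` c') = c"
  and 3: "c \<in> Obj Cart"
  using assms unfolding dgop_covering_def by - (elim conjE, assumption)+
 show "c \<in> Obj Cart" by (rule 3)
 show "(c', f) \<in> K ==> c' \<in> Obj Cart" "(c', f) \<in> K ==> open_embedding c' c f" using 1 by auto
 show "x \<in> c ==> \<exists>c' f. (c', f) \<in> K \<and> x \<in> f ` c'" unfolding 2[symmetric] by auto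
qed

lemma dfl_plots_Cart: "diffeological_space X ==> \<phi> \<in> plots X c ==> c \<in> Obj Cart"
 using diffeological_spaceD(1)[of X] by auto

lemma dfl_plots_PiE: "diffeological_space X ==> \<phi> \<in> plots X c ==> \<phi> \<in> c \<rightarrow>\<^sub>E pts X"
 using dfl_plots_Cart[of X \<phi> c] diffeological_spaceD(2)[of X] by auto

lemma dfl_plots_pts: "diffeological_space X ==> \<phi> \<in> plots X c ==> y \<in> c ==> \<phi> y \<in> pts X"
 by (rule PiE_mem[OF dfl_plots_PiE])

lemma dfl_plots_point: "diffeological_space X ==> x \<in> pts X ==> (\<lambda>_\<in>RN 0. x) \<in> plots X (RN 0)"
 by (simp add: diffeological_spaceD(3))

lemma dfl_plots_compose:
 assumes "diffeological_space X" "\<phi> \<in> plots X c" "c' \<in> Obj Cart" "smooth_map c' c f"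
 shows "(\<lambda>y\<in>c'. \<phi> (f y)) \<in> plots X c'"
proof -
 have "restrict f c' \<in> Hom Cart c' c"
  unfolding Hom_Cart_iff by (auto intro: smooth_map_cong[OF _ assms(4)])
 then have "compose c' \<phi> (restrict f c') \<in> plots X c'"
  using diffeological_spaceD(4)[OF assms(1)] assms(2,3) dfl_plots_Cart[OF assms(1,2)] by simp
 moreover have "compose c' \<phi> (restrict f c') = (\<lambda>y\<in>c'. \<phi> (f y))"
  by (auto simp: compose_def)
 ultimately show ?thesis by simp
qed

lemma dfl_plots_sheaf:
 assumes "diffeological_space X" "\<phi> \<in> c \<rightarrow>\<^sub>E pts X" "dgop_covering c K"
  "\<And>c' f. (c', f) \<in> K ==> compose c' \<phi> f \<in> plots X c'"
 shows "\<phi> \<in> plots X c"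
 by (rule diffeological_spaceD(5)[OF assms(1), rule_format, OF assms(2)]) (use assms(3,4) in auto)

text \<open>Being a plot is local for all open coverings, although the sheaf condition only mentions good ones.\<close>

lemma dfl_plots_local:
 assumes X: "diffeological_space X" and \<phi>: "\<phi> \<in> c \<rightarrow>\<^sub>E pts X" and c: "c \<in> Obj Cart"
  and loc: "\<And>y. y \<in> c ==> \<exists>W. openin Rinf W \<and> y \<in> W \<and>
   (\<forall>c'\<in>Obj Cart. c' \<subseteq> c \<inter> W --> restrict \<phi> c' \<in> plots X c')"
 shows "\<phi> \<in> plots X c"
proof -
 define \<U> where "\<U> = {c \<inter> W |W. openin Rinf W \<and> (\<forall>c'\<in>Obj Cart. c' \<subseteq> c \<inter> W --> restrict \<phi> c' \<in> plots X c')}"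
 obtain K where K: "dgop_covering c K"
  "\<And>c' f. (c', f) \<in> K ==> f = (\<lambda>x\<in>c'. x) \<and> c' \<subseteq> c \<and> (\<exists>U\<in>\<U>. c' \<subseteq> U)"
 proof (rule dgop_refinement[OF c, of \<U>])
  show "openin (subtopology Rinf c) U" if "U \<in> \<U>" for U
   using that by (auto simp: \<U>_def openin_subtopology)
  show "\<exists>U\<in>\<U>. y \<in> U" if "y \<in> c" for y
   using loc[OF that] that unfolding \<U>_def by blast
 qed blast
 show ?thesis
 proof (rule dfl_plots_sheaf[OF X \<phi> K(1)])
  fix c' f assume cf: "(c', f) \<in> K"
  then have "c' \<in> Obj Cart" using dgop_coveringD(2)[OF K(1)] by blast
  moreover obtain W where "c' \<subseteq> c \<inter> W" "\<forall>c'\<in>Obj Cart. c' \<subseteq> c \<inter> W --> restrict \<phi> c' \<in> plots X c'"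
   using K(2)[OF cf] by (auto simp: \<U>_def)
  ultimately have "restrict \<phi> c' \<in> plots X c'" by blast
  moreover have "compose c' \<phi> f = restrict \<phi> c'"
   using K(2)[OF cf] by (auto simp: compose_def fun_eq_iff)
  ultimately show "compose c' \<phi> f \<in> plots X c'" by simp
 qed
qed

lemma Cart_neighbourhood:
 assumes c: "c \<in> Obj Cart" and y: "y \<in> c" and W: "openin Rinf W" "y \<in> W"
 obtains c' where "c' \<in> Obj Cart" "y \<in> c'" "c' \<subseteq> c \<inter> W" "openin (subtopology Rinf c) c'"
proof -
 have y': "openin Rinf (- {y})" by (intro open_imp_openin_Rinf) auto
 obtain K where K: "dgop_covering c K"
  "\<And>c' f. (c', f) \<in> K ==> f = (\<lambda>x\<in>c'. x) \<and> c' \<subseteq> c \<and> (\<exists>U\<in>{c \<inter> W, c \<inter> - {y}}. c' \<subseteq> U)"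
 proof (rule dgop_refinement[OF c, of "{c \<inter> W, c \<inter> - {y}}"])
  show "openin (subtopology Rinf c) U" if "U \<in> {c \<inter> W, c \<inter> - {y}}" for U
   using that W(1) y' by (auto simp: openin_subtopology)
  show "\<exists>U\<in>{c \<inter> W, c \<inter> - {y}}. x \<in> U" if "x \<in> c" for x
   using that W(2) by (cases "x = y") auto
 qed blast
 obtain c' f where cf: "(c', f) \<in> K" "y \<in> f ` c'" using dgop_coveringD(4)[OF K(1) y] by blast
 then have f: "f = (\<lambda>x\<in>c'. x)" and "c' \<subseteq> c" using K(2)[OF cf(1)] by simp_all
 have "c' \<in> Obj Cart" "open_embedding c' c f" using dgop_coveringD(2,3)[OF K(1) cf(1)] by blast+
 then have "openin (subtopology Rinf c) (f ` c')" by (simp add: open_embedding_def)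
 moreover have fc: "f ` c' = c'" by (simp add: f)
 ultimately show ?thesis
  using that[of c'] \<open>c' \<in> Obj Cart\<close> cf(2) K(2)[OF cf(1)] by auto
qed

section \<open>Frames\<close>

text \<open>A frame of \<open>E\<close> over \<open>U\<close> along \<open>\<phi>\<close>. The second conjunct says that \<open>U \<times> \<complex>\<^sup>k \<rightarrow> U \<times>\<^sub>X E\<close> is an isomorphism of
diffeological spaces, tested on plots. Here \<open>U\<close> is any subset of \<open>\<real>\<^sup>\<infinity>\<close>, which allows frames to be
restricted to open pieces.\<close>

definition trivialises ::
  "'u vbundle => rinf set => (rinf => 'u) => nat => (rinf => complex Matrix.vec => 'u) => bool" where
 "trivialises E U \<phi> k s \<longleftrightarrow>
   (\<forall>y\<in>U. s y \<in> linear_maps (cvec k) (fibre E (\<phi> y)) \<and>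
    bij_betw (s y) (carrier_vec k) (carrier (fibre E (\<phi> y)))) \<and>
   (\<forall>c\<in>Obj Cart. \<forall>f v. smooth_map c U f --> (\<forall>y\<in>c. v y \<in> carrier_vec k) -->
    ((\<lambda>y\<in>c. s (f y) (v y)) \<in> plots (tot E) c \<longleftrightarrow> smooth_vec c k v))"

lemma trivialisesD:
 assumes "trivialises E U \<phi> k s"
 shows "y \<in> U ==> s y \<in> linear_maps (cvec k) (fibre E (\<phi> y))"
  "y \<in> U ==> bij_betw (s y) (carrier_vec k) (carrier (fibre E (\<phi> y)))"
  "c \<in> Obj Cart ==> smooth_map c U f ==> (\<And>y. y \<in> c ==> v y \<in> carrier_vec k) ==>
   (\<lambda>y\<in>c. s (f y) (v y)) \<in> plots (tot E) c \<longleftrightarrow> smooth_vec c k v"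
 using assms by (simp_all add: trivialises_def)

lemma trivialises_inj:
 assumes "trivialises E U \<phi> k s" "y \<in> U" "v \<in> carrier_vec k" "w \<in> carrier_vec k" "s y v = s y w"
 shows "v = w"
 using trivialisesD(2)[OF assms(1,2)] assms(3-5) by (meson bij_betw_imp_inj_on inj_onD)

lemma trivialises_fibre:
 assumes "trivialises E U \<phi> k s" "y \<in> U" "v \<in> carrier_vec k"
 shows "s y v \<in> carrier (fibre E (\<phi> y))"
 using trivialisesD(2)[OF assms(1,2)] assms(3) by (rule bij_betwE[rule_format])

lemma trivialises_surj:
 assumes "trivialises E U \<phi> k s" "y \<in> U" "e \<in> carrier (fibre E (\<phi> y))"
 obtains v where "v \<in> carrier_vec k" "s y v = e"
proof -
 have "e \<in> s y ` carrier_vec k"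
  using trivialisesD(2)[OF assms(1,2)] assms(3) by (simp add: bij_betw_imp_surj_on)
 then show ?thesis using that by blast
qed

lemma trivialises_subset:
 assumes "trivialises E U \<phi> k s" "U' \<subseteq> U"
 shows "trivialises E U' \<phi> k s"
 unfolding trivialises_def
proof (intro conjI ballI allI impI)
 fix c f and v :: "rinf => complex Matrix.vec"
 assume "c \<in> Obj Cart" "smooth_map c U' f" and v: "\<forall>y\<in>c. v y \<in> carrier_vec k"
 moreover have "smooth_map c U f"
  by (rule smooth_map_subset[OF \<open>smooth_map c U' f\<close>])
   (use smooth_map_image[OF \<open>smooth_map c U' f\<close>] assms(2) in auto)
 ultimately show "(\<lambda>y\<in>c. s (f y) (v y)) \<in> plots (tot E) c \<longleftrightarrow> smooth_vec c k v"
  using trivialisesD(3)[OF assms(1)] by simp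
qed (use trivialisesD(1,2)[OF assms(1)] assms(2) in auto)

lemma trivialises_cong:
 assumes "trivialises E U \<phi> k s" "\<And>y v. y \<in> U ==> v \<in> carrier_vec k ==> s y v = s' y v"
  "\<And>y. y \<in> U ==> \<phi> y = \<phi>' y"
 shows "trivialises E U \<phi>' k s'"
 unfolding trivialises_def
proof (intro conjI ballI allI impI)
 fix y assume y: "y \<in> U"
 show "s' y \<in> linear_maps (cvec k) (fibre E (\<phi>' y))"
  by (rule linear_maps_cong[OF _ trivialisesD(1)[OF assms(1) y, unfolded assms(3)[OF y]]])
   (use assms(2)[OF y] cvec_closed in auto)
 show "bij_betw (s' y) (carrier_vec k) (carrier (fibre E (\<phi>' y)))"
  using trivialisesD(2)[OF assms(1) y] assms(2)[OF y] assms(3)[OF y]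
   bij_betw_cong[of "carrier_vec k" "s y" "s' y"] by simp
next
 fix c f and v :: "rinf => complex Matrix.vec"
 assume c: "c \<in> Obj Cart" and f: "smooth_map c U f" and v: "\<forall>y\<in>c. v y \<in> carrier_vec k"
 have "(\<lambda>y\<in>c. s' (f y) (v y)) = (\<lambda>y\<in>c. s (f y) (v y))"
  using assms(2) smooth_map_image[OF f] v by (auto simp: fun_eq_iff)
 then show "(\<lambda>y\<in>c. s' (f y) (v y)) \<in> plots (tot E) c \<longleftrightarrow> smooth_vec c k v"
  using trivialisesD(3)[OF assms(1) c f] v by simp
qed

lemma trivialises_pull:
 assumes "trivialises E U \<phi> k s" "smooth_map U' U g"
 shows "trivialises E U' (\<lambda>y. \<phi> (g y)) k (\<lambda>y. s (g y))"
 unfolding trivialises_def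
proof (intro conjI ballI allI impI)
 fix c f and v :: "rinf => complex Matrix.vec"
 assume c: "c \<in> Obj Cart" and f: "smooth_map c U' f" and v: "\<forall>y\<in>c. v y \<in> carrier_vec k"
 then show "(\<lambda>y\<in>c. s (g (f y)) (v y)) \<in> plots (tot E) c \<longleftrightarrow> smooth_vec c k v"
  using trivialisesD(3)[OF assms(1) c smooth_map_compose[OF Cart_locally_bounded[OF c] f assms(2)], of v] by simp
qed (use trivialisesD(1,2)[OF assms(1)] smooth_map_image[OF assms(2)] in auto)

definition smooth_iso ::
  "rinf set => nat => nat => (rinf => complex mat) => (rinf => complex mat) => bool" where
 "smooth_iso U l k g h \<longleftrightarrow> smooth_mat U l k g \<and> smooth_mat U k l h \<and>
   (\<forall>y\<in>U. (\<forall>v\<in>carrier_vec k. h y *\<^sub>v (g y *\<^sub>v v) = v) \<and> (\<forall>w\<in>carrier_vec l. g y *\<^sub>v (h y *\<^sub>v w) = w))"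

lemma smooth_iso_compose:
 "locally_bounded_source A ==> smooth_map A U f ==> smooth_iso U l k g h ==>
  smooth_iso A l k (\<lambda>x. g (f x)) (\<lambda>x. h (f x))"
 unfolding smooth_iso_def using smooth_map_image[of A U f] by (simp add: smooth_mat_compose)

lemma smooth_mat_mult_carrier:
 "smooth_mat U l k g ==> y \<in> U ==> v \<in> carrier_vec k ==> g y *\<^sub>v v \<in> carrier_vec l"
 by (auto simp: smooth_mat_def)

lemma trivialises_change_frame:
 assumes t: "trivialises E U \<phi> l t" and g: "smooth_iso U l k g h"
 shows "trivialises E U \<phi> k (\<lambda>y v. t y (g y *\<^sub>v v))"
 unfolding trivialises_def
proof (intro conjI ballI allI impI)
 fix y assume y: "y \<in> U"
 have gm: "g y \<in> carrier_mat l k" "h y \<in> carrier_mat k l" using g y by (auto simp: smooth_iso_def smooth_mat_def)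
 show "(\<lambda>v. t y (g y *\<^sub>v v)) \<in> linear_maps (cvec k) (fibre E (\<phi> y))"
  by (rule linear_maps_compose[OF mat_vec_linear[OF gm(1)] trivialisesD(1)[OF t y]])
 have "bij_betw (\<lambda>v. g y *\<^sub>v v) (carrier_vec k) (carrier_vec l)"
  by (rule bij_betw_byWitness[where f'="\<lambda>v. h y *\<^sub>v v"]) (use g y gm in "auto simp: smooth_iso_def")
 then show "bij_betw (\<lambda>v. t y (g y *\<^sub>v v)) (carrier_vec k) (carrier (fibre E (\<phi> y)))"
  using bij_betw_trans[OF _ trivialisesD(2)[OF t y]] by (simp add: o_def)
next
 fix c f and v :: "rinf => complex Matrix.vec"
 assume c: "c \<in> Obj Cart" and f: "smooth_map c U f" and v: "\<forall>y\<in>c. v y \<in> carrier_vec k"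
 have gf: "smooth_iso c l k (\<lambda>x. g (f x)) (\<lambda>x. h (f x))"
  by (rule smooth_iso_compose[OF Cart_locally_bounded[OF c] f g])
 have "(\<lambda>y\<in>c. t (f y) (g (f y) *\<^sub>v v y)) \<in> plots (tot E) c \<longleftrightarrow> smooth_vec c l (\<lambda>y. g (f y) *\<^sub>v v y)"
  using v gf by (intro trivialisesD(3)[OF t c f]) (auto simp: smooth_iso_def smooth_mat_def)
 also have "\<dots> \<longleftrightarrow> smooth_vec c k v"
 proof
  assume "smooth_vec c l (\<lambda>y. g (f y) *\<^sub>v v y)"
  then have "smooth_vec c k (\<lambda>y. h (f y) *\<^sub>v (g (f y) *\<^sub>v v y))"
   using gf by (intro smooth_mat_vec[of _ k l "\<lambda>y. h (f y)" "\<lambda>y. g (f y) *\<^sub>v v y"]) (simp_all add: smooth_iso_def)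
  then show "smooth_vec c k v"
   by (rule smooth_vec_cong[rotated]) (use gf v in "auto simp: smooth_iso_def")
 qed (use gf in "auto simp: smooth_iso_def intro: smooth_mat_vec[where n=k]")
 finally show "(\<lambda>y\<in>c. t (f y) (g (f y) *\<^sub>v v y)) \<in> plots (tot E) c \<longleftrightarrow> smooth_vec c k v" .
qed

text \<open>The matrix entries are smooth because the coordinates of the images of the constant sections are.\<close>

lemma matrix_in_frames:
 assumes U: "U \<in> Obj Cart" and t: "trivialises E U \<psi> l t"
  and s: "\<And>y. y \<in> U ==> s y \<in> linear_maps (cvec k) (fibre E (\<psi> y))"
  and sm: "\<And>v. v \<in> carrier_vec k ==> (\<lambda>y\<in>U. s y v) \<in> plots (tot E) U"
 obtains g where "smooth_mat U l k g" "\<And>y v. y \<in> U ==> v \<in> carrier_vec k ==> s y v = t y (g y *\<^sub>v v)"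
proof -
 define T where "T y = (\<lambda>e. inv_into (carrier_vec l) (t y) e)" for y
 have T: "T y e \<in> carrier_vec l \<and> t y (T y e) = e" if "y \<in> U" "e \<in> carrier (fibre E (\<psi> y))" for y e
  unfolding T_def using trivialisesD(2)[OF t that(1)] that(2)
  by (metis bij_betw_imp_surj_on f_inv_into_f inv_into_into)
 have Tlin: "T y \<in> linear_maps (fibre E (\<psi> y)) (cvec l)" if y: "y \<in> U" for y
 proof (rule linear_maps_inverse[OF trivialisesD(1)[OF t y]])
  show "T y e \<in> carrier (cvec l) \<and> t y (T y e) = e" if "e \<in> carrier (fibre E (\<psi> y))" for e
   using T[OF y that] by simp
  show "T y (t y a) = a" if "a \<in> carrier (cvec l)" for a
   using that trivialisesD(2)[OF t y] by (simp add: T_def bij_betw_imp_inj_on)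
 qed (use cvec_closed in auto)
 define g where "g y = matrix_of l k (\<lambda>v. T y (s y v))" for y
 have lin: "(\<lambda>v. T y (s y v)) \<in> linear_maps (cvec k) (cvec l)" if "y \<in> U" for y
  by (rule linear_maps_compose[OF s[OF that] Tlin[OF that]])
 have gv: "g y *\<^sub>v v = T y (s y v)" if "y \<in> U" "v \<in> carrier_vec k" for y v
  unfolding g_def by (rule matrix_of_mult[OF lin[OF that(1)] that(2)])
 have s_fib: "s y v \<in> carrier (fibre E (\<psi> y))" if "y \<in> U" "v \<in> carrier_vec k" for y v
  using s[OF that(1)] that(2) by (auto simp: linear_maps_iff)
 have "smooth_mat U l k g"
  unfolding smooth_mat_def
 proof (intro conjI ballI allI impI)
  show "g y \<in> carrier_mat l k" for y by (simp add: g_def)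
  fix i j assume i: "i < l" and j: "j < k"
  let ?e = "unit_vec k j"
  have "(\<lambda>y\<in>U. t y (T y (s y ?e))) = (\<lambda>y\<in>U. s y ?e)"
   using T s_fib by (auto simp: fun_eq_iff)
  then have "(\<lambda>y\<in>U. t y (T y (s y ?e))) \<in> plots (tot E) U" using sm by simp
  then have "smooth_vec U l (\<lambda>y. T y (s y ?e))"
   using trivialisesD(3)[OF t U smooth_map_id[OF subset_refl]] T s_fib by auto
  then have "smooth_cfun U (\<lambda>y. vec_index (T y (s y ?e)) i)" using i by (simp add: smooth_vec_def)
  then show "smooth_cfun U (\<lambda>y. index_mat (g y) (i, j))"
   using i j by (simp add: g_def matrix_of_def)
 qed
 moreover have "s y v = t y (g y *\<^sub>v v)" if "y \<in> U" "v \<in> carrier_vec k" for y v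
  using gv[OF that] T[OF that(1) s_fib[OF that]] by simp
 ultimately show ?thesis by (rule that)
qed

lemma frame_plot:
 assumes U: "U \<in> Obj Cart" and s: "trivialises E U \<phi> k s" and v: "smooth_vec U k v"
 shows "(\<lambda>y\<in>U. s y (v y)) \<in> plots (tot E) U"
 using trivialisesD(3)[OF s U smooth_map_id[OF subset_refl], of v] v by (simp add: smooth_vec_def)

lemma transition_matrix:
 assumes U: "U \<in> Obj Cart" and s: "trivialises E U \<phi> k s" and t: "trivialises E U \<phi> l t"
 obtains g h where "smooth_iso U l k g h" "\<And>y v. y \<in> U ==> v \<in> carrier_vec k ==> s y v = t y (g y *\<^sub>v v)"
proof -
 obtain g where g: "smooth_mat U l k g" "\<And>y v. y \<in> U ==> v \<in> carrier_vec k ==> s y v = t y (g y *\<^sub>v v)"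
  using matrix_in_frames[OF U t trivialisesD(1)[OF s] frame_plot[OF U s smooth_vec_const]] by blast
 obtain h where h: "smooth_mat U k l h" "\<And>y v. y \<in> U ==> v \<in> carrier_vec l ==> t y v = s y (h y *\<^sub>v v)"
  using matrix_in_frames[OF U s trivialisesD(1)[OF t] frame_plot[OF U t smooth_vec_const]] by blast
 have "h y *\<^sub>v (g y *\<^sub>v v) = v" if "y \<in> U" "v \<in> carrier_vec k" for y v
  using smooth_mat_mult_carrier[OF g(1) that] smooth_mat_mult_carrier[OF h(1) that(1)] g(2)[OF that] h(2)[OF that(1)]
  by (intro trivialises_inj[OF s that(1) _ that(2)]) auto
 moreover have "g y *\<^sub>v (h y *\<^sub>v v) = v" if "y \<in> U" "v \<in> carrier_vec l" for y v
  using smooth_mat_mult_carrier[OF h(1) that] smooth_mat_mult_carrier[OF g(1) that(1)] h(2)[OF that] g(2)[OF that(1)]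
  by (intro trivialises_inj[OF t that(1) _ that(2)]) auto
 ultimately show ?thesis using g h that[of g h] by (simp add: smooth_iso_def)
qed

lemma fibre_in_pts: "e \<in> carrier (fibre E x) \<longleftrightarrow> e \<in> pts (tot E) \<and> prj E e = x"
 by (auto simp: fibre_def)

text \<open>A fixed family of linear isomorphisms is a frame as soon as it is one locally, since both plots and
smooth vectors are local.\<close>

lemma trivialises_glue:
 assumes E: "diffeological_space (tot E)"
  and loc: "\<And>y. y \<in> U ==> \<exists>W. openin Rinf W \<and> y \<in> W \<and> trivialises E (U \<inter> W) \<phi> k s"
 shows "trivialises E U \<phi> k s"
 unfolding trivialises_def
proof (intro conjI ballI allI impI)
 fix y assume y: "y \<in> U"
 then obtain W where W: "y \<in> U \<inter> W" "trivialises E (U \<inter> W) \<phi> k s" using loc by blast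
 show "s y \<in> linear_maps (cvec k) (fibre E (\<phi> y))" "bij_betw (s y) (carrier_vec k) (carrier (fibre E (\<phi> y)))"
  by (rule trivialisesD(1,2)[OF W(2) W(1)])+
next
 fix c f and v :: "rinf => complex Matrix.vec"
 assume c: "c \<in> Obj Cart" and f: "smooth_map c U f" and v: "\<forall>y\<in>c. v y \<in> carrier_vec k"
 let ?b = "\<lambda>y\<in>c. s (f y) (v y)"
 have local: "\<exists>V. openin Rinf V \<and> y \<in> V \<and>
   (\<forall>c'\<in>Obj Cart. c' \<subseteq> c \<inter> V --> (restrict ?b c' \<in> plots (tot E) c' \<longleftrightarrow> smooth_vec c' k v))" if y: "y \<in> c" for y
 proof -
  obtain W where W: "openin Rinf W" "f y \<in> W" "trivialises E (U \<inter> W) \<phi> k s"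
   using loc[OF smooth_map_image[OF f y]] by blast
  obtain V where V: "openin Rinf V" "\<And>y. y \<in> c ==> y \<in> V \<longleftrightarrow> f y \<in> W"
   by (rule smooth_map_preimage[OF f W(1)]) blast
  have "restrict ?b c' \<in> plots (tot E) c' \<longleftrightarrow> smooth_vec c' k v" if c': "c' \<in> Obj Cart" "c' \<subseteq> c \<inter> V" for c'
  proof -
   have "smooth_map c' (U \<inter> W) f"
    by (rule smooth_map_subset[OF f]) (use c'(2) V(2) smooth_map_image[OF f] in auto)
   from trivialisesD(3)[OF W(3) c'(1) this, of v]
   have "(\<lambda>y\<in>c'. s (f y) (v y)) \<in> plots (tot E) c' \<longleftrightarrow> smooth_vec c' k v" using v c'(2) by auto
   moreover have "restrict ?b c' = (\<lambda>y\<in>c'. s (f y) (v y))" using c'(2) by (auto simp: fun_eq_iff)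
   ultimately show ?thesis by simp
  qed
  then show ?thesis using V(1) V(2)[OF y] W(2) by blast
 qed
 show "?b \<in> plots (tot E) c \<longleftrightarrow> smooth_vec c k v"
 proof
  assume b: "?b \<in> plots (tot E) c"
  show "smooth_vec c k v"
  proof (rule smooth_vec_local)
   fix y assume y: "y \<in> c"
   obtain V where V: "openin Rinf V" "y \<in> V"
    "\<forall>c'\<in>Obj Cart. c' \<subseteq> c \<inter> V --> (restrict ?b c' \<in> plots (tot E) c' \<longleftrightarrow> smooth_vec c' k v)"
    using local[OF y] by blast
   obtain c' where c': "c' \<in> Obj Cart" "y \<in> c'" "c' \<subseteq> c \<inter> V" "openin (subtopology Rinf c) c'"
    by (rule Cart_neighbourhood[OF c y V(1,2)])
   have "restrict ?b c' \<in> plots (tot E) c'"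
    by (rule dfl_plots_compose[OF E b c'(1) smooth_map_id]) (use c'(3) in auto)
   then have "smooth_vec c' k v" using bspec[OF V(3) c'(1)] c'(3) by blast
   moreover obtain V' where "openin Rinf V'" "c' = V' \<inter> c" using c'(4) by (auto simp: openin_subtopology)
   ultimately show "\<exists>V. openin Rinf V \<and> y \<in> V \<and> smooth_vec (c \<inter> V) k v"
    using c'(2) by (intro exI[of _ V']) (auto simp: Int_commute)
  qed
 next
  assume vs: "smooth_vec c k v"
  show "?b \<in> plots (tot E) c"
  proof (rule dfl_plots_local[OF E _ c])
   have "s (f y) (v y) \<in> pts (tot E)" if y: "y \<in> c" for y
   proof -
    obtain W where W: "f y \<in> U \<inter> W" "trivialises E (U \<inter> W) \<phi> k s"
     using loc smooth_map_image[OF f y] by blast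
    show ?thesis using trivialises_fibre[OF W(2,1)] v y by (auto simp: fibre_in_pts)
   qed
   then show "?b \<in> c \<rightarrow>\<^sub>E pts (tot E)" by auto
   fix y assume y: "y \<in> c"
   obtain V where V: "openin Rinf V" "y \<in> V"
    "\<forall>c'\<in>Obj Cart. c' \<subseteq> c \<inter> V --> (restrict ?b c' \<in> plots (tot E) c' \<longleftrightarrow> smooth_vec c' k v)"
    using local[OF y] by blast
   show "\<exists>W. openin Rinf W \<and> y \<in> W \<and> (\<forall>c'\<in>Obj Cart. c' \<subseteq> c \<inter> W --> restrict ?b c' \<in> plots (tot E) c')"
    using V smooth_vec_subset[OF vs] by (intro exI[of _ V]) auto
  qed
 qed
qed

section \<open>Triviality of vector bundles on cartesian spaces\<close>

lemma exp_bound: "x \<ge> 0 ==> x * exp (- (x * flat 1 x)) < (3::real)"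
proof -
 assume x: "x \<ge> 0"
 show ?thesis
 proof (cases "x \<le> 1")
  case True
  have "flat 1 x \<ge> 0" by (simp add: flat_def)
  then have "x * exp (- (x * flat 1 x)) \<le> x * 1" using x by (intro mult_left_mono) auto
  then show ?thesis using True by simp
 next
  case False
  have "exp (1::real) \<le> 3" using exp_le by simp
  then have "inverse 3 \<le> inverse (exp (1::real))" by (intro le_imp_inverse_le) auto
  then have "inverse 3 \<le> exp (-1::real)" by (simp only: exp_minus)
  also have "\<dots> \<le> flat 1 x" using False by (simp add: flat_def)
  finally have "x * inverse 3 \<le> x * flat 1 x" using x by (rule mult_left_mono)
  then have "x / 3 \<le> x * flat 1 x" by (simp only: divide_inverse)
  then have "exp (- (x * flat 1 x)) \<le> exp (- (x / 3))" by simp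
  also have "\<dots> < inverse (x / 3)"
  proof -
   have "x / 3 < exp (x / 3)" using exp_ge_add_one_self[of "x / 3"] by linarith
   then have "inverse (exp (x / 3)) < inverse (x / 3)" by (rule less_imp_inverse_less) (use False in simp)
   then show ?thesis by (simp only: exp_minus)
  qed
  finally have "x * exp (- (x * flat 1 x)) < x * inverse (x / 3)" using False by (intro mult_strict_left_mono) auto
  then show ?thesis using False by simp
 qed
qed

text \<open>Modulo scaling, \<open>\<rho> x = x e\<^sup>-\<^sup>x\<^sup>f\<^sup>(\<^sup>x\<^sup>)\<close> with the flat function \<open>f\<close>: it is the identity for \<open>x \<le> 0\<close>, and the
exponential keeps it bounded for \<open>x > 0\<close>. Such a function replaces bump functions and integration.\<close>

lemma soft_bound_exists:
 assumes "\<epsilon> > 0"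
 obtains \<rho> :: "real => real" where "\<And>x. x \<le> 0 ==> \<rho> x = x" "\<And>x. x \<ge> 0 ==> 0 \<le> \<rho> x" "\<And>x. \<rho> x < \<epsilon>"
  "\<And>A f. smooth_fun A f ==> smooth_fun A (\<lambda>x. \<rho> (f x))"
proof -
 define r where "r x = x * exp (- (x * flat 1 x))" for x
 define \<rho> where "\<rho> x = (\<epsilon> / 3) * r ((3 / \<epsilon>) * x)" for x
 have neg: "\<rho> x = x" if "x \<le> 0" for x
 proof -
  have "(3 / \<epsilon>) * x \<le> 0" using assms that by (simp add: mult_nonneg_nonpos divide_nonpos_pos)
  then have "r ((3 / \<epsilon>) * x) = (3 / \<epsilon>) * x" by (simp add: r_def flat_def)
  then show ?thesis using assms by (simp add: \<rho>_def)
 qed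
 moreover have "0 \<le> \<rho> x" if "x \<ge> 0" for x using assms that by (simp add: \<rho>_def r_def)
 moreover have "\<rho> x < \<epsilon>" for x
 proof (cases "x \<le> 0")
  case False
  have "r ((3 / \<epsilon>) * x) < 3" unfolding r_def using assms False by (intro exp_bound) simp
  then show ?thesis using assms by (simp add: \<rho>_def)
 qed (use assms neg in auto)
 moreover have "smooth_fun A (\<lambda>x. \<rho> (f x))" if "smooth_fun A f" for A f
  unfolding \<rho>_def r_def
  by (intro smooth_fun_mult smooth_fun_const smooth_fun_exp smooth_fun_uminus smooth_fun_flat that)
 ultimately show ?thesis by (rule that)
qed

lemma obox_mono:
 "(\<And>i. i < n ==> a' i \<le> a i) ==> (\<And>i. i < n ==> b i \<le> b' i) ==> obox n a b \<subseteq> obox n a' b'"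
 by (fastforce simp: obox_def)

text \<open>The two boxes overlap in the slab \<open>W\<close> around the hyperplane at \<open>m\<close>, where the frames differ by a matrix
\<open>g\<close>. The map \<open>r\<close> sends the right box \<open>V\<close> into \<open>W\<close> and fixes the points to the left of the hyperplane. So
\<open>g \<circ> r\<close> is defined on all of \<open>V\<close>, and changing \<open>t\<close> by it makes \<open>t\<close> agree with \<open>s\<close> to the left.\<close>

lemma merge_trivialisations:
 assumes E: "diffeological_space (tot E)" and i: "i < n" and \<epsilon>: "\<epsilon> > 0"
  and ab: "\<And>j. j < n ==> a j < b j" and m: "a i \<le> m - \<epsilon>" "m + \<epsilon> \<le> b i"
  and s: "trivialises E (obox n a (b(i := m + \<epsilon>))) \<phi> k s"
  and t: "trivialises E (obox n (a(i := m - \<epsilon>)) b) \<phi> l t"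
 shows "\<exists>s. trivialises E (obox n a b) \<phi> k s"
proof -
 define U where "U = obox n a (b(i := m + \<epsilon>))"
 define V where "V = obox n (a(i := m - \<epsilon>)) b"
 define W where "W = obox n (a(i := m - \<epsilon>)) (b(i := m + \<epsilon>))"
 have WU: "W \<subseteq> U" unfolding W_def U_def by (rule obox_mono) (use m in auto)
 have WV: "W \<subseteq> V" unfolding W_def V_def by (rule obox_mono) (use m in auto)
 have "W \<noteq> {}" unfolding W_def obox_nonempty using ab m \<epsilon> by auto
 then have W: "W \<in> Obj Cart" unfolding W_def by (rule obox_in_Cart)
 then have V: "V \<in> Obj Cart" using WV \<open>W \<noteq> {}\<close> unfolding V_def by (intro obox_in_Cart) auto
 obtain g h where gh: "smooth_iso W l k g h"
  and g: "\<And>y v. y \<in> W ==> v \<in> carrier_vec k ==> s y v = t y (g y *\<^sub>v v)"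
  using transition_matrix[OF W trivialises_subset[OF s WU[unfolded U_def]] trivialises_subset[OF t WV[unfolded V_def]]] by blast
 obtain \<rho> :: "real => real" where \<rho>: "\<And>x. x \<le> 0 ==> \<rho> x = x" "\<And>x. x \<ge> 0 ==> 0 \<le> \<rho> x" "\<And>x. \<rho> x < \<epsilon>"
  "\<And>A f. smooth_fun A f ==> smooth_fun A (\<lambda>x. \<rho> (f x))"
  using soft_bound_exists[OF \<epsilon>] by blast
 have \<rho>_low: "- \<epsilon> < \<rho> x" if "- \<epsilon> < x" for x using \<rho>(1)[of x] \<rho>(2)[of x] that \<epsilon> by (cases "x \<le> 0") auto
 \<comment> \<open>squeezes the \<open>i\<close>-th coordinate into the slab and fixes it below \<open>m\<close>\<close>
 define r where "r x = (\<Sum>j<n. axis_pt j (if j = i then m + \<rho> (coord x i - m) else coord x j))" for x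
 have r: "smooth_map V W r"
 proof (rule smooth_mapI_RN)
  show "r x \<in> RN n" for x by (simp add: r_def axis_sum_in_RN)
  show "r x \<in> W" if "x \<in> V" for x
  proof -
   have x: "\<And>j. j < n ==> (a(i := m - \<epsilon>)) j < coord x j \<and> coord x j < b j" using that by (auto simp: V_def obox_def)
   have "m - \<epsilon> < m + \<rho> (coord x i - m)" using x[OF i] \<rho>_low[of "coord x i - m"] by simp
   moreover have "m + \<rho> (coord x i - m) < m + \<epsilon>" using \<rho>(3) by simp
   moreover have "a j < coord x j" if "j < n" "j \<noteq> i" for j using x[OF that(1)] that(2) by simp
   ultimately show ?thesis using x by (auto simp: W_def obox_def r_def axis_sum_in_RN coord_axis_sum)
  qed
  show "smooth_fun V (\<lambda>x. coord (r x) j)" if "j < n" for j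
  proof (cases "j = i")
   case True
   have "smooth_fun V (\<lambda>x. m + \<rho> (coord x i - m))"
    by (intro smooth_fun_add smooth_fun_diff smooth_fun_const smooth_fun_coord \<rho>(4))
   then show ?thesis using that True by (simp add: r_def coord_axis_sum)
  next
   case False
   then show ?thesis using that by (simp add: r_def coord_axis_sum smooth_fun_coord)
  qed
 qed
 have gr: "smooth_iso V l k (\<lambda>x. g (r x)) (\<lambda>x. h (r x))"
  by (rule smooth_iso_compose[OF Cart_locally_bounded[OF V] r gh])
 define t' where "t' = (\<lambda>y v. t y (g (r y) *\<^sub>v v))"
 have t': "trivialises E V \<phi> k t'"
  unfolding t'_def by (rule trivialises_change_frame[OF t[folded V_def] gr])
 define s' where "s' y = (if coord y i < m then s y else t' y)" for y
 have s't': "t' y v = s' y v" if "y \<in> V" "v \<in> carrier_vec k" for y v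
 proof (cases "coord y i < m")
  case True
  have "y \<in> W" using that(1) True \<epsilon> by (auto simp: W_def V_def obox_def)
  have "r y = y"
  proof (rule RN_eqI)
   show "y \<in> RN n" using \<open>y \<in> W\<close> by (simp add: W_def obox_def)
   show "coord (r y) j = coord y j" if "j < n" for j
    using that True \<rho>(1)[of "coord y i - m"] by (simp add: r_def coord_axis_sum)
  qed (simp add: r_def axis_sum_in_RN)
  then show ?thesis using True g[OF \<open>y \<in> W\<close> that(2)] by (simp add: s'_def t'_def)
 qed (simp add: s'_def)
 have "trivialises E (obox n a b) \<phi> k s'"
 proof (rule trivialises_glue[OF E])
  fix y assume y: "y \<in> obox n a b"
  show "\<exists>O'. openin Rinf O' \<and> y \<in> O' \<and> trivialises E (obox n a b \<inter> O') \<phi> k s'"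
  proof (cases "coord y i < m")
   case True
   have "openin Rinf {x. coord x i < m}"
    by (intro open_imp_openin_Rinf open_Collect_less continuous_intros)
   moreover have "trivialises E (obox n a b \<inter> {x. coord x i < m}) \<phi> k s'"
   proof (rule trivialises_cong)
    show "trivialises E (obox n a b \<inter> {x. coord x i < m}) \<phi> k s"
     by (rule trivialises_subset[OF s]) (use \<epsilon> in "auto simp: obox_def")
   qed (auto simp: s'_def)
   ultimately show ?thesis using True by blast
  next
   case False
   have "openin Rinf {x. coord x i > m - \<epsilon>}"
    by (intro open_imp_openin_Rinf open_Collect_less continuous_intros)
   moreover have "trivialises E (obox n a b \<inter> {x. coord x i > m - \<epsilon>}) \<phi> k s'"
   proof (rule trivialises_cong)
    show "trivialises E (obox n a b \<inter> {x. coord x i > m - \<epsilon>}) \<phi> k t'"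
     by (rule trivialises_subset[OF t']) (auto simp: V_def obox_def)
    show "t' y v = s' y v" if "y \<in> obox n a b \<inter> {x. coord x i > m - \<epsilon>}" "v \<in> carrier_vec k" for y v
     by (rule s't'[OF _ that(2)]) (use that(1) in "auto simp: V_def obox_def")
   qed auto
   moreover have "y \<in> {x. coord x i > m - \<epsilon>}" using False \<epsilon> by simp
   ultimately show ?thesis by blast
  qed
 qed
 then show ?thesis by blast
qed

text \<open>Triviality on a neighbourhood of the compact box \<open>[a, b]\<close>; degenerate sides are allowed, so that a
point is the starting case.\<close>

definition trivial_near :: "'u vbundle => nat => (rinf => 'u) => (nat => real) => (nat => real) => bool" where
 "trivial_near E n \<phi> a b \<longleftrightarrow>
   (\<exists>\<epsilon>>0. \<exists>k s. trivialises E (obox n (\<lambda>i. a i - \<epsilon>) (\<lambda>i. b i + \<epsilon>)) \<phi> k s)"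

lemma trivial_near_merge:
 assumes E: "diffeological_space (tot E)" and j: "j < n" and ab: "\<And>i. i < n ==> i \<noteq> j ==> a i \<le> b i"
  and uvw: "u \<le> v" "v \<le> w"
  and uv: "trivial_near E n \<phi> (a(j := u)) (b(j := v))" and vw: "trivial_near E n \<phi> (a(j := v)) (b(j := w))"
 shows "trivial_near E n \<phi> (a(j := u)) (b(j := w))"
proof -
 obtain \<epsilon>1 k s where 1: "\<epsilon>1 > 0" "trivialises E (obox n (\<lambda>i. (a(j := u)) i - \<epsilon>1) (\<lambda>i. (b(j := v)) i + \<epsilon>1)) \<phi> k s"
  using uv unfolding trivial_near_def by blast
 obtain \<epsilon>2 l t where 2: "\<epsilon>2 > 0" "trivialises E (obox n (\<lambda>i. (a(j := v)) i - \<epsilon>2) (\<lambda>i. (b(j := w)) i + \<epsilon>2)) \<phi> l t"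
  using vw unfolding trivial_near_def by blast
 define \<epsilon> where "\<epsilon> = min \<epsilon>1 \<epsilon>2"
 have \<epsilon>: "\<epsilon> > 0" "\<epsilon> \<le> \<epsilon>1" "\<epsilon> \<le> \<epsilon>2" using 1(1) 2(1) by (auto simp: \<epsilon>_def)
 have "\<exists>s. trivialises E (obox n (\<lambda>i. (a(j := u)) i - \<epsilon>) (\<lambda>i. (b(j := w)) i + \<epsilon>)) \<phi> k s"
 proof (rule merge_trivialisations[OF E j \<epsilon>(1), where m=v])
  show "(a(j := u)) i - \<epsilon> < (b(j := w)) i + \<epsilon>" if "i < n" for i
   using ab[OF that] uvw \<epsilon>(1) by (cases "i = j") (auto simp: add_strict_increasing2)
  show "trivialises E (obox n (\<lambda>i. (a(j := u)) i - \<epsilon>) ((\<lambda>i. (b(j := w)) i + \<epsilon>)(j := v + \<epsilon>))) \<phi> k s"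
   by (rule trivialises_subset[OF 1(2)], rule obox_mono) (use \<epsilon> in auto)
  show "trivialises E (obox n ((\<lambda>i. (a(j := u)) i - \<epsilon>)(j := v - \<epsilon>)) (\<lambda>i. (b(j := w)) i + \<epsilon>)) \<phi> l t"
   by (rule trivialises_subset[OF 2(2)], rule obox_mono) (use \<epsilon> in auto)
 qed (use uvw in auto)
 then show ?thesis unfolding trivial_near_def using \<epsilon>(1) by blast
qed

text \<open>Induction on the number \<open>j\<close> of sides with positive length. A new side is handled by bisection: small
pieces are covered by the induction hypothesis, and adjacent pieces merge.\<close>

lemma trivial_near_compact_box:
 assumes E: "diffeological_space (tot E)"
  and loc: "\<And>y. y \<in> RN n ==> \<exists>W k s. openin Rinf W \<and> y \<in> W \<and> trivialises E (RN n \<inter> W) \<phi> k s"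
  and jn: "j \<le> n" and ab: "\<And>i. i < n ==> a i \<le> b i" "\<And>i. j \<le> i ==> i < n ==> a i = b i"
 shows "trivial_near E n \<phi> a b"
 using jn ab
proof (induction j arbitrary: a b)
 case 0
 define p where "p = (\<Sum>i<n. axis_pt i (a i))"
 have p: "p \<in> RN n" "\<And>i. i < n ==> coord p i = a i" by (auto simp: p_def axis_sum_in_RN coord_axis_sum)
 obtain W k s where W: "openin Rinf W" "p \<in> W" "trivialises E (RN n \<inter> W) \<phi> k s" using loc[OF p(1)] by blast
 obtain r where r: "r > 0" "obox n (\<lambda>i. coord p i - r) (\<lambda>i. coord p i + r) \<subseteq> W \<inter> RN n"
  by (rule obox_neighbourhood[OF openin_Rinf_RN[OF W(1)], of p n]) (use W p in auto)
 have "trivialises E (obox n (\<lambda>i. a i - r) (\<lambda>i. b i + r)) \<phi> k s"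
 proof (rule trivialises_subset[OF W(3)])
  have "obox n (\<lambda>i. a i - r) (\<lambda>i. b i + r) \<subseteq> obox n (\<lambda>i. coord p i - r) (\<lambda>i. coord p i + r)"
   by (rule obox_mono) (use p 0 in auto)
  then show "obox n (\<lambda>i. a i - r) (\<lambda>i. b i + r) \<subseteq> RN n \<inter> W" using r(2) by blast
 qed
 then show ?case unfolding trivial_near_def using r(1) by blast
next
 case (Suc j)
 then have j: "j < n" by simp
 have "trivial_near E n \<phi> (a(j := a j)) (b(j := b j))"
 proof (rule Bolzano[where P="\<lambda>u v. trivial_near E n \<phi> (a(j := u)) (b(j := v))"])
  show "a j \<le> b j" using Suc.prems(2) j by simp
  show "trivial_near E n \<phi> (a(j := u)) (b(j := w))"
   if "trivial_near E n \<phi> (a(j := u)) (b(j := v))" "trivial_near E n \<phi> (a(j := v)) (b(j := w))" "u \<le> v" "v \<le> w" for u v w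
   by (rule trivial_near_merge[OF E j Suc.prems(2) that(3,4,1,2)])
  fix x assume "a j \<le> x" "x \<le> b j"
  have "trivial_near E n \<phi> (a(j := x)) (b(j := x))"
  proof (rule Suc.IH)
   show "(a(j := x)) i = (b(j := x)) i" if "j \<le> i" "i < n" for i
    using Suc.prems(3)[of i] that by (cases "i = j") auto
  qed (use Suc.prems in auto)
  then obtain \<epsilon> k s where e: "\<epsilon> > 0" "trivialises E (obox n (\<lambda>i. (a(j := x)) i - \<epsilon>) (\<lambda>i. (b(j := x)) i + \<epsilon>)) \<phi> k s"
   unfolding trivial_near_def by blast
  have "trivial_near E n \<phi> (a(j := u)) (b(j := v))" if "u \<le> x" "x \<le> v" "v - u < \<epsilon> / 2" for u v
  proof -
   have "trivialises E (obox n (\<lambda>i. (a(j := u)) i - \<epsilon> / 2) (\<lambda>i. (b(j := v)) i + \<epsilon> / 2)) \<phi> k s"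
    by (rule trivialises_subset[OF e(2)], rule obox_mono) (use that e(1) in auto)
   then show ?thesis unfolding trivial_near_def using half_gt_zero[OF e(1)] by blast
  qed
  then show "\<exists>d>0. \<forall>u v. u \<le> x \<and> x \<le> v \<and> v - u < d --> trivial_near E n \<phi> (a(j := u)) (b(j := v))"
   using half_gt_zero[OF e(1)] by blast
 qed
 then show ?case by simp
qed

abbreviation cube :: "nat => real => rinf set" where
 "cube n R \<equiv> obox n (\<lambda>_. - R) (\<lambda>_. R)"

lemma soft_clamp_exists:
 assumes "R \<ge> 0"
 obtains \<kappa> :: "real => real" where "\<And>x. \<bar>x\<bar> < R ==> \<kappa> x = x" "\<And>x. \<bar>\<kappa> x\<bar> < R + 1"
  "\<And>A f. smooth_fun A f ==> smooth_fun A (\<lambda>x. \<kappa> (f x))"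
proof -
 obtain \<rho> :: "real => real" where \<rho>: "\<And>x. x \<le> 0 ==> \<rho> x = x" "\<And>x. x \<ge> 0 ==> 0 \<le> \<rho> x" "\<And>x. \<rho> x < 1"
  "\<And>A f. smooth_fun A f ==> smooth_fun A (\<lambda>x. \<rho> (f x))"
  using soft_bound_exists[of 1] by auto
 define up where "up x = R + \<rho> (x - R)" for x
 define \<kappa> where "\<kappa> x = - up (- up x)" for x
 have up1: "up x = x" if "x \<le> R" for x using \<rho>(1)[of "x - R"] that by (simp add: up_def)
 have up2: "up x \<ge> R" if "x \<ge> R" for x using \<rho>(2)[of "x - R"] that by (simp add: up_def)
 have up3: "up x < R + 1" for x using \<rho>(3) by (simp add: up_def)
 have "\<kappa> x = x" if "\<bar>x\<bar> < R" for x using that up1[of x] up1[of "- x"] by (simp add: \<kappa>_def)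
 moreover have "\<bar>\<kappa> x\<bar> < R + 1" for x
 proof -
  have "- up x \<ge> R \<or> up (- up x) = - up x" using up1[of "- up x"] by (cases "- up x \<le> R") auto
  then have "- up (- up x) < R + 1" using up2[of "- up x"] up3[of x] assms by auto
  then show ?thesis using up3[of "- up x"] by (simp add: \<kappa>_def abs_less_iff)
 qed
 moreover have "smooth_fun A (\<lambda>x. \<kappa> (f x))" if "smooth_fun A f" for A f
  unfolding \<kappa>_def up_def
  by (intro smooth_fun_add smooth_fun_diff smooth_fun_uminus smooth_fun_const \<rho>(4) that)
 ultimately show ?thesis by (rule that)
qed

text \<open>A frame on a cube need not extend, but after shrinking the cube it does: change the frame of the
larger cube by the transition matrix composed with a soft clamp, which is the identity on the
smaller cube.\<close>

lemma extend_trivialisation: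
 assumes R: "R \<ge> 0" and s: "trivialises E (cube n (R + 1)) \<phi> k s" and t: "trivialises E (cube n (R + 2)) \<phi> l t"
 obtains s' where "trivialises E (cube n (R + 2)) \<phi> k s'"
  "\<And>y v. y \<in> cube n R ==> v \<in> carrier_vec k ==> s' y v = s y v"
proof -
 have sub: "cube n (R + 1) \<subseteq> cube n (R + 2)" "cube n R \<subseteq> cube n (R + 1)" by (rule obox_mono; simp)+
 have C: "cube n (R + 1) \<in> Obj Cart" "cube n (R + 2) \<in> Obj Cart"
  by (rule obox_in_Cart, unfold obox_nonempty, use R in simp)+
 obtain g h where gh: "smooth_iso (cube n (R + 1)) l k g h"
  and g: "\<And>y v. y \<in> cube n (R + 1) ==> v \<in> carrier_vec k ==> s y v = t y (g y *\<^sub>v v)"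
  using transition_matrix[OF C(1) s trivialises_subset[OF t sub(1)]] by blast
 obtain \<kappa> :: "real => real" where \<kappa>: "\<And>x. \<bar>x\<bar> < R ==> \<kappa> x = x" "\<And>x. \<bar>\<kappa> x\<bar> < R + 1"
  "\<And>A f. smooth_fun A f ==> smooth_fun A (\<lambda>x. \<kappa> (f x))"
  using soft_clamp_exists[OF R] by blast
 define r where "r x = (\<Sum>j<n. axis_pt j (\<kappa> (coord x j)))" for x
 have r: "smooth_map (cube n (R + 2)) (cube n (R + 1)) r"
 proof (rule smooth_mapI_RN)
  show "r x \<in> RN n" for x by (simp add: r_def axis_sum_in_RN)
  show "r x \<in> cube n (R + 1)" for x
  proof -
   have "- (R + 1) < \<kappa> (coord x j) \<and> \<kappa> (coord x j) < R + 1" for j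
    using \<kappa>(2)[of "coord x j"] by (simp add: abs_less_iff)
   then show ?thesis by (auto simp: r_def obox_def axis_sum_in_RN coord_axis_sum)
  qed
  show "smooth_fun (cube n (R + 2)) (\<lambda>x. coord (r x) j)" if "j < n" for j
   using that by (simp add: r_def coord_axis_sum) (intro \<kappa>(3) smooth_fun_coord)
 qed
 have gr: "smooth_iso (cube n (R + 2)) l k (\<lambda>x. g (r x)) (\<lambda>x. h (r x))"
  by (rule smooth_iso_compose[OF Cart_locally_bounded[OF C(2)] r gh])
 show ?thesis
 proof (rule that)
  show "trivialises E (cube n (R + 2)) \<phi> k (\<lambda>y v. t y (g (r y) *\<^sub>v v))"
   by (rule trivialises_change_frame[OF t gr])
  fix y and v :: "complex Matrix.vec" assume y: "y \<in> cube n R" and v: "v \<in> carrier_vec k"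
  have "r y = y"
  proof (rule RN_eqI)
   show "y \<in> RN n" using y by (simp add: obox_def)
   show "coord (r y) j = coord y j" if "j < n" for j
    using that y \<kappa>(1)[of "coord y j"] by (auto simp: r_def coord_axis_sum obox_def abs_less_iff)
  qed (simp add: r_def axis_sum_in_RN)
  then show "t y (g (r y) *\<^sub>v v) = s y v" using g[of y v] y v sub(2) by auto
 qed
qed

text \<open>Extending from cube to cube with agreement on the previous one, the frames stabilise at each point
and their limit is a frame everywhere.\<close>

lemma trivial_on_RN:
 assumes E: "diffeological_space (tot E)"
  and loc: "\<And>y. y \<in> RN n ==> \<exists>W k s. openin Rinf W \<and> y \<in> W \<and> trivialises E (RN n \<inter> W) \<phi> k s"
 shows "\<exists>k s. trivialises E (RN n) \<phi> k s"
proof -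
 have big: "\<exists>k t. trivialises E (cube n R) \<phi> k t" if "R \<ge> 0" for R
 proof -
  have "trivial_near E n \<phi> (\<lambda>_. - R) (\<lambda>_. R)"
   by (rule trivial_near_compact_box[OF E loc, where j=n]) (use that in auto)
  then obtain \<epsilon> k s where "\<epsilon> > 0" "trivialises E (obox n (\<lambda>i. - R - \<epsilon>) (\<lambda>i. R + \<epsilon>)) \<phi> k s"
   unfolding trivial_near_def by blast
  then have "trivialises E (cube n R) \<phi> k s"
   by (elim trivialises_subset) (rule obox_mono, auto)
  then show ?thesis by blast
 qed
 obtain k s0 where s0: "trivialises E (cube n 1) \<phi> k s0" using big[of 1] by auto
 \<comment> \<open>frames on cubes of radius \<open>N + 1\<close>, prescribed on the cube of radius \<open>N\<close> by the predecessor\<close>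
 define good where "good N s \<longleftrightarrow> trivialises E (cube n (real N + 1)) \<phi> k s" for N s
 define agree where "agree N s s' \<longleftrightarrow> (\<forall>y\<in>cube n (real N). \<forall>v\<in>carrier_vec k. s' y v = s y v)" for N and s s' :: "rinf => complex Matrix.vec => 'a"
 have "\<exists>S. \<forall>N. good N (S N) \<and> agree N (S N) (S (Suc N))"
 proof (rule dependent_nat_choice)
  show "\<exists>s. good 0 s" using s0 by (auto simp: good_def)
  fix s N assume "good N s"
  then have s: "trivialises E (cube n (real N + 1)) \<phi> k s" by (simp add: good_def)
  obtain l t where t: "trivialises E (cube n (real N + 2)) \<phi> l t" using big[of "real N + 2"] by auto
  obtain s' where s': "trivialises E (cube n (real N + 2)) \<phi> k s'"
   "\<And>y v. y \<in> cube n (real N) ==> v \<in> carrier_vec k ==> s' y v = s y v"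
   using extend_trivialisation[OF _ s t] by auto
  have "real (Suc N) + 1 = real N + 2" by simp
  then have "good (Suc N) s'" unfolding good_def using s'(1) by (simp only:)
  then show "\<exists>s'. good (Suc N) s' \<and> agree N s s'" using s'(2) by (auto simp: agree_def)
 qed
 then obtain S where S: "\<And>N. good N (S N)" "\<And>N. agree N (S N) (S (Suc N))" by blast
 have stable: "S M y v = S N y v" if "N \<le> M" "y \<in> cube n (real N)" "v \<in> carrier_vec k" for N M y v
  using that(1)
 proof (induction M rule: dec_induct)
  case (step M)
  have "y \<in> cube n (real M)" using that(2) step(1) by (auto intro: obox_mono[THEN subsetD, rotated 2])
  then show ?case using S(2)[of M] step that(3) by (auto simp: agree_def)
 qed simp
 define L where "L y = (LEAST N. y \<in> cube n (real N))" for y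
 define s where "s y = S (L y) y" for y
 have s: "S N y v = s y v" if "y \<in> cube n (real N)" "v \<in> carrier_vec k" for N y v
 proof -
  have "y \<in> cube n (real (L y))" "L y \<le> N" unfolding L_def using that(1) by (auto intro: LeastI Least_le)
  then show ?thesis using stable that(2) by (simp add: s_def)
 qed
 have "trivialises E (RN n) \<phi> k s"
 proof (rule trivialises_glue[OF E])
  fix y assume y: "y \<in> RN n"
  obtain N where N: "real N > norm y" using reals_Archimedean2 by blast
  let ?W = "{x. \<forall>i<n. - real N < coord x i \<and> coord x i < real N}"
  have "?W = (\<Inter>i\<in>{..<n}. {x. - real N < coord x i \<and> coord x i < real N})" by auto
  moreover have "open (\<Inter>i\<in>{..<n}. {x. - real N < coord x i \<and> coord x i < real N})"
   by (intro open_INT ballI open_Collect_conj open_Collect_less continuous_intros) auto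
  ultimately have "openin Rinf ?W" by (simp add: open_imp_openin_Rinf)
  moreover have "y \<in> ?W"
  proof -
   have "\<bar>coord y i\<bar> < real N" for i using abs_coord_le_norm[of y i] N by simp
   then show ?thesis by (simp add: abs_less_iff) (meson minus_less_iff)
  qed
  moreover have "trivialises E (RN n \<inter> ?W) \<phi> k s"
  proof (rule trivialises_cong)
   show "trivialises E (RN n \<inter> ?W) \<phi> k (S N)"
    using S(1)[of N] unfolding good_def by (elim trivialises_subset) (force simp: obox_def)
   show "S N y v = s y v" if "y \<in> RN n \<inter> ?W" "v \<in> carrier_vec k" for y v
    by (rule s) (use that in "auto simp: obox_def")
  qed simp
  ultimately show "\<exists>W. openin Rinf W \<and> y \<in> W \<and> trivialises E (RN n \<inter> W) \<phi> k s" by blast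
 qed
 then show ?thesis by blast
qed

text \<open>A chart reduces the claim to \<open>\<real>\<^sup>n\<close>.\<close>

theorem locally_trivial_imp_trivial:
 assumes E: "diffeological_space (tot E)" and c: "c \<in> Obj Cart"
  and loc: "\<And>y. y \<in> c ==> \<exists>W k s. openin Rinf W \<and> y \<in> W \<and> trivialises E (c \<inter> W) \<phi> k s"
 shows "\<exists>k s. trivialises E c \<phi> k s"
proof -
 obtain n e where "diffeo (RN n) c e" using c by (auto simp: Obj_Cart_iff)
 then obtain e' where e: "smooth_map (RN n) c e" "smooth_map c (RN n) e'" "\<forall>y\<in>c. e (e' y) = y"
  unfolding diffeo_def by blast
 have "\<exists>k s. trivialises E (RN n) (\<lambda>x. \<phi> (e x)) k s"
 proof (rule trivial_on_RN[OF E])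
  fix y assume y: "y \<in> RN n"
  obtain W k s where W: "openin Rinf W" "e y \<in> W" "trivialises E (c \<inter> W) \<phi> k s"
   using loc[OF smooth_map_image[OF e(1) y]] by blast
  obtain V where V: "openin Rinf V" "\<And>x. x \<in> RN n ==> x \<in> V \<longleftrightarrow> e x \<in> W"
   by (rule smooth_map_preimage[OF e(1) W(1)]) blast
  have "smooth_map (RN n \<inter> V) (c \<inter> W) e"
   by (rule smooth_map_subset[OF e(1)]) (use V(2) smooth_map_image[OF e(1)] in auto)
  from trivialises_pull[OF W(3) this] have "trivialises E (RN n \<inter> V) (\<lambda>x. \<phi> (e x)) k (\<lambda>x. s (e x))" .
  then show "\<exists>W k s. openin Rinf W \<and> y \<in> W \<and> trivialises E (RN n \<inter> W) (\<lambda>x. \<phi> (e x)) k s"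
   using V W y by blast
 qed
 then obtain k s where "trivialises E (RN n) (\<lambda>x. \<phi> (e x)) k s" by blast
 from trivialises_pull[OF this e(2)] have "trivialises E c \<phi> k (\<lambda>y. s (e' y))"
  by (rule trivialises_cong) (use e(3) in auto)
 then show ?thesis by blast
qed

section \<open>Equivalences of categories\<close>

lemma is_categoryD:
 assumes "is_category C"
 shows "x \<in> Obj C ==> Id C x \<in> Hom C x x"
  "x \<in> Obj C ==> y \<in> Obj C ==> z \<in> Obj C ==> f \<in> Hom C x y ==> g \<in> Hom C y z ==> Cmp C x y z g f \<in> Hom C x z"
  "x \<in> Obj C ==> y \<in> Obj C ==> f \<in> Hom C x y ==> Cmp C x x y f (Id C x) = f"
  "x \<in> Obj C ==> y \<in> Obj C ==> f \<in> Hom C x y ==> Cmp C x y y (Id C y) f = f"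
  "w \<in> Obj C ==> x \<in> Obj C ==> y \<in> Obj C ==> z \<in> Obj C ==> f \<in> Hom C w x ==> g \<in> Hom C x y ==> h \<in> Hom C y z ==>
   Cmp C w x z (Cmp C x y z h g) f = Cmp C w y z h (Cmp C w x y g f)"
 using assms unfolding is_category_def by blast+

lemma is_functorD:
 assumes "is_functor C D F"
 shows "is_category C" "is_category D" "x \<in> Obj C ==> FO F x \<in> Obj D"
  "x \<in> Obj C ==> y \<in> Obj C ==> f \<in> Hom C x y ==> FM F x y f \<in> Hom D (FO F x) (FO F y)"
  "x \<in> Obj C ==> FM F x x (Id C x) = Id D (FO F x)"
  "x \<in> Obj C ==> y \<in> Obj C ==> z \<in> Obj C ==> f \<in> Hom C x y ==> g \<in> Hom C y z ==>
   FM F x z (Cmp C x y z g f) = Cmp D (FO F x) (FO F y) (FO F z) (FM F y z g) (FM F x y f)"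
 using assms unfolding is_functor_def by blast+

text \<open>The coherence isomorphisms and their inverses are composed in the canonical descent datum.\<close>

lemma inverse_arrows_compose:
 assumes C: "is_category C" and o: "x \<in> Obj C" "y \<in> Obj C" "z \<in> Obj C"
  and f: "inverse_arrows C x y f f'" and g: "inverse_arrows C y z g g'"
 shows "inverse_arrows C x z (Cmp C x y z g f) (Cmp C z y x f' g')"
proof -
 note fD = f[unfolded inverse_arrows_def] and gD = g[unfolded inverse_arrows_def] and cD = is_categoryD[OF C]
 have fg: "Cmp C x y z g f \<in> Hom C x z" "Cmp C z y x f' g' \<in> Hom C z x" using cD(2) o fD gD by simp_all
 have "Cmp C x z x (Cmp C z y x f' g') (Cmp C x y z g f) = Cmp C x y x f' (Cmp C x z y g' (Cmp C x y z g f))"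
  by (rule cD(5)) (use o fD gD fg in simp_all)
 also have "Cmp C x z y g' (Cmp C x y z g f) = Cmp C x y y (Cmp C y z y g' g) f" by (rule cD(5)[symmetric]) (use o fD gD in simp_all)
 finally have 1: "Cmp C x z x (Cmp C z y x f' g') (Cmp C x y z g f) = Id C x" using fD gD cD(4)[OF o(1,2), of f] by simp
 have "Cmp C z x z (Cmp C x y z g f) (Cmp C z y x f' g') = Cmp C z y z g (Cmp C z x y f (Cmp C z y x f' g'))"
  by (rule cD(5)) (use o fD gD fg in simp_all)
 also have "Cmp C z x y f (Cmp C z y x f' g') = Cmp C z y y (Cmp C y x y f f') g'" by (rule cD(5)[symmetric]) (use o fD gD in simp_all)
 finally have 2: "Cmp C z x z (Cmp C x y z g f) (Cmp C z y x f' g') = Id C z" using fD gD cD(4)[OF o(3,2), of g'] by simp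
 show ?thesis using fg 1 2 by (simp add: inverse_arrows_def)
qed

lemma inverse_arrows_sym: "inverse_arrows C x y f g ==> inverse_arrows C y x g f"
 by (simp add: inverse_arrows_def)

lemma Inv_eqI:
 assumes C: "is_category C" and x: "x \<in> Obj C" and y: "y \<in> Obj C" and g: "inverse_arrows C x y f g"
 shows "Inv C x y f = g"
 unfolding Inv_def
proof (rule the_equality)
 show "inverse_arrows C x y f g" by (rule g)
 fix g' assume g': "inverse_arrows C x y f g'"
 note gD = g[unfolded inverse_arrows_def] and g'D = g'[unfolded inverse_arrows_def]
 have "g' = Cmp C y x x (Cmp C x y x g f) g'" using is_categoryD(4)[OF C y x, of g'] gD g'D by simp
 also have "\<dots> = Cmp C y y x g (Cmp C y x y f g')" using is_categoryD(5)[OF C y x y x, of g' f g] gD g'D by simp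
 also have "\<dots> = g" using is_categoryD(3)[OF C y x, of g] gD g'D by simp
 finally show "g' = g" .
qed

text \<open>Choose for each object \<open>d\<close> of \<open>D\<close> an object \<open>g d\<close> of \<open>C\<close> and an isomorphism \<open>e d : F (g d) \<rightarrow> d\<close>. Conjugation by
these isomorphisms, followed by the inverse of \<open>F\<close> on morphisms, is the quasi-inverse; every
equation in \<open>C\<close> is checked after applying the faithful functor \<open>F\<close>.\<close>

lemma fully_faithful_ess_surj_equivalence:
 assumes F: "is_functor C D F"
  and ff: "\<And>x y. x \<in> Obj C ==> y \<in> Obj C ==> bij_betw (FM F x y) (Hom C x y) (Hom D (FO F x) (FO F y))"
  and es: "\<And>d. d \<in> Obj D ==> \<exists>x\<in>Obj C. \<exists>e e'. inverse_arrows D (FO F x) d e e'"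
 shows "is_equivalence C D F"
proof -
 note C = is_categoryD[OF is_functorD(1)[OF F]] and D = is_categoryD[OF is_functorD(2)[OF F]]
 note FO = is_functorD(3)[OF F] and FM = is_functorD(4)[OF F] and FId = is_functorD(5)[OF F] and FC = is_functorD(6)[OF F]
 have "\<exists>g. \<forall>d\<in>Obj D. g d \<in> Obj C \<and> (\<exists>e e'. inverse_arrows D (FO F (g d)) d e e')"
  using es by (intro bchoice) blast
 then obtain g where g: "\<And>d. d \<in> Obj D ==> g d \<in> Obj C"
  "\<And>d. d \<in> Obj D ==> \<exists>e e'. inverse_arrows D (FO F (g d)) d e e'" by blast
 define FG where "FG d = FO F (g d)" for d
 have FG: "\<And>d. d \<in> Obj D ==> FG d \<in> Obj D" using g(1) FO by (simp add: FG_def)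
 have "\<exists>e. \<forall>d\<in>Obj D. \<exists>e'. inverse_arrows D (FG d) d (e d) e'"
  using g(2) unfolding FG_def by (intro bchoice) blast
 then obtain e where "\<And>d. d \<in> Obj D ==> \<exists>e'. inverse_arrows D (FG d) d (e d) e'" by blast
 then have "\<exists>e'. \<forall>d\<in>Obj D. inverse_arrows D (FG d) d (e d) (e' d)" by (intro bchoice) blast
 then obtain e' where "\<And>d. d \<in> Obj D ==> inverse_arrows D (FG d) d (e d) (e' d)" by blast
 then have e: "e d \<in> Hom D (FG d) d" "e' d \<in> Hom D d (FG d)"
   "Cmp D (FG d) d (FG d) (e' d) (e d) = Id D (FG d)" "Cmp D d (FG d) d (e d) (e' d) = Id D d"
  if "d \<in> Obj D" for d using that by (auto simp: inverse_arrows_def)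
 define L where "L x y = inv_into (Hom C x y) (FM F x y)" for x y
 have L: "L x y m \<in> Hom C x y" "FM F x y (L x y m) = m"
  if "x \<in> Obj C" "y \<in> Obj C" "m \<in> Hom D (FO F x) (FO F y)" for x y m
  using ff[OF that(1,2)] that(3) unfolding L_def
  by (metis bij_betw_imp_surj_on inv_into_into, metis bij_betw_imp_surj_on f_inv_into_f)
 have inj: "f = f'" if "x \<in> Obj C" "y \<in> Obj C" "f \<in> Hom C x y" "f' \<in> Hom C x y" "FM F x y f = FM F x y f'" for x y f f'
  by (rule inj_onD[OF bij_betw_imp_inj_on[OF ff[OF that(1,2)]] that(5,3,4)])
 define conj where "conj d d' k = Cmp D (FG d) d' (FG d') (e' d') (Cmp D (FG d) d d' k (e d))" for d d' k
 have conj: "conj d d' k \<in> Hom D (FG d) (FG d')" if "d \<in> Obj D" "d' \<in> Obj D" "k \<in> Hom D d d'" for d d' k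
  unfolding conj_def using that e FG D(2) by metis
 define G where "G = \<lparr>FO = g, FM = \<lambda>d d' k. L (g d) (g d') (conj d d' k)\<rparr>"
 have GM: "FM G d d' k \<in> Hom C (g d) (g d')" "FM F (g d) (g d') (FM G d d' k) = conj d d' k"
  if "d \<in> Obj D" "d' \<in> Obj D" "k \<in> Hom D d d'" for d d' k
  using L[OF g(1)[OF that(1)] g(1)[OF that(2)] conj[OF that, unfolded FG_def]] by (simp_all add: G_def)
 have conj_e: "Cmp D (FG d) (FG d') d' (e d') (conj d d' k) = Cmp D (FG d) d d' k (e d)"
  if "d \<in> Obj D" "d' \<in> Obj D" "k \<in> Hom D d d'" for d d' k
 proof -
  have ke: "Cmp D (FG d) d d' k (e d) \<in> Hom D (FG d) d'" using that e FG D(2) by metis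
  have "Cmp D (FG d) (FG d') d' (e d') (conj d d' k)
    = Cmp D (FG d) d' d' (Cmp D d' (FG d') d' (e d') (e' d')) (Cmp D (FG d) d d' k (e d))"
   unfolding conj_def by (rule D(5)[symmetric]) (use that FG e ke in auto)
  then show ?thesis using e(4)[OF that(2)] D(4)[OF FG[OF that(1)] that(2) ke] by simp
 qed
 have conj_e': "Cmp D d (FG d) (FG d') (conj d d' k) (e' d) = Cmp D d d' (FG d') (e' d') k"
  if "d \<in> Obj D" "d' \<in> Obj D" "k \<in> Hom D d d'" for d d' k
 proof -
  have ke: "Cmp D (FG d) d d' k (e d) \<in> Hom D (FG d) d'" using that e FG D(2) by metis
  have "Cmp D d (FG d) (FG d') (conj d d' k) (e' d)
    = Cmp D d d' (FG d') (e' d') (Cmp D d (FG d) d' (Cmp D (FG d) d d' k (e d)) (e' d))"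
   unfolding conj_def by (rule D(5)) (use that FG e ke in auto)
  also have "Cmp D d (FG d) d' (Cmp D (FG d) d d' k (e d)) (e' d) = Cmp D d d d' k (Cmp D d (FG d) d (e d) (e' d))"
   by (rule D(5)) (use that FG e in auto)
  also have "\<dots> = k" using e(4)[OF that(1)] D(3)[OF that] by simp
  finally show ?thesis .
 qed
 have G: "is_functor D C G"
  unfolding is_functor_def
 proof (intro conjI ballI)
  show "is_category D" "is_category C" using is_functorD[OF F] by auto
  show "FO G d \<in> Obj C" if "d \<in> Obj D" for d using g(1)[OF that] by (simp add: G_def)
  show "FM G d d' k \<in> Hom C (FO G d) (FO G d')" if "d \<in> Obj D" "d' \<in> Obj D" "k \<in> Hom D d d'" for d d' k
   using GM(1)[OF that] by (simp add: G_def)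
  show "FM G d d (Id D d) = Id C (FO G d)" if d: "d \<in> Obj D" for d
  proof (rule inj[OF g(1)[OF d] g(1)[OF d] GM(1)[OF d d D(1)[OF d]]])
   show "Id C (FO G d) \<in> Hom C (g d) (g d)" using C(1)[OF g(1)[OF d]] by (simp add: G_def)
   have "conj d d (Id D d) = Id D (FG d)"
    unfolding conj_def using D(4)[OF FG[OF d] d e(1)[OF d]] e(3)[OF d] by simp
   then show "FM F (g d) (g d) (FM G d d (Id D d)) = FM F (g d) (g d) (Id C (FO G d))"
    using GM(2)[OF d d D(1)[OF d]] FId[OF g(1)[OF d]] by (simp add: G_def FG_def)
  qed
  fix a b c k l assume a: "a \<in> Obj D" and b: "b \<in> Obj D" and c: "c \<in> Obj D" and k: "k \<in> Hom D a b" and l: "l \<in> Hom D b c"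
  note ga = g(1)[OF a] and gb = g(1)[OF b] and gc = g(1)[OF c]
  have lk: "Cmp D a b c l k \<in> Hom D a c" by (rule D(2)[OF a b c k l])
  have ke: "Cmp D (FG a) a b k (e a) \<in> Hom D (FG a) b" by (rule D(2)[OF FG[OF a] a b e(1)[OF a] k])
  show "FM G a c (Cmp D a b c l k) = Cmp C (FO G a) (FO G b) (FO G c) (FM G b c l) (FM G a b k)"
  proof (rule inj[OF ga gc GM(1)[OF a c lk]])
   have comp: "Cmp C (g a) (g b) (g c) (FM G b c l) (FM G a b k) \<in> Hom C (g a) (g c)"
    by (rule C(2)[OF ga gb gc GM(1)[OF a b k] GM(1)[OF b c l]])
   then show "Cmp C (FO G a) (FO G b) (FO G c) (FM G b c l) (FM G a b k) \<in> Hom C (g a) (g c)" by (simp add: G_def)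
   have "FM F (g a) (g c) (Cmp C (g a) (g b) (g c) (FM G b c l) (FM G a b k)) = Cmp D (FG a) (FG b) (FG c) (conj b c l) (conj a b k)"
    using FC[OF ga gb gc GM(1)[OF a b k] GM(1)[OF b c l]] GM(2)[OF a b k] GM(2)[OF b c l] by (simp add: FG_def)
   also have "\<dots> = Cmp D (FG a) c (FG c) (e' c) (Cmp D (FG a) (FG b) c (Cmp D (FG b) b c l (e b)) (conj a b k))"
    unfolding conj_def[of b c l] by (rule D(5)) (use a b c k l FG e conj D(2)[OF FG[OF b] b c e(1)[OF b] l] in auto)
   also have "Cmp D (FG a) (FG b) c (Cmp D (FG b) b c l (e b)) (conj a b k) = Cmp D (FG a) b c l (Cmp D (FG a) (FG b) b (e b) (conj a b k))"
    by (rule D(5)) (use a b c k l FG e conj in auto)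
   also have "\<dots> = Cmp D (FG a) b c l (Cmp D (FG a) a b k (e a))" using conj_e[OF a b k] by simp
   also have "\<dots> = Cmp D (FG a) a c (Cmp D a b c l k) (e a)"
    by (rule D(5)[symmetric]) (use a b c k l FG e in auto)
   finally show "FM F (g a) (g c) (FM G a c (Cmp D a b c l k)) = FM F (g a) (g c) (Cmp C (FO G a) (FO G b) (FO G c) (FM G b c l) (FM G a b k))"
    using GM(2)[OF a c lk] by (simp add: G_def conj_def)
  qed
 qed
 define \<eta> where "\<eta> x = L x (g (FO F x)) (e' (FO F x))" for x
 define \<eta>' where "\<eta>' x = L (g (FO F x)) x (e (FO F x))" for x
 have \<eta>: "\<eta> x \<in> Hom C x (g (FO F x))" "FM F x (g (FO F x)) (\<eta> x) = e' (FO F x)"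
  and \<eta>': "\<eta>' x \<in> Hom C (g (FO F x)) x" "FM F (g (FO F x)) x (\<eta>' x) = e (FO F x)" if x: "x \<in> Obj C" for x
  using L[OF x g(1)[OF FO[OF x]] e(2)[OF FO[OF x], unfolded FG_def]]
   L[OF g(1)[OF FO[OF x]] x e(1)[OF FO[OF x], unfolded FG_def]] by (simp_all add: \<eta>_def \<eta>'_def)
 have "natural_iso C C id_func (comp_func G F) \<eta>"
  unfolding natural_iso_def id_func_def comp_func_def
 proof (intro conjI ballI, simp_all)
  fix x assume x: "x \<in> Obj C"
  note gx = g(1)[OF FO[OF x]]
  have "inverse_arrows C x (g (FO F x)) (\<eta> x) (\<eta>' x)"
   unfolding inverse_arrows_def
  proof (intro conjI \<eta>(1)[OF x] \<eta>'(1)[OF x])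
   show "Cmp C x (g (FO F x)) x (\<eta>' x) (\<eta> x) = Id C x"
    by (rule inj[OF x x C(2)[OF x gx x \<eta>(1)[OF x] \<eta>'(1)[OF x]] C(1)[OF x]])
     (use FC[OF x gx x \<eta>(1)[OF x] \<eta>'(1)[OF x]] \<eta>(2)[OF x] \<eta>'(2)[OF x] e(4)[OF FO[OF x]] FId[OF x] in "simp add: FG_def")
   show "Cmp C (g (FO F x)) x (g (FO F x)) (\<eta> x) (\<eta>' x) = Id C (g (FO F x))"
    by (rule inj[OF gx gx C(2)[OF gx x gx \<eta>'(1)[OF x] \<eta>(1)[OF x]] C(1)[OF gx]])
     (use FC[OF gx x gx \<eta>'(1)[OF x] \<eta>(1)[OF x]] \<eta>(2)[OF x] \<eta>'(2)[OF x] e(3)[OF FO[OF x]] FId[OF gx] in "simp add: FG_def")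
  qed
  then show "\<eta> x \<in> Iso C x (FO G (FO F x))" by (auto simp: Iso_def G_def)
 next
  fix x y f assume x: "x \<in> Obj C" and y: "y \<in> Obj C" and f: "f \<in> Hom C x y"
  note gx = g(1)[OF FO[OF x]] and gy = g(1)[OF FO[OF y]] and Ff = FM[OF x y f]
  have "Cmp C x y (g (FO F y)) (\<eta> y) f = Cmp C x (g (FO F x)) (g (FO F y)) (FM G (FO F x) (FO F y) (FM F x y f)) (\<eta> x)"
  proof (rule inj[OF x gy])
   show "Cmp C x y (g (FO F y)) (\<eta> y) f \<in> Hom C x (g (FO F y))"
    by (rule C(2)[OF x y gy f \<eta>(1)[OF y]])
   show "Cmp C x (g (FO F x)) (g (FO F y)) (FM G (FO F x) (FO F y) (FM F x y f)) (\<eta> x) \<in> Hom C x (g (FO F y))"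
    by (rule C(2)[OF x gx gy \<eta>(1)[OF x] GM(1)[OF FO[OF x] FO[OF y] Ff]])
   show "FM F x (g (FO F y)) (Cmp C x y (g (FO F y)) (\<eta> y) f) =
     FM F x (g (FO F y)) (Cmp C x (g (FO F x)) (g (FO F y)) (FM G (FO F x) (FO F y) (FM F x y f)) (\<eta> x))"
    using FC[OF x y gy f \<eta>(1)[OF y]] FC[OF x gx gy \<eta>(1)[OF x] GM(1)[OF FO[OF x] FO[OF y] Ff]]
     \<eta>(2)[OF x] \<eta>(2)[OF y] GM(2)[OF FO[OF x] FO[OF y] Ff] conj_e'[OF FO[OF x] FO[OF y] Ff]
    by (simp add: FG_def)
  qed
  then show "Cmp C x y (FO G (FO F y)) (\<eta> y) f =
    Cmp C x (FO G (FO F x)) (FO G (FO F y)) (FM G (FO F x) (FO F y) (FM F x y f)) (\<eta> x)" by (simp add: G_def)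
 qed
 moreover have "natural_iso D D (comp_func F G) id_func e"
  unfolding natural_iso_def id_func_def comp_func_def
 proof (intro conjI ballI, simp_all)
  fix d assume d: "d \<in> Obj D"
  then have "inverse_arrows D (FO F (FO G d)) d (e d) (e' d)"
   using e[OF d] by (simp add: inverse_arrows_def G_def FG_def)
  then show "e d \<in> Iso D (FO F (FO G d)) d" by (auto simp: Iso_def)
 next
  fix d d' k assume "d \<in> Obj D" "d' \<in> Obj D" "k \<in> Hom D d d'"
  then show "Cmp D (FO F (FO G d)) (FO F (FO G d')) d' (e d') (FM F (FO G d) (FO G d') (FM G d d' k)) =
    Cmp D (FO F (FO G d)) d d' k (e d)"
   using conj_e[of d d' k] GM(2)[of d d' k] by (simp add: G_def FG_def)
 qed
 ultimately show ?thesis unfolding is_equivalence_def using F G by blast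
qed

section \<open>The category of diffeological spaces\<close>

lemma Obj_Dfg: "X \<in> Obj Dfg \<longleftrightarrow> diffeological_space X \<and> small (pts X)"
 by (simp add: Dfg_def)

lemma Hom_Dfg: "Hom Dfg X Y = dfl_hom X Y"
 by (simp add: Dfg_def)

lemma Cmp_Dfg: "Cmp Dfg X Y Z g f = compose (pts X) g f"
 by (simp add: Dfg_def)

lemma Id_Dfg: "Id Dfg X = (\<lambda>x\<in>pts X. x)"
 by (simp add: Dfg_def)

lemma Dfg_diffeological: "X \<in> Obj Dfg ==> diffeological_space X"
 by (simp add: Obj_Dfg)

lemma dfl_homI:
 assumes "diffeological_space X" "f \<in> pts X \<rightarrow>\<^sub>E pts Y"
  "\<And>c \<phi>. c \<in> Obj Cart ==> \<phi> \<in> plots X c ==> (\<lambda>y\<in>c. f (\<phi> y)) \<in> plots Y c"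
 shows "f \<in> dfl_hom X Y"
 using assms by (auto simp: dfl_hom_def compose_def)

lemma dfl_hom_PiE: "f \<in> dfl_hom X Y ==> f \<in> pts X \<rightarrow>\<^sub>E pts Y"
 by (simp add: dfl_hom_def)

lemma dfl_hom_pts: "f \<in> dfl_hom X Y ==> x \<in> pts X ==> f x \<in> pts Y"
 by (auto simp: dfl_hom_def)

lemma dfl_hom_plots:
 "diffeological_space X ==> f \<in> dfl_hom X Y ==> \<phi> \<in> plots X c ==> (\<lambda>y\<in>c. f (\<phi> y)) \<in> plots Y c"
 using dfl_plots_Cart[of X \<phi> c] by (auto simp: dfl_hom_def compose_def)

lemma dfl_hom_compose:
 assumes X: "diffeological_space X" and f: "f \<in> dfl_hom X Y" and Y: "diffeological_space Y" and g: "g \<in> dfl_hom Y Z"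
 shows "compose (pts X) g f \<in> dfl_hom X Z"
proof (rule dfl_homI[OF X])
 show "compose (pts X) g f \<in> pts X \<rightarrow>\<^sub>E pts Z"
  using dfl_hom_pts[OF f] dfl_hom_pts[OF g] by (auto simp: compose_def)
 fix c \<phi> assume "\<phi> \<in> plots X c"
 then have "(\<lambda>y\<in>c. g ((\<lambda>y\<in>c. f (\<phi> y)) y)) \<in> plots Z c" by (intro dfl_hom_plots[OF Y g] dfl_hom_plots[OF X f])
 moreover have "(\<lambda>y\<in>c. g ((\<lambda>y\<in>c. f (\<phi> y)) y)) = (\<lambda>y\<in>c. compose (pts X) g f (\<phi> y))"
  using dfl_plots_pts[OF X \<open>\<phi> \<in> plots X c\<close>] by (auto simp: compose_def fun_eq_iff)
 ultimately show "(\<lambda>y\<in>c. compose (pts X) g f (\<phi> y)) \<in> plots Z c" by simp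
qed

lemma dfl_hom_id: "diffeological_space X ==> (\<lambda>x\<in>pts X. x) \<in> dfl_hom X X"
proof (rule dfl_homI)
 fix c \<phi> assume X: "diffeological_space X" and \<phi>: "\<phi> \<in> plots X c"
 have "(\<lambda>y\<in>c. (\<lambda>x\<in>pts X. x) (\<phi> y)) = \<phi>"
  using dfl_plots_PiE[OF X \<phi>] by (auto simp: fun_eq_iff PiE_def extensional_def)
 then show "(\<lambda>y\<in>c. (\<lambda>x\<in>pts X. x) (\<phi> y)) \<in> plots X c" using \<phi> by simp
qed auto

lemma is_category_Dfg: "is_category Dfg"
 unfolding is_category_def
proof (intro conjI ballI)
 fix X :: "'a dfl" assume X: "X \<in> Obj Dfg"
 show "Id Dfg X \<in> Hom Dfg X X"
  using dfl_hom_id[OF Dfg_diffeological[OF X]] by (simp add: Id_Dfg Hom_Dfg)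
 fix Y f assume "Y \<in> Obj Dfg" and f: "f \<in> Hom Dfg X Y"
 then show "Cmp Dfg X X Y f (Id Dfg X) = f" "Cmp Dfg X Y Y (Id Dfg Y) f = f"
  using dfl_hom_PiE[of f X Y] by (auto simp: Cmp_Dfg Id_Dfg Hom_Dfg compose_def fun_eq_iff PiE_def extensional_def)
next
 fix X Y Z :: "'a dfl" and f g
 assume "X \<in> Obj Dfg" "Y \<in> Obj Dfg" "Z \<in> Obj Dfg" "f \<in> Hom Dfg X Y" "g \<in> Hom Dfg Y Z"
 then show "Cmp Dfg X Y Z g f \<in> Hom Dfg X Z"
  by (simp add: Cmp_Dfg Hom_Dfg Dfg_diffeological dfl_hom_compose)
next
 fix W X Y Z :: "'a dfl" and f g h
 assume "f \<in> Hom Dfg W X"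
 then show "Cmp Dfg W X Z (Cmp Dfg X Y Z h g) f = Cmp Dfg W Y Z h (Cmp Dfg W X Y g f)"
  using dfl_hom_pts[of f W X] by (auto simp: Cmp_Dfg Hom_Dfg compose_def fun_eq_iff)
qed

section \<open>Fibre products\<close>

lemma ufst_upair [simp]: "ufst (upair a b) = a"
 unfolding ufst_def by (rule the_equality) (auto simp: upair_inject)

lemma usnd_upair [simp]: "usnd (upair a b) = b"
 unfolding usnd_def by (rule the_equality) (auto simp: upair_inject)

text \<open>Sets of pairs are iterated small unions, hence small.\<close>

lemma small_pairs:
 assumes "small (A :: 'u::universe set)" "small B" "Z \<subseteq> {upair a b |a b. a \<in> A \<and> b \<in> B}"
 shows "small Z"
proof -
 have "small (\<Union>a\<in>A. upair a ` B)" by (intro small_UN small_image assms)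
 moreover have "Z \<subseteq> (\<Union>a\<in>A. upair a ` B)"
 proof
  fix z assume "z \<in> Z"
  then obtain a b where "z = upair a b" "a \<in> A" "b \<in> B" using assms(3) by blast
  then show "z \<in> (\<Union>a\<in>A. upair a ` B)" by blast
 qed
 ultimately show ?thesis by (rule small_subset)
qed

lemma upair_in_fibre_prod [simp]:
 "upair a b \<in> pts (fibre_prod upair A B f g) \<longleftrightarrow> a \<in> pts A \<and> b \<in> pts B \<and> f a = g b"
 by (auto simp: fibre_prod_def upair_inject)

lemma fibre_prod_cases:
 assumes "z \<in> pts (fibre_prod upair A B f g)"
 obtains a b where "z = upair a b" "a \<in> pts A" "b \<in> pts B" "f a = g b"
 using assms by (auto simp: fibre_prod_def)

lemma plots_fibre_prod:
 "q \<in> plots (fibre_prod p A B f g) c \<longleftrightarrow> (\<exists>\<alpha> b. q = (\<lambda>y\<in>c. p (\<alpha> y) (b y)) \<and>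
  \<alpha> \<in> plots A c \<and> b \<in> plots B c \<and> (\<forall>y\<in>c. f (\<alpha> y) = g (b y)))"
 by (auto simp: fibre_prod_def)

text \<open>The definition of the plots of a fibre product quantifies over pairs of plots; the pairing being
injective, these are the components.\<close>

lemma fibre_prod_plots:
 assumes A: "diffeological_space A" and B: "diffeological_space B"
 shows "q \<in> plots (fibre_prod upair A B f g) c \<longleftrightarrow> q \<in> c \<rightarrow>\<^sub>E pts (fibre_prod upair A B f g) \<and>
  (\<lambda>y\<in>c. ufst (q y)) \<in> plots A c \<and> (\<lambda>y\<in>c. usnd (q y)) \<in> plots B c"
proof
 assume "q \<in> plots (fibre_prod upair A B f g) c"
 then obtain \<alpha> b where q: "q = (\<lambda>y\<in>c. upair (\<alpha> y) (b y))" "\<alpha> \<in> plots A c" "b \<in> plots B c" "\<forall>y\<in>c. f (\<alpha> y) = g (b y)"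
  by (auto simp: fibre_prod_def)
 then have "(\<lambda>y\<in>c. ufst (q y)) = \<alpha>" "(\<lambda>y\<in>c. usnd (q y)) = b"
  using dfl_plots_PiE[OF A, of \<alpha> c] dfl_plots_PiE[OF B, of b c] by (auto simp: fun_eq_iff PiE_def extensional_def)
 then show "q \<in> c \<rightarrow>\<^sub>E pts (fibre_prod upair A B f g) \<and> (\<lambda>y\<in>c. ufst (q y)) \<in> plots A c \<and> (\<lambda>y\<in>c. usnd (q y)) \<in> plots B c"
  using q dfl_plots_pts[OF A q(2)] dfl_plots_pts[OF B q(3)] by auto
next
 assume a: "q \<in> c \<rightarrow>\<^sub>E pts (fibre_prod upair A B f g) \<and> (\<lambda>y\<in>c. ufst (q y)) \<in> plots A c \<and> (\<lambda>y\<in>c. usnd (q y)) \<in> plots B c"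
 have z: "upair (ufst (q y)) (usnd (q y)) = q y \<and> f (ufst (q y)) = g (usnd (q y))" if "y \<in> c" for y
 proof -
  have "q y \<in> pts (fibre_prod upair A B f g)" using a that by (meson PiE_mem)
  then show ?thesis by (rule fibre_prod_cases) simp
 qed
 then have eq: "q = (\<lambda>y\<in>c. upair ((\<lambda>y\<in>c. ufst (q y)) y) ((\<lambda>y\<in>c. usnd (q y)) y))"
  using a by (auto simp: fun_eq_iff PiE_def extensional_def)
 show "q \<in> plots (fibre_prod upair A B f g) c"
  unfolding plots_fibre_prod
  by (rule exI[of _ "\<lambda>y\<in>c. ufst (q y)"], rule exI[of _ "\<lambda>y\<in>c. usnd (q y)"], intro conjI, rule eq)
   (use a z in simp_all)
qed

lemma fibre_prod_pair_plot:
 assumes "diffeological_space A" "diffeological_space B" "\<And>y. y \<in> c ==> f (\<alpha> y) = g (b y)"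
  "(\<lambda>y\<in>c. \<alpha> y) \<in> plots A c" "(\<lambda>y\<in>c. b y) \<in> plots B c"
 shows "(\<lambda>y\<in>c. upair (\<alpha> y) (b y)) \<in> plots (fibre_prod upair A B f g) c"
proof -
 have "(\<lambda>y\<in>c. ufst ((\<lambda>y\<in>c. upair (\<alpha> y) (b y)) y)) = (\<lambda>y\<in>c. \<alpha> y)"
  "(\<lambda>y\<in>c. usnd ((\<lambda>y\<in>c. upair (\<alpha> y) (b y)) y)) = (\<lambda>y\<in>c. b y)" by (auto simp: fun_eq_iff)
 then show ?thesis
  using assms(3-5) dfl_plots_pts[OF assms(1,4)] dfl_plots_pts[OF assms(2,5)]
  by (auto simp: fibre_prod_plots[OF assms(1,2)])
qed

lemma fibre_prod_diffeological:
 assumes A: "diffeological_space A" and B: "diffeological_space B"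
 shows "diffeological_space (fibre_prod upair A B f g)"
 unfolding diffeological_space_def
proof (intro conjI allI ballI impI)
 let ?P = "fibre_prod upair A B f g"
 note P = fibre_prod_plots[OF A B]
 show "plots ?P c = {}" if "c \<notin> Obj Cart" for c
  using that diffeological_spaceD(1)[OF A] by (auto simp: P)
 show "plots ?P c \<subseteq> c \<rightarrow>\<^sub>E pts ?P" for c using P by blast
 show "plots ?P (RN 0) = RN 0 \<rightarrow>\<^sub>E pts ?P"
 proof (intro equalityI subsetI)
  fix q assume q: "q \<in> RN 0 \<rightarrow>\<^sub>E pts ?P"
  have "ufst (q y) \<in> pts A \<and> usnd (q y) \<in> pts B" if "y \<in> RN 0" for y
  proof -
   have "q y \<in> pts ?P" using q that by (rule PiE_mem)
   then show ?thesis by (rule fibre_prod_cases) simp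
  qed
  then show "q \<in> plots ?P (RN 0)"
   using q by (simp add: P diffeological_spaceD(3)[OF A] diffeological_spaceD(3)[OF B])
 qed (use P in blast)
 show "compose c' q h \<in> plots ?P c'" if "c' \<in> Obj Cart" "h \<in> Hom Cart c' c" "q \<in> plots ?P c" for c c' h q
 proof -
  have h: "smooth_map c' c h" using that(2) by (simp add: Hom_Cart_iff)
  have "(\<lambda>y\<in>c'. (\<lambda>y\<in>c. ufst (q y)) (h y)) \<in> plots A c'" "(\<lambda>y\<in>c'. (\<lambda>y\<in>c. usnd (q y)) (h y)) \<in> plots B c'"
   by (rule dfl_plots_compose[OF A _ that(1) h] dfl_plots_compose[OF B _ that(1) h], use that(3) P in blast)+
  moreover have "(\<lambda>y\<in>c'. (\<lambda>y\<in>c. ufst (q y)) (h y)) = (\<lambda>y\<in>c'. ufst (compose c' q h y))"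
   "(\<lambda>y\<in>c'. (\<lambda>y\<in>c. usnd (q y)) (h y)) = (\<lambda>y\<in>c'. usnd (compose c' q h y))"
   using smooth_map_image[OF h] by (auto simp: fun_eq_iff compose_def)
  moreover have "compose c' q h \<in> c' \<rightarrow>\<^sub>E pts ?P"
  proof -
   have "q \<in> c \<rightarrow>\<^sub>E pts ?P" using that(3) P by blast
   from PiE_mem[OF this smooth_map_image[OF h]] show ?thesis by (auto simp: compose_def)
  qed
  ultimately show ?thesis by (simp add: P)
 qed
 fix c K q assume q: "q \<in> c \<rightarrow>\<^sub>E pts ?P" and K: "dgop_covering c K \<and> (\<forall>(c', h)\<in>K. compose c' q h \<in> plots ?P c')"
 have pt: "ufst (q y) \<in> pts A \<and> usnd (q y) \<in> pts B" if "y \<in> c" for y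
 proof -
  have "q y \<in> pts ?P" using q that by (rule PiE_mem)
  then show ?thesis by (rule fibre_prod_cases) simp
 qed
 have loc: "compose c' (\<lambda>y\<in>c. ufst (q y)) h \<in> plots A c' \<and> compose c' (\<lambda>y\<in>c. usnd (q y)) h \<in> plots B c'"
  if "(c', h) \<in> K" for c' h
 proof -
  have "smooth_map c' c h" using dgop_coveringD(3)[of c K c' h] K that by (simp add: open_embedding_def Hom_Cart_iff)
  then have eqs: "compose c' (\<lambda>y\<in>c. ufst (q y)) h = (\<lambda>y\<in>c'. ufst (compose c' q h y))"
   "compose c' (\<lambda>y\<in>c. usnd (q y)) h = (\<lambda>y\<in>c'. usnd (compose c' q h y))"
   using smooth_map_image[of c' c h] by (auto simp: fun_eq_iff compose_def)
  have "compose c' q h \<in> plots ?P c'" using K that by blast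
  then show ?thesis unfolding eqs by (simp add: P)
 qed
 have "(\<lambda>y\<in>c. ufst (q y)) \<in> plots A c" "(\<lambda>y\<in>c. usnd (q y)) \<in> plots B c"
  by (rule dfl_plots_sheaf[OF A, of _ c K] dfl_plots_sheaf[OF B, of _ c K]; use K pt loc in auto)+
 then show "q \<in> plots ?P c" using q by (simp add: P)
qed

lemma fibre_prod_Dfg:
 assumes "A \<in> Obj Dfg" "B \<in> Obj Dfg"
 shows "fibre_prod upair A B f g \<in> Obj Dfg"
proof -
 have "small (pts (fibre_prod upair A B f g))"
  by (rule small_pairs[of "pts A" "pts B"]) (use assms in "auto simp: Obj_Dfg fibre_prod_def")
 then show ?thesis using assms fibre_prod_diffeological by (auto simp: Obj_Dfg)
qed

lemma fibre_prod_proj: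
 assumes A: "diffeological_space A" and B: "diffeological_space B"
 shows "(\<lambda>z\<in>pts (fibre_prod upair A B f g). ufst z) \<in> dfl_hom (fibre_prod upair A B f g) A"
  "(\<lambda>z\<in>pts (fibre_prod upair A B f g). usnd z) \<in> dfl_hom (fibre_prod upair A B f g) B"
proof -
 note d = fibre_prod_diffeological[OF A B, of f g]
 show "(\<lambda>z\<in>pts (fibre_prod upair A B f g). ufst z) \<in> dfl_hom (fibre_prod upair A B f g) A"
  by (rule dfl_homI[OF d]) (auto simp: dfl_plots_pts[OF d] fibre_prod_plots[OF A B, THEN iffD1] elim: fibre_prod_cases cong: restrict_cong)
 show "(\<lambda>z\<in>pts (fibre_prod upair A B f g). usnd z) \<in> dfl_hom (fibre_prod upair A B f g) B"
  by (rule dfl_homI[OF d]) (auto simp: dfl_plots_pts[OF d] fibre_prod_plots[OF A B, THEN iffD1] elim: fibre_prod_cases cong: restrict_cong)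
qed

lemma fibre_prod_pairing:
 assumes C: "diffeological_space C" and A: "diffeological_space A" and B: "diffeological_space B"
  and u: "u \<in> dfl_hom C A" and v: "v \<in> dfl_hom C B" and eq: "\<And>z. z \<in> pts C ==> f (u z) = g (v z)"
 shows "(\<lambda>z\<in>pts C. upair (u z) (v z)) \<in> dfl_hom C (fibre_prod upair A B f g)"
proof (rule dfl_homI[OF C])
 fix c \<phi> assume \<phi>: "\<phi> \<in> plots C c"
 have "(\<lambda>y\<in>c. upair (u (\<phi> y)) (v (\<phi> y))) \<in> plots (fibre_prod upair A B f g) c"
  by (rule fibre_prod_pair_plot[OF A B _ dfl_hom_plots[OF C u \<phi>] dfl_hom_plots[OF C v \<phi>]]) (rule eq[OF dfl_plots_pts[OF C \<phi>]])
 then show "(\<lambda>y\<in>c. (\<lambda>z\<in>pts C. upair (u z) (v z)) (\<phi> y)) \<in> plots (fibre_prod upair A B f g) c"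
  using dfl_plots_pts[OF C \<phi>] by (simp cong: restrict_cong)
qed (use dfl_hom_pts[OF u] dfl_hom_pts[OF v] eq in auto)

section \<open>Vector bundles\<close>

lemma prod_pts: "pts (dfl_prod (cart_space c) (complex_space k)) = c \<times> carrier_vec k"
 by (auto simp: dfl_prod_def fibre_prod_def cart_space_def complex_space_def)

lemma prod_plots:
 assumes "c' \<in> Obj Cart"
 shows "q \<in> plots (dfl_prod (cart_space c) (complex_space k)) c' \<longleftrightarrow>
  q \<in> extensional c' \<and> smooth_map c' c (\<lambda>y. fst (q y)) \<and> smooth_vec c' k (\<lambda>y. snd (q y))"
proof
 assume "q \<in> plots (dfl_prod (cart_space c) (complex_space k)) c'"
 then obtain \<alpha> b where g: "q = (\<lambda>y\<in>c'. (\<alpha> y, b y))" "smooth_map c' c \<alpha>" "smooth_vec c' k b"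
  using assms by (auto simp: dfl_prod_def fibre_prod_def cart_space_def complex_space_def Hom_Cart_iff smooth_vec_def)
 show "q \<in> extensional c' \<and> smooth_map c' c (\<lambda>y. fst (q y)) \<and> smooth_vec c' k (\<lambda>y. snd (q y))"
  by (intro conjI smooth_map_cong[OF _ g(2)] smooth_vec_cong[OF _ g(3)]) (auto simp: g(1))
next
 assume g: "q \<in> extensional c' \<and> smooth_map c' c (\<lambda>y. fst (q y)) \<and> smooth_vec c' k (\<lambda>y. snd (q y))"
 have 1: "q = (\<lambda>y\<in>c'. ((\<lambda>y\<in>c'. fst (q y)) y, (\<lambda>y\<in>c'. snd (q y)) y))"
  using g by (auto simp: fun_eq_iff extensional_def)
 have 2: "(\<lambda>y\<in>c'. fst (q y)) \<in> plots (cart_space c) c'"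
  using assms g by (auto simp: cart_space_def Hom_Cart_iff intro: smooth_map_cong)
 have 3: "(\<lambda>y\<in>c'. snd (q y)) \<in> plots (complex_space k) c'"
  using assms g by (auto simp: complex_space_def smooth_vec_def intro: smooth_cfun_cong[rotated])
 show "q \<in> plots (dfl_prod (cart_space c) (complex_space k)) c'"
  unfolding dfl_prod_def plots_fibre_prod using 1 2 3 by blast
qed

lemma pull_pts: "pts (fibre_prod Pair (cart_space c) A \<phi> p) = {(y, e). y \<in> c \<and> e \<in> pts A \<and> \<phi> y = p e}"
 by (auto simp: fibre_prod_def cart_space_def)

lemma pull_plots:
 assumes "c' \<in> Obj Cart" and A: "diffeological_space A"
 shows "q \<in> plots (fibre_prod Pair (cart_space c) A \<phi> p) c' \<longleftrightarrow>
  q \<in> extensional c' \<and> smooth_map c' c (\<lambda>y. fst (q y)) \<and> (\<lambda>y\<in>c'. snd (q y)) \<in> plots A c' \<and>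
  (\<forall>y\<in>c'. \<phi> (fst (q y)) = p (snd (q y)))"
proof
 assume "q \<in> plots (fibre_prod Pair (cart_space c) A \<phi> p) c'"
 then obtain \<alpha> b where g: "q = (\<lambda>y\<in>c'. (\<alpha> y, b y))" "smooth_map c' c \<alpha>" "b \<in> plots A c'" "\<forall>y\<in>c'. \<phi> (\<alpha> y) = p (b y)"
  using assms(1) by (auto simp: fibre_prod_def cart_space_def Hom_Cart_iff)
 have "(\<lambda>y\<in>c'. snd (q y)) = b"
  using dfl_plots_PiE[OF A g(3)] by (auto simp: g(1) fun_eq_iff PiE_def extensional_def)
 then show "q \<in> extensional c' \<and> smooth_map c' c (\<lambda>y. fst (q y)) \<and> (\<lambda>y\<in>c'. snd (q y)) \<in> plots A c' \<and>
  (\<forall>y\<in>c'. \<phi> (fst (q y)) = p (snd (q y)))"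
  using g by (intro conjI smooth_map_cong[OF _ g(2)]) (auto simp: g(1))
next
 assume g: "q \<in> extensional c' \<and> smooth_map c' c (\<lambda>y. fst (q y)) \<and> (\<lambda>y\<in>c'. snd (q y)) \<in> plots A c' \<and>
  (\<forall>y\<in>c'. \<phi> (fst (q y)) = p (snd (q y)))"
 have 1: "q = (\<lambda>y\<in>c'. ((\<lambda>y\<in>c'. fst (q y)) y, (\<lambda>y\<in>c'. snd (q y)) y))"
  using g by (auto simp: fun_eq_iff extensional_def)
 have 2: "(\<lambda>y\<in>c'. fst (q y)) \<in> plots (cart_space c) c'"
  using assms g by (auto simp: cart_space_def Hom_Cart_iff intro: smooth_map_cong)
 have 3: "\<forall>y\<in>c'. \<phi> ((\<lambda>y\<in>c'. fst (q y)) y) = p ((\<lambda>y\<in>c'. snd (q y)) y)" using g by simp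
 show "q \<in> plots (fibre_prod Pair (cart_space c) A \<phi> p) c'"
  unfolding plots_fibre_prod using 1 2 3 g by blast
qed

text \<open>The inverse of \<open>\<Phi>\<close> is smooth, which is the direction from plots of \<open>E\<close> to smooth coordinate vectors.\<close>

lemma trivialises_of_iso:
 assumes E: "diffeological_space (tot E)" and c: "c \<in> Obj Cart"
  and \<Phi>: "\<Phi> \<in> dfl_iso (dfl_prod (cart_space c) (complex_space k)) (fibre_prod Pair (cart_space c) (tot E) \<phi> (prj E))"
  and fst_\<Phi>: "\<And>y v. y \<in> c ==> v \<in> carrier_vec k ==> fst (\<Phi> (y, v)) = y"
  and lin: "\<And>y. y \<in> c ==> (\<lambda>v. snd (\<Phi> (y, v))) \<in> linear_maps (cvec k) (fibre E (\<phi> y))"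
 shows "trivialises E c \<phi> k (\<lambda>y v. snd (\<Phi> (y, v)))"
proof -
 let ?D = "dfl_prod (cart_space c) (complex_space k)" and ?P = "fibre_prod Pair (cart_space c) (tot E) \<phi> (prj E)"
 define s where "s y v = snd (\<Phi> (y, v))" for y v
 obtain \<Psi> where \<Phi>': "\<Phi> \<in> dfl_hom ?D ?P" and \<Psi>: "\<Psi> \<in> dfl_hom ?P ?D"
  "\<forall>x\<in>pts ?D. \<Psi> (\<Phi> x) = x" "\<forall>x\<in>pts ?P. \<Phi> (\<Psi> x) = x"
  using \<Phi> by (auto simp: dfl_iso_def)
 have \<Phi>s: "\<Phi> (y, v) = (y, s y v)" if "y \<in> c" "v \<in> carrier_vec k" for y v
  using fst_\<Phi>[OF that] by (simp add: s_def prod_eq_iff)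
 have s_fib: "s y v \<in> carrier (fibre E (\<phi> y))" if "y \<in> c" "v \<in> carrier_vec k" for y v
  using lin[OF that(1)] that(2) by (auto simp: s_def linear_maps_iff)
 have "trivialises E c \<phi> k s"
  unfolding trivialises_def
 proof (intro conjI ballI allI impI)
  fix y assume y: "y \<in> c"
  show "s y \<in> linear_maps (cvec k) (fibre E (\<phi> y))" using lin[OF y] by (simp add: s_def[abs_def])
  show "bij_betw (s y) (carrier_vec k) (carrier (fibre E (\<phi> y)))"
  proof (rule bij_betw_imageI)
   show "inj_on (s y) (carrier_vec k)"
   proof (rule inj_onI)
    fix v w assume v: "v \<in> carrier_vec k" and w: "w \<in> carrier_vec k" and "s y v = s y w"
    then have "\<Phi> (y, v) = \<Phi> (y, w)" using \<Phi>s[OF y v] \<Phi>s[OF y w] by simp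
    then have "\<Psi> (\<Phi> (y, v)) = \<Psi> (\<Phi> (y, w))" by simp
    then show "v = w" using \<Psi>(2) y v w by (simp add: prod_pts)
   qed
   show "s y ` carrier_vec k = carrier (fibre E (\<phi> y))"
   proof (intro equalityI subsetI)
    fix e assume e: "e \<in> carrier (fibre E (\<phi> y))"
    then have ye: "(y, e) \<in> pts ?P" using y by (auto simp: pull_pts fibre_in_pts)
    then have "\<Psi> (y, e) \<in> pts ?D" using dfl_hom_pts[OF \<Psi>(1)] by blast
    then obtain z v where zv: "\<Psi> (y, e) = (z, v)" "z \<in> c" "v \<in> carrier_vec k" by (auto simp: prod_pts)
    then have "\<Phi> (z, v) = (y, e)" using \<Psi>(3) ye by force
    then have "z = y" "s y v = e" using \<Phi>s[OF zv(2,3)] by auto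
    then show "e \<in> s y ` carrier_vec k" using zv(3) by blast
   qed (use s_fib[OF y] in auto)
  qed
 next
  fix c' f and v :: "rinf => complex Matrix.vec"
  assume c': "c' \<in> Obj Cart" and f: "smooth_map c' c f" and v: "\<forall>y\<in>c'. v y \<in> carrier_vec k"
  note fi = smooth_map_image[OF f]
  let ?g = "\<lambda>y\<in>c'. (f y, v y)" and ?\<delta> = "\<lambda>y\<in>c'. (f y, s (f y) (v y))"
  have e1: "?g \<in> plots ?D c' \<longleftrightarrow> smooth_vec c' k v"
   using f smooth_map_cong[of c' f "\<lambda>y. fst (?g y)" c] smooth_vec_cong[of c' v "\<lambda>y. snd (?g y)" k]
    smooth_vec_cong[of c' "\<lambda>y. snd (?g y)" v k]
   by (auto simp: prod_plots[OF c'])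
  have e2: "?\<delta> \<in> plots ?P c' \<longleftrightarrow> (\<lambda>y\<in>c'. s (f y) (v y)) \<in> plots (tot E) c'"
  proof -
   have "(\<lambda>y\<in>c'. snd (?\<delta> y)) = (\<lambda>y\<in>c'. s (f y) (v y))" by (auto simp: fun_eq_iff)
   moreover have "smooth_map c' c (\<lambda>y. fst (?\<delta> y))" by (rule smooth_map_cong[OF _ f]) simp
   moreover have "\<phi> (f y) = prj E (s (f y) (v y))" if "y \<in> c'" for y
    using s_fib[OF fi[OF that]] v that by (simp add: fibre_in_pts)
   ultimately show ?thesis by (simp add: pull_plots[OF c' E])
  qed
  have c1: "compose c' \<Phi> ?g = ?\<delta>" using v fi \<Phi>s by (auto simp: compose_def fun_eq_iff)
  have c2: "compose c' \<Psi> ?\<delta> = ?g"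
  proof -
   have "\<Psi> (f y, s (f y) (v y)) = (f y, v y)" if "y \<in> c'" for y
    using \<Psi>(2) \<Phi>s[OF fi[OF that]] v that fi[OF that] by (metis mem_Sigma_iff prod_pts)
   then show ?thesis by (auto simp: compose_def fun_eq_iff)
  qed
  have i: "?g \<in> plots ?D c' ==> compose c' \<Phi> ?g \<in> plots ?P c'" "?\<delta> \<in> plots ?P c' ==> compose c' \<Psi> ?\<delta> \<in> plots ?D c'"
   using \<Phi>' \<Psi>(1) c' unfolding dfl_hom_def by blast+
  show "(\<lambda>y\<in>c'. s (f y) (v y)) \<in> plots (tot E) c' \<longleftrightarrow> smooth_vec c' k v"
   using i[unfolded c1 c2] e1 e2 by blast
 qed
 then show ?thesis by (simp add: s_def[abs_def])
qed

lemma iso_of_trivialises: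
 assumes E: "diffeological_space (tot E)" and c: "c \<in> Obj Cart" and s: "trivialises E c \<phi> k s"
 shows "\<exists>\<Phi>\<in>dfl_iso (dfl_prod (cart_space c) (complex_space k)) (fibre_prod Pair (cart_space c) (tot E) \<phi> (prj E)).
  (\<forall>y\<in>c. \<forall>v\<in>carrier_vec k. fst (\<Phi> (y, v)) = y) \<and>
  (\<forall>y\<in>c. (\<lambda>v. snd (\<Phi> (y, v))) \<in> linear_maps (cvec k) (fibre E (\<phi> y)))"
proof -
 let ?D = "dfl_prod (cart_space c) (complex_space k)" and ?P = "fibre_prod Pair (cart_space c) (tot E) \<phi> (prj E)"
 define \<Phi> where "\<Phi> = (\<lambda>p\<in>c \<times> carrier_vec k. (fst p, s (fst p) (snd p)))"
 define t where "t y = inv_into (carrier_vec k) (s y)" for y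
 have t: "t y e \<in> carrier_vec k \<and> s y (t y e) = e" if "y \<in> c" "e \<in> carrier (fibre E (\<phi> y))" for y e
  using trivialisesD(2)[OF s that(1)] that(2) unfolding t_def
  by (metis bij_betw_imp_surj_on f_inv_into_f inv_into_into)
 have ts: "t y (s y v) = v" if "y \<in> c" "v \<in> carrier_vec k" for y v
  using trivialisesD(2)[OF s that(1)] that(2) by (simp add: t_def bij_betw_imp_inj_on)
 define \<Psi> where "\<Psi> = (\<lambda>p\<in>pts ?P. (fst p, t (fst p) (snd p)))"
 note fib = trivialises_fibre[OF s]
 have "\<Phi> \<in> dfl_hom ?D ?P"
  unfolding dfl_hom_def
 proof (intro CollectI conjI ballI)
  show "\<Phi> \<in> pts ?D \<rightarrow>\<^sub>E pts ?P" using fib by (auto simp: prod_pts pull_pts \<Phi>_def fibre_in_pts)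
  fix c' q assume c': "c' \<in> Obj Cart" and q: "q \<in> plots ?D c'"
  then have g: "smooth_map c' c (\<lambda>y. fst (q y))" "smooth_vec c' k (\<lambda>y. snd (q y))" by (auto simp: prod_plots)
  have gc: "fst (q y) \<in> c \<and> snd (q y) \<in> carrier_vec k" if "y \<in> c'" for y
   using smooth_map_image[OF g(1) that] g(2) that by (simp add: smooth_vec_def)
  have "compose c' \<Phi> q = (\<lambda>y\<in>c'. (fst (q y), s (fst (q y)) (snd (q y))))"
   using gc by (auto simp: compose_def fun_eq_iff \<Phi>_def mem_Times_iff)
  moreover have "(\<lambda>y\<in>c'. snd ((\<lambda>y\<in>c'. (fst (q y), s (fst (q y)) (snd (q y)))) y)) = (\<lambda>y\<in>c'. s (fst (q y)) (snd (q y)))"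
   by (auto simp: fun_eq_iff)
  moreover have "(\<lambda>y\<in>c'. s (fst (q y)) (snd (q y))) \<in> plots (tot E) c'"
   using trivialisesD(3)[OF s c' g(1)] g(2) gc by auto
  moreover have "\<phi> (fst (q y)) = prj E (s (fst (q y)) (snd (q y)))" if "y \<in> c'" for y
   using fib[of "fst (q y)" "snd (q y)"] gc[OF that] by (simp add: fibre_in_pts)
  ultimately show "compose c' \<Phi> q \<in> plots ?P c'"
   using smooth_map_cong[OF _ g(1), of "\<lambda>y. fst ((\<lambda>y\<in>c'. (fst (q y), s (fst (q y)) (snd (q y)))) y)"]
   by (simp add: pull_plots[OF c' E])
 qed
 moreover have "\<Psi> \<in> dfl_hom ?P ?D"
  unfolding dfl_hom_def
 proof (intro CollectI conjI ballI)
  show "\<Psi> \<in> pts ?P \<rightarrow>\<^sub>E pts ?D" using t by (auto simp: prod_pts pull_pts \<Psi>_def fibre_in_pts)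
  fix c' q assume c': "c' \<in> Obj Cart" and q: "q \<in> plots ?P c'"
  then have g: "smooth_map c' c (\<lambda>y. fst (q y))" "(\<lambda>y\<in>c'. snd (q y)) \<in> plots (tot E) c'"
   "\<forall>y\<in>c'. \<phi> (fst (q y)) = prj E (snd (q y))" by (auto simp: pull_plots[OF c' E])
  have gc: "fst (q y) \<in> c" "snd (q y) \<in> carrier (fibre E (\<phi> (fst (q y))))" if "y \<in> c'" for y
   using smooth_map_image[OF g(1) that] g(3) that dfl_plots_pts[OF E g(2) that] by (auto simp: fibre_in_pts)
  have eq: "(\<lambda>y\<in>c'. s (fst (q y)) (t (fst (q y)) (snd (q y)))) = (\<lambda>y\<in>c'. snd (q y))"
   using t gc by (auto simp: fun_eq_iff)
  have "smooth_vec c' k (\<lambda>y. t (fst (q y)) (snd (q y)))"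
   using trivialisesD(3)[OF s c' g(1), of "\<lambda>y. t (fst (q y)) (snd (q y))"] eq g(2) t gc by auto
  moreover have "q y \<in> pts ?P" if "y \<in> c'" for y
   using gc[OF that] by (cases "q y") (auto simp: pull_pts fibre_in_pts)
  then have \<Psi>q: "compose c' \<Psi> q = (\<lambda>y\<in>c'. (fst (q y), t (fst (q y)) (snd (q y))))"
   by (auto simp: compose_def fun_eq_iff \<Psi>_def)
  ultimately show "compose c' \<Psi> q \<in> plots ?D c'"
   unfolding prod_plots[OF c'] \<Psi>q
   by (intro conjI smooth_map_cong[OF _ g(1)]) (auto elim: smooth_vec_cong[rotated])
 qed
 moreover have "\<Psi> (\<Phi> x) = x" if "x \<in> pts ?D" for x
  using that ts fib by (auto simp: prod_pts \<Phi>_def \<Psi>_def pull_pts fibre_in_pts)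
 moreover have "\<Phi> (\<Psi> x) = x" if "x \<in> pts ?P" for x
  using that t by (auto simp: \<Phi>_def \<Psi>_def pull_pts fibre_in_pts)
 ultimately have "\<Phi> \<in> dfl_iso ?D ?P" unfolding dfl_iso_def by blast
 moreover have "(\<lambda>v. snd (\<Phi> (y, v))) \<in> linear_maps (cvec k) (fibre E (\<phi> y))" if "y \<in> c" for y
  by (rule linear_maps_cong[OF _ trivialisesD(1)[OF s that]]) (use that cvec_closed in "auto simp: \<Phi>_def")
 ultimately show ?thesis by (intro bexI[of _ \<Phi>]) (auto simp: \<Phi>_def)
qed

text \<open>The working form of the definition: local isomorphisms with a product are frames.\<close>

lemma vector_bundle_iff:
 "vector_bundle X E \<longleftrightarrow> X \<in> Obj Dfg \<and> tot E \<in> Obj Dfg \<and> prj E \<in> dfl_hom (tot E) X \<and>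
   (\<forall>x\<in>pts X. vectorspace class_ring (fibre E x)) \<and>
   (\<forall>c \<phi>. \<phi> \<in> plots X c --> (\<exists>k s. trivialises E c \<phi> k s))"
proof
 assume vb: "vector_bundle X E"
 then have X: "X \<in> Obj Dfg" and E: "tot E \<in> Obj Dfg" by (auto simp: vector_bundle_def)
 have "\<exists>k s. trivialises E c \<phi> k s" if \<phi>: "\<phi> \<in> plots X c" for c \<phi>
 proof -
  have c: "c \<in> Obj Cart" by (rule dfl_plots_Cart[OF Dfg_diffeological[OF X] \<phi>])
  obtain k \<Phi> where "\<Phi> \<in> dfl_iso (dfl_prod (cart_space c) (complex_space k)) (fibre_prod Pair (cart_space c) (tot E) \<phi> (prj E))"
   "\<forall>y\<in>c. \<forall>v\<in>carrier_vec k. fst (\<Phi> (y, v)) = y"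
   "\<forall>y\<in>c. (\<lambda>v. snd (\<Phi> (y, v))) \<in> linear_maps (cvec k) (fibre E (\<phi> y))"
   using vb \<phi> c unfolding vector_bundle_def by blast
  then show ?thesis using trivialises_of_iso[OF Dfg_diffeological[OF E] c] by blast
 qed
 then show "X \<in> Obj Dfg \<and> tot E \<in> Obj Dfg \<and> prj E \<in> dfl_hom (tot E) X \<and>
   (\<forall>x\<in>pts X. vectorspace class_ring (fibre E x)) \<and> (\<forall>c \<phi>. \<phi> \<in> plots X c --> (\<exists>k s. trivialises E c \<phi> k s))"
  using vb by (auto simp: vector_bundle_def Hom_Dfg)
next
 assume a: "X \<in> Obj Dfg \<and> tot E \<in> Obj Dfg \<and> prj E \<in> dfl_hom (tot E) X \<and>
   (\<forall>x\<in>pts X. vectorspace class_ring (fibre E x)) \<and> (\<forall>c \<phi>. \<phi> \<in> plots X c --> (\<exists>k s. trivialises E c \<phi> k s))"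
 then have E: "diffeological_space (tot E)" by (auto simp: Obj_Dfg)
 show "vector_bundle X E"
  unfolding vector_bundle_def
 proof (intro conjI ballI)
  fix c \<phi> assume c: "c \<in> Obj Cart" and "\<phi> \<in> plots X c"
  then obtain k s where s: "trivialises E c \<phi> k s" using a by blast
  show "\<exists>k. \<exists>\<Phi>\<in>dfl_iso (dfl_prod (cart_space c) (complex_space k)) (fibre_prod Pair (cart_space c) (tot E) \<phi> (prj E)).
   (\<forall>y\<in>c. \<forall>v\<in>carrier_vec k. fst (\<Phi> (y, v)) = y) \<and>
   (\<forall>y\<in>c. (\<lambda>v. snd (\<Phi> (y, v))) \<in> linear_maps (cvec k) (fibre E (\<phi> y)))"
   by (rule exI, rule iso_of_trivialises[OF E c s])
 qed (use a in "auto simp: Hom_Dfg")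
qed

lemma vector_bundleD:
 assumes "vector_bundle X E"
 shows "X \<in> Obj Dfg" "tot E \<in> Obj Dfg" "diffeological_space X" "diffeological_space (tot E)"
  "prj E \<in> dfl_hom (tot E) X" "x \<in> pts X ==> vectorspace class_ring (fibre E x)"
  "\<phi> \<in> plots X c ==> \<exists>k s. trivialises E c \<phi> k s" "e \<in> pts (tot E) ==> prj E e \<in> pts X"
 using assms by (auto simp: vector_bundle_iff Obj_Dfg dfl_hom_pts)

lemma vectorspace_closed:
 assumes "vectorspace class_ring V"
 shows "a \<in> carrier V ==> b \<in> carrier V ==> a \<oplus>\<^bsub>V\<^esub> b \<in> carrier V"
  "a \<in> carrier V ==> r \<odot>\<^bsub>V\<^esub> a \<in> carrier V" "\<zero>\<^bsub>V\<^esub> \<in> carrier V"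
proof -
 interpret vectorspace class_ring V by fact
 show "a \<in> carrier V ==> b \<in> carrier V ==> a \<oplus>\<^bsub>V\<^esub> b \<in> carrier V" "\<zero>\<^bsub>V\<^esub> \<in> carrier V" by simp_all
 show "a \<in> carrier V ==> r \<odot>\<^bsub>V\<^esub> a \<in> carrier V" by (rule smult_closed) (auto simp: class_ring_simps)
qed

lemma bundle_closed:
 assumes E: "vector_bundle X E"
 shows "e \<in> pts (tot E) ==> e' \<in> pts (tot E) ==> prj E e = prj E e' ==>
   vadd E e e' \<in> pts (tot E) \<and> prj E (vadd E e e') = prj E e'"
  "e \<in> pts (tot E) ==> vsmult E r e \<in> pts (tot E) \<and> prj E (vsmult E r e) = prj E e"
proof -
 assume e: "e \<in> pts (tot E)"
 note V = vectorspace_closed[OF vector_bundleD(6)[OF E vector_bundleD(8)[OF E e]]]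
 show "vadd E e e' \<in> pts (tot E) \<and> prj E (vadd E e e') = prj E e'" if "e' \<in> pts (tot E)" "prj E e = prj E e'"
  using V(1)[of e e'] e that by (simp add: fibre_def)
 show "vsmult E r e \<in> pts (tot E) \<and> prj E (vsmult E r e) = prj E e"
  using V(2)[of e r] e by (simp add: fibre_def)
qed

lemma linear_maps_fibre:
 "u \<in> linear_maps (fibre E x) (fibre E' x') \<longleftrightarrow>
  (\<forall>e. e \<in> pts (tot E) \<and> prj E e = x --> u e \<in> pts (tot E') \<and> prj E' (u e) = x') \<and>
  (\<forall>e e'. e \<in> pts (tot E) \<and> prj E e = x \<and> e' \<in> pts (tot E) \<and> prj E e' = x --> u (vadd E e e') = vadd E' (u e) (u e')) \<and>
  (\<forall>r e. e \<in> pts (tot E) \<and> prj E e = x --> u (vsmult E r e) = vsmult E' r (u e))"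
 by (auto simp: linear_maps_iff fibre_def)

lemma bundle_homI:
 assumes "u \<in> dfl_hom (tot E) (tot E')" "\<And>e. e \<in> pts (tot E) ==> prj E' (u e) = prj E e"
  "\<And>e e'. e \<in> pts (tot E) ==> e' \<in> pts (tot E) ==> prj E e = prj E e' ==> u (vadd E e e') = vadd E' (u e) (u e')"
  "\<And>r e. e \<in> pts (tot E) ==> u (vsmult E r e) = vsmult E' r (u e)"
 shows "u \<in> bundle_hom X E E'"
 using assms dfl_hom_pts[OF assms(1)] by (auto simp: bundle_hom_def linear_maps_fibre Hom_Dfg)

lemma bundle_homD:
 assumes "u \<in> bundle_hom X E E'" "vector_bundle X E"
 shows "u \<in> dfl_hom (tot E) (tot E')" "e \<in> pts (tot E) ==> u e \<in> pts (tot E')"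
  "e \<in> pts (tot E) ==> prj E' (u e) = prj E e"
  "e \<in> pts (tot E) ==> e' \<in> pts (tot E) ==> prj E e = prj E e' ==> u (vadd E e e') = vadd E' (u e) (u e')"
  "e \<in> pts (tot E) ==> u (vsmult E r e) = vsmult E' r (u e)"
  "x \<in> pts X ==> u \<in> linear_maps (fibre E x) (fibre E' x)"
proof -
 have h: "u \<in> dfl_hom (tot E) (tot E')" and p: "\<forall>e\<in>pts (tot E). prj E' (u e) = prj E e"
  and l: "\<And>x. x \<in> pts X ==> u \<in> linear_maps (fibre E x) (fibre E' x)"
  using assms(1) by (auto simp: bundle_hom_def Hom_Dfg)
 show "u \<in> dfl_hom (tot E) (tot E')" "e \<in> pts (tot E) ==> u e \<in> pts (tot E')" "e \<in> pts (tot E) ==> prj E' (u e) = prj E e"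
  "x \<in> pts X ==> u \<in> linear_maps (fibre E x) (fibre E' x)"
  using h p l dfl_hom_pts[OF h] by auto
 show "e \<in> pts (tot E) ==> e' \<in> pts (tot E) ==> prj E e = prj E e' ==> u (vadd E e e') = vadd E' (u e) (u e')"
  using l[of "prj E e"] vector_bundleD(8)[OF assms(2), of e] unfolding linear_maps_fibre by simp
 show "e \<in> pts (tot E) ==> u (vsmult E r e) = vsmult E' r (u e)"
  using l[of "prj E e"] vector_bundleD(8)[OF assms(2), of e] unfolding linear_maps_fibre by simp
qed

lemma Obj_VBun: "E \<in> Obj (VBun_cat X) \<longleftrightarrow> vector_bundle X E" by (simp add: VBun_cat_def)
lemma Hom_VBun: "Hom (VBun_cat X) = bundle_hom X" by (simp add: VBun_cat_def)
lemma Id_VBun: "Id (VBun_cat X) E = (\<lambda>e\<in>pts (tot E). e)" by (simp add: VBun_cat_def)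
lemma Cmp_VBun: "Cmp (VBun_cat X) E E' E'' v u = compose (pts (tot E)) v u" by (simp add: VBun_cat_def)

lemma bundle_hom_extensional: "u \<in> bundle_hom X E E' ==> e \<notin> pts (tot E) ==> u e = undefined"
 by (auto simp: bundle_hom_def Hom_Dfg dfl_hom_def PiE_def extensional_def)

lemma bundle_hom_eqI:
 assumes "u \<in> bundle_hom X E E'" "v \<in> bundle_hom X E E''" "\<And>e. e \<in> pts (tot E) ==> u e = v e"
 shows "u = v"
 using assms bundle_hom_extensional by (metis ext)

lemma bundle_hom_compose:
 assumes "vector_bundle X E" "vector_bundle X E'" "u \<in> bundle_hom X E E'" "v \<in> bundle_hom X E' E''"
 shows "compose (pts (tot E)) v u \<in> bundle_hom X E E''"
proof (rule bundle_homI)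
 note u = bundle_homD[OF assms(3,1)] and v = bundle_homD[OF assms(4,2)] and cl = bundle_closed[OF assms(1)]
 show "compose (pts (tot E)) v u \<in> dfl_hom (tot E) (tot E'')"
  using dfl_hom_compose[OF vector_bundleD(4)[OF assms(1)] u(1) vector_bundleD(4)[OF assms(2)] v(1)] .
qed (use bundle_homD[OF assms(3,1)] bundle_homD[OF assms(4,2)] bundle_closed[OF assms(1)] in "auto simp: compose_def")

lemma bundle_hom_id:
 assumes "vector_bundle X E"
 shows "(\<lambda>e\<in>pts (tot E). e) \<in> bundle_hom X E E"
 by (rule bundle_homI) (use dfl_hom_id[OF vector_bundleD(4)[OF assms]] bundle_closed[OF assms] in auto)

lemma is_category_VBun: "is_category (VBun_cat X)"
 unfolding is_category_def Obj_VBun Hom_VBun Id_VBun Cmp_VBun mem_Collect_eq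
proof (intro conjI ballI, unfold Obj_VBun)
 fix E E' :: "'a vbundle" and u assume "vector_bundle X E" "vector_bundle X E'" "u \<in> bundle_hom X E E'"
 then show "compose (pts (tot E)) u (\<lambda>e\<in>pts (tot E). e) = u" "compose (pts (tot E)) (\<lambda>e\<in>pts (tot E'). e) u = u"
  using bundle_hom_extensional[of u X E E'] bundle_homD(2)[of u X E E'] by (auto simp: fun_eq_iff compose_def)
next
 fix E0 E E' E'' :: "'a vbundle" and u v w
 assume "vector_bundle X E0" "u \<in> bundle_hom X E0 E"
 then show "compose (pts (tot E0)) (compose (pts (tot E)) w v) u = compose (pts (tot E0)) w (compose (pts (tot E0)) v u)"
  using bundle_homD(2)[of u X E0 E] by (auto simp: fun_eq_iff compose_def)
qed (auto intro: bundle_hom_compose bundle_hom_id)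

text \<open>Linearity of a fibrewise inverse is automatic.\<close>

lemma bundle_inverse_arrows:
 assumes E: "vector_bundle X E" and E': "vector_bundle X E'" and u: "u \<in> bundle_hom X E E'"
  and w: "w \<in> dfl_hom (tot E') (tot E)" and wu: "\<And>e. e \<in> pts (tot E) ==> w (u e) = e"
  and uw: "\<And>e. e \<in> pts (tot E') ==> u (w e) = e"
 shows "inverse_arrows (VBun_cat X) E E' u w"
proof -
 note uD = bundle_homD[OF u E] and wp = dfl_hom_pts[OF w]
 have pw: "prj E (w e) = prj E' e" if "e \<in> pts (tot E')" for e
  using uD(3)[OF wp[OF that]] uw[OF that] by simp
 have "w \<in> bundle_hom X E' E"
 proof (rule bundle_homI[OF w pw])
  fix e e' assume e: "e \<in> pts (tot E')" "e' \<in> pts (tot E')" "prj E' e = prj E' e'"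
  have "vadd E (w e) (w e') \<in> pts (tot E)" using bundle_closed(1)[OF E] wp pw e by simp
  then show "w (vadd E' e e') = vadd E (w e) (w e')"
   using uD(4)[OF wp[OF e(1)] wp[OF e(2)]] pw e uw wu by metis
 next
  fix r e assume e: "e \<in> pts (tot E')"
  have "vsmult E r (w e) \<in> pts (tot E)" using bundle_closed(2)[OF E] wp e by simp
  then show "w (vsmult E' r e) = vsmult E r (w e)"
   using uD(5)[OF wp[OF e]] e uw wu by metis
 qed
 then show ?thesis
  using u uD(2) wp uw wu by (auto simp: inverse_arrows_def Hom_VBun Cmp_VBun Id_VBun compose_def fun_eq_iff)
qed

lemma plot_coords:
 assumes s: "trivialises E c \<phi> k s" and c: "c \<in> Obj Cart" and b: "b \<in> plots (tot E) c"
  and in_fib: "\<And>y. y \<in> c ==> b y \<in> pts (tot E) \<and> prj E (b y) = \<phi> y" and ext: "b \<in> extensional c"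
 obtains v where "smooth_vec c k v" "\<And>y. y \<in> c ==> s y (v y) = b y"
proof -
 have "\<forall>y\<in>c. \<exists>v. v \<in> carrier_vec k \<and> s y v = b y"
 proof
  fix y assume y: "y \<in> c"
  have "b y \<in> carrier (fibre E (\<phi> y))" using in_fib[OF y] by (simp add: fibre_in_pts)
  then show "\<exists>v. v \<in> carrier_vec k \<and> s y v = b y" by (rule trivialises_surj[OF s y]) blast
 qed
 then obtain v where v: "\<forall>y\<in>c. v y \<in> carrier_vec k \<and> s y (v y) = b y" by (rule bchoice[THEN exE])
 have "(\<lambda>y\<in>c. s y (v y)) = b" using v ext by (auto simp: fun_eq_iff extensional_def)
 then have "smooth_vec c k v" using trivialisesD(3)[OF s c smooth_map_id[OF subset_refl], of v] v b by simp
 then show ?thesis using v that by blast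
qed

text \<open>At a single point, a frame along the plot \<open>\<real>\<^sup>0 \<rightarrow> X\<close> shows that \<open>u\<close> is linear on the fibre. For smoothness,
write a plot of \<open>E\<close> in coordinates and apply the matrix.\<close>

lemma frames_bundle_hom:
 assumes E: "vector_bundle X E" and E': "vector_bundle X E'" and ext: "u \<in> extensional (pts (tot E))"
  and fr: "\<And>c \<phi>. \<phi> \<in> plots X c ==> \<exists>k s l s' M. trivialises E c \<phi> k s \<and> trivialises E' c \<phi> l s' \<and>
   smooth_mat c l k M \<and> (\<forall>y\<in>c. \<forall>v\<in>carrier_vec k. u (s y v) = s' y (M y *\<^sub>v v))"
 shows "u \<in> bundle_hom X E E'"
proof -
 note vE = vector_bundleD[OF E]
 have lin: "u \<in> linear_maps (fibre E x) (fibre E' x)" if x: "x \<in> pts X" for x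
 proof -
  have z: "(0::rinf) \<in> RN 0" by (simp add: RN_0)
  obtain k s l s' M where t: "trivialises E (RN 0) (\<lambda>_\<in>RN 0. x) k s" "trivialises E' (RN 0) (\<lambda>_\<in>RN 0. x) l s'"
   and M: "smooth_mat (RN 0) l k M" and u: "\<forall>y\<in>RN 0. \<forall>v\<in>carrier_vec k. u (s y v) = s' y (M y *\<^sub>v v)"
   using fr[OF dfl_plots_point[OF vE(3) x]] by blast
  have s: "s 0 \<in> linear_maps (cvec k) (fibre E x)" "bij_betw (s 0) (carrier_vec k) (carrier (fibre E x))"
   "s' 0 \<in> linear_maps (cvec l) (fibre E' x)"
   using trivialisesD(1,2)[OF t(1) z] trivialisesD(1)[OF t(2) z] z by simp_all
  have M0: "M 0 \<in> carrier_mat l k" using M z by (simp add: smooth_mat_def)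
  define r where "r = inv_into (carrier_vec k) (s 0)"
  have r: "r b \<in> carrier (cvec k) \<and> s 0 (r b) = b" if "b \<in> carrier (fibre E x)" for b
   using that s(2) by (simp add: r_def bij_betw_inv_into_right inv_into_into bij_betw_imp_surj_on)
  have rs: "r (s 0 v) = v" if "v \<in> carrier (cvec k)" for v
   using that s(2) by (simp add: r_def bij_betw_inv_into_left)
  have eq: "s' 0 (M 0 *\<^sub>v r b) = u b" if "b \<in> carrier (fibre E x)" for b
   using bspec[OF bspec[OF u z], of "r b"] r[OF that] by simp
  have "r \<in> linear_maps (fibre E x) (cvec k)" by (rule linear_maps_inverse[OF s(1) r rs cvec_closed])
  from linear_maps_compose[OF linear_maps_compose[OF this mat_vec_linear[OF M0]] s(3)] show ?thesis
   by (rule linear_maps_cong[where f="\<lambda>b. s' 0 (M 0 *\<^sub>v r b)", rotated]) (use eq vectorspace_closed(1,2)[OF vE(6)[OF x]] in auto)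
 qed
 have ue: "u e \<in> pts (tot E')" "prj E' (u e) = prj E e" if "e \<in> pts (tot E)" for e
  using lin[OF vE(8)[OF that]] that by (auto simp: linear_maps_fibre)
 show ?thesis
 proof (rule bundle_homI)
  show "u \<in> dfl_hom (tot E) (tot E')"
  proof (rule dfl_homI[OF vE(4)])
   show "u \<in> pts (tot E) \<rightarrow>\<^sub>E pts (tot E')" using ue ext by (auto simp: PiE_def)
   fix c q assume c: "c \<in> Obj Cart" and q: "q \<in> plots (tot E) c"
   define \<phi> where "\<phi> = (\<lambda>y\<in>c. prj E (q y))"
   have \<phi>: "\<phi> \<in> plots X c" unfolding \<phi>_def by (rule dfl_hom_plots[OF vE(4,5) q])
   obtain k s l s' M where s: "trivialises E c \<phi> k s" "trivialises E' c \<phi> l s'" "smooth_mat c l k M"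
    "\<forall>y\<in>c. \<forall>v\<in>carrier_vec k. u (s y v) = s' y (M y *\<^sub>v v)" using fr[OF \<phi>] by blast
   have fib: "q y \<in> pts (tot E) \<and> prj E (q y) = \<phi> y" if "y \<in> c" for y
    using dfl_plots_pts[OF vE(4) q that] that by (simp add: \<phi>_def)
   have ex: "q \<in> extensional c" using dfl_plots_PiE[OF vE(4) q] by (auto simp: PiE_def)
   obtain v where v: "smooth_vec c k v" "\<And>y. y \<in> c ==> s y (v y) = q y" using plot_coords[OF s(1) c q fib ex] by blast
   have "u (q y) = s' y (M y *\<^sub>v v y)" if "y \<in> c" for y
    using bspec[OF bspec[OF s(4) that], of "v y"] v that by (simp add: smooth_vec_def)
   then have "(\<lambda>y\<in>c. u (q y)) = (\<lambda>y\<in>c. s' y (M y *\<^sub>v v y))" by (auto simp: fun_eq_iff)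
   then show "(\<lambda>y\<in>c. u (q y)) \<in> plots (tot E') c" using frame_plot[OF c s(2) smooth_mat_vec[OF s(3) v(1)]] by simp
  qed
 qed (use lin[OF vE(8)] in "auto simp: linear_maps_fibre")
qed

text \<open>A map that carries frames to frames is bijective on fibres, and its inverse carries the frames back, so
the criterion for morphisms applies to both.\<close>

lemma frames_inverse_arrows:
 assumes E: "vector_bundle X E" and E': "vector_bundle X E'" and ext: "u \<in> extensional (pts (tot E))"
  and fr: "\<And>c \<phi>. \<phi> \<in> plots X c ==> \<exists>k s s'. trivialises E c \<phi> k s \<and> trivialises E' c \<phi> k s' \<and>
   (\<forall>y\<in>c. \<forall>v\<in>carrier_vec k. u (s y v) = s' y v)"
 shows "\<exists>w. inverse_arrows (VBun_cat X) E E' u w"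
proof -
 have u: "u \<in> bundle_hom X E E'"
 proof (rule frames_bundle_hom[OF E E' ext])
  fix c \<phi> assume "\<phi> \<in> plots X c"
  then obtain k s s' where "trivialises E c \<phi> k s" "trivialises E' c \<phi> k s'" "\<forall>y\<in>c. \<forall>v\<in>carrier_vec k. u (s y v) = s' y v"
   using fr by blast
  then show "\<exists>k s l s' M. trivialises E c \<phi> k s \<and> trivialises E' c \<phi> l s' \<and>
   smooth_mat c l k M \<and> (\<forall>y\<in>c. \<forall>v\<in>carrier_vec k. u (s y v) = s' y (M y *\<^sub>v v))"
   using smooth_mat_one[of c k] by (intro exI[of _ k] exI[of _ s] exI[of _ s'] exI[of _ "\<lambda>_. 1\<^sub>m k"]) simp
 qed
 note ue = bundle_homD(2,3)[OF u E]
 have "inj_on u (pts (tot E)) \<and> u ` pts (tot E) = pts (tot E')"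
 proof -
  have bij: "bij_betw u (carrier (fibre E x)) (carrier (fibre E' x))" if x: "x \<in> pts X" for x
  proof -
   have z: "(0::rinf) \<in> RN 0" by (simp add: RN_0)
   obtain k s s' where t: "trivialises E (RN 0) (\<lambda>_\<in>RN 0. x) k s" "trivialises E' (RN 0) (\<lambda>_\<in>RN 0. x) k s'"
    and us: "\<forall>y\<in>RN 0. \<forall>v\<in>carrier_vec k. u (s y v) = s' y v"
    using fr[OF dfl_plots_point[OF vector_bundleD(3)[OF E] x]] by blast
   have s: "bij_betw (s 0) (carrier_vec k) (carrier (fibre E x))" "bij_betw (s' 0) (carrier_vec k) (carrier (fibre E' x))"
    using trivialisesD(2)[OF t(1) z] trivialisesD(2)[OF t(2) z] z by simp_all
   have "u e = (s' 0 \<circ> inv_into (carrier_vec k) (s 0)) e" if "e \<in> carrier (fibre E x)" for e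
    using bspec[OF bspec[OF us z], of "inv_into (carrier_vec k) (s 0) e"] that s(1)
    by (simp add: bij_betw_inv_into_right inv_into_into bij_betw_imp_surj_on)
   then show ?thesis
    using bij_betw_trans[OF bij_betw_inv_into[OF s(1)] s(2)] bij_betw_cong[of "carrier (fibre E x)" u] by blast
  qed
  have "e = e'" if "e \<in> pts (tot E)" "e' \<in> pts (tot E)" "u e = u e'" for e e'
  proof (rule inj_onD[OF bij_betw_imp_inj_on[OF bij[OF vector_bundleD(8)[OF E that(1)]]] that(3)])
   show "e' \<in> carrier (fibre E (prj E e))" using ue(2)[OF that(1)] ue(2)[OF that(2)] that by (simp add: fibre_in_pts)
  qed (use that in "simp add: fibre_in_pts")
  moreover have "e \<in> u ` pts (tot E)" if "e \<in> pts (tot E')" for e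
  proof -
   have "e \<in> u ` carrier (fibre E (prj E' e))"
    unfolding bij_betw_imp_surj_on[OF bij[OF vector_bundleD(8)[OF E' that]]] using that by (simp add: fibre_in_pts)
   then show ?thesis by (auto simp: fibre_in_pts)
  qed
  ultimately show ?thesis using ue(1) by (auto intro: inj_onI)
 qed
 then have inj: "inj_on u (pts (tot E))" and surj: "u ` pts (tot E) = pts (tot E')" by auto
 define w where "w = (\<lambda>e\<in>pts (tot E'). inv_into (pts (tot E)) u e)"
 have wu: "w (u e) = e" if "e \<in> pts (tot E)" for e using that ue(1)[OF that] inj by (simp add: w_def)
 have uw: "u (w e) = e" if "e \<in> pts (tot E')" for e using that surj by (simp add: w_def f_inv_into_f)
 have "w \<in> bundle_hom X E' E"
 proof (rule frames_bundle_hom[OF E' E])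
  fix c \<phi> assume "\<phi> \<in> plots X c"
  then obtain k s s' where s: "trivialises E c \<phi> k s" "trivialises E' c \<phi> k s'" "\<forall>y\<in>c. \<forall>v\<in>carrier_vec k. u (s y v) = s' y v"
   using fr by blast
  have "w (s' y v) = s y v" if "y \<in> c" "v \<in> carrier_vec k" for y v
   using wu[of "s y v"] trivialises_fibre[OF s(1) that] s(3) that by (simp add: fibre_in_pts)
  then show "\<exists>k s l s' M. trivialises E' c \<phi> k s \<and> trivialises E c \<phi> l s' \<and>
   smooth_mat c l k M \<and> (\<forall>y\<in>c. \<forall>v\<in>carrier_vec k. w (s y v) = s' y (M y *\<^sub>v v))"
   using smooth_mat_one[of c k] s by (intro exI[of _ k] exI[of _ s] exI[of _ s'] exI[of _ "\<lambda>_. 1\<^sub>m k"]) simp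
 qed (simp add: w_def)
 from bundle_inverse_arrows[OF E E' u bundle_homD(1)[OF this E'] wu uw] show ?thesis by blast
qed

declare upair_inject [simp]

section \<open>Pullback of vector bundles\<close>

text \<open>Bundle constructions relabel the points of fibres; this carries the vector space axioms along.\<close>

lemma vectorspace_transport:
 assumes V: "vectorspace class_ring (V :: (complex, 'a) module)"
  and j: "bij_betw j (carrier V) (carrier (W :: (complex, 'b) module))"
  and add: "\<And>a b. a \<in> carrier V ==> b \<in> carrier V ==> j (a \<oplus>\<^bsub>V\<^esub> b) = j a \<oplus>\<^bsub>W\<^esub> j b"
  and smult: "\<And>r a. a \<in> carrier V ==> j (r \<odot>\<^bsub>V\<^esub> a) = r \<odot>\<^bsub>W\<^esub> j a"
  and zero: "j \<zero>\<^bsub>V\<^esub> = \<zero>\<^bsub>W\<^esub>"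
 shows "vectorspace class_ring W"
proof -
 interpret V: vectorspace class_ring V by fact
 note [simp] = class_ring_simps
 have W: "\<exists>a\<in>carrier V. w = j a" if "w \<in> carrier W" for w
  using j that by (auto simp: bij_betw_def)
 have jW: "j a \<in> carrier W" if "a \<in> carrier V" for a using j that by (auto simp: bij_betw_def)
 have sm: "r \<odot>\<^bsub>V\<^esub> a \<in> carrier V" if "a \<in> carrier V" for r a using vectorspace_closed(2)[OF V that] .
 have "abelian_group W"
 proof (rule abelian_groupI)
  show "a \<oplus>\<^bsub>W\<^esub> b \<in> carrier W" if "a \<in> carrier W" "b \<in> carrier W" for a b
   using W[OF that(1)] W[OF that(2)] by (auto simp: add[symmetric] jW)
  show "\<zero>\<^bsub>W\<^esub> \<in> carrier W" by (simp add: zero[symmetric] jW)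
  show "a \<oplus>\<^bsub>W\<^esub> b \<oplus>\<^bsub>W\<^esub> c = a \<oplus>\<^bsub>W\<^esub> (b \<oplus>\<^bsub>W\<^esub> c)" if "a \<in> carrier W" "b \<in> carrier W" "c \<in> carrier W" for a b c
   using W[OF that(1)] W[OF that(2)] W[OF that(3)] by (auto simp: add[symmetric] V.a_assoc)
  show "a \<oplus>\<^bsub>W\<^esub> b = b \<oplus>\<^bsub>W\<^esub> a" if "a \<in> carrier W" "b \<in> carrier W" for a b
   using W[OF that(1)] W[OF that(2)] by (auto simp: add[symmetric] V.a_comm)
  show "\<zero>\<^bsub>W\<^esub> \<oplus>\<^bsub>W\<^esub> a = a" if "a \<in> carrier W" for a
   using W[OF that] by (auto simp: add[symmetric] zero[symmetric])
  show "\<exists>b\<in>carrier W. b \<oplus>\<^bsub>W\<^esub> a = \<zero>\<^bsub>W\<^esub>" if "a \<in> carrier W" for a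
  proof -
   obtain v where v: "v \<in> carrier V" "a = j v" using W[OF \<open>a \<in> carrier W\<close>] by blast
   have "j (\<ominus>\<^bsub>V\<^esub> v) \<oplus>\<^bsub>W\<^esub> a = \<zero>\<^bsub>W\<^esub>" using v by (simp add: add[symmetric] zero[symmetric] V.l_neg)
   then show ?thesis using v jW by (intro bexI[of _ "j (\<ominus>\<^bsub>V\<^esub> v)"]) auto
  qed
 qed
 have "module class_ring W"
 proof (rule moduleI)
  show "cring (class_ring :: complex ring)" by (rule module.axioms(1)[OF V.module_axioms])
  show "abelian_group W" by fact
  show "r \<odot>\<^bsub>W\<^esub> a \<in> carrier W" if "a \<in> carrier W" for r a
   using W[OF that] by (auto simp: smult[symmetric] jW sm)
  fix r s a b
  assume "a \<in> carrier W"
  then obtain v where v: "v \<in> carrier V" "a = j v" using W by blast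
  show "(r \<oplus>\<^bsub>class_ring\<^esub> s) \<odot>\<^bsub>W\<^esub> a = r \<odot>\<^bsub>W\<^esub> a \<oplus>\<^bsub>W\<^esub> s \<odot>\<^bsub>W\<^esub> a"
   using V.smult_l_distr[of r s v] v by (simp add: smult[symmetric] add[symmetric] sm)
  show "(r \<otimes>\<^bsub>class_ring\<^esub> s) \<odot>\<^bsub>W\<^esub> a = r \<odot>\<^bsub>W\<^esub> (s \<odot>\<^bsub>W\<^esub> a)"
   using V.smult_assoc1[of r s v] v by (simp add: smult[symmetric] sm)
  show "\<one>\<^bsub>class_ring\<^esub> \<odot>\<^bsub>W\<^esub> a = a"
   using V.smult_one[of v] v by (simp add: smult[symmetric] sm)
  assume "b \<in> carrier W"
  then obtain w where w: "w \<in> carrier V" "b = j w" using W by blast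
  show "r \<odot>\<^bsub>W\<^esub> (a \<oplus>\<^bsub>W\<^esub> b) = r \<odot>\<^bsub>W\<^esub> a \<oplus>\<^bsub>W\<^esub> r \<odot>\<^bsub>W\<^esub> b"
   using V.smult_r_distr[of r v w] v w by (simp add: smult[symmetric] add[symmetric] sm)
 qed
 then show ?thesis using V by (simp add: vectorspace_def)
qed

lemma pb_pts [simp]: "upair x e \<in> pts (pb_space X' f E) \<longleftrightarrow> x \<in> pts X' \<and> e \<in> pts (tot E) \<and> f x = prj E e"
 by (simp add: pb_space_def)

lemma pb_cases:
 assumes "z \<in> pts (pb_space X' f E)"
 obtains x e where "z = upair x e" "x \<in> pts X'" "e \<in> pts (tot E)" "f x = prj E e"
 using fibre_prod_cases[OF assms[unfolded pb_space_def]] .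

lemma pb_bundle_simps [simp]:
 "tot (pb_bundle X' f E) = pb_space X' f E"
 "x \<in> pts X' ==> e \<in> pts (tot E) ==> f x = prj E e ==> prj (pb_bundle X' f E) (upair x e) = x"
 "vadd (pb_bundle X' f E) (upair x e) (upair x' e') = upair x (vadd E e e')"
 "vsmult (pb_bundle X' f E) r (upair x e) = upair x (vsmult E r e)"
 "vzero (pb_bundle X' f E) x = upair x (vzero E (f x))"
 by (simp_all add: pb_bundle_def)

lemma pb_space_plots:
 assumes "vector_bundle X E" "diffeological_space X'"
 shows "g \<in> plots (pb_space X' f E) c \<longleftrightarrow> g \<in> c \<rightarrow>\<^sub>E pts (pb_space X' f E) \<and>
  (\<lambda>y\<in>c. ufst (g y)) \<in> plots X' c \<and> (\<lambda>y\<in>c. usnd (g y)) \<in> plots (tot E) c"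
 unfolding pb_space_def by (rule fibre_prod_plots[OF assms(2) vector_bundleD(4)[OF assms(1)]])

lemma pb_space_pair_plot:
 assumes "vector_bundle X E" "diffeological_space X'" "\<And>y. y \<in> c ==> f (\<alpha> y) = prj E (b y)"
  "(\<lambda>y\<in>c. \<alpha> y) \<in> plots X' c" "(\<lambda>y\<in>c. b y) \<in> plots (tot E) c"
 shows "(\<lambda>y\<in>c. upair (\<alpha> y) (b y)) \<in> plots (pb_space X' f E) c"
 unfolding pb_space_def by (rule fibre_prod_pair_plot[where \<alpha>=\<alpha> and b=b and f=f and g="prj E", OF assms(2) vector_bundleD(4)[OF assms(1)] assms(3-5)])

lemma dfl_hom_to_pb:
 assumes "vector_bundle X E" "diffeological_space X'" "diffeological_space A"
  and "\<And>a. a \<in> pts A ==> u a = upair (p a) (q a) \<and> upair (p a) (q a) \<in> pts (pb_space X' f E)"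
  "u \<in> extensional (pts A)" "\<And>c \<phi>. \<phi> \<in> plots A c ==> (\<lambda>y\<in>c. p (\<phi> y)) \<in> plots X' c"
  "\<And>c \<phi>. \<phi> \<in> plots A c ==> (\<lambda>y\<in>c. q (\<phi> y)) \<in> plots (tot E) c"
 shows "u \<in> dfl_hom A (pb_space X' f E)"
proof (rule dfl_homI[OF assms(3)])
 show "u \<in> pts A \<rightarrow>\<^sub>E pts (pb_space X' f E)" using assms(4,5) by (auto simp: PiE_def)
 fix c \<phi> assume \<phi>: "\<phi> \<in> plots A c"
 note pt = dfl_plots_pts[OF assms(3) \<phi>]
 have "(\<lambda>y\<in>c. upair (p (\<phi> y)) (q (\<phi> y))) \<in> plots (pb_space X' f E) c"
  by (rule pb_space_pair_plot[OF assms(1,2) _ assms(6)[OF \<phi>] assms(7)[OF \<phi>]]) (use assms(4) pt in auto)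
 moreover have "(\<lambda>y\<in>c. upair (p (\<phi> y)) (q (\<phi> y))) = (\<lambda>y\<in>c. u (\<phi> y))"
  using assms(4) pt by (auto simp: fun_eq_iff)
 ultimately show "(\<lambda>y\<in>c. u (\<phi> y)) \<in> plots (pb_space X' f E) c" by simp
qed

lemma pb_proj1:
 assumes "vector_bundle X E" "diffeological_space X'" "\<phi> \<in> plots (pb_space X' f E) c"
 shows "(\<lambda>y\<in>c. ufst (\<phi> y)) \<in> plots X' c"
 using assms(3) pb_space_plots[OF assms(1,2)] by blast

lemma pb_proj2:
 assumes "vector_bundle X E" "diffeological_space X'" "\<phi> \<in> plots (pb_space X' f E) c"
 shows "(\<lambda>y\<in>c. usnd (\<phi> y)) \<in> plots (tot E) c"
 using assms(3) pb_space_plots[OF assms(1,2)] by blast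

text \<open>Frames pull back by pairing with the base point.\<close>

lemma pb_frame:
 assumes E: "vector_bundle X E" and X': "X' \<in> Obj Dfg" and \<phi>: "\<phi> \<in> plots X' c"
  and s: "trivialises E c (\<lambda>y\<in>c. f (\<phi> y)) k s"
 shows "trivialises (pb_bundle X' f E) c \<phi> k (\<lambda>y v. upair (\<phi> y) (s y v))"
proof -
 note dX' = Dfg_diffeological[OF X']
 have fib: "s y v \<in> pts (tot E) \<and> f (\<phi> y) = prj E (s y v)" if "y \<in> c" "v \<in> carrier_vec k" for y v
  using trivialises_fibre[OF s that] that(1) by (simp add: fibre_in_pts)
 note \<phi>p = dfl_plots_pts[OF dX' \<phi>]
 show ?thesis
  unfolding trivialises_def
 proof (intro conjI ballI allI impI)
  fix y assume y: "y \<in> c"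
  show "(\<lambda>v. upair (\<phi> y) (s y v)) \<in> linear_maps (cvec k) (fibre (pb_bundle X' f E) (\<phi> y))"
   using trivialisesD(1)[OF s y] fib[OF y] \<phi>p[OF y] by (auto simp: linear_maps_iff fibre_def)
  show "bij_betw (\<lambda>v. upair (\<phi> y) (s y v)) (carrier_vec k) (carrier (fibre (pb_bundle X' f E) (\<phi> y)))"
  proof (rule bij_betw_imageI)
   show "inj_on (\<lambda>v. upair (\<phi> y) (s y v)) (carrier_vec k)"
    using trivialises_inj[OF s y] by (auto simp: inj_on_def upair_inject)
   show "(\<lambda>v. upair (\<phi> y) (s y v)) ` carrier_vec k = carrier (fibre (pb_bundle X' f E) (\<phi> y))"
   proof (intro equalityI subsetI)
    fix z assume "z \<in> carrier (fibre (pb_bundle X' f E) (\<phi> y))"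
    then have z: "z \<in> pts (pb_space X' f E)" "prj (pb_bundle X' f E) z = \<phi> y" by (auto simp: fibre_in_pts)
    from z(1) obtain x e where xe: "z = upair x e" "x \<in> pts X'" "e \<in> pts (tot E)" "f x = prj E e" by (rule pb_cases)
    then have "x = \<phi> y" using z(2) by simp
    then have "e \<in> carrier (fibre E ((\<lambda>y\<in>c. f (\<phi> y)) y))" using xe y by (simp add: fibre_in_pts)
    then obtain v where "v \<in> carrier_vec k" "s y v = e" by (rule trivialises_surj[OF s y])
    then show "z \<in> (\<lambda>v. upair (\<phi> y) (s y v)) ` carrier_vec k" using xe \<open>x = \<phi> y\<close> by blast
   qed (use fib[OF y] \<phi>p[OF y] in "auto simp: fibre_in_pts")
  qed
 next
  fix c' g and v :: "rinf => complex Matrix.vec"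
  assume c': "c' \<in> Obj Cart" and g: "smooth_map c' c g" and v: "\<forall>y\<in>c'. v y \<in> carrier_vec k"
  note gi = smooth_map_image[OF g]
  let ?q = "\<lambda>y\<in>c'. upair (\<phi> (g y)) (s (g y) (v y))"
  have 1: "(\<lambda>y\<in>c'. ufst (?q y)) = (\<lambda>y\<in>c'. \<phi> (g y))" "(\<lambda>y\<in>c'. usnd (?q y)) = (\<lambda>y\<in>c'. s (g y) (v y))"
   by (auto simp: fun_eq_iff)
  have 2: "?q \<in> c' \<rightarrow>\<^sub>E pts (pb_space X' f E)" using fib gi v \<phi>p by auto
  have "?q \<in> plots (pb_space X' f E) c' \<longleftrightarrow> (\<lambda>y\<in>c'. s (g y) (v y)) \<in> plots (tot E) c'"
   unfolding pb_space_plots[OF E dX'] 1 using 2 dfl_plots_compose[OF dX' \<phi> c' g] by blast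
  then show "?q \<in> plots (tot (pb_bundle X' f E)) c' \<longleftrightarrow> smooth_vec c' k v"
   using trivialisesD(3)[OF s c' g, of v] v by simp
 qed
qed

lemma pb_bundle_vector_bundle:
 assumes E: "vector_bundle X E" and X': "X' \<in> Obj Dfg" and f: "f \<in> dfl_hom X' X"
 shows "vector_bundle X' (pb_bundle X' f E)"
 unfolding vector_bundle_iff
proof (intro conjI ballI allI impI X')
 note dX' = Dfg_diffeological[OF X']
 show T: "tot (pb_bundle X' f E) \<in> Obj Dfg"
  by (simp add: pb_space_def) (rule fibre_prod_Dfg[OF X' vector_bundleD(2)[OF E]])
 then have dT: "diffeological_space (pb_space X' f E)" by (simp add: Obj_Dfg)
 show "prj (pb_bundle X' f E) \<in> dfl_hom (tot (pb_bundle X' f E)) X'"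
 proof (simp, rule dfl_homI[OF dT])
  show "prj (pb_bundle X' f E) \<in> pts (pb_space X' f E) \<rightarrow>\<^sub>E pts X'"
   by (auto simp: pb_bundle_def elim: pb_cases)
  fix c \<phi> assume \<phi>: "\<phi> \<in> plots (pb_space X' f E) c"
  have "(\<lambda>y\<in>c. prj (pb_bundle X' f E) (\<phi> y)) = (\<lambda>y\<in>c. ufst (\<phi> y))"
   using dfl_plots_pts[OF dT \<phi>] by (auto simp: fun_eq_iff pb_bundle_def)
  then show "(\<lambda>y\<in>c. prj (pb_bundle X' f E) (\<phi> y)) \<in> plots X' c" using pb_proj1[OF E dX' \<phi>] by simp
 qed
 show "vectorspace class_ring (fibre (pb_bundle X' f E) x)" if x: "x \<in> pts X'" for x
 proof (rule vectorspace_transport[where j="upair x"])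
  show "vectorspace class_ring (fibre E (f x))" by (rule vector_bundleD(6)[OF E dfl_hom_pts[OF f x]])
  show "bij_betw (upair x) (carrier (fibre E (f x))) (carrier (fibre (pb_bundle X' f E) x))"
   by (rule bij_betw_imageI) (use x in "auto simp: inj_on_def upair_inject fibre_in_pts image_iff elim!: pb_cases")
 qed (simp_all add: fibre_def)
 show "\<exists>k s. trivialises (pb_bundle X' f E) c \<phi> k s" if "\<phi> \<in> plots X' c" for c \<phi>
 proof -
  have "(\<lambda>y\<in>c. f (\<phi> y)) \<in> plots X c" by (rule dfl_hom_plots[OF dX' f that])
  then obtain k s where "trivialises E c (\<lambda>y\<in>c. f (\<phi> y)) k s" using vector_bundleD(7)[OF E] by blast
  from pb_frame[OF E X' that this] show ?thesis by blast
 qed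
qed

definition pb_map :: "'u::universe dfl => ('u => 'u) => 'u vbundle => ('u => 'u) => 'u => 'u" where
 "pb_map X' f E u = (\<lambda>z\<in>pts (pb_space X' f E). upair (ufst z) (u (usnd z)))"

lemma pb_func_simps [simp]:
 "FO (pb_func X' f) E = pb_bundle X' f E" "FM (pb_func X' f) E E' u = pb_map X' f E u"
 by (simp_all add: pb_func_def pb_map_def)

lemma pb_map_upair [simp]:
 "x \<in> pts X' ==> e \<in> pts (tot E) ==> f x = prj E e ==> pb_map X' f E u (upair x e) = upair x (u e)"
 by (simp add: pb_map_def)

lemma restrict_comp_plot:
 assumes "diffeological_space A" "u \<in> dfl_hom A B" "(\<lambda>y\<in>c. \<phi> y) \<in> plots A c"
 shows "(\<lambda>y\<in>c. u (\<phi> y)) \<in> plots B c"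
proof -
 have "(\<lambda>y\<in>c. u ((\<lambda>y\<in>c. \<phi> y) y)) \<in> plots B c" by (rule dfl_hom_plots[OF assms])
 moreover have "(\<lambda>y\<in>c. u ((\<lambda>y\<in>c. \<phi> y) y)) = (\<lambda>y\<in>c. u (\<phi> y))" by (auto simp: fun_eq_iff)
 ultimately show ?thesis by simp
qed

lemma pb_map_bundle_hom:
 assumes E: "vector_bundle X E" and E': "vector_bundle X E'" and u: "u \<in> bundle_hom X E E'"
  and X': "X' \<in> Obj Dfg" and f: "f \<in> dfl_hom X' X"
 shows "pb_map X' f E u \<in> bundle_hom X' (pb_bundle X' f E) (pb_bundle X' f E')"
proof (rule bundle_homI)
 note dX' = Dfg_diffeological[OF X'] and uD = bundle_homD[OF u E]
 note pE = pb_bundle_vector_bundle[OF E X' f]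
 show "pb_map X' f E u \<in> dfl_hom (tot (pb_bundle X' f E)) (tot (pb_bundle X' f E'))"
 proof (simp, rule dfl_hom_to_pb[OF E' dX', where p=ufst and q="\<lambda>z. u (usnd z)"])
  show d: "diffeological_space (pb_space X' f E)" using vector_bundleD(4)[OF pE] by simp
  show "pb_map X' f E u a = upair (ufst a) (u (usnd a)) \<and> upair (ufst a) (u (usnd a)) \<in> pts (pb_space X' f E')"
   if "a \<in> pts (pb_space X' f E)" for a using that uD(2,3) by (auto elim!: pb_cases)
  show "pb_map X' f E u \<in> extensional (pts (pb_space X' f E))" by (simp add: pb_map_def)
  fix c \<phi> assume \<phi>: "\<phi> \<in> plots (pb_space X' f E) c"
  show "(\<lambda>y\<in>c. ufst (\<phi> y)) \<in> plots X' c" by (rule pb_proj1[OF E dX' \<phi>])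
  show "(\<lambda>y\<in>c. u (usnd (\<phi> y))) \<in> plots (tot E') c"
   by (rule restrict_comp_plot[OF vector_bundleD(4)[OF E] uD(1) pb_proj2[OF E dX' \<phi>]])
 qed
qed (use bundle_homD[OF u E] bundle_closed[OF E] in "auto elim!: pb_cases")

lemma pb_functor:
 assumes X: "X \<in> Obj Dfg" and X': "X' \<in> Obj Dfg" and f: "f \<in> dfl_hom X' X"
 shows "is_functor (VBun_cat X) (VBun_cat X') (pb_func X' f)"
 unfolding is_functor_def
proof (intro conjI ballI is_category_VBun, unfold Obj_VBun Hom_VBun Id_VBun Cmp_VBun pb_func_simps)
 fix E :: "'a vbundle" assume E: "vector_bundle X E"
 show "vector_bundle X' (pb_bundle X' f E)" by (rule pb_bundle_vector_bundle[OF E X' f])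
 show "pb_map X' f E (\<lambda>e\<in>pts (tot E). e) = (\<lambda>e\<in>pts (tot (pb_bundle X' f E)). e)"
  by (auto simp: fun_eq_iff pb_map_def elim!: pb_cases)
 fix E' u assume E': "vector_bundle X E'" and u: "u \<in> bundle_hom X E E'"
 show "pb_map X' f E u \<in> bundle_hom X' (pb_bundle X' f E) (pb_bundle X' f E')"
  by (rule pb_map_bundle_hom[OF E E' u X' f])
 fix E'' v
 show "pb_map X' f E (compose (pts (tot E)) v u) = compose (pts (tot (pb_bundle X' f E))) (pb_map X' f E' v) (pb_map X' f E u)"
 proof
  fix z
  show "pb_map X' f E (compose (pts (tot E)) v u) z = compose (pts (tot (pb_bundle X' f E))) (pb_map X' f E' v) (pb_map X' f E u) z"
  proof (cases "z \<in> pts (pb_space X' f E)")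
   case True
   then show ?thesis using bundle_homD(2,3)[OF u E] by (auto simp: compose_def elim!: pb_cases)
  qed (simp add: pb_map_def compose_def)
 qed
qed

section \<open>The pseudo-functor of vector bundles\<close>

lemma VBun_Dfg_simps [simp]:
 "Val VBun_Dfg = VBun_cat" "Res VBun_Dfg X' X f = pb_func X' f"
 "Unt VBun_Dfg X E = (\<lambda>e\<in>pts (tot E). upair (prj E e) e)"
 "Cmb VBun_Dfg X'' X' X g f E = (\<lambda>z\<in>pts (pb_space X'' g (pb_bundle X' f E)). upair (ufst z) (usnd (usnd z)))"
 by (simp_all add: VBun_Dfg_def)

text \<open>The comparison \<open>f\<^sup>*(g\<^sup>*E) \<rightarrow> (g \<circ> f)\<^sup>*E\<close> forgets the middle point. It also is the shape of the comparison of
the strict model with bundles, where the middle point is forgotten as well.\<close>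

abbreviation flatten :: "'u::universe dfl => ('u => 'u) => 'u vbundle => 'u => 'u" where
 "flatten X f E \<equiv> (\<lambda>z\<in>pts (pb_space X f E). upair (ufst z) (usnd (usnd z)))"

lemma pb2_cases:
 assumes "z \<in> pts (pb_space X'' g (pb_bundle X' f E))"
 obtains x e where "z = upair x (upair (g x) e)" "x \<in> pts X''" "g x \<in> pts X'" "e \<in> pts (tot E)" "f (g x) = prj E e"
 using assms by (elim pb_cases) (auto elim!: pb_cases)

lemma unit_iso:
 assumes E: "vector_bundle X E"
 shows "(\<lambda>e\<in>pts (tot E). upair (prj E e) e) \<in> Iso (VBun_cat X) E (pb_bundle X (\<lambda>x\<in>pts X. x) E)"
proof -
 note vE = vector_bundleD[OF E]
 have pE: "vector_bundle X (pb_bundle X (\<lambda>x\<in>pts X. x) E)" by (rule pb_bundle_vector_bundle[OF E vE(1) dfl_hom_id[OF vE(3)]])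
 have "\<exists>w. inverse_arrows (VBun_cat X) E (pb_bundle X (\<lambda>x\<in>pts X. x) E) (\<lambda>e\<in>pts (tot E). upair (prj E e) e) w"
 proof (rule frames_inverse_arrows[OF E pE])
  fix c \<phi> assume \<phi>: "\<phi> \<in> plots X c"
  obtain k s where s: "trivialises E c \<phi> k s" using vE(7)[OF \<phi>] by blast
  have "trivialises E c (\<lambda>y\<in>c. (\<lambda>x\<in>pts X. x) (\<phi> y)) k s"
   by (rule trivialises_cong[OF s refl]) (use dfl_plots_pts[OF vE(3) \<phi>] in simp)
  note t = pb_frame[OF E vE(1) \<phi> this]
  have "(\<lambda>e\<in>pts (tot E). upair (prj E e) e) (s y v) = upair (\<phi> y) (s y v)" if "y \<in> c" "v \<in> carrier_vec k" for y v
   using trivialises_fibre[OF s that] by (simp add: fibre_in_pts)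
  with s t show "\<exists>k s s'. trivialises E c \<phi> k s \<and> trivialises (pb_bundle X (\<lambda>x\<in>pts X. x) E) c \<phi> k s' \<and>
   (\<forall>y\<in>c. \<forall>v\<in>carrier_vec k. (\<lambda>e\<in>pts (tot E). upair (prj E e) e) (s y v) = s' y v)" by blast
 qed simp
 then show ?thesis by (auto simp: Iso_def)
qed

text \<open>The explicit inverse is needed in the descent data, where coherence isomorphisms are inverted.\<close>

lemma comb_inverse_arrows:
 assumes E: "vector_bundle X E" and X': "X' \<in> Obj Dfg" and X'': "X'' \<in> Obj Dfg"
  and f: "f \<in> dfl_hom X' X" and g: "g \<in> dfl_hom X'' X'"
 shows "inverse_arrows (VBun_cat X'') (pb_bundle X'' g (pb_bundle X' f E)) (pb_bundle X'' (compose (pts X'') f g) E)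
  (flatten X'' g (pb_bundle X' f E))
  (\<lambda>z\<in>pts (pb_space X'' (compose (pts X'') f g) E). upair (ufst z) (upair (g (ufst z)) (usnd z)))"
  (is "inverse_arrows _ ?P ?Q ?u ?w")
proof -
 note dX' = Dfg_diffeological[OF X'] and dX'' = Dfg_diffeological[OF X'']
 have P': "vector_bundle X' (pb_bundle X' f E)" by (rule pb_bundle_vector_bundle[OF E X' f])
 have P: "vector_bundle X'' ?P" by (rule pb_bundle_vector_bundle[OF P' X'' g])
 have Q: "vector_bundle X'' ?Q" by (rule pb_bundle_vector_bundle[OF E X'' dfl_hom_compose[OF dX'' g dX' f]])
 have "\<exists>w. inverse_arrows (VBun_cat X'') ?P ?Q ?u w"
 proof (rule frames_inverse_arrows[OF P Q])
  fix c \<phi> assume \<phi>: "\<phi> \<in> plots X'' c"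
  note \<phi>p = dfl_plots_pts[OF dX'' \<phi>]
  have g\<phi>: "(\<lambda>y\<in>c. g (\<phi> y)) \<in> plots X' c" by (rule dfl_hom_plots[OF dX'' g \<phi>])
  obtain k s where s: "trivialises E c (\<lambda>y\<in>c. f ((\<lambda>y\<in>c. g (\<phi> y)) y)) k s"
   using vector_bundleD(7)[OF E dfl_hom_plots[OF dX' f g\<phi>]] by blast
  have "trivialises E c (\<lambda>y\<in>c. compose (pts X'') f g (\<phi> y)) k s"
   by (rule trivialises_cong[OF s refl]) (simp add: compose_def \<phi>p)
  note t = pb_frame[OF P' X'' \<phi> pb_frame[OF E X' g\<phi> s]] pb_frame[OF E X'' \<phi> this]
  have "?u (upair (\<phi> y) (upair ((\<lambda>y\<in>c. g (\<phi> y)) y) (s y v))) = upair (\<phi> y) (s y v)" if "y \<in> c" "v \<in> carrier_vec k" for y v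
   using trivialises_fibre[OF t(1) that] by (simp add: fibre_in_pts)
  with t show "\<exists>k s s'. trivialises ?P c \<phi> k s \<and> trivialises ?Q c \<phi> k s' \<and> (\<forall>y\<in>c. \<forall>v\<in>carrier_vec k. ?u (s y v) = s' y v)" by blast
 qed simp
 then obtain w where w: "inverse_arrows (VBun_cat X'') ?P ?Q ?u w" by blast
 have "w = ?w"
 proof (rule extensionalityI[of _ "pts (tot ?Q)"])
  have wb: "w \<in> bundle_hom X'' ?Q ?P" and wu: "compose (pts (tot ?P)) w ?u = (\<lambda>z\<in>pts (tot ?P). z)"
   using w by (simp_all add: inverse_arrows_def Hom_VBun Cmp_VBun Id_VBun)
  show "w \<in> extensional (pts (tot ?Q))" using dfl_hom_PiE[OF bundle_homD(1)[OF wb Q]] by (auto simp: PiE_def)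
  fix z assume "z \<in> pts (tot ?Q)"
  then have "z \<in> pts (pb_space X'' (compose (pts X'') f g) E)" by simp
  then obtain x e where z: "z = upair x e" "x \<in> pts X''" "e \<in> pts (tot E)" "compose (pts X'') f g x = prj E e" by (rule pb_cases)
  then have m: "upair x (upair (g x) e) \<in> pts (tot ?P)" using dfl_hom_pts[OF g] by (simp add: compose_def)
  show "w z = ?w z" using fun_cong[OF wu, of "upair x (upair (g x) e)"] m z by (simp add: compose_def)
 qed simp
 then show ?thesis using w by simp
qed

lemma func_simps [simp]:
 "FO id_func x = x" "FM id_func x y u = u"
 "FO (comp_func G F) x = FO G (FO F x)" "FM (comp_func G F) x y u = FM G (FO F x) (FO F y) (FM F x y u)"
 by (simp_all add: id_func_def comp_func_def)

lemma pseudofunctor_VBun_Dfg: "pseudofunctor_op Dfg (VBun_Dfg :: ('u::universe dfl, 'u => 'u, 'u vbundle, 'u => 'u) pseudo)"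
 unfolding pseudofunctor_op_def Let_def VBun_Dfg_simps pb_func_simps Obj_VBun Hom_VBun Cmp_VBun Id_VBun Hom_Dfg Cmp_Dfg Id_Dfg pb_bundle_simps
proof (intro conjI ballI is_category_Dfg is_category_VBun, unfold Obj_VBun)
 fix a b :: "'u dfl" and f assume a: "a \<in> Obj Dfg" and b: "b \<in> Obj Dfg" and f: "f \<in> dfl_hom a b"
 show "is_functor (VBun_cat b) (VBun_cat a) (pb_func a f)" by (rule pb_functor[OF b a f])
next
 fix a :: "'u dfl" assume a: "a \<in> Obj Dfg"
 show "natural_iso (VBun_cat a) (VBun_cat a) id_func (pb_func a (\<lambda>x\<in>pts a. x)) (\<lambda>E. \<lambda>e\<in>pts (tot E). upair (prj E e) e)"
  unfolding natural_iso_def Hom_VBun Cmp_VBun func_simps pb_func_simps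
 proof (intro conjI ballI, unfold Obj_VBun)
  show "(\<lambda>e\<in>pts (tot E). upair (prj E e) e) \<in> Iso (VBun_cat a) E (pb_bundle a (\<lambda>x\<in>pts a. x) E)"
   if "vector_bundle a E" for E using unit_iso[OF that] .
  fix E E' u assume E: "vector_bundle a E" and u: "u \<in> bundle_hom a E E'"
  show "compose (pts (tot E)) (\<lambda>e\<in>pts (tot E'). upair (prj E' e) e) u =
   compose (pts (tot E)) (pb_map a (\<lambda>x\<in>pts a. x) E u) (\<lambda>e\<in>pts (tot E). upair (prj E e) e)"
   using bundle_homD(2,3)[OF u E] vector_bundleD(8)[OF E] by (auto simp: fun_eq_iff compose_def)
 qed
next
 fix a b c :: "'u dfl" and f g assume a: "a \<in> Obj Dfg" and b: "b \<in> Obj Dfg" and c: "c \<in> Obj Dfg"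
  and f: "f \<in> dfl_hom a b" and g: "g \<in> dfl_hom b c"
 show "natural_iso (VBun_cat c) (VBun_cat a) (comp_func (pb_func a f) (pb_func b g)) (pb_func a (compose (pts a) g f))
  (\<lambda>E. \<lambda>z\<in>pts (pb_space a f (pb_bundle b g E)). upair (ufst z) (usnd (usnd z)))"
  unfolding natural_iso_def Hom_VBun Cmp_VBun func_simps pb_func_simps pb_bundle_simps(1)
 proof (intro conjI ballI, unfold Obj_VBun)
  show "flatten a f (pb_bundle b g E) \<in> Iso (VBun_cat a) (pb_bundle a f (pb_bundle b g E)) (pb_bundle a (compose (pts a) g f) E)"
   if "vector_bundle c E" for E using comb_inverse_arrows[OF that b a g f] by (auto simp: Iso_def)
  fix E E' u assume E: "vector_bundle c E" and u: "u \<in> bundle_hom c E E'"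
  show "compose (pts (pb_space a f (pb_bundle b g E))) (flatten a f (pb_bundle b g E')) (pb_map a f (pb_bundle b g E) (pb_map b g E u)) =
   compose (pts (pb_space a f (pb_bundle b g E))) (pb_map a (compose (pts a) g f) E u) (flatten a f (pb_bundle b g E))"
   using bundle_homD(2,3)[OF u E] by (auto simp: fun_eq_iff compose_def elim!: pb2_cases)
 qed
next
 fix a b :: "'u dfl" and f E assume f: "f \<in> dfl_hom a b" and E: "vector_bundle b E"
 note fp = dfl_hom_pts[OF f]
 show "compose (pts (pb_space a f E)) (flatten a (\<lambda>x\<in>pts a. x) (pb_bundle a f E))
   (\<lambda>e\<in>pts (pb_space a f E). upair (prj (pb_bundle a f E) e) e) = (\<lambda>e\<in>pts (pb_space a f E). e)"
  by (auto simp: fun_eq_iff compose_def elim!: pb_cases)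
 show "compose (pts (pb_space a f E)) (flatten a f (pb_bundle b (\<lambda>x\<in>pts b. x) E))
   (pb_map a f E (\<lambda>e\<in>pts (tot E). upair (prj E e) e)) = (\<lambda>e\<in>pts (pb_space a f E). e)"
  using fp vector_bundleD(8)[OF E] by (auto simp: fun_eq_iff compose_def elim!: pb_cases)
next
 fix a b c d :: "'u dfl" and f g h E assume f: "f \<in> dfl_hom a b" and g: "g \<in> dfl_hom b c" and h: "h \<in> dfl_hom c d"
  and E: "vector_bundle d E"
 note fp = dfl_hom_pts[OF f] and gp = dfl_hom_pts[OF g]
 show "compose (pts (pb_space a f (pb_bundle b g (pb_bundle c h E))))
   (flatten a f (pb_bundle b (compose (pts b) h g) E))
   (pb_map a f (pb_bundle b g (pb_bundle c h E)) (flatten b g (pb_bundle c h E))) =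
  compose (pts (pb_space a f (pb_bundle b g (pb_bundle c h E))))
   (flatten a (compose (pts a) g f) (pb_bundle c h E))
   (flatten a f (pb_bundle b g (pb_bundle c h E)))"
  using fp gp by (auto simp: fun_eq_iff compose_def elim!: pb_cases)
qed

section \<open>The strict model\<close>

lemma strict_functor_opD:
 assumes "strict_functor_op C D"
 shows "is_category C" "a \<in> Obj C ==> is_category (Val D a)"
  "a \<in> Obj C ==> b \<in> Obj C ==> f \<in> Hom C a b ==> is_functor (Val D b) (Val D a) (Res D a b f)"
  "a \<in> Obj C ==> x \<in> Obj (Val D a) ==> FO (Res D a a (Id C a)) x = x"
  "a \<in> Obj C ==> x \<in> Obj (Val D a) ==> y \<in> Obj (Val D a) ==> u \<in> Hom (Val D a) x y ==>
   FM (Res D a a (Id C a)) x y u = u"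
  "a \<in> Obj C ==> b \<in> Obj C ==> c \<in> Obj C ==> f \<in> Hom C a b ==> g \<in> Hom C b c ==> x \<in> Obj (Val D c) ==>
   FO (Res D a c (Cmp C a b c g f)) x = FO (Res D a b f) (FO (Res D b c g) x)"
  "a \<in> Obj C ==> b \<in> Obj C ==> c \<in> Obj C ==> f \<in> Hom C a b ==> g \<in> Hom C b c ==> x \<in> Obj (Val D c) ==>
   y \<in> Obj (Val D c) ==> u \<in> Hom (Val D c) x y ==>
   FM (Res D a c (Cmp C a b c g f)) x y u =
   FM (Res D a b f) (FO (Res D b c g) x) (FO (Res D b c g) y) (FM (Res D b c g) x y u)"
 using assms unfolding strict_functor_op_def comp_func_def by simp_all

lemma identity_inverse_arrows:
 "is_category C ==> x \<in> Obj C ==> inverse_arrows C x x (Id C x) (Id C x)"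
 by (simp add: inverse_arrows_def is_categoryD)

text \<open>All coherence isomorphisms are identities, and each law reduces to the unit law of composition.\<close>

lemma pseudofunctor_as_pseudo:
 assumes D: "strict_functor_op C D"
 shows "pseudofunctor_op C (as_pseudo D)"
proof -
 note S = strict_functor_opD[OF D]
 note cat = is_categoryD[OF S(2)]
 note Fn = is_functorD[OF S(3)]
 note cC = is_categoryD[OF S(1)]
 have idiso: "Id (Val D a) x \<in> Iso (Val D a) x x" if "a \<in> Obj C" "x \<in> Obj (Val D a)" for a x
  using identity_inverse_arrows[OF S(2)[OF that(1)] that(2)] by (auto simp: Iso_def)
 show ?thesis
  unfolding pseudofunctor_op_def as_pseudo_def Let_def
 proof (simp, intro conjI ballI, goal_cases)
  case 1 show ?case by (rule S(1))
 next
  case (2 a) then show ?case by (rule S(2))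
 next
  case (3 a b f) then show ?case by (rule S(3))
 next
  case (4 a) then show ?case
   unfolding natural_iso_def id_func_def using S(4,5)[OF 4] cat[OF 4] idiso[OF 4] by simp
 next
  case (5 a b c f g) then show ?case
   unfolding natural_iso_def comp_func_def
   using S(6,7)[OF 5] cat[OF 5(1)] idiso[OF 5(1)] Fn(3,4)[OF 5(1,2,4)] Fn(3,4)[OF 5(2,3,5)] by simp
 next
  case (6 a b f x)
  note fx = Fn(3)[OF 6]
  show ?case using S(4)[OF 6(1) fx] cat(1,3)[OF 6(1) fx] fx cat(3)[OF 6(1) fx fx cat(1)[OF 6(1) fx]] by simp
 next
  case (7 a b f x)
  note fx = Fn(3)[OF 7]
  show ?case using S(4)[OF 7(2,4)] Fn(5)[OF 7] cat(3)[OF 7(1) fx fx cat(1)[OF 7(1) fx]] by simp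
 next
  case (8 a b c d f g h x)
  note hx = Fn(3)[OF 8(3,4,7,8)]
  show ?case
   using S(6)[OF 8(2-4,6-8)] S(6)[OF 8(1,2,4,5) cC(2)[OF 8(2-4,6,7)] 8(8)] S(6)[OF 8(1-3,5,6) hx]
    Fn(5)[OF 8(1,2,5) Fn(3)[OF 8(2,3,6) hx]] by simp
 qed
qed

lemma holim_objD:
 assumes "(x, h) \<in> holim_obj J D"
 shows "x \<in> extensional (Obj J)" "a \<in> Obj J ==> x a \<in> Obj (Val D a)" "h \<in> extensional (arrows J)"
  "(a, b, f) \<in> arrows J ==> h (a, b, f) \<in> Iso (Val D a) (x a) (FO (Res D a b f) (x b))"
  "a \<in> Obj J ==> h (a, a, Id J a) = Id (Val D a) (x a)"
  "a \<in> Obj J ==> b \<in> Obj J ==> c \<in> Obj J ==> f \<in> Hom J a b ==> g \<in> Hom J b c ==> h (a, c, Cmp J a b c g f) =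
    Cmp (Val D a) (x a) (FO (Res D a b f) (x b)) (FO (Res D a b f) (FO (Res D b c g) (x c)))
     (FM (Res D a b f) (x b) (FO (Res D b c g) (x c)) (h (b, c, g))) (h (a, b, f))"
 using assms unfolding holim_obj_def by (auto simp: PiE_def Pi_def)

lemma arrowsD: "(a, b, f) \<in> arrows C \<longleftrightarrow> a \<in> Obj C \<and> b \<in> Obj C \<and> f \<in> Hom C a b"
 by (simp add: arrows_def)

lemma holim_homD:
 assumes "u \<in> holim_hom J D (x, h) (y, k)"
 shows "u \<in> extensional (Obj J)" "a \<in> Obj J ==> u a \<in> Hom (Val D a) (x a) (y a)"
  "(a, b, f) \<in> arrows J ==>
     Cmp (Val D a) (x a) (y a) (FO (Res D a b f) (y b)) (k (a, b, f)) (u a) =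
     Cmp (Val D a) (x a) (FO (Res D a b f) (x b)) (FO (Res D a b f) (y b))
      (FM (Res D a b f) (x b) (y b) (u b)) (h (a, b, f))"
 using assms unfolding holim_hom_def by (auto simp: PiE_def Pi_def)

lemma holim_objI:
 assumes "x \<in> extensional (Obj J)" "\<And>a. a \<in> Obj J ==> x a \<in> Obj (Val D a)" "h \<in> extensional (arrows J)"
  "\<And>a b f. (a, b, f) \<in> arrows J ==> h (a, b, f) \<in> Iso (Val D a) (x a) (FO (Res D a b f) (x b))"
  "\<And>a. a \<in> Obj J ==> h (a, a, Id J a) = Id (Val D a) (x a)"
  "\<And>a b c f g. a \<in> Obj J ==> b \<in> Obj J ==> c \<in> Obj J ==> f \<in> Hom J a b ==> g \<in> Hom J b c ==> h (a, c, Cmp J a b c g f) =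
    Cmp (Val D a) (x a) (FO (Res D a b f) (x b)) (FO (Res D a b f) (FO (Res D b c g) (x c)))
     (FM (Res D a b f) (x b) (FO (Res D b c g) (x c)) (h (b, c, g))) (h (a, b, f))"
 shows "(x, h) \<in> holim_obj J D"
 using assms unfolding holim_obj_def by (auto simp: PiE_def Pi_def)

lemma holim_homI:
 assumes "u \<in> extensional (Obj J)" "\<And>a. a \<in> Obj J ==> u a \<in> Hom (Val D a) (x a) (y a)"
  "\<And>a b f. (a, b, f) \<in> arrows J ==>
     Cmp (Val D a) (x a) (y a) (FO (Res D a b f) (y b)) (k (a, b, f)) (u a) =
     Cmp (Val D a) (x a) (FO (Res D a b f) (x b)) (FO (Res D a b f) (y b))
      (FM (Res D a b f) (x b) (y b) (u b)) (h (a, b, f))"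
 shows "u \<in> holim_hom J D (x, h) (y, k)"
 using assms unfolding holim_hom_def by (auto simp: PiE_def Pi_def)

lemma holim_simps [simp]:
 "Obj (holim J D) = holim_obj J D" "Hom (holim J D) = holim_hom J D"
 "Id (holim J D) (x, h) = (\<lambda>a\<in>Obj J. Id (Val D a) (x a))"
 "Cmp (holim J D) (x, h) (y, k) (z, l) v u = (\<lambda>a\<in>Obj J. Cmp (Val D a) (x a) (y a) (z a) (v a) (u a))"
 by (simp_all add: holim_def)

lemma is_category_holim:
 assumes cat: "\<And>a. a \<in> Obj J ==> is_category (Val D a)"
  and func: "\<And>a b f. (a, b, f) \<in> arrows J ==> is_functor (Val D b) (Val D a) (Res D a b f)"
 shows "is_category (holim J D)"
 unfolding is_category_def holim_simps
proof (intro conjI ballI; clarify?)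
 note C = is_categoryD[OF cat] and F = is_functorD[OF func]
 fix x h assume X: "(x, h) \<in> holim_obj J D"
 note xD = holim_objD[OF X]
 have hH: "h (a, b, f) \<in> Hom (Val D a) (x a) (FO (Res D a b f) (x b))" if "(a, b, f) \<in> arrows J" for a b f
  using xD(4)[OF that] by (auto simp: Iso_def inverse_arrows_def)
 show "Id (holim J D) (x, h) \<in> holim_hom J D (x, h) (x, h)"
  unfolding holim_simps
 proof (rule holim_homI)
  show "restrict (\<lambda>a. Id (Val D a) (x a)) (Obj J) a \<in> Hom (Val D a) (x a) (x a)" if "a \<in> Obj J" for a
   using C(1)[OF that xD(2)[OF that]] that by simp
  fix a b f assume ar: "(a, b, f) \<in> arrows J"
  then have a: "a \<in> Obj J" and b: "b \<in> Obj J" by (auto simp: arrowsD)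
  show "Cmp (Val D a) (x a) (x a) (FO (Res D a b f) (x b)) (h (a, b, f)) (restrict (\<lambda>a. Id (Val D a) (x a)) (Obj J) a) =
   Cmp (Val D a) (x a) (FO (Res D a b f) (x b)) (FO (Res D a b f) (x b))
    (FM (Res D a b f) (x b) (x b) (restrict (\<lambda>a. Id (Val D a) (x a)) (Obj J) b)) (h (a, b, f))"
   using a b F(5)[OF ar xD(2)[OF b]] C(3)[OF a xD(2)[OF a] F(3)[OF ar xD(2)[OF b]] hH[OF ar]]
    C(4)[OF a xD(2)[OF a] F(3)[OF ar xD(2)[OF b]] hH[OF ar]] by simp
 qed simp
 fix y k assume Y: "(y, k) \<in> holim_obj J D"
 note yD = holim_objD[OF Y]
 have kH: "k (a, b, f) \<in> Hom (Val D a) (y a) (FO (Res D a b f) (y b))" if "(a, b, f) \<in> arrows J" for a b f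
  using yD(4)[OF that] by (auto simp: Iso_def inverse_arrows_def)
 {
  fix u assume u: "u \<in> holim_hom J D (x, h) (y, k)"
  note uD = holim_homD[OF u]
  show "Cmp (holim J D) (x, h) (x, h) (y, k) u (Id (holim J D) (x, h)) = u"
   "Cmp (holim J D) (x, h) (y, k) (y, k) (Id (holim J D) (y, k)) u = u"
   using uD(1) C(3)[OF _ xD(2) yD(2) uD(2)] C(4)[OF _ xD(2) yD(2) uD(2)] by (auto simp: fun_eq_iff extensional_def)
 }
 fix z l assume Z: "(z, l) \<in> holim_obj J D"
 note zD = holim_objD[OF Z]
 fix u v assume u: "u \<in> holim_hom J D (x, h) (y, k)" and v: "v \<in> holim_hom J D (y, k) (z, l)"
 note uD = holim_homD[OF u] and vD = holim_homD[OF v]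
 show "Cmp (holim J D) (x, h) (y, k) (z, l) v u \<in> holim_hom J D (x, h) (z, l)"
  unfolding holim_simps
 proof (rule holim_homI)
  show "restrict (\<lambda>a. Cmp (Val D a) (x a) (y a) (z a) (v a) (u a)) (Obj J) a \<in> Hom (Val D a) (x a) (z a)" if "a \<in> Obj J" for a
   using C(2)[OF that xD(2)[OF that] yD(2)[OF that] zD(2)[OF that] uD(2)[OF that] vD(2)[OF that]] that by simp
  fix a b f assume ar: "(a, b, f) \<in> arrows J"
  then have a: "a \<in> Obj J" and b: "b \<in> Obj J" by (auto simp: arrowsD)
  note xa = xD(2)[OF a] and ya = yD(2)[OF a] and za = zD(2)[OF a] and xb = xD(2)[OF b] and yb = yD(2)[OF b] and zb = zD(2)[OF b]
  note fx = F(3)[OF ar xb] and fy = F(3)[OF ar yb] and fz = F(3)[OF ar zb]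
  note ua = uD(2)[OF a] and va = vD(2)[OF a] and ub = uD(2)[OF b] and vb = vD(2)[OF b]
  note fu = F(4)[OF ar xb yb ub] and fv = F(4)[OF ar yb zb vb]
  have lH: "l (a, b, f) \<in> Hom (Val D a) (z a) (FO (Res D a b f) (z b))"
   using zD(4)[OF ar] by (auto simp: Iso_def inverse_arrows_def)
  have "Cmp (Val D a) (x a) (z a) (FO (Res D a b f) (z b)) (l (a, b, f)) (Cmp (Val D a) (x a) (y a) (z a) (v a) (u a))
   = Cmp (Val D a) (x a) (y a) (FO (Res D a b f) (z b)) (Cmp (Val D a) (y a) (z a) (FO (Res D a b f) (z b)) (l (a, b, f)) (v a)) (u a)"
   by (rule C(5)[OF a xa ya za fz ua va lH, symmetric])
  also have "\<dots> = Cmp (Val D a) (x a) (y a) (FO (Res D a b f) (z b)) (Cmp (Val D a) (y a) (FO (Res D a b f) (y b)) (FO (Res D a b f) (z b))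
    (FM (Res D a b f) (y b) (z b) (v b)) (k (a, b, f))) (u a)" by (simp only: vD(3)[OF ar])
  also have "\<dots> = Cmp (Val D a) (x a) (FO (Res D a b f) (y b)) (FO (Res D a b f) (z b)) (FM (Res D a b f) (y b) (z b) (v b))
    (Cmp (Val D a) (x a) (y a) (FO (Res D a b f) (y b)) (k (a, b, f)) (u a))"
   by (rule C(5)[OF a xa ya fy fz ua kH[OF ar] fv])
  also have "\<dots> = Cmp (Val D a) (x a) (FO (Res D a b f) (y b)) (FO (Res D a b f) (z b)) (FM (Res D a b f) (y b) (z b) (v b))
    (Cmp (Val D a) (x a) (FO (Res D a b f) (x b)) (FO (Res D a b f) (y b)) (FM (Res D a b f) (x b) (y b) (u b)) (h (a, b, f)))"
   by (simp only: uD(3)[OF ar])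
  also have "\<dots> = Cmp (Val D a) (x a) (FO (Res D a b f) (x b)) (FO (Res D a b f) (z b))
    (Cmp (Val D a) (FO (Res D a b f) (x b)) (FO (Res D a b f) (y b)) (FO (Res D a b f) (z b)) (FM (Res D a b f) (y b) (z b) (v b)) (FM (Res D a b f) (x b) (y b) (u b)))
    (h (a, b, f))"
   by (rule C(5)[OF a xa fx fy fz hH[OF ar] fu fv, symmetric])
  also have "\<dots> = Cmp (Val D a) (x a) (FO (Res D a b f) (x b)) (FO (Res D a b f) (z b))
    (FM (Res D a b f) (x b) (z b) (Cmp (Val D b) (x b) (y b) (z b) (v b) (u b))) (h (a, b, f))"
   by (simp only: F(6)[OF ar xb yb zb ub vb])
  finally show "Cmp (Val D a) (x a) (z a) (FO (Res D a b f) (z b)) (l (a, b, f))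
    (restrict (\<lambda>a. Cmp (Val D a) (x a) (y a) (z a) (v a) (u a)) (Obj J) a) =
   Cmp (Val D a) (x a) (FO (Res D a b f) (x b)) (FO (Res D a b f) (z b))
    (FM (Res D a b f) (x b) (z b) (restrict (\<lambda>a. Cmp (Val D a) (x a) (y a) (z a) (v a) (u a)) (Obj J) b)) (h (a, b, f))"
   using a b by simp
 qed simp
 fix w m w' assume W: "(w, m) \<in> holim_obj J D" and w': "w' \<in> holim_hom J D (z, l) (w, m)"
 note wD = holim_objD[OF W] and w'D = holim_homD[OF w']
 show "Cmp (holim J D) (x, h) (y, k) (w, m) (Cmp (holim J D) (y, k) (z, l) (w, m) w' v) u =
  Cmp (holim J D) (x, h) (z, l) (w, m) w' (Cmp (holim J D) (x, h) (y, k) (z, l) v u)"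
  using C(5)[OF _ xD(2) yD(2) zD(2) wD(2) uD(2) vD(2) w'D(2)] by (auto simp: fun_eq_iff)
qed

lemma holim_restrict_simps [simp]:
 "FO (holim_restrict J' P) (x, h) = (\<lambda>a\<in>Obj J'. x (FO P a), \<lambda>(a, b, f)\<in>arrows J'. h (FO P a, FO P b, FM P a b f))"
 "FM (holim_restrict J' P) X Y u = (\<lambda>a\<in>Obj J'. u (FO P a))"
 by (simp_all add: holim_restrict_def)

text \<open>Restricting a coherent family along \<open>P\<close> is again coherent because the cocycle identities are
instances of the old ones.\<close>

lemma functor_holim_restrict:
 assumes cat: "\<And>a. a \<in> Obj J ==> is_category (Val D a)"
  and func: "\<And>a b f. (a, b, f) \<in> arrows J ==> is_functor (Val D b) (Val D a) (Res D a b f)"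
  and P: "is_functor J' J P"
 shows "is_functor (holim J D) (holim J' (reindex P D)) (holim_restrict J' P)"
proof -
 note J' = is_categoryD[OF is_functorD(1)[OF P]] and P = is_functorD[OF P]
 have Par: "(FO P a, FO P b, FM P a b f) \<in> arrows J" if "(a, b, f) \<in> arrows J'" for a b f
  using that P by (simp add: arrowsD)
 have R [simp]: "Val (reindex P D) a = Val D (FO P a)" "Res (reindex P D) a b f = Res D (FO P a) (FO P b) (FM P a b f)" for a b f
  by (simp_all add: reindex_def)
 show ?thesis
  unfolding is_functor_def
 proof (intro conjI ballI; (clarsimp simp del: holim_restrict_simps)?)
  show "is_category (holim J D)" by (rule is_category_holim[OF cat func])
  show "is_category (holim J' (reindex P D))"
   by (rule is_category_holim) (use cat func Par P in auto)
 next
  fix x h assume X: "(x, h) \<in> holim_obj J D"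
  note xD = holim_objD[OF X]
  show "FO (holim_restrict J' P) (x, h) \<in> holim_obj J' (reindex P D)"
   unfolding holim_restrict_simps
  proof (rule holim_objI, goal_cases)
   case (2 a) then show ?case using xD(2) P(3) by simp
  next
   case (4 a b f) then show ?case using xD(4)[OF Par[OF 4]] by (simp add: arrowsD)
  next
   case (5 a) then show ?case using J'(1)[OF 5] P(5)[OF 5] xD(5)[OF P(3)[OF 5]] by (simp add: arrowsD)
  next
   case (6 a b c f g) then show ?case
    using J'(2)[OF 6] P(6)[OF 6] xD(6)[OF P(3)[OF 6(1)] P(3)[OF 6(2)] P(3)[OF 6(3)] P(4)[OF 6(1,2,4)] P(4)[OF 6(2,3,5)]]
    by (simp add: arrowsD)
  qed simp_all
  show "FM (holim_restrict J' P) (x, h) (x, h) (\<lambda>a\<in>Obj J. Id (Val D a) (x a)) =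
    Id (holim J' (reindex P D)) (FO (holim_restrict J' P) (x, h))"
   using P(3) by (auto simp: fun_eq_iff)
  fix y k u assume Y: "(y, k) \<in> holim_obj J D" and u: "u \<in> holim_hom J D (x, h) (y, k)"
  note uD = holim_homD[OF u]
  show "FM (holim_restrict J' P) (x, h) (y, k) u \<in> holim_hom J' (reindex P D) (FO (holim_restrict J' P) (x, h)) (FO (holim_restrict J' P) (y, k))"
   unfolding holim_restrict_simps
  proof (rule holim_homI, goal_cases)
   case (2 a) then show ?case using uD(2)[OF P(3)[OF 2]] by simp
  next
   case (3 a b f) then show ?case using uD(3)[OF Par[OF 3]] by (simp add: arrowsD)
  qed simp
  fix z l v
  show "FM (holim_restrict J' P) (x, h) (z, l) (\<lambda>a\<in>Obj J. Cmp (Val D a) (x a) (y a) (z a) (v a) (u a)) =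
    Cmp (holim J' (reindex P D)) (FO (holim_restrict J' P) (x, h)) (FO (holim_restrict J' P) (y, k)) (FO (holim_restrict J' P) (z, l))
     (FM (holim_restrict J' P) (y, k) (z, l) v) (FM (holim_restrict J' P) (x, h) (y, k) u)"
   using P(3) by (auto simp: fun_eq_iff)
 qed
qed

lemma Cmp_Cart: "Cmp Cart c d e g f = compose c g f" by (simp add: Cart_def)
lemma Id_Cart: "Id Cart c = (\<lambda>x\<in>c. x)" by (simp add: Cart_def)

lemma Hom_Cart_compose:
 assumes "c \<in> Obj Cart" "f \<in> Hom Cart c d" "g \<in> Hom Cart d e"
 shows "compose c g f \<in> Hom Cart c e"
 unfolding Hom_Cart_iff
proof
 have "smooth_map c e (\<lambda>x. g (f x))"
  by (rule smooth_map_compose[OF Cart_locally_bounded[OF assms(1)]]) (use assms in "auto simp: Hom_Cart_iff")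
 then show "smooth_map c e (compose c g f)" by (rule smooth_map_cong[rotated]) (simp add: compose_def)
qed simp

lemma Hom_Cart_id: "(\<lambda>x\<in>c. x) \<in> Hom Cart c c"
 unfolding Hom_Cart_iff by (auto intro: smooth_map_cong[OF _ smooth_map_id[OF subset_refl]])

lemma Hom_Cart_mem: "f \<in> Hom Cart c d ==> x \<in> c ==> f x \<in> d"
 by (auto simp: Hom_Cart_iff intro: smooth_map_image)

lemma Obj_plot_cat: "(c, \<phi>) \<in> Obj (plot_cat X) \<longleftrightarrow> c \<in> Obj Cart \<and> \<phi> \<in> plots X c"
 by (simp add: plot_cat_def)

lemma Hom_plot_cat: "f \<in> Hom (plot_cat X) (c0, \<phi>0) (c1, \<phi>1) \<longleftrightarrow> f \<in> Hom Cart c0 c1 \<and> compose c0 \<phi>1 f = \<phi>0"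
 by (simp add: plot_cat_def)

lemma Id_plot_cat: "Id (plot_cat X) (c, \<phi>) = (\<lambda>x\<in>c. x)"
 by (simp add: plot_cat_def Id_Cart)

lemma Cmp_plot_cat: "Cmp (plot_cat X) (c0, \<phi>0) (c1, \<phi>1) (c2, \<phi>2) g f = compose c0 g f"
 by (simp add: plot_cat_def Cmp_Cart)

lemma is_category_plot_cat:
 assumes X: "diffeological_space X"
 shows "is_category (plot_cat X)"
 unfolding is_category_def
proof (intro conjI ballI; clarify?)
 fix c \<phi> assume "(c, \<phi>) \<in> Obj (plot_cat X)"
 then have c: "c \<in> Obj Cart" "\<phi> \<in> plots X c" by (auto simp: Obj_plot_cat)
 have "compose c \<phi> (\<lambda>x\<in>c. x) = \<phi>"
  using dfl_plots_PiE[OF X c(2)] by (auto simp: compose_def fun_eq_iff PiE_def extensional_def)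
 then show "Id (plot_cat X) (c, \<phi>) \<in> Hom (plot_cat X) (c, \<phi>) (c, \<phi>)"
  by (simp add: Id_plot_cat Hom_plot_cat Hom_Cart_id)
 fix c1 \<phi>1 f assume "f \<in> Hom (plot_cat X) (c, \<phi>) (c1, \<phi>1)"
 then have f: "f \<in> Hom Cart c c1" "compose c \<phi>1 f = \<phi>" by (auto simp: Hom_plot_cat)
 then show "Cmp (plot_cat X) (c, \<phi>) (c, \<phi>) (c1, \<phi>1) f (Id (plot_cat X) (c, \<phi>)) = f"
  "Cmp (plot_cat X) (c, \<phi>) (c1, \<phi>1) (c1, \<phi>1) (Id (plot_cat X) (c1, \<phi>1)) f = f"
  using Hom_Cart_mem[OF f(1)] by (auto simp: Id_plot_cat Cmp_plot_cat Hom_Cart_iff compose_def fun_eq_iff extensional_def)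
 fix c2 \<phi>2 g assume "g \<in> Hom (plot_cat X) (c1, \<phi>1) (c2, \<phi>2)"
 then have g: "g \<in> Hom Cart c1 c2" "compose c1 \<phi>2 g = \<phi>1" by (auto simp: Hom_plot_cat)
 have "compose c \<phi>2 (compose c g f) = compose c (compose c1 \<phi>2 g) f"
  using Hom_Cart_mem[OF f(1)] by (auto simp: compose_def fun_eq_iff)
 then have "compose c \<phi>2 (compose c g f) = \<phi>" by (simp only: f(2) g(2))
 then show "Cmp (plot_cat X) (c, \<phi>) (c1, \<phi>1) (c2, \<phi>2) g f \<in> Hom (plot_cat X) (c, \<phi>) (c2, \<phi>2)"
  using Hom_Cart_compose[OF c(1) f(1) g(1)] by (simp add: Cmp_plot_cat Hom_plot_cat)
 fix c3 \<phi>3 h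
 show "Cmp (plot_cat X) (c, \<phi>) (c1, \<phi>1) (c3, \<phi>3) (Cmp (plot_cat X) (c1, \<phi>1) (c2, \<phi>2) (c3, \<phi>3) h g) f =
  Cmp (plot_cat X) (c, \<phi>) (c2, \<phi>2) (c3, \<phi>3) h (Cmp (plot_cat X) (c, \<phi>) (c1, \<phi>1) (c2, \<phi>2) g f)"
  using Hom_Cart_mem[OF f(1)] by (auto simp: Cmp_plot_cat compose_def fun_eq_iff)
qed

lemma Obj_triv [simp]: "Obj (VBun_triv_cat c) = UNIV" by (simp add: VBun_triv_cat_def)

lemma Hom_triv: "M \<in> Hom (VBun_triv_cat c) n m \<longleftrightarrow> M \<in> extensional c \<and> smooth_mat c m n M"
 by (auto simp: VBun_triv_cat_def smooth_mat_def PiE_def Pi_def)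

lemma Id_triv [simp]: "Id (VBun_triv_cat c) n = (\<lambda>y\<in>c. 1\<^sub>m n)" by (simp add: VBun_triv_cat_def)
lemma Cmp_triv [simp]: "Cmp (VBun_triv_cat c) n m l N M = (\<lambda>y\<in>c. N y * M y)" by (simp add: VBun_triv_cat_def)

lemma smooth_mat_restrict: "smooth_mat c m n M ==> smooth_mat c m n (\<lambda>y\<in>c. M y)"
 by (rule smooth_mat_cong[rotated]) auto

lemma is_category_triv: "is_category (VBun_triv_cat c)"
 unfolding is_category_def
proof (intro conjI ballI)
 show "Id (VBun_triv_cat c) n \<in> Hom (VBun_triv_cat c) n n" for n
  by (simp add: Hom_triv smooth_mat_restrict smooth_mat_one)
 fix n m M assume M: "M \<in> Hom (VBun_triv_cat c) n m"
 then have Mc: "\<And>y. y \<in> c ==> M y \<in> carrier_mat m n" by (simp add: Hom_triv smooth_mat_def)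
 show "Cmp (VBun_triv_cat c) n n m M (Id (VBun_triv_cat c) n) = M"
  "Cmp (VBun_triv_cat c) n m m (Id (VBun_triv_cat c) m) M = M"
  using M right_mult_one_mat[OF Mc] left_mult_one_mat[OF Mc] by (auto simp: fun_eq_iff Hom_triv extensional_def)
 fix l N assume N: "N \<in> Hom (VBun_triv_cat c) m l"
 then have Nc: "\<And>y. y \<in> c ==> N y \<in> carrier_mat l m" by (simp add: Hom_triv smooth_mat_def)
 show "Cmp (VBun_triv_cat c) n m l N M \<in> Hom (VBun_triv_cat c) n l"
  using M N by (auto simp: Hom_triv intro!: smooth_mat_restrict smooth_mat_mult[where n=m])
 fix k P assume P: "P \<in> Hom (VBun_triv_cat c) l k"
 then have Pc: "\<And>y. y \<in> c ==> P y \<in> carrier_mat k l" by (simp add: Hom_triv smooth_mat_def)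
 show "Cmp (VBun_triv_cat c) n m k (Cmp (VBun_triv_cat c) m l k P N) M =
  Cmp (VBun_triv_cat c) n l k P (Cmp (VBun_triv_cat c) n m l N M)"
  using Mc Nc Pc by (auto simp: fun_eq_iff assoc_mult_mat[of _ k l _ m _ n])
qed

abbreviation triv_diagram :: "('u plot, rinf => rinf, nat, rinf => complex mat) diagram" where
 "triv_diagram \<equiv> reindex plot_dom VBun_triv"

lemma triv_diagram_simps [simp]:
 "Val triv_diagram a = VBun_triv_cat (fst a)" "FO (Res triv_diagram a b f) n = n"
 "FM (Res triv_diagram a b f) n m M = compose (fst a) M f"
 by (simp_all add: reindex_def plot_dom_def VBun_triv_def)

lemma triv_functor:
 assumes "(a, b, f) \<in> arrows (plot_cat X)"
 shows "is_functor (VBun_triv_cat (fst b)) (VBun_triv_cat (fst a)) (Res triv_diagram a b f)"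
proof -
 obtain c0 \<phi>0 c1 \<phi>1 where ab: "a = (c0, \<phi>0)" "b = (c1, \<phi>1)" by (cases a, cases b)
 have c0: "c0 \<in> Obj Cart" and f: "smooth_map c0 c1 f"
  using assms by (auto simp: ab arrowsD Obj_plot_cat Hom_plot_cat Hom_Cart_iff)
 show ?thesis
  unfolding is_functor_def triv_diagram_simps
  using smooth_map_image[OF f] smooth_mat_compose[OF Cart_locally_bounded[OF c0] f]
  by (auto simp: ab is_category_triv Hom_triv compose_def fun_eq_iff intro!: smooth_mat_restrict)
qed

abbreviation "Str X \<equiv> holim (plot_cat X) triv_diagram"
abbreviation "Str_obj X \<equiv> holim_obj (plot_cat X) triv_diagram"
abbreviation "Str_hom X \<equiv> holim_hom (plot_cat X) triv_diagram"

lemma VBun_str_simps [simp]: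
 "Val VBun_str X = Str X" "Res VBun_str X' X g = holim_restrict (plot_cat X') (plot_push g)"
 by (simp_all add: VBun_str_def)

lemma plot_push_simps [simp]: "FO (plot_push g) (c, \<phi>) = (c, compose c g \<phi>)" "FM (plot_push g) a b f = f"
 by (simp_all add: plot_push_def)

lemma reindex_push: "reindex (plot_push g) triv_diagram = triv_diagram"
 by (simp add: reindex_def plot_dom_def plot_push_def VBun_triv_def fun_eq_iff)

lemma plot_push_functor:
 assumes X': "diffeological_space X'" and X: "diffeological_space X" and g: "g \<in> dfl_hom X' X"
 shows "is_functor (plot_cat X') (plot_cat X) (plot_push g)"
 unfolding is_functor_def
proof (intro conjI ballI is_category_plot_cat X X'; clarify?)
 fix c \<phi> assume "(c, \<phi>) \<in> Obj (plot_cat X')"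
 then have c: "c \<in> Obj Cart" "\<phi> \<in> plots X' c" by (auto simp: Obj_plot_cat)
 show "FO (plot_push g) (c, \<phi>) \<in> Obj (plot_cat X)"
  using dfl_hom_plots[OF X' g c(2)] c(1) by (simp add: Obj_plot_cat compose_def)
 show "FM (plot_push g) (c, \<phi>) (c, \<phi>) (Id (plot_cat X') (c, \<phi>)) = Id (plot_cat X) (FO (plot_push g) (c, \<phi>))"
  by (simp add: Id_plot_cat)
 fix c1 \<phi>1 f assume "f \<in> Hom (plot_cat X') (c, \<phi>) (c1, \<phi>1)"
 then have f: "f \<in> Hom Cart c c1" "compose c \<phi>1 f = \<phi>" by (auto simp: Hom_plot_cat)
 show "FM (plot_push g) (c, \<phi>) (c1, \<phi>1) f \<in> Hom (plot_cat X) (FO (plot_push g) (c, \<phi>)) (FO (plot_push g) (c1, \<phi>1))"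
 proof -
  have "compose c (compose c1 g \<phi>1) f = compose c g (compose c \<phi>1 f)"
   using Hom_Cart_mem[OF f(1)] by (auto simp: compose_def fun_eq_iff)
  then show ?thesis using f by (simp add: Hom_plot_cat)
 qed
 fix c2 \<phi>2 h
 show "FM (plot_push g) (c, \<phi>) (c2, \<phi>2) (Cmp (plot_cat X') (c, \<phi>) (c1, \<phi>1) (c2, \<phi>2) h f) =
  Cmp (plot_cat X) (FO (plot_push g) (c, \<phi>)) (FO (plot_push g) (c1, \<phi>1)) (FO (plot_push g) (c2, \<phi>2))
   (FM (plot_push g) (c1, \<phi>1) (c2, \<phi>2) h) (FM (plot_push g) (c, \<phi>) (c1, \<phi>1) f)"
  by (simp add: Cmp_plot_cat)
qed

lemma plot_push_id:
 assumes X: "diffeological_space X" and a: "a \<in> Obj (plot_cat X)"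
 shows "FO (plot_push (\<lambda>x\<in>pts X. x)) a = a"
proof (cases a)
 case (Pair c \<phi>)
 then have "\<phi> \<in> plots X c" using a by (simp add: Obj_plot_cat)
 then show ?thesis using dfl_plots_PiE[OF X] Pair
  by (fastforce simp: compose_def fun_eq_iff PiE_def extensional_def)
qed

lemma plot_push_compose:
 assumes X: "diffeological_space X" and a: "a \<in> Obj (plot_cat X)"
 shows "FO (plot_push (compose (pts X) g f)) a = FO (plot_push g) (FO (plot_push f) a)"
proof (cases a)
 case (Pair c \<phi>)
 then have "\<phi> \<in> plots X c" using a by (simp add: Obj_plot_cat)
 then show ?thesis using dfl_plots_pts[OF X] Pair by (auto simp: compose_def fun_eq_iff)
qed

text \<open>The arrow families are undefined off the arrows, so they are compared on arrows only.\<close>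

lemma restrict_arrows_cong:
 "(\<And>a b f. (a, b, f) \<in> arrows J ==> h (a, b, f) = k (a, b, f)) ==> restrict h (arrows J) = restrict k (arrows J)"
 by (intro restrict_ext) auto

lemma strict_functor_VBun_str: "strict_functor_op Dfg (VBun_str :: ('u::universe dfl, 'u => 'u, 'u str_obj, 'u str_mor) diagram)"
 unfolding strict_functor_op_def VBun_str_simps Hom_Dfg Id_Dfg Cmp_Dfg holim_simps
proof (intro conjI ballI is_category_Dfg; (clarify?))
 fix a :: "'u dfl" assume a: "a \<in> Obj Dfg"
 note da = Dfg_diffeological[OF a]
 show "is_category (Str a)"
  by (rule is_category_holim) (simp_all add: is_category_triv triv_functor)
 fix x h assume "(x, h) \<in> Str_obj a"
 note xD = holim_objD[OF this]
 have 1: "(\<lambda>p\<in>Obj (plot_cat a). x (FO (plot_push (\<lambda>x\<in>pts a. x)) p)) = x"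
  by (rule trans[OF restrict_ext extensional_restrict[OF xD(1)]]) (simp add: plot_push_id[OF da])
 have 2: "(\<lambda>(p, q, f)\<in>arrows (plot_cat a). h (FO (plot_push (\<lambda>x\<in>pts a. x)) p, FO (plot_push (\<lambda>x\<in>pts a. x)) q, FM (plot_push (\<lambda>x\<in>pts a. x)) p q f)) = h"
  by (rule trans[OF restrict_arrows_cong extensional_restrict[OF xD(3)]]) (simp add: plot_push_id[OF da] arrowsD)
 show "FO (holim_restrict (plot_cat a) (plot_push (\<lambda>x\<in>pts a. x))) (x, h) = (x, h)"
  using 1 2 by simp
 fix y k u assume "u \<in> Str_hom a (x, h) (y, k)"
 from holim_homD(1)[OF this]
 show "FM (holim_restrict (plot_cat a) (plot_push (\<lambda>x\<in>pts a. x))) (x, h) (y, k) u = u"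
  by (simp, intro trans[OF restrict_ext extensional_restrict]) (simp_all add: plot_push_id[OF da])
next
 fix a b :: "'u dfl" and f assume a: "a \<in> Obj Dfg" and b: "b \<in> Obj Dfg" and f: "f \<in> dfl_hom a b"
 note da = Dfg_diffeological[OF a] and db = Dfg_diffeological[OF b]
 have "is_functor (Str b) (holim (plot_cat a) (reindex (plot_push f) triv_diagram)) (holim_restrict (plot_cat a) (plot_push f))"
  by (rule functor_holim_restrict[OF _ _ plot_push_functor[OF da db f]]) (simp_all add: is_category_triv triv_functor)
 then show "is_functor (Str b) (Str a) (holim_restrict (plot_cat a) (plot_push f))"
  by (simp only: reindex_push)
next
 fix a b c :: "'u dfl" and f g assume a: "a \<in> Obj Dfg" and b: "b \<in> Obj Dfg" and f: "f \<in> dfl_hom a b"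
 note da = Dfg_diffeological[OF a] and db = Dfg_diffeological[OF b]
 note P = is_functorD[OF plot_push_functor[OF da db f]]
 note pc = plot_push_compose[OF da]
 fix x h
 have 1: "(\<lambda>p\<in>Obj (plot_cat a). x (FO (plot_push (compose (pts a) g f)) p)) =
  (\<lambda>p\<in>Obj (plot_cat a). (\<lambda>q\<in>Obj (plot_cat b). x (FO (plot_push g) q)) (FO (plot_push f) p))" for x
  by (rule restrict_ext) (simp add: P(3) pc)
 have 2: "(\<lambda>(p, q, u)\<in>arrows (plot_cat a). h (FO (plot_push (compose (pts a) g f)) p, FO (plot_push (compose (pts a) g f)) q, u)) =
  (\<lambda>(p, q, u)\<in>arrows (plot_cat a). (\<lambda>(p, q, u)\<in>arrows (plot_cat b). h (FO (plot_push g) p, FO (plot_push g) q, u))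
   (FO (plot_push f) p, FO (plot_push f) q, u))"
  by (rule restrict_arrows_cong) (simp add: P(3) P(4)[unfolded plot_push_simps(2)] pc arrowsD)
 show "FO (holim_restrict (plot_cat a) (plot_push (compose (pts a) g f))) (x, h) =
  FO (comp_func (holim_restrict (plot_cat a) (plot_push f)) (holim_restrict (plot_cat b) (plot_push g))) (x, h)"
  using 1 2 by (simp add: comp_func_def)
 fix y k u
 show "FM (holim_restrict (plot_cat a) (plot_push (compose (pts a) g f))) (x, h) (y, k) u =
  FM (comp_func (holim_restrict (plot_cat a) (plot_push f)) (holim_restrict (plot_cat b) (plot_push g))) (x, h) (y, k) u"
  using 1 by (simp add: comp_func_def)
qed

section \<open>Total spaces given by frames\<close>

lemma smooth_vec_RN0: "(\<And>y. y \<in> RN 0 ==> v y \<in> carrier_vec k) ==> smooth_vec (RN 0) k v"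
 by (rule smooth_vec_cong[OF _ smooth_vec_const[of "v 0"]]) (auto simp: RN_0)

lemma smooth_vec_sheaf:
 assumes K: "dgop_covering c K"
  and loc: "\<And>c' f. (c', f) \<in> K ==> smooth_vec c' k (\<lambda>y. v (f y))"
 shows "smooth_vec c k v"
proof (rule smooth_vec_local)
 fix y assume y: "y \<in> c"
 obtain c' f where cf: "(c', f) \<in> K" "y \<in> f ` c'" using dgop_coveringD(4)[OF K y] by blast
 have c': "c' \<in> Obj Cart" and e: "open_embedding c' c f" using dgop_coveringD(2,3)[OF K cf(1)] by auto
 then have d: "diffeo c' (f ` c') f" and op: "openin (subtopology Rinf c) (f ` c')" by (auto simp: open_embedding_def)
 obtain g where g: "smooth_map (f ` c') c' g" "\<forall>y\<in>f ` c'. f (g y) = y" using d unfolding diffeo_def by blast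
 have "smooth_vec (f ` c') k (\<lambda>y. v (f (g y)))"
  by (rule smooth_vec_compose[OF Cart_locally_bounded[OF Cart_diffeo[OF c' d]] g(1) loc[OF cf(1)]])
 then have "smooth_vec (f ` c') k v" by (rule smooth_vec_cong[rotated]) (use g(2) in auto)
 moreover obtain V where "openin Rinf V" "f ` c' = V \<inter> c" using op by (auto simp: openin_subtopology)
 ultimately show "\<exists>V. openin Rinf V \<and> y \<in> V \<and> smooth_vec (c \<inter> V) k v"
  using cf(2) by (intro exI[of _ V]) (auto simp: Int_commute)
qed

text \<open>If every plot of the base has a frame in the sense of the given set of plots, then this set inherits
the axioms of a diffeology from smooth vectors. This avoids a direct verification for bundles whose
plots are defined by coordinates.\<close>

lemma frames_diffeological:
 assumes X: "diffeological_space X"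
  and P: "\<And>c b. b \<in> plots (tot E) c ==> c \<in> Obj Cart \<and> b \<in> c \<rightarrow>\<^sub>E pts (tot E) \<and> (\<lambda>y\<in>c. prj E (b y)) \<in> plots X c"
  and prj: "\<And>e. e \<in> pts (tot E) ==> prj E e \<in> pts X"
  and fr: "\<And>c \<phi>. \<phi> \<in> plots X c ==> \<exists>k s. trivialises E c \<phi> k s"
 shows "diffeological_space (tot E)"
proof -
 have coords: "\<exists>v. (\<forall>y\<in>c. v y \<in> carrier_vec k \<and> s y (v y) = b y)"
  if "b \<in> c \<rightarrow>\<^sub>E pts (tot E)" "trivialises E c (\<lambda>y\<in>c. prj E (b y)) k s" for c b k s
 proof -
  have "\<exists>v. v \<in> carrier_vec k \<and> s y v = b y" if "y \<in> c" for y
  proof -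
   have "b y \<in> carrier (fibre E ((\<lambda>y\<in>c. prj E (b y)) y))"
    using \<open>b \<in> c \<rightarrow>\<^sub>E pts (tot E)\<close> \<open>y \<in> c\<close> by (auto simp: fibre_in_pts)
   then show ?thesis by (rule trivialises_surj[OF \<open>trivialises E c _ k s\<close> \<open>y \<in> c\<close>]) blast
  qed
  then show ?thesis by (intro bchoice) blast
 qed
 have crit: "b \<in> plots (tot E) c \<longleftrightarrow> smooth_vec c k v"
  if "c \<in> Obj Cart" "b \<in> c \<rightarrow>\<^sub>E pts (tot E)" "trivialises E c \<phi> k s" "\<forall>y\<in>c. v y \<in> carrier_vec k \<and> s y (v y) = b y" for c b \<phi> k s v
 proof -
  have "(\<lambda>y\<in>c. s y (v y)) = b" using that(2,4) by (auto simp: fun_eq_iff PiE_def extensional_def)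
  then show ?thesis using trivialisesD(3)[OF that(3,1) smooth_map_id[OF subset_refl], of v] that(4) by simp
 qed
 show ?thesis
  unfolding diffeological_space_def
 proof (intro conjI allI ballI impI)
  show "plots (tot E) c = {}" if "c \<notin> Obj Cart" for c using that P by blast
  show "plots (tot E) c \<subseteq> c \<rightarrow>\<^sub>E pts (tot E)" for c using P by blast
  show "plots (tot E) (RN 0) = RN 0 \<rightarrow>\<^sub>E pts (tot E)"
  proof (intro equalityI subsetI)
   fix b assume b: "b \<in> RN 0 \<rightarrow>\<^sub>E pts (tot E)"
   then have "(\<lambda>y\<in>RN 0. prj E (b y)) \<in> plots X (RN 0)"
    using prj by (auto simp: diffeological_spaceD(3)[OF X])
   then obtain k s where s: "trivialises E (RN 0) (\<lambda>y\<in>RN 0. prj E (b y)) k s" using fr by blast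
   obtain v where v: "\<forall>y\<in>RN 0. v y \<in> carrier_vec k \<and> s y (v y) = b y" using coords[OF b s] by blast
   show "b \<in> plots (tot E) (RN 0)"
    using crit[OF RN_in_Cart b s v] smooth_vec_RN0[of v k] v by simp
  qed (use P in blast)
  show "compose c' b f \<in> plots (tot E) c'" if "c' \<in> Obj Cart" "f \<in> Hom Cart c' c" "b \<in> plots (tot E) c" for c c' f b
  proof -
   have c: "c \<in> Obj Cart" and b: "b \<in> c \<rightarrow>\<^sub>E pts (tot E)" and \<phi>: "(\<lambda>y\<in>c. prj E (b y)) \<in> plots X c" using P[OF that(3)] by auto
   have f: "smooth_map c' c f" using that(2) by (simp add: Hom_Cart_iff)
   obtain k s where s: "trivialises E c (\<lambda>y\<in>c. prj E (b y)) k s" using fr[OF \<phi>] by blast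
   obtain v where v: "\<forall>y\<in>c. v y \<in> carrier_vec k \<and> s y (v y) = b y" using coords[OF b s] by blast
   have "smooth_vec c k v" using crit[OF c b s v] that(3) by simp
   then have "smooth_vec c' k (\<lambda>y. v (f y))" by (rule smooth_vec_compose[OF Cart_locally_bounded[OF that(1)] f])
   then have "(\<lambda>y\<in>c'. s (f y) (v (f y))) \<in> plots (tot E) c'"
    using trivialisesD(3)[OF s that(1) f, of "\<lambda>y. v (f y)"] v smooth_map_image[OF f] by simp
   moreover have "(\<lambda>y\<in>c'. s (f y) (v (f y))) = compose c' b f"
    using v smooth_map_image[OF f] by (auto simp: compose_def fun_eq_iff)
   ultimately show ?thesis by simp
  qed
  fix c K b assume b: "b \<in> c \<rightarrow>\<^sub>E pts (tot E)" and K: "dgop_covering c K \<and> (\<forall>(c', f)\<in>K. compose c' b f \<in> plots (tot E) c')"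
  then have cov: "dgop_covering c K" and loc: "\<And>c' f. (c', f) \<in> K ==> compose c' b f \<in> plots (tot E) c'" by auto
  have f: "smooth_map c' c f" "c' \<in> Obj Cart" if "(c', f) \<in> K" for c' f
   using dgop_coveringD(2,3)[OF cov that] by (auto simp: open_embedding_def Hom_Cart_iff)
  have \<phi>: "(\<lambda>y\<in>c. prj E (b y)) \<in> plots X c"
  proof (rule dfl_plots_sheaf[OF X _ cov])
   fix c' f assume cf: "(c', f) \<in> K"
   have "compose c' (\<lambda>y\<in>c. prj E (b y)) f = (\<lambda>y\<in>c'. prj E (compose c' b f y))"
    using smooth_map_image[OF f(1)[OF cf]] by (auto simp: compose_def fun_eq_iff)
   then show "compose c' (\<lambda>y\<in>c. prj E (b y)) f \<in> plots X c'" using P[OF loc[OF cf]] by simp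
  qed (use b prj in auto)
  obtain k s where s: "trivialises E c (\<lambda>y\<in>c. prj E (b y)) k s" using fr[OF \<phi>] by blast
  obtain v where v: "\<forall>y\<in>c. v y \<in> carrier_vec k \<and> s y (v y) = b y" using coords[OF b s] by blast
  have "smooth_vec c k v"
  proof (rule smooth_vec_sheaf[OF cov])
   fix c' f assume cf: "(c', f) \<in> K"
   have "(\<lambda>y\<in>c'. s (f y) (v (f y))) = compose c' b f"
    using v smooth_map_image[OF f(1)[OF cf]] by (auto simp: compose_def fun_eq_iff)
   then show "smooth_vec c' k (\<lambda>y. v (f y))"
    using trivialisesD(3)[OF s f(2)[OF cf] f(1)[OF cf], of "\<lambda>y. v (f y)"] v smooth_map_image[OF f(1)[OF cf]] loc[OF cf] by simp
  qed
  then show "b \<in> plots (tot E) c" using crit[OF dgop_coveringD(1)[OF cov] b s v] by simp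
 qed
qed

section \<open>The bundle of a strict object\<close>

text \<open>The fibres \<open>\<complex>\<^sup>n\<close> of the constructed bundles have to consist of elements of the universe, and to be small.
Vectors are coded by lists of reals, these by single reals together with their length, and the
continuum is small.\<close>

lemma ex_vec_code: "\<exists>f :: complex Matrix.vec => 'u::universe. inj f \<and> small (range f)"
proof -
 obtain p :: "real \<times> real => real" where p: "inj p" using real_pairing_exists by blast
 have "inj (\<lambda>z. p (Re z, Im z))" by (auto intro!: injI simp: inj_eq[OF p] complex_eq_iff)
 then have m: "inj (map (\<lambda>z. p (Re z, Im z)))" by simp
 \<comment> \<open>injective on lists of equal length\<close>
 define enc where "enc = rec_list (0::real) (\<lambda>x _ e. p (x, e))"
 have enc: "enc xs = enc ys --> xs = ys" if "length xs = length ys" for xs ys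
  using that by (induction xs ys rule: list_induct2) (auto simp: enc_def inj_eq[OF p])
 define q where "q xs = p (real (length xs), enc xs)" for xs
 have q: "inj q" using enc by (auto intro!: injI simp: q_def inj_eq[OF p])
 have l: "inj (list_of_vec :: complex Matrix.vec => _)" by (rule inj_on_inverseI[where g=vec_of_list]) (rule vec_list)
 obtain r :: "real => 'u" where r: "inj r" "small (range r)" using small_continuum by blast
 have "inj (r \<circ> q \<circ> map (\<lambda>z. p (Re z, Im z)) \<circ> list_of_vec)"
  by (intro inj_compose l m q r)
 moreover have "small (range (r \<circ> q \<circ> map (\<lambda>z. p (Re z, Im z)) \<circ> list_of_vec))"
  by (rule small_subset[OF r(2)]) auto
 ultimately show ?thesis by blast
qed

definition vec_code :: "complex Matrix.vec => 'u::universe" where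
 "vec_code = (SOME f. inj f \<and> small (range f))"

definition vec_decode :: "'u::universe => complex Matrix.vec" where
 "vec_decode = inv_into UNIV vec_code"

lemma vec_code: "inj (vec_code :: _ => 'u::universe)" "small (range (vec_code :: _ => 'u))"
 using someI_ex[OF ex_vec_code[where 'u='u]] by (simp_all add: vec_code_def)

lemma vec_decode_code [simp]: "vec_decode (vec_code v) = v"
 by (simp add: vec_decode_def vec_code(1))

lemma vec_code_inject [simp]: "vec_code v = vec_code w \<longleftrightarrow> v = w"
 by (rule inj_eq[OF vec_code(1)])

definition pt_plot :: "'u::universe => 'u plot" where
 "pt_plot x = (RN 0, \<lambda>_\<in>RN 0. x)"

definition pt_map :: "rinf => rinf => rinf" where
 "pt_map y = (\<lambda>_\<in>RN 0. y)"

text \<open>The isomorphism of a strict object for the morphism of plots \<open>\<real>\<^sup>0 \<rightarrow> a\<close> with value \<open>y\<close>. It compares the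
fibre at the point with the value of the strict object at the plot.\<close>

definition point_matrix ::
  "('u::universe plot \<times> 'u plot \<times> (rinf => rinf) => (rinf => complex mat)) => 'u plot => rinf => complex mat" where
 "point_matrix h a y = h (pt_plot (snd a y), a, pt_map y) 0"

definition str_pts :: "'u::universe dfl => ('u plot => nat) => 'u set" where
 "str_pts X n = {upair x (vec_code v) |x v. x \<in> pts X \<and> v \<in> carrier_vec (n (pt_plot x))}"

text \<open>Points are pairs of \<open>x\<close> and a coded vector in \<open>\<complex>\<^sup>n\<^sup>x\<close>. A map is a plot if it becomes smooth after the vectors are
moved to the trivial bundle of the strict object at the plot of base points.\<close>

definition str_bundle :: "'u::universe dfl => ('u plot => nat) =>
  ('u plot \<times> 'u plot \<times> (rinf => rinf) => (rinf => complex mat)) => 'u vbundle" where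
 "str_bundle X n h = \<lparr>
   tot = \<lparr> pts = str_pts X n,
    plots = \<lambda>c. {b. c \<in> Obj Cart \<and> b \<in> c \<rightarrow>\<^sub>E str_pts X n \<and> (\<lambda>y\<in>c. ufst (b y)) \<in> plots X c \<and>
     smooth_vec c (n (c, \<lambda>y\<in>c. ufst (b y)))
      (\<lambda>y. point_matrix h (c, \<lambda>y\<in>c. ufst (b y)) y *\<^sub>v vec_decode (usnd (b y)))} \<rparr>,
   prj = \<lambda>z\<in>str_pts X n. ufst z,
   vadd = \<lambda>z w. upair (ufst z) (vec_code (vec_decode (usnd z) + vec_decode (usnd w))),
   vsmult = \<lambda>r z. upair (ufst z) (vec_code (smult_vec r (vec_decode (usnd z)))),
   vzero = \<lambda>x. upair x (vec_code (zero_vec (n (pt_plot x)))) \<rparr>"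

definition str_map :: "'u::universe dfl => ('u plot => nat) => 'u str_mor => 'u => 'u" where
 "str_map X n u = (\<lambda>z\<in>str_pts X n. upair (ufst z) (vec_code (u (pt_plot (ufst z)) 0 *\<^sub>v vec_decode (usnd z))))"

definition str_func :: "'u::universe dfl => ('u str_obj, 'u str_mor, 'u vbundle, 'u => 'u) func" where
 "str_func X = \<lparr> FO = \<lambda>(n, h). str_bundle X n h, FM = \<lambda>(n, h) _ u. str_map X n u \<rparr>"

lemma str_func_simps [simp]: "FO (str_func X) (n, h) = str_bundle X n h" "FM (str_func X) (n, h) y u = str_map X n u"
 by (simp_all add: str_func_def)

lemma upair_str_pts [simp]: "upair x (vec_code v) \<in> str_pts X n \<longleftrightarrow> x \<in> pts X \<and> v \<in> carrier_vec (n (pt_plot x))"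
 by (auto simp: str_pts_def)

lemma str_pts_cases:
 assumes "z \<in> str_pts X n"
 obtains x v where "z = upair x (vec_code v)" "x \<in> pts X" "v \<in> carrier_vec (n (pt_plot x))"
 using assms by (auto simp: str_pts_def)

lemma str_bundle_simps [simp]:
 "pts (tot (str_bundle X n h)) = str_pts X n"
 "x \<in> pts X ==> v \<in> carrier_vec (n (pt_plot x)) ==> prj (str_bundle X n h) (upair x (vec_code v)) = x"
 "vadd (str_bundle X n h) (upair x (vec_code v)) (upair x' (vec_code v')) = upair x (vec_code (v + v'))"
 "vsmult (str_bundle X n h) r (upair x (vec_code v)) = upair x (vec_code (smult_vec r v))"
 "vzero (str_bundle X n h) x = upair x (vec_code (zero_vec (n (pt_plot x))))"
 by (simp_all add: str_bundle_def)

lemma str_bundle_plots: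
 "b \<in> plots (tot (str_bundle X n h)) c \<longleftrightarrow> c \<in> Obj Cart \<and> b \<in> c \<rightarrow>\<^sub>E str_pts X n \<and> (\<lambda>y\<in>c. ufst (b y)) \<in> plots X c \<and>
   smooth_vec c (n (c, \<lambda>y\<in>c. ufst (b y)))
    (\<lambda>y. point_matrix h (c, \<lambda>y\<in>c. ufst (b y)) y *\<^sub>v vec_decode (usnd (b y)))"
 by (simp add: str_bundle_def)

locale strict_object =
 fixes X :: "'u::universe dfl" and n :: "'u plot => nat"
  and h :: "'u plot \<times> 'u plot \<times> (rinf => rinf) => (rinf => complex mat)"
 assumes X: "X \<in> Obj Dfg" and nh: "(n, h) \<in> Str_obj X"
begin

lemma dX: "diffeological_space X" by (rule Dfg_diffeological[OF X])

lemma arrow_iso: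
 assumes "(a, b, f) \<in> arrows (plot_cat X)"
 obtains k where "smooth_iso (fst a) (n b) (n a) (h (a, b, f)) k"
proof -
 obtain k where k: "inverse_arrows (VBun_triv_cat (fst a)) (n a) (n b) (h (a, b, f)) k"
  using holim_objD(4)[OF nh assms] by (auto simp: Iso_def)
 then have sm: "smooth_mat (fst a) (n b) (n a) (h (a, b, f))" "smooth_mat (fst a) (n a) (n b) k"
  and kh: "(\<lambda>y\<in>fst a. k y * h (a, b, f) y) = (\<lambda>y\<in>fst a. 1\<^sub>m (n a))" "(\<lambda>y\<in>fst a. h (a, b, f) y * k y) = (\<lambda>y\<in>fst a. 1\<^sub>m (n b))"
  by (auto simp: inverse_arrows_def Hom_triv)
 have "k y *\<^sub>v (h (a, b, f) y *\<^sub>v v) = v" if "y \<in> fst a" "v \<in> carrier_vec (n a)" for y v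
 proof -
  have "k y * h (a, b, f) y = 1\<^sub>m (n a)" using fun_cong[OF kh(1), of y] that(1) by simp
  then show ?thesis using assoc_mult_mat_vec[of "k y" "n a" "n b" "h (a, b, f) y" "n a" v] sm that by (simp add: smooth_mat_def)
 qed
 moreover have "h (a, b, f) y *\<^sub>v (k y *\<^sub>v v) = v" if "y \<in> fst a" "v \<in> carrier_vec (n b)" for y v
 proof -
  have "h (a, b, f) y * k y = 1\<^sub>m (n b)" using fun_cong[OF kh(2), of y] that(1) by simp
  then show ?thesis using assoc_mult_mat_vec[of "h (a, b, f) y" "n b" "n a" "k y" "n b" v] sm that by (simp add: smooth_mat_def)
 qed
 ultimately have "smooth_iso (fst a) (n b) (n a) (h (a, b, f)) k" using sm by (simp add: smooth_iso_def)
 then show ?thesis by (rule that)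
qed

lemma pt_plot_Obj: "x \<in> pts X ==> pt_plot x \<in> Obj (plot_cat X)"
 by (simp add: pt_plot_def Obj_plot_cat dfl_plots_point[OF dX])

lemma pt_arrow:
 assumes "\<phi> \<in> plots X c" "y \<in> c"
 shows "(pt_plot (\<phi> y), (c, \<phi>), pt_map y) \<in> arrows (plot_cat X)"
proof -
 have c: "c \<in> Obj Cart" by (rule dfl_plots_Cart[OF dX assms(1)])
 obtain m where m: "y \<in> RN m" using ex_RN by blast
 have "smooth_map (RN 0) c (pt_map y)"
 proof (rule smooth_mapI_RN)
  show "smooth_fun (RN 0) (\<lambda>x. coord (pt_map y x) i)" for i
   by (rule smooth_fun_cong[OF _ smooth_fun_const[of _ "coord y i"]]) (simp add: pt_map_def)
 qed (use assms(2) m in "auto simp: pt_map_def")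
 moreover have "compose (RN 0) \<phi> (pt_map y) = (\<lambda>_\<in>RN 0. \<phi> y)" by (auto simp: compose_def pt_map_def fun_eq_iff)
 ultimately show ?thesis
  using pt_plot_Obj[OF dfl_plots_pts[OF dX assms]] c assms(1)
  by (simp add: arrowsD pt_plot_def Obj_plot_cat Hom_plot_cat Hom_Cart_iff) (simp add: pt_map_def)
qed

end

context strict_object
begin

abbreviation H :: "'u plot => rinf => complex mat" where "H \<equiv> point_matrix h"
abbreviation B :: "'u vbundle" where "B \<equiv> str_bundle X n h"

lemma H_iso:
 assumes "\<phi> \<in> plots X c" "y \<in> c"
 shows "\<exists>G. H (c, \<phi>) y \<in> carrier_mat (n (c, \<phi>)) (n (pt_plot (\<phi> y))) \<and> G \<in> carrier_mat (n (pt_plot (\<phi> y))) (n (c, \<phi>)) \<and>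
  (\<forall>v\<in>carrier_vec (n (pt_plot (\<phi> y))). G *\<^sub>v (H (c, \<phi>) y *\<^sub>v v) = v) \<and>
  (\<forall>w\<in>carrier_vec (n (c, \<phi>)). H (c, \<phi>) y *\<^sub>v (G *\<^sub>v w) = w)"
proof -
 obtain k where k: "smooth_iso (fst (pt_plot (\<phi> y))) (n (c, \<phi>)) (n (pt_plot (\<phi> y))) (h (pt_plot (\<phi> y), (c, \<phi>), pt_map y)) k"
  by (rule arrow_iso[OF pt_arrow[OF assms]])
 have "(0::rinf) \<in> fst (pt_plot (\<phi> y))" by (simp add: pt_plot_def RN_0)
 then show ?thesis using k by (intro exI[of _ "k 0"]) (auto simp: smooth_iso_def smooth_mat_def point_matrix_def)
qed

definition G :: "'u plot => rinf => complex mat" where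
 "G a y = (SOME G. H a y \<in> carrier_mat (n a) (n (pt_plot (snd a y))) \<and> G \<in> carrier_mat (n (pt_plot (snd a y))) (n a) \<and>
  (\<forall>v\<in>carrier_vec (n (pt_plot (snd a y))). G *\<^sub>v (H a y *\<^sub>v v) = v) \<and>
  (\<forall>w\<in>carrier_vec (n a). H a y *\<^sub>v (G *\<^sub>v w) = w))"

lemma HG:
 assumes "\<phi> \<in> plots X c" "y \<in> c"
 shows "H (c, \<phi>) y \<in> carrier_mat (n (c, \<phi>)) (n (pt_plot (\<phi> y)))" "G (c, \<phi>) y \<in> carrier_mat (n (pt_plot (\<phi> y))) (n (c, \<phi>))"
  "v \<in> carrier_vec (n (pt_plot (\<phi> y))) ==> G (c, \<phi>) y *\<^sub>v (H (c, \<phi>) y *\<^sub>v v) = v"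
  "w \<in> carrier_vec (n (c, \<phi>)) ==> H (c, \<phi>) y *\<^sub>v (G (c, \<phi>) y *\<^sub>v w) = w"
  "v \<in> carrier_vec (n (pt_plot (\<phi> y))) ==> H (c, \<phi>) y *\<^sub>v v \<in> carrier_vec (n (c, \<phi>))"
  "w \<in> carrier_vec (n (c, \<phi>)) ==> G (c, \<phi>) y *\<^sub>v w \<in> carrier_vec (n (pt_plot (\<phi> y)))"
proof -
 note G = someI_ex[OF H_iso[OF assms]]
 have e: "G (c, \<phi>) y = (SOME G. H (c, \<phi>) y \<in> carrier_mat (n (c, \<phi>)) (n (pt_plot (\<phi> y))) \<and> G \<in> carrier_mat (n (pt_plot (\<phi> y))) (n (c, \<phi>)) \<and>
  (\<forall>v\<in>carrier_vec (n (pt_plot (\<phi> y))). G *\<^sub>v (H (c, \<phi>) y *\<^sub>v v) = v) \<and>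
  (\<forall>w\<in>carrier_vec (n (c, \<phi>)). H (c, \<phi>) y *\<^sub>v (G *\<^sub>v w) = w))" by (simp add: G_def)
 note * = G[folded e]
 show c: "H (c, \<phi>) y \<in> carrier_mat (n (c, \<phi>)) (n (pt_plot (\<phi> y)))" "G (c, \<phi>) y \<in> carrier_mat (n (pt_plot (\<phi> y))) (n (c, \<phi>))"
  using * by blast+
 show "v \<in> carrier_vec (n (pt_plot (\<phi> y))) ==> G (c, \<phi>) y *\<^sub>v (H (c, \<phi>) y *\<^sub>v v) = v"
  "w \<in> carrier_vec (n (c, \<phi>)) ==> H (c, \<phi>) y *\<^sub>v (G (c, \<phi>) y *\<^sub>v w) = w"
  using * by blast+
 show "v \<in> carrier_vec (n (pt_plot (\<phi> y))) ==> H (c, \<phi>) y *\<^sub>v v \<in> carrier_vec (n (c, \<phi>))"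
  "w \<in> carrier_vec (n (c, \<phi>)) ==> G (c, \<phi>) y *\<^sub>v w \<in> carrier_vec (n (pt_plot (\<phi> y)))"
  using c by (auto intro: mult_mat_vec_carrier)
qed

text \<open>The cocycle identity for the composite of a morphism of plots with the inclusion of a point.\<close>

lemma H_arrow:
 assumes "((c0, \<phi>0), (c1, \<phi>1), f) \<in> arrows (plot_cat X)" "y \<in> c0"
 shows "H (c1, \<phi>1) (f y) = h ((c0, \<phi>0), (c1, \<phi>1), f) y * H (c0, \<phi>0) y" "\<phi>1 (f y) = \<phi>0 y"
proof -
 have a: "(c0, \<phi>0) \<in> Obj (plot_cat X)" "(c1, \<phi>1) \<in> Obj (plot_cat X)" "f \<in> Hom (plot_cat X) (c0, \<phi>0) (c1, \<phi>1)"
  and p: "\<phi>0 \<in> plots X c0" "compose c0 \<phi>1 f = \<phi>0" using assms(1) by (auto simp: arrowsD Obj_plot_cat Hom_plot_cat)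
 show e: "\<phi>1 (f y) = \<phi>0 y" using fun_cong[OF p(2), of y] assms(2) by (simp add: compose_def)
 have b: "pt_plot (\<phi>0 y) \<in> Obj (plot_cat X)" "pt_map y \<in> Hom (plot_cat X) (pt_plot (\<phi>0 y)) (c0, \<phi>0)"
  using pt_arrow[OF p(1) assms(2)] by (auto simp: arrowsD)
 have c: "Cmp (plot_cat X) (pt_plot (\<phi>0 y)) (c0, \<phi>0) (c1, \<phi>1) f (pt_map y) = pt_map (f y)"
  by (simp add: pt_plot_def Cmp_plot_cat compose_def pt_map_def fun_eq_iff)
 have z: "(0::rinf) \<in> RN 0" by (simp add: RN_0)
 have "h (pt_plot (\<phi>0 y), (c1, \<phi>1), pt_map (f y)) = (\<lambda>z\<in>RN 0. compose (RN 0) (h ((c0, \<phi>0), (c1, \<phi>1), f)) (pt_map y) z * h (pt_plot (\<phi>0 y), (c0, \<phi>0), pt_map y) z)"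
  using holim_objD(6)[OF nh b(1) a(1,2) b(2) a(3)] unfolding c by (simp add: pt_plot_def)
 from fun_cong[OF this, of 0] show "H (c1, \<phi>1) (f y) = h ((c0, \<phi>0), (c1, \<phi>1), f) y * H (c0, \<phi>0) y"
  using z by (simp add: point_matrix_def e compose_def pt_map_def)
qed

lemma H_point:
 assumes "x \<in> pts X"
 shows "H (pt_plot x) 0 = 1\<^sub>m (n (pt_plot x))"
proof -
 have "pt_map 0 = Id (plot_cat X) (pt_plot x)" by (auto simp: pt_plot_def Id_plot_cat pt_map_def RN_0 fun_eq_iff)
 then have "h (pt_plot x, pt_plot x, pt_map 0) = Id (VBun_triv_cat (RN 0)) (n (pt_plot x))"
  using holim_objD(5)[OF nh pt_plot_Obj[OF assms]] by (simp add: pt_plot_def)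
 then show ?thesis by (simp add: point_matrix_def) (simp add: pt_plot_def RN_0)
qed

definition str_frame :: "'u plot => rinf => complex Matrix.vec => 'u" where
 "str_frame a y w = upair (snd a y) (vec_code (G a y *\<^sub>v w))"

lemma carrier_fibre_B: "x \<in> pts X ==> carrier (fibre B x) = (\<lambda>v. upair x (vec_code v)) ` carrier_vec (n (pt_plot x))"
 by (auto simp: fibre_in_pts elim!: str_pts_cases)

text \<open>For a morphism of plots \<open>f : \<psi> \<rightarrow> \<phi>\<close> the point matrices of \<open>\<phi>\<close> at \<open>f y\<close> and of \<open>\<psi>\<close> at \<open>y\<close> differ by the smooth
invertible matrix \<open>h\<^sub>f y\<close>. Hence smoothness along \<open>\<psi>\<close> can be tested with the frame along \<open>\<phi>\<close>.\<close>

lemma str_frame_trivialises: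
 assumes \<phi>: "\<phi> \<in> plots X c"
 shows "trivialises B c \<phi> (n (c, \<phi>)) (str_frame (c, \<phi>))"
 unfolding trivialises_def
proof (intro conjI ballI allI impI)
 fix y assume y: "y \<in> c"
 note HG = HG[OF \<phi> y] and x = dfl_plots_pts[OF dX \<phi> y]
 show "bij_betw (str_frame (c, \<phi>) y) (carrier_vec (n (c, \<phi>))) (carrier (fibre B (\<phi> y)))"
 proof (rule bij_betwI[where g="\<lambda>z. H (c, \<phi>) y *\<^sub>v vec_decode (usnd z)"])
  show "str_frame (c, \<phi>) y \<in> carrier_vec (n (c, \<phi>)) \<rightarrow> carrier (fibre B (\<phi> y))"
   using HG(6) by (auto simp: str_frame_def carrier_fibre_B[OF x])
 qed (use HG in "auto simp: str_frame_def carrier_fibre_B[OF x]")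
 show "str_frame (c, \<phi>) y \<in> linear_maps (cvec (n (c, \<phi>))) (fibre B (\<phi> y))"
  unfolding linear_maps_iff
 proof (intro conjI ballI allI)
  show "str_frame (c, \<phi>) y \<in> carrier (cvec (n (c, \<phi>))) \<rightarrow> carrier (fibre B (\<phi> y))"
   using HG(6) by (auto simp: str_frame_def carrier_fibre_B[OF x])
 qed (use HG(2) in \<open>auto simp: str_frame_def fibre_def module_vec_simps mult_add_distrib_mat_vec[of _ "n (pt_plot (\<phi> y))" "n (c, \<phi>)"] mult_mat_vec[of _ "n (pt_plot (\<phi> y))" "n (c, \<phi>)"]\<close>)
next
 fix c' f and v :: "rinf => complex Matrix.vec"
 assume c': "c' \<in> Obj Cart" and f: "smooth_map c' c f" and v: "\<forall>y\<in>c'. v y \<in> carrier_vec (n (c, \<phi>))"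
 define \<psi> where "\<psi> = (\<lambda>y\<in>c'. \<phi> (f y))"
 define b where "b = (\<lambda>y\<in>c'. str_frame (c, \<phi>) (f y) (v y))"
 have \<psi>: "\<psi> \<in> plots X c'" unfolding \<psi>_def by (rule dfl_plots_compose[OF dX \<phi> c' f])
 have ar: "((c', \<psi>), (c, \<phi>), restrict f c') \<in> arrows (plot_cat X)"
  using c' dfl_plots_Cart[OF dX \<phi>] \<phi> \<psi> smooth_map_cong[OF _ f, of "restrict f c'"]
  by (auto simp: arrowsD Obj_plot_cat Hom_plot_cat Hom_Cart_iff \<psi>_def compose_def fun_eq_iff)
 obtain k where k: "smooth_iso c' (n (c, \<phi>)) (n (c', \<psi>)) (h ((c', \<psi>), (c, \<phi>), restrict f c')) k"
  using arrow_iso[OF ar] by auto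
 let ?m = "h ((c', \<psi>), (c, \<phi>), restrict f c')"
 have fy: "f y \<in> c" if "y \<in> c'" for y using smooth_map_image[OF f that] .
 have pts: "b \<in> c' \<rightarrow>\<^sub>E str_pts X n"
  using HG(6)[OF \<phi> fy] v dfl_plots_pts[OF dX \<phi> fy] by (auto simp: b_def str_frame_def)
 have b\<psi>: "(\<lambda>y\<in>c'. ufst (b y)) = \<psi>" by (auto simp: b_def str_frame_def \<psi>_def fun_eq_iff)
 have eq: "?m y *\<^sub>v (H (c', \<psi>) y *\<^sub>v vec_decode (usnd (b y))) = v y" if y: "y \<in> c'" for y
 proof -
  have x: "\<psi> y = \<phi> (f y)" using y by (simp add: \<psi>_def)
  have g: "vec_decode (usnd (b y)) = G (c, \<phi>) (f y) *\<^sub>v v y" using y by (simp add: b_def str_frame_def)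
  have "?m y *\<^sub>v (H (c', \<psi>) y *\<^sub>v (G (c, \<phi>) (f y) *\<^sub>v v y)) = (?m y * H (c', \<psi>) y) *\<^sub>v (G (c, \<phi>) (f y) *\<^sub>v v y)"
   by (rule assoc_mult_mat_vec[symmetric, of _ "n (c, \<phi>)" "n (c', \<psi>)" _ "n (pt_plot (\<phi> (f y)))"])
    (use k y HG(1)[OF \<psi> y] HG(6)[OF \<phi> fy[OF y]] v x in "auto simp: smooth_iso_def smooth_mat_def")
  also have "?m y * H (c', \<psi>) y = H (c, \<phi>) (f y)" using H_arrow(1)[OF ar y] y by simp
  also have "H (c, \<phi>) (f y) *\<^sub>v (G (c, \<phi>) (f y) *\<^sub>v v y) = v y"
   by (rule HG(4)[OF \<phi> fy[OF y]]) (use v y in simp)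
  finally show ?thesis unfolding g .
 qed
 have car: "H (c', \<psi>) y *\<^sub>v vec_decode (usnd (b y)) \<in> carrier_vec (n (c', \<psi>))" if y: "y \<in> c'" for y
  using HG(5)[OF \<psi> y] HG(6)[OF \<phi> fy[OF y]] v y by (simp add: b_def str_frame_def \<psi>_def)
 have "smooth_vec c' (n (c', \<psi>)) (\<lambda>y. H (c', \<psi>) y *\<^sub>v vec_decode (usnd (b y))) \<longleftrightarrow> smooth_vec c' (n (c, \<phi>)) v"
 proof
  assume s: "smooth_vec c' (n (c', \<psi>)) (\<lambda>y. H (c', \<psi>) y *\<^sub>v vec_decode (usnd (b y)))"
  show "smooth_vec c' (n (c, \<phi>)) v"
   by (rule smooth_vec_cong[OF eq smooth_mat_vec[OF _ s]]) (use k in "auto simp: smooth_iso_def")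
 next
  assume s: "smooth_vec c' (n (c, \<phi>)) v"
  have "H (c', \<psi>) y *\<^sub>v vec_decode (usnd (b y)) = k y *\<^sub>v v y" if y: "y \<in> c'" for y
   unfolding eq[OF y, symmetric] using k car[OF y] y by (simp add: smooth_iso_def)
  then show "smooth_vec c' (n (c', \<psi>)) (\<lambda>y. H (c', \<psi>) y *\<^sub>v vec_decode (usnd (b y)))"
   by (intro smooth_vec_cong[OF _ smooth_mat_vec[OF _ s, of "n (c', \<psi>)" k]]) (use k in "auto simp: smooth_iso_def")
 qed
 then show "(\<lambda>y\<in>c'. str_frame (c, \<phi>) (f y) (v y)) \<in> plots (tot B) c' \<longleftrightarrow> smooth_vec c' (n (c, \<phi>)) v"
  unfolding b_def[symmetric] str_bundle_plots b\<psi> using c' pts \<psi> by simp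
qed

lemma B_prj: "e \<in> str_pts X n ==> prj B e = ufst e"
 by (auto elim!: str_pts_cases)

lemma diffeological_B: "diffeological_space (tot B)"
proof (rule frames_diffeological[OF dX])
 fix c b assume b: "b \<in> plots (tot B) c"
 then have "(\<lambda>y\<in>c. prj B (b y)) = (\<lambda>y\<in>c. ufst (b y))"
  by (auto simp: str_bundle_plots fun_eq_iff intro!: B_prj dest: PiE_mem)
 then show "c \<in> Obj Cart \<and> b \<in> c \<rightarrow>\<^sub>E pts (tot B) \<and> (\<lambda>y\<in>c. prj B (b y)) \<in> plots X c"
  using b by (simp add: str_bundle_plots)
next
 show "prj B e \<in> pts X" if "e \<in> pts (tot B)" for e using that by (auto elim!: str_pts_cases)
qed (use str_frame_trivialises in blast)

lemma vector_bundle_B: "vector_bundle X B"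
 unfolding vector_bundle_iff
proof (intro conjI ballI allI impI X)
 have "small (str_pts X n)"
  by (rule small_pairs[of "pts X" "range vec_code"]) (use X vec_code(2) in "auto simp: Obj_Dfg str_pts_def")
 then show "tot B \<in> Obj Dfg" by (simp add: Obj_Dfg diffeological_B)
 show "prj B \<in> dfl_hom (tot B) X"
 proof (rule dfl_homI[OF diffeological_B])
  show "prj B \<in> pts (tot B) \<rightarrow>\<^sub>E pts X" by (auto simp: str_bundle_def str_pts_def)
  fix c b assume b: "b \<in> plots (tot B) c"
  then have "(\<lambda>y\<in>c. prj B (b y)) = (\<lambda>y\<in>c. ufst (b y))"
   by (auto simp: str_bundle_plots fun_eq_iff intro!: B_prj dest: PiE_mem)
  then show "(\<lambda>y\<in>c. prj B (b y)) \<in> plots X c" using b by (simp add: str_bundle_plots)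
 qed
 show "vectorspace class_ring (fibre B x)" if x: "x \<in> pts X" for x
 proof (rule vectorspace_transport[where j="\<lambda>v. upair x (vec_code v)"])
  show "vectorspace class_ring (cvec (n (pt_plot x)))" by (rule vec_vs)
  show "bij_betw (\<lambda>v. upair x (vec_code v)) (carrier (cvec (n (pt_plot x)))) (carrier (fibre B x))"
   by (auto intro!: bij_betw_imageI inj_onI simp: carrier_fibre_B[OF x])
 qed (simp_all add: fibre_def module_vec_simps)
qed (use str_frame_trivialises in blast)

end

section \<open>Morphisms of strict objects\<close>

locale strict_pair = src: strict_object X n h + tgt: strict_object X n' h'
 for X :: "'u::universe dfl" and n h n' h'
begin

abbreviation S where "S \<equiv> src.str_frame"
abbreviation T where "T \<equiv> tgt.str_frame"

lemma str_hom_mat: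
 assumes "u \<in> Str_hom X (n, h) (n', h')" "\<phi> \<in> plots X c"
 shows "smooth_mat c (n' (c, \<phi>)) (n (c, \<phi>)) (u (c, \<phi>))" "u (c, \<phi>) \<in> extensional c"
 using holim_homD(2)[OF assms(1), of "(c, \<phi>)"] assms(2) dfl_plots_Cart[OF src.dX assms(2)]
 by (auto simp: Obj_plot_cat Hom_triv)

text \<open>A morphism of strict objects acts on the bundles by its values at points. Intertwining along the
inclusion of a point says that in frames it acts by its matrix at the plot.\<close>

lemma str_map_frame:
 assumes u: "u \<in> Str_hom X (n, h) (n', h')" and \<phi>: "\<phi> \<in> plots X c"
  and y: "y \<in> c" and w: "w \<in> carrier_vec (n (c, \<phi>))"
 shows "str_map X n u (S (c, \<phi>) y w) = T (c, \<phi>) y (u (c, \<phi>) y *\<^sub>v w)"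
proof -
 let ?p = "pt_plot (\<phi> y)"
 note x = dfl_plots_pts[OF src.dX \<phi> y]
 note HG = src.HG[OF \<phi> y] and HG' = tgt.HG[OF \<phi> y]
 have p: "\<phi> y \<in> pts X ==> (\<lambda>_\<in>RN 0. \<phi> y) \<in> plots X (RN 0)" by (rule dfl_plots_point[OF src.dX])
 have up: "u ?p 0 \<in> carrier_mat (n' ?p) (n ?p)"
  using str_hom_mat(1)[OF u p[OF x]] by (simp add: pt_plot_def smooth_mat_def RN_0)
 have uy: "u (c, \<phi>) y \<in> carrier_mat (n' (c, \<phi>)) (n (c, \<phi>))"
  using str_hom_mat(1)[OF u \<phi>] y by (simp add: smooth_mat_def)
 have "(\<lambda>z\<in>RN 0. h' (?p, (c, \<phi>), pt_map y) z * u ?p z) = (\<lambda>z\<in>RN 0. compose (RN 0) (u (c, \<phi>)) (pt_map y) z * h (?p, (c, \<phi>), pt_map y) z)"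
  using holim_homD(3)[OF u src.pt_arrow[OF \<phi> y]] by (simp add: pt_plot_def)
 from fun_cong[OF this, of 0] have eq: "point_matrix h' (c, \<phi>) y * u ?p 0 = u (c, \<phi>) y * point_matrix h (c, \<phi>) y"
  by (simp add: point_matrix_def compose_def pt_map_def RN_0)
 let ?v = "src.G (c, \<phi>) y *\<^sub>v w"
 have v: "?v \<in> carrier_vec (n ?p)" by (rule HG(6)[OF w])
 have "point_matrix h' (c, \<phi>) y *\<^sub>v (u ?p 0 *\<^sub>v ?v) = u (c, \<phi>) y *\<^sub>v w"
  using assoc_mult_mat_vec[OF HG'(1) up v] assoc_mult_mat_vec[OF uy HG(1) v] HG(4)[OF w] by (simp add: eq)
 moreover have uv: "u ?p 0 *\<^sub>v ?v \<in> carrier_vec (n' ?p)" by (rule mult_mat_vec_carrier[OF up v])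
 ultimately have "tgt.G (c, \<phi>) y *\<^sub>v (u (c, \<phi>) y *\<^sub>v w) = u ?p 0 *\<^sub>v ?v" using HG'(3)[OF uv] by simp
 then show ?thesis using x v by (simp add: src.str_frame_def tgt.str_frame_def str_map_def)
qed

lemma str_map_bundle_hom:
 assumes u: "u \<in> Str_hom X (n, h) (n', h')"
 shows "str_map X n u \<in> bundle_hom X src.B tgt.B"
proof (rule frames_bundle_hom[OF src.vector_bundle_B tgt.vector_bundle_B])
 show "str_map X n u \<in> extensional (pts (tot src.B))" by (simp add: str_map_def)
 show "\<exists>k s l s' M. trivialises src.B c \<phi> k s \<and> trivialises tgt.B c \<phi> l s' \<and>
   smooth_mat c l k M \<and> (\<forall>y\<in>c. \<forall>v\<in>carrier_vec k. str_map X n u (s y v) = s' y (M y *\<^sub>v v))" if \<phi>: "\<phi> \<in> plots X c" for c \<phi>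
  using src.str_frame_trivialises[OF \<phi>] tgt.str_frame_trivialises[OF \<phi>] str_hom_mat(1)[OF u \<phi>] str_map_frame[OF u \<phi>] by blast
qed

text \<open>The matrices can be read off in the frames, and the families are undefined elsewhere.\<close>

lemma str_map_inj:
 assumes u: "u \<in> Str_hom X (n, h) (n', h')"
  and u': "u' \<in> Str_hom X (n, h) (n', h')" and eq: "str_map X n u = str_map X n u'"
 shows "u = u'"
proof (rule extensionalityI[OF holim_homD(1)[OF u] holim_homD(1)[OF u']])
 fix a assume "a \<in> Obj (plot_cat X)"
 then obtain c \<phi> where a: "a = (c, \<phi>)" and \<phi>: "\<phi> \<in> plots X c" by (cases a) (auto simp: Obj_plot_cat)
 note m = str_hom_mat[OF u \<phi>] and m' = str_hom_mat[OF u' \<phi>]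
 show "u a = u' a"
  unfolding a
 proof (rule extensionalityI[OF m(2) m'(2)])
  fix y assume y: "y \<in> c"
  show "u (c, \<phi>) y = u' (c, \<phi>) y"
  proof (rule mat_eq_vecI)
   show c: "u (c, \<phi>) y \<in> carrier_mat (n' (c, \<phi>)) (n (c, \<phi>))" "u' (c, \<phi>) y \<in> carrier_mat (n' (c, \<phi>)) (n (c, \<phi>))"
    using m(1) m'(1) y by (auto simp: smooth_mat_def)
   fix v :: "complex Matrix.vec" assume v: "v \<in> carrier_vec (n (c, \<phi>))"
   show "u (c, \<phi>) y *\<^sub>v v = u' (c, \<phi>) y *\<^sub>v v"
    by (rule trivialises_inj[OF tgt.str_frame_trivialises[OF \<phi>] y])
     (use c v str_map_frame[OF u \<phi> y v] str_map_frame[OF u' \<phi> y v] eq in "auto intro: mult_mat_vec_carrier")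
  qed
 qed
qed

end

context strict_object
begin

text \<open>The frames along \<open>\<phi>\<^sub>0\<close> and \<open>\<phi>\<^sub>1\<close> are related by the cocycle \<open>h\<close>; this turns equations of matrices into
equations in fibres.\<close>

lemma frame_arrow:
 assumes ar: "((c0, \<phi>0), (c1, \<phi>1), f) \<in> arrows (plot_cat X)" and y: "y \<in> c0" and w: "w \<in> carrier_vec (n (c0, \<phi>0))"
 shows "str_frame (c1, \<phi>1) (f y) (h ((c0, \<phi>0), (c1, \<phi>1), f) y *\<^sub>v w) = str_frame (c0, \<phi>0) y w"
proof -
 have \<phi>: "\<phi>0 \<in> plots X c0" "\<phi>1 \<in> plots X c1" and f: "f y \<in> c1"
  using ar Hom_Cart_mem[OF _ y] by (auto simp: arrowsD Obj_plot_cat Hom_plot_cat)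
 let ?m = "h ((c0, \<phi>0), (c1, \<phi>1), f) y"
 obtain k where "smooth_iso c0 (n (c1, \<phi>1)) (n (c0, \<phi>0)) (h ((c0, \<phi>0), (c1, \<phi>1), f)) k" using arrow_iso[OF ar] by auto
 then have m: "?m \<in> carrier_mat (n (c1, \<phi>1)) (n (c0, \<phi>0))" using y by (simp add: smooth_iso_def smooth_mat_def)
 note HG0 = HG[OF \<phi>(1) y] and HG1 = HG[OF \<phi>(2) f] and e = H_arrow[OF ar y]
 have g: "G (c0, \<phi>0) y *\<^sub>v w \<in> carrier_vec (n (pt_plot (\<phi>0 y)))" by (rule HG0(6)[OF w])
 have "H (c1, \<phi>1) (f y) *\<^sub>v (G (c0, \<phi>0) y *\<^sub>v w) = ?m *\<^sub>v w"
  unfolding e(1) using assoc_mult_mat_vec[OF m HG0(1) g] HG0(4)[OF w] by simp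
 then have "G (c1, \<phi>1) (f y) *\<^sub>v (?m *\<^sub>v w) = G (c0, \<phi>0) y *\<^sub>v w" using HG1(3)[unfolded e(2), OF g] by simp
 then show ?thesis by (simp add: str_frame_def e(2))
qed

lemma frame_point:
 assumes x: "x \<in> pts X" and v: "v \<in> carrier_vec (n (pt_plot x))"
 shows "str_frame (pt_plot x) 0 v = upair x (vec_code v)"
proof -
 have p: "(\<lambda>_\<in>RN 0. x) \<in> plots X (RN 0)" "(0::rinf) \<in> RN 0" using dfl_plots_point[OF dX x] by (auto simp: RN_0)
 have "G (pt_plot x) 0 *\<^sub>v (H (pt_plot x) 0 *\<^sub>v v) = v"
  using HG(3)[OF p] v p(2) by (simp add: pt_plot_def)
 then show ?thesis using v by (simp add: str_frame_def H_point[OF x]) (simp add: pt_plot_def RN_0)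
qed

end

context strict_pair
begin

text \<open>Take the matrix of the bundle morphism in the frames along each plot. It intertwines the cocycles since
both sides describe the same morphism of fibres.\<close>

lemma str_map_surj:
 assumes w: "w \<in> bundle_hom X src.B tgt.B"
 obtains u where "u \<in> Str_hom X (n, h) (n', h')" "str_map X n u = w"
proof -
 note wD = bundle_homD[OF w src.vector_bundle_B]
 have "\<exists>g. smooth_mat (fst a) (n' a) (n a) g \<and> (\<forall>y\<in>fst a. \<forall>v\<in>carrier_vec (n a). w (S a y v) = T a y (g y *\<^sub>v v))"
  if a: "a \<in> Obj (plot_cat X)" for a
 proof -
  obtain c \<phi> where ac: "a = (c, \<phi>)" and c: "c \<in> Obj Cart" and \<phi>: "\<phi> \<in> plots X c"
   using a by (cases a) (auto simp: Obj_plot_cat)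
  note s = src.str_frame_trivialises[OF \<phi>] and t = tgt.str_frame_trivialises[OF \<phi>]
  have lin: "(\<lambda>v. w (S (c, \<phi>) y v)) \<in> linear_maps (cvec (n (c, \<phi>))) (fibre tgt.B (\<phi> y))" if "y \<in> c" for y
   by (rule linear_maps_compose[OF trivialisesD(1)[OF s that] wD(6)[OF dfl_plots_pts[OF src.dX \<phi> that]]])
  have pl: "(\<lambda>y\<in>c. w (S (c, \<phi>) y v)) \<in> plots (tot tgt.B) c" if "v \<in> carrier_vec (n (c, \<phi>))" for v
   by (rule restrict_comp_plot[OF src.diffeological_B wD(1) frame_plot[OF c s smooth_vec_const[OF that]]])
  obtain g where "smooth_mat c (n' (c, \<phi>)) (n (c, \<phi>)) g"
   "\<And>y v. y \<in> c ==> v \<in> carrier_vec (n (c, \<phi>)) ==> w (S (c, \<phi>) y v) = T (c, \<phi>) y (g y *\<^sub>v v)"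
   using matrix_in_frames[OF c t lin pl] by blast
  then show ?thesis unfolding ac fst_conv by blast
 qed
 then have "\<forall>a\<in>Obj (plot_cat X). \<exists>g. smooth_mat (fst a) (n' a) (n a) g \<and> (\<forall>y\<in>fst a. \<forall>v\<in>carrier_vec (n a). w (S a y v) = T a y (g y *\<^sub>v v))"
  by blast
 then obtain g where g: "\<forall>a\<in>Obj (plot_cat X). smooth_mat (fst a) (n' a) (n a) (g a) \<and> (\<forall>y\<in>fst a. \<forall>v\<in>carrier_vec (n a). w (S a y v) = T a y (g a y *\<^sub>v v))"
  by (rule bchoice[THEN exE])
 define u where "u = (\<lambda>a\<in>Obj (plot_cat X). \<lambda>y\<in>fst a. g a y)"
 have um: "smooth_mat c (n' (c, \<phi>)) (n (c, \<phi>)) (u (c, \<phi>))" "u (c, \<phi>) \<in> extensional c"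
  and uw: "y \<in> c ==> v \<in> carrier_vec (n (c, \<phi>)) ==> w (S (c, \<phi>) y v) = T (c, \<phi>) y (u (c, \<phi>) y *\<^sub>v v)"
  if a: "(c, \<phi>) \<in> Obj (plot_cat X)" for c \<phi> y v
  using bspec[OF g a] a by (auto simp: u_def smooth_mat_restrict)
 have u: "u \<in> Str_hom X (n, h) (n', h')"
 proof (rule holim_homI)
  show "u \<in> extensional (Obj (plot_cat X))" by (simp add: u_def)
  show "u a \<in> Hom (Val triv_diagram a) (n a) (n' a)" if "a \<in> Obj (plot_cat X)" for a
   using um that by (cases a) (simp add: Hom_triv)
  fix a b f assume ar: "(a, b, f) \<in> arrows (plot_cat X)"
  obtain c0 \<phi>0 c1 \<phi>1 where ab: "a = (c0, \<phi>0)" "b = (c1, \<phi>1)" by (cases a, cases b)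
  note ar = ar[unfolded ab]
  have o: "(c0, \<phi>0) \<in> Obj (plot_cat X)" "(c1, \<phi>1) \<in> Obj (plot_cat X)"
   and \<phi>: "\<phi>0 \<in> plots X c0" "\<phi>1 \<in> plots X c1" and f: "\<And>y. y \<in> c0 ==> f y \<in> c1"
   using ar Hom_Cart_mem by (auto simp: arrowsD Obj_plot_cat Hom_plot_cat)
  obtain k where k: "smooth_iso c0 (n (c1, \<phi>1)) (n (c0, \<phi>0)) (h ((c0, \<phi>0), (c1, \<phi>1), f)) k" using src.arrow_iso[OF ar] by auto
  obtain k' where k': "smooth_iso c0 (n' (c1, \<phi>1)) (n' (c0, \<phi>0)) (h' ((c0, \<phi>0), (c1, \<phi>1), f)) k'" using tgt.arrow_iso[OF ar] by auto
  have "h' ((c0, \<phi>0), (c1, \<phi>1), f) y * u (c0, \<phi>0) y = u (c1, \<phi>1) (f y) * h ((c0, \<phi>0), (c1, \<phi>1), f) y" if y: "y \<in> c0" for y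
  proof -
   let ?m = "h ((c0, \<phi>0), (c1, \<phi>1), f) y" and ?m' = "h' ((c0, \<phi>0), (c1, \<phi>1), f) y"
   have c: "?m \<in> carrier_mat (n (c1, \<phi>1)) (n (c0, \<phi>0))" "?m' \<in> carrier_mat (n' (c1, \<phi>1)) (n' (c0, \<phi>0))"
    "u (c0, \<phi>0) y \<in> carrier_mat (n' (c0, \<phi>0)) (n (c0, \<phi>0))" "u (c1, \<phi>1) (f y) \<in> carrier_mat (n' (c1, \<phi>1)) (n (c1, \<phi>1))"
    using k k' um(1)[OF o(1)] um(1)[OF o(2)] y f by (auto simp: smooth_iso_def smooth_mat_def)
   show ?thesis
   proof (rule mat_eq_vecI)
    fix v :: "complex Matrix.vec" assume v: "v \<in> carrier_vec (n (c0, \<phi>0))"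
    have v': "?m *\<^sub>v v \<in> carrier_vec (n (c1, \<phi>1))" "u (c0, \<phi>0) y *\<^sub>v v \<in> carrier_vec (n' (c0, \<phi>0))"
     using c v by (auto intro: mult_mat_vec_carrier)
    have "T (c1, \<phi>1) (f y) (?m' *\<^sub>v (u (c0, \<phi>0) y *\<^sub>v v)) = T (c0, \<phi>0) y (u (c0, \<phi>0) y *\<^sub>v v)"
     by (rule tgt.frame_arrow[OF ar y v'(2)])
    also have "\<dots> = w (S (c0, \<phi>0) y v)" by (rule uw[OF o(1) y v, symmetric])
    also have "\<dots> = w (S (c1, \<phi>1) (f y) (?m *\<^sub>v v))" by (simp only: src.frame_arrow[OF ar y v])
    also have "\<dots> = T (c1, \<phi>1) (f y) (u (c1, \<phi>1) (f y) *\<^sub>v (?m *\<^sub>v v))" by (rule uw[OF o(2) f[OF y] v'(1)])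
    finally have "?m' *\<^sub>v (u (c0, \<phi>0) y *\<^sub>v v) = u (c1, \<phi>1) (f y) *\<^sub>v (?m *\<^sub>v v)"
     by (rule trivialises_inj[OF tgt.str_frame_trivialises[OF \<phi>(2)] f[OF y], rotated 2]) (use c v v' in "auto intro: mult_mat_vec_carrier")
    then show "(?m' * u (c0, \<phi>0) y) *\<^sub>v v = (u (c1, \<phi>1) (f y) * ?m) *\<^sub>v v"
     using assoc_mult_mat_vec[OF c(2,3) v] assoc_mult_mat_vec[OF c(4,1) v] by simp
   qed (use c in auto)
  qed
  then show "Cmp (Val triv_diagram a) (n a) (n' a) (FO (Res triv_diagram a b f) (n' b)) (h' (a, b, f)) (u a) =
    Cmp (Val triv_diagram a) (n a) (FO (Res triv_diagram a b f) (n b)) (FO (Res triv_diagram a b f) (n' b))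
     (FM (Res triv_diagram a b f) (n b) (n' b) (u b)) (h (a, b, f))"
   by (simp add: ab fun_eq_iff compose_def)
 qed
 moreover have "str_map X n u = w"
 proof (rule bundle_hom_eqI[OF str_map_bundle_hom[OF u] w])
  fix e assume "e \<in> pts (tot src.B)"
  then obtain x v where e: "e = upair x (vec_code v)" "x \<in> pts X" "v \<in> carrier_vec (n (pt_plot x))" by (auto elim: str_pts_cases)
  have e': "e = S (pt_plot x) 0 v" using src.frame_point[OF e(2,3)] e(1) by simp
  have p: "(\<lambda>_\<in>RN 0. x) \<in> plots X (RN 0)" "(0::rinf) \<in> RN 0" using dfl_plots_point[OF src.dX e(2)] by (auto simp: RN_0)
  show "str_map X n u e = w e"
   unfolding e' using str_map_frame[OF u p e(3)[unfolded pt_plot_def]] uw[OF src.pt_plot_Obj[OF e(2), unfolded pt_plot_def] p(2) e(3)[unfolded pt_plot_def]]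
   by (simp add: pt_plot_def)
 qed
 ultimately show ?thesis by (rule that)
qed

end

lemma str_functor:
 assumes X: "X \<in> Obj Dfg"
 shows "is_functor (Str X) (VBun_cat X) (str_func X)"
 unfolding is_functor_def
proof (intro conjI ballI is_category_VBun; clarify?)
 show "is_category (Str X)"
  by (rule is_category_holim) (auto simp: is_category_triv triv_functor)
 fix n h assume "(n, h) \<in> Obj (Str X)"
 then interpret A: strict_object X n h using X by (simp add: strict_object_def)
 show "FO (str_func X) (n, h) \<in> Obj (VBun_cat X)" by (simp add: Obj_VBun A.vector_bundle_B)
 show "FM (str_func X) (n, h) (n, h) (Id (Str X) (n, h)) = Id (VBun_cat X) (FO (str_func X) (n, h))"
 proof -
  have "str_map X n (\<lambda>a\<in>Obj (plot_cat X). \<lambda>y\<in>fst a. 1\<^sub>m (n a)) z = restrict (\<lambda>e. e) (str_pts X n) z" for z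
   using A.pt_plot_Obj by (cases "z \<in> str_pts X n") (auto simp: str_map_def pt_plot_def RN_0 elim!: str_pts_cases)
  then show ?thesis by (simp add: Id_VBun fun_eq_iff)
 qed
 fix n' h' assume "(n', h') \<in> Obj (Str X)"
 then interpret A': strict_object X n' h' using X by (simp add: strict_object_def)
 interpret P: strict_pair X n h n' h' ..
 fix u assume "u \<in> Hom (Str X) (n, h) (n', h')"
 then have u: "u \<in> Str_hom X (n, h) (n', h')" by simp
 show "FM (str_func X) (n, h) (n', h') u \<in> Hom (VBun_cat X) (FO (str_func X) (n, h)) (FO (str_func X) (n', h'))"
  by (simp add: Hom_VBun P.str_map_bundle_hom[OF u])
 fix n'' h'' v assume "(n'', h'') \<in> Obj (Str X)" and "v \<in> Hom (Str X) (n', h') (n'', h'')"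
 then interpret A'': strict_object X n'' h'' using X by (simp add: strict_object_def)
 interpret P': strict_pair X n' h' n'' h'' ..
 have v: "v \<in> Str_hom X (n', h') (n'', h'')" using \<open>v \<in> Hom _ _ _\<close> by simp
 have up: "u (pt_plot x) 0 \<in> carrier_mat (n' (pt_plot x)) (n (pt_plot x))" "v (pt_plot x) 0 \<in> carrier_mat (n'' (pt_plot x)) (n' (pt_plot x))"
  if "x \<in> pts X" for x
  using P.str_hom_mat(1)[OF u dfl_plots_point[OF A.dX that]] P'.str_hom_mat(1)[OF v dfl_plots_point[OF A.dX that]]
  by (auto simp: pt_plot_def smooth_mat_def RN_0)
 have "str_map X n (\<lambda>a\<in>Obj (plot_cat X). \<lambda>y\<in>fst a. v a y * u a y) z = compose (str_pts X n) (str_map X n' v) (str_map X n u) z" for z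
 proof (cases "z \<in> str_pts X n")
  case True
  then obtain x w where z: "z = upair x (vec_code w)" "x \<in> pts X" "w \<in> carrier_vec (n (pt_plot x))" by (rule str_pts_cases)
  have "(0::rinf) \<in> fst (pt_plot x)" by (simp add: pt_plot_def RN_0)
  then show ?thesis using z up[OF z(2)] A.pt_plot_Obj[OF z(2)] assoc_mult_mat_vec[OF up(2)[OF z(2)] up(1)[OF z(2)] z(3)]
   by (simp add: compose_def str_map_def mult_mat_vec_carrier)
 qed (simp add: str_map_def compose_def)
 then show "FM (str_func X) (n, h) (n'', h'') (Cmp (Str X) (n, h) (n', h') (n'', h'') v u) =
  Cmp (VBun_cat X) (FO (str_func X) (n, h)) (FO (str_func X) (n', h')) (FO (str_func X) (n'', h''))
   (FM (str_func X) (n', h') (n'', h'') v) (FM (str_func X) (n, h) (n', h') u)"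
  by (simp add: Cmp_VBun fun_eq_iff)
qed

section \<open>Every bundle comes from a strict object\<close>

text \<open>Identities and the cocycle law for the transition matrices \<open>h\<close> of the chosen frames hold because a
matrix is determined by its effect in a frame.\<close>

lemma str_ess_surj:
 assumes E: "vector_bundle X E"
 shows "\<exists>n h. (n, h) \<in> Str_obj X \<and> (\<exists>u w. inverse_arrows (VBun_cat X) (str_bundle X n h) E u w)"
proof -
 note vE = vector_bundleD[OF E]
 have "\<forall>a\<in>Obj (plot_cat X). \<exists>p. trivialises E (fst a) (snd a) (fst p) (snd p)"
  using vE(7) by (auto simp: Obj_plot_cat)
 then obtain p where p: "\<forall>a\<in>Obj (plot_cat X). trivialises E (fst a) (snd a) (fst (p a)) (snd (p a))"
  by (rule bchoice[THEN exE])
 define n where "n = (\<lambda>a\<in>Obj (plot_cat X). fst (p a))"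
 define s where "s a = snd (p a)" for a
 have s: "trivialises E (fst a) (snd a) (n a) (s a)" if "a \<in> Obj (plot_cat X)" for a
  using bspec[OF p that] that by (simp add: n_def s_def)
 have "\<forall>t\<in>arrows (plot_cat X). \<exists>q. case t of (a, b, f) => smooth_iso (fst a) (n b) (n a) (fst q) (snd q) \<and>
   (\<forall>y\<in>fst a. \<forall>v\<in>carrier_vec (n a). s a y v = s b (f y) (fst q y *\<^sub>v v))"
 proof (intro ballI, clarify)
  fix c0 \<phi>0 c1 \<phi>1 f assume ar: "((c0, \<phi>0), (c1, \<phi>1), f) \<in> arrows (plot_cat X)"
  then have o: "(c0, \<phi>0) \<in> Obj (plot_cat X)" "(c1, \<phi>1) \<in> Obj (plot_cat X)" and f: "smooth_map c0 c1 f"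
   and c0: "c0 \<in> Obj Cart" and eq: "compose c0 \<phi>1 f = \<phi>0"
   by (auto simp: arrowsD Obj_plot_cat Hom_plot_cat Hom_Cart_iff)
  have eq': "\<phi>1 (f y) = \<phi>0 y" if "y \<in> c0" for y using fun_cong[OF eq, of y] that by (simp add: compose_def)
  have s0: "trivialises E c0 \<phi>0 (n (c0, \<phi>0)) (s (c0, \<phi>0))" using s[OF o(1)] by simp
  have s1: "trivialises E c0 \<phi>0 (n (c1, \<phi>1)) (\<lambda>y. s (c1, \<phi>1) (f y))"
   by (rule trivialises_cong[OF trivialises_pull[OF _ f, of E \<phi>1]])
    (use s[OF o(2)] eq' in auto)
  obtain g k where "smooth_iso c0 (n (c1, \<phi>1)) (n (c0, \<phi>0)) g k"
   "\<And>y v. y \<in> c0 ==> v \<in> carrier_vec (n (c0, \<phi>0)) ==> s (c0, \<phi>0) y v = s (c1, \<phi>1) (f y) (g y *\<^sub>v v)"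
   using transition_matrix[OF c0 s0 s1] by blast
  then show "\<exists>q. smooth_iso (fst (c0, \<phi>0)) (n (c1, \<phi>1)) (n (c0, \<phi>0)) (fst q) (snd q) \<and>
   (\<forall>y\<in>fst (c0, \<phi>0). \<forall>v\<in>carrier_vec (n (c0, \<phi>0)). s (c0, \<phi>0) y v = s (c1, \<phi>1) (f y) (fst q y *\<^sub>v v))"
   by (intro exI[of _ "(g, k)"]) simp
 qed
 then obtain q where q: "\<forall>t\<in>arrows (plot_cat X). case t of (a, b, f) => smooth_iso (fst a) (n b) (n a) (fst (q t)) (snd (q t)) \<and>
   (\<forall>y\<in>fst a. \<forall>v\<in>carrier_vec (n a). s a y v = s b (f y) (fst (q t) y *\<^sub>v v))"
  by (rule bchoice[THEN exE])
 define h where "h = (\<lambda>t\<in>arrows (plot_cat X). \<lambda>y\<in>fst (fst t). fst (q t) y)"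
 have hq: "h (a, b, f) = (\<lambda>y\<in>fst a. fst (q (a, b, f)) y)" if "(a, b, f) \<in> arrows (plot_cat X)" for a b f
  using that by (simp add: h_def)
 have iso: "smooth_iso (fst a) (n b) (n a) (fst (q (a, b, f))) (snd (q (a, b, f)))"
  and hs: "y \<in> fst a ==> v \<in> carrier_vec (n a) ==> s b (f y) (h (a, b, f) y *\<^sub>v v) = s a y v"
  if "(a, b, f) \<in> arrows (plot_cat X)" for a b f y v
  using bspec[OF q that] hq[OF that] by simp_all
 have hm: "h (a, b, f) y \<in> carrier_mat (n b) (n a)" if "(a, b, f) \<in> arrows (plot_cat X)" "y \<in> fst a" for a b f y
  using iso[OF that(1)] hq[OF that(1)] that(2) by (simp add: smooth_iso_def smooth_mat_def)
 have J: "is_category (plot_cat X)" by (rule is_category_plot_cat[OF vE(3)])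
 have nh: "(n, h) \<in> Str_obj X"
 proof (rule holim_objI)
  show "n \<in> extensional (Obj (plot_cat X))" "h \<in> extensional (arrows (plot_cat X))" by (simp_all add: n_def h_def)
  show "n a \<in> Obj (Val triv_diagram a)" for a by simp
  show "h (a, b, f) \<in> Iso (Val triv_diagram a) (n a) (FO (Res triv_diagram a b f) (n b))"
   if ar: "(a, b, f) \<in> arrows (plot_cat X)" for a b f
  proof -
   define g k where "g = fst (q (a, b, f))" and "k = snd (q (a, b, f))"
   have gk: "smooth_iso (fst a) (n b) (n a) g k" using iso[OF ar] by (simp add: g_def k_def)
   then have m: "g y \<in> carrier_mat (n b) (n a)" "k y \<in> carrier_mat (n a) (n b)" if "y \<in> fst a" for y
    using that by (auto simp: smooth_iso_def smooth_mat_def)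
   have kg: "k y * g y = 1\<^sub>m (n a)" "g y * k y = 1\<^sub>m (n b)" if y: "y \<in> fst a" for y
   proof -
    show "k y * g y = 1\<^sub>m (n a)"
     by (rule mat_eq_vecI[of _ "n a" "n a"]) (use m[OF y] gk y in "auto simp: smooth_iso_def assoc_mult_mat_vec[OF m(2,1)[OF y]]")
    show "g y * k y = 1\<^sub>m (n b)"
     by (rule mat_eq_vecI[of _ "n b" "n b"]) (use m[OF y] gk y in "auto simp: smooth_iso_def assoc_mult_mat_vec[OF m(1,2)[OF y]]")
   qed
   have "inverse_arrows (VBun_triv_cat (fst a)) (n a) (n b) (\<lambda>y\<in>fst a. g y) (\<lambda>y\<in>fst a. k y)"
    using gk kg by (auto simp: inverse_arrows_def Hom_triv smooth_iso_def fun_eq_iff intro!: smooth_mat_restrict)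
   then show ?thesis unfolding hq[OF ar] g_def by (auto simp: Iso_def)
  qed
  show "h (a, a, Id (plot_cat X) a) = Id (Val triv_diagram a) (n a)" if a: "a \<in> Obj (plot_cat X)" for a
  proof -
   have ar: "(a, a, Id (plot_cat X) a) \<in> arrows (plot_cat X)" using a is_categoryD(1)[OF J a] by (simp add: arrowsD)
   have "h (a, a, Id (plot_cat X) a) y = 1\<^sub>m (n a)" if y: "y \<in> fst a" for y
   proof (rule mat_eq_vecI[OF hm[OF ar y]])
    fix v :: "complex Matrix.vec" assume v: "v \<in> carrier_vec (n a)"
    have i: "Id (plot_cat X) a y = y" using y by (cases a) (simp add: Id_plot_cat)
    have "h (a, a, Id (plot_cat X) a) y *\<^sub>v v = v"
     by (rule trivialises_inj[OF s[OF a] y]) (use hs[OF ar y v] hm[OF ar y] v i in auto)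
    then show "h (a, a, Id (plot_cat X) a) y *\<^sub>v v = 1\<^sub>m (n a) *\<^sub>v v" using v by simp
   qed simp
   then show ?thesis unfolding hq[OF ar] by (auto simp: fun_eq_iff)
  qed
  show "h (a, c, Cmp (plot_cat X) a b c g f) =
   Cmp (Val triv_diagram a) (n a) (FO (Res triv_diagram a b f) (n b)) (FO (Res triv_diagram a b f) (FO (Res triv_diagram b c g) (n c)))
    (FM (Res triv_diagram a b f) (n b) (FO (Res triv_diagram b c g) (n c)) (h (b, c, g))) (h (a, b, f))"
   if o: "a \<in> Obj (plot_cat X)" "b \<in> Obj (plot_cat X)" "c \<in> Obj (plot_cat X)" and f: "f \<in> Hom (plot_cat X) a b" and g: "g \<in> Hom (plot_cat X) b c"
   for a b c f g
  proof -
   have af: "(a, b, f) \<in> arrows (plot_cat X)" and bg: "(b, c, g) \<in> arrows (plot_cat X)"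
    and ar: "(a, c, Cmp (plot_cat X) a b c g f) \<in> arrows (plot_cat X)"
    using o f g is_categoryD(2)[OF J o f g] by (simp_all add: arrowsD)
   have "h (a, c, Cmp (plot_cat X) a b c g f) y = h (b, c, g) (f y) * h (a, b, f) y" if y: "y \<in> fst a" for y
   proof -
    have fy: "f y \<in> fst b" using f y Hom_Cart_mem by (cases a, cases b) (auto simp: Hom_plot_cat)
    have gfy: "g (f y) \<in> fst c" using g fy Hom_Cart_mem by (cases b, cases c) (auto simp: Hom_plot_cat)
    have i: "Cmp (plot_cat X) a b c g f y = g (f y)" using y by (cases a, cases b, cases c) (simp add: Cmp_plot_cat compose_def)
    show ?thesis
    proof (rule mat_eq_vecI[OF hm[OF ar y]])
     show "h (b, c, g) (f y) * h (a, b, f) y \<in> carrier_mat (n c) (n a)" using hm[OF af y] hm[OF bg fy] by simp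
     fix v :: "complex Matrix.vec" assume v: "v \<in> carrier_vec (n a)"
     have hv: "h (a, b, f) y *\<^sub>v v \<in> carrier_vec (n b)" by (rule mult_mat_vec_carrier[OF hm[OF af y] v])
     have "h (a, c, Cmp (plot_cat X) a b c g f) y *\<^sub>v v = h (b, c, g) (f y) *\<^sub>v (h (a, b, f) y *\<^sub>v v)"
     proof (rule trivialises_inj[OF s[OF o(3)] gfy])
      show "h (a, c, Cmp (plot_cat X) a b c g f) y *\<^sub>v v \<in> carrier_vec (n c)" by (rule mult_mat_vec_carrier[OF hm[OF ar y] v])
      show "h (b, c, g) (f y) *\<^sub>v (h (a, b, f) y *\<^sub>v v) \<in> carrier_vec (n c)" by (rule mult_mat_vec_carrier[OF hm[OF bg fy] hv])
      show "s c (g (f y)) (h (a, c, Cmp (plot_cat X) a b c g f) y *\<^sub>v v) = s c (g (f y)) (h (b, c, g) (f y) *\<^sub>v (h (a, b, f) y *\<^sub>v v))"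
       using hs[OF ar y v] hs[OF bg fy hv] hs[OF af y v] by (simp add: i)
     qed
     then show "h (a, c, Cmp (plot_cat X) a b c g f) y *\<^sub>v v = (h (b, c, g) (f y) * h (a, b, f) y) *\<^sub>v v"
      using assoc_mult_mat_vec[OF hm[OF bg fy] hm[OF af y] v] by simp
    qed
   qed
   then show ?thesis unfolding hq[OF ar] by (auto simp: fun_eq_iff compose_def)
  qed
 qed
 interpret A: strict_object X n h using vE(1) nh by (simp add: strict_object_def)
 define u where "u = (\<lambda>z\<in>str_pts X n. s (pt_plot (ufst z)) 0 (vec_decode (usnd z)))"
 have "\<exists>w. inverse_arrows (VBun_cat X) (str_bundle X n h) E u w"
 proof (rule frames_inverse_arrows[OF A.vector_bundle_B E])
  show "u \<in> extensional (pts (tot A.B))" by (simp add: u_def)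
  fix c \<phi> assume \<phi>: "\<phi> \<in> plots X c"
  have o: "(c, \<phi>) \<in> Obj (plot_cat X)" using \<phi> dfl_plots_Cart[OF vE(3) \<phi>] by (simp add: Obj_plot_cat)
  have "u (A.str_frame (c, \<phi>) y v) = s (c, \<phi>) y v" if y: "y \<in> c" and v: "v \<in> carrier_vec (n (c, \<phi>))" for y v
  proof -
   note HG = A.HG[OF \<phi> y]
   have z: "(0::rinf) \<in> fst (pt_plot (\<phi> y))" by (simp add: pt_plot_def RN_0)
   have "s (c, \<phi>) (pt_map y 0) (h (pt_plot (\<phi> y), (c, \<phi>), pt_map y) 0 *\<^sub>v (A.G (c, \<phi>) y *\<^sub>v v)) =
     s (pt_plot (\<phi> y)) 0 (A.G (c, \<phi>) y *\<^sub>v v)"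
    by (rule hs[OF A.pt_arrow[OF \<phi> y] z HG(6)[OF v]])
   then have "s (c, \<phi>) y v = s (pt_plot (\<phi> y)) 0 (A.G (c, \<phi>) y *\<^sub>v v)"
    using HG(4)[OF v] by (simp add: pt_map_def RN_0 point_matrix_def)
   then show ?thesis using HG(6)[OF v] dfl_plots_pts[OF vE(3) \<phi> y] by (simp add: u_def A.str_frame_def)
  qed
  then show "\<exists>k s s'. trivialises A.B c \<phi> k s \<and> trivialises E c \<phi> k s' \<and> (\<forall>y\<in>c. \<forall>v\<in>carrier_vec k. u (s y v) = s' y v)"
   using A.str_frame_trivialises[OF \<phi>] s[OF o]
   by (intro exI[of _ "n (c, \<phi>)"] exI[of _ "A.str_frame (c, \<phi>)"] exI[of _ "s (c, \<phi>)"]) simp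
 qed
 with nh show ?thesis by blast
qed

lemma str_equivalence:
 assumes X: "X \<in> Obj Dfg"
 shows "is_equivalence (Str X) (VBun_cat X) (str_func X)"
proof (rule fully_faithful_ess_surj_equivalence[OF str_functor[OF X]])
 fix a b assume a: "a \<in> Obj (Str X)" and b: "b \<in> Obj (Str X)"
 obtain n h where nh: "a = (n, h)" by (cases a)
 obtain n' h' where nh': "b = (n', h')" by (cases b)
 interpret A: strict_object X n h using X a by (simp add: strict_object_def nh)
 interpret A': strict_object X n' h' using X b by (simp add: strict_object_def nh')
 interpret P: strict_pair X n h n' h' ..
 show "bij_betw (FM (str_func X) a b) (Hom (Str X) a b) (Hom (VBun_cat X) (FO (str_func X) a) (FO (str_func X) b))"
 proof (rule bij_betw_imageI)
  show "inj_on (FM (str_func X) a b) (Hom (Str X) a b)"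
   by (rule inj_onI) (use P.str_map_inj in "simp add: nh nh'")
  show "FM (str_func X) a b ` Hom (Str X) a b = Hom (VBun_cat X) (FO (str_func X) a) (FO (str_func X) b)"
  proof
   show "FM (str_func X) a b ` Hom (Str X) a b \<subseteq> Hom (VBun_cat X) (FO (str_func X) a) (FO (str_func X) b)"
    using P.str_map_bundle_hom by (auto simp: nh nh' Hom_VBun)
   show "Hom (VBun_cat X) (FO (str_func X) a) (FO (str_func X) b) \<subseteq> FM (str_func X) a b ` Hom (Str X) a b"
   proof
    fix w assume "w \<in> Hom (VBun_cat X) (FO (str_func X) a) (FO (str_func X) b)"
    then have "w \<in> bundle_hom X A.B A'.B" by (simp add: nh nh' Hom_VBun)
    then obtain u where "u \<in> Str_hom X (n, h) (n', h')" "str_map X n u = w" by (rule P.str_map_surj)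
    then show "w \<in> FM (str_func X) a b ` Hom (Str X) a b" by (auto simp: nh nh')
   qed
  qed
 qed
next
 fix E assume "E \<in> Obj (VBun_cat X)"
 then obtain n h where "(n, h) \<in> Str_obj X" "\<exists>u w. inverse_arrows (VBun_cat X) (str_bundle X n h) E u w"
  using str_ess_surj[of X E] by (auto simp: Obj_VBun)
 then show "\<exists>a\<in>Obj (Str X). \<exists>u w. inverse_arrows (VBun_cat X) (FO (str_func X) a) E u w"
  by (intro bexI[of _ "(n, h)"]) simp_all
qed

section \<open>Compatibility with pullback\<close>

locale strict_restriction = strict_object X n h
 for X :: "'u::universe dfl" and n h +
 fixes X' :: "'u dfl" and g :: "'u => 'u"
 assumes X': "X' \<in> Obj Dfg" and g: "g \<in> dfl_hom X' X"
begin

definition n' where "n' = (\<lambda>a\<in>Obj (plot_cat X'). n (FO (plot_push g) a))"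
definition h' where "h' = (\<lambda>(a, b, f)\<in>arrows (plot_cat X'). h (FO (plot_push g) a, FO (plot_push g) b, f))"

lemma Res_eq: "FO (Res VBun_str X' X g) (n, h) = (n', h')"
 by (simp add: n'_def h'_def)

lemma restricted: "(n', h') \<in> Str_obj X'"
 using is_functorD(3)[OF strict_functor_opD(3)[OF strict_functor_VBun_str X' X], of g "(n, h)"] g nh
 unfolding Res_eq by (simp add: Hom_Dfg)

sublocale res: strict_object X' n' h'
 by (rule strict_object.intro[OF X' restricted])

lemma push_pt_plot: "FO (plot_push g) (pt_plot x) = pt_plot (g x)"
 by (auto simp: pt_plot_def compose_def fun_eq_iff)

lemma n'_pt: "x \<in> pts X' ==> n' (pt_plot x) = n (pt_plot (g x))"
 using res.pt_plot_Obj by (simp add: push_pt_plot n'_def)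

lemma restricted_rank: "\<phi> \<in> plots X' c ==> n' (c, \<phi>) = n (c, compose c g \<phi>)"
 using dfl_plots_Cart[OF res.dX, of \<phi> c] by (simp add: Obj_plot_cat n'_def)

lemma restricted_frame:
 assumes \<phi>: "\<phi> \<in> plots X' c" and y: "y \<in> c"
 shows "res.G (c, \<phi>) y = G (c, compose c g \<phi>) y"
proof -
 note n = restricted_rank[OF \<phi>]
 have x: "snd (c, compose c g \<phi>) y = g (snd (c, \<phi>) y)" using y by (simp add: compose_def)
 have p: "n' (pt_plot (snd (c, \<phi>) y)) = n (pt_plot (snd (c, compose c g \<phi>) y))"
  unfolding x using n'_pt[OF dfl_plots_pts[OF res.dX \<phi> y]] by simp
 have "res.H (c, \<phi>) y = H (c, compose c g \<phi>) y"
  using res.pt_arrow[OF \<phi> y] unfolding point_matrix_def x h'_def by (simp add: push_pt_plot)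
 then show ?thesis
  unfolding res.G_def G_def n p by simp
qed

definition cmp_map :: "'u => 'u" where
 "cmp_map = (flatten X' g B)"

lemma pb_B_cases:
 assumes "z \<in> pts (pb_space X' g B)"
 obtains x v where "z = upair x (upair (g x) (vec_code v))" "x \<in> pts X'" "g x \<in> pts X" "v \<in> carrier_vec (n (pt_plot (g x)))"
proof -
 obtain x e where z: "z = upair x e" "x \<in> pts X'" "e \<in> pts (tot B)" "g x = prj B e" using assms by (rule pb_cases)
 obtain y v where "e = upair y (vec_code v)" "y \<in> pts X" "v \<in> carrier_vec (n (pt_plot y))" using z(3) by (auto elim: str_pts_cases)
 then show ?thesis using z that by simp
qed

lemma vector_bundle_pb_B: "vector_bundle X' (pb_bundle X' g B)"
 by (rule pb_bundle_vector_bundle[OF vector_bundle_B X' g])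

text \<open>Restriction leaves the point matrices unchanged, so the frames on both sides correspond.\<close>

lemma cmp_map_iso: "\<exists>w. inverse_arrows (VBun_cat X') (pb_bundle X' g B) res.B cmp_map w"
proof (rule frames_inverse_arrows[OF vector_bundle_pb_B res.vector_bundle_B])
 show "cmp_map \<in> extensional (pts (tot (pb_bundle X' g B)))" by (simp add: cmp_map_def)
 fix c \<phi> assume \<phi>: "\<phi> \<in> plots X' c"
 let ?\<psi> = "compose c g \<phi>"
 have \<psi>: "?\<psi> \<in> plots X c" using dfl_hom_plots[OF res.dX g \<phi>] by (simp add: compose_def)
 have t: "trivialises (pb_bundle X' g B) c \<phi> (n (c, ?\<psi>)) (\<lambda>y v. upair (\<phi> y) (str_frame (c, ?\<psi>) y v))"
  by (rule pb_frame[OF vector_bundle_B X' \<phi>]) (use str_frame_trivialises[OF \<psi>] in "simp add: compose_def")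
 have r: "trivialises res.B c \<phi> (n (c, ?\<psi>)) (res.str_frame (c, \<phi>))"
  using res.str_frame_trivialises[OF \<phi>] unfolding restricted_rank[OF \<phi>] .
 have "cmp_map (upair (\<phi> y) (str_frame (c, ?\<psi>) y v)) = res.str_frame (c, \<phi>) y v"
  if y: "y \<in> c" and v: "v \<in> carrier_vec (n (c, ?\<psi>))" for y v
  using restricted_frame[OF \<phi> y] HG(6)[OF \<psi> y v] dfl_plots_pts[OF res.dX \<phi> y] dfl_plots_pts[OF dX \<psi> y] y
  by (simp add: cmp_map_def str_frame_def res.str_frame_def compose_def)
 with t r show "\<exists>k s s'. trivialises (pb_bundle X' g B) c \<phi> k s \<and> trivialises res.B c \<phi> k s' \<and>
   (\<forall>y\<in>c. \<forall>v\<in>carrier_vec k. cmp_map (s y v) = s' y v)" by blast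
qed

lemma cmp_map_upair:
 "x \<in> pts X' ==> g x \<in> pts X ==> v \<in> carrier_vec (n (pt_plot (g x))) ==>
  cmp_map (upair x (upair (g x) (vec_code v))) = upair x (vec_code v)"
 by (simp add: cmp_map_def)

end

lemma str_map_Id:
 assumes X: "X \<in> Obj Dfg" and nh: "(n, h) \<in> Str_obj X"
 shows "str_map X n (Id (Str X) (n, h)) = (\<lambda>z\<in>str_pts X n. z)"
 using is_functorD(5)[OF str_functor[OF X], of "(n, h)"] nh by (simp add: Id_VBun)

definition str_trans :: "('u::universe dfl, 'u => 'u, 'u str_obj, 'u str_mor, 'u vbundle, 'u => 'u) pseudo_trans" where
 "str_trans = \<lparr> Cpt = str_func,
   Sq = \<lambda>X' X g (n, h). \<lambda>z\<in>pts (pb_space X' g (str_bundle X n h)). upair (ufst z) (usnd (usnd z)) \<rparr>"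

lemma str_trans_simps [simp]:
 "Cpt str_trans = str_func"
 "Sq str_trans X' X g (n, h) = (flatten X' g (str_bundle X n h))"
 by (simp_all add: str_trans_def)

lemma str_square_natural:
 assumes X': "X' \<in> Obj Dfg" and X: "X \<in> Obj Dfg" and g: "g \<in> dfl_hom X' X"
 shows "natural_iso (Val VBun_str X) (VBun_cat X') (comp_func (pb_func X' g) (str_func X))
  (comp_func (str_func X') (Res VBun_str X' X g)) (Sq str_trans X' X g)"
 unfolding natural_iso_def
proof (intro conjI ballI; clarify?)
 fix n h assume "(n, h) \<in> Obj (Val VBun_str X)"
 then have nh: "(n, h) \<in> Str_obj X" by simp
 interpret A: strict_restriction X n h X' g using X nh X' g by (simp add: strict_restriction_def strict_object_def strict_restriction_axioms_def)
 note FOr = A.Res_eq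
 have sq: "Sq str_trans X' X g (n, h) = A.cmp_map" by (simp add: A.cmp_map_def)
 show "Sq str_trans X' X g (n, h) \<in> Iso (VBun_cat X') (FO (comp_func (pb_func X' g) (str_func X)) (n, h))
   (FO (comp_func (str_func X') (Res VBun_str X' X g)) (n, h))"
  unfolding sq using A.cmp_map_iso by (simp add: comp_func_def Iso_def FOr del: VBun_str_simps)
 fix m k u assume "(m, k) \<in> Obj (Val VBun_str X)" and u': "u \<in> Hom (Val VBun_str X) (n, h) (m, k)"
 then have mk: "(m, k) \<in> Str_obj X" and u: "u \<in> Str_hom X (n, h) (m, k)" by simp_all
 interpret B: strict_restriction X m k X' g using X mk X' g by (simp add: strict_restriction_def strict_object_def strict_restriction_axioms_def)
 interpret P: strict_pair X n h m k ..
 note FOr' = B.Res_eq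
 have sq': "Sq str_trans X' X g (m, k) = B.cmp_map" by (simp add: B.cmp_map_def)
 have "compose (pts (pb_space X' g A.B)) B.cmp_map (pb_map X' g A.B (str_map X n u)) z =
  compose (pts (pb_space X' g A.B)) (str_map X' A.n' (FM (Res VBun_str X' X g) (n, h) (m, k) u)) A.cmp_map z" for z
 proof (cases "z \<in> pts (pb_space X' g A.B)")
  case True
  then obtain x v where z: "z = upair x (upair (g x) (vec_code v))" "x \<in> pts X'" "g x \<in> pts X" "v \<in> carrier_vec (n (pt_plot (g x)))"
   by (rule A.pb_B_cases)
  have up: "u (pt_plot (g x)) 0 *\<^sub>v v \<in> carrier_vec (m (pt_plot (g x)))"
   by (rule mult_mat_vec_carrier[OF _ z(4)])
    (use P.str_hom_mat(1)[OF u dfl_plots_point[OF A.dX z(3)]] in "simp add: pt_plot_def smooth_mat_def RN_0")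
  have "B.cmp_map (pb_map X' g A.B (str_map X n u) z) = upair x (vec_code (u (pt_plot (g x)) 0 *\<^sub>v v))"
   using z B.cmp_map_upair[OF z(2,3) up] by (simp add: str_map_def)
  moreover have "upair x (vec_code v) \<in> str_pts X' A.n'" using z A.n'_pt[OF z(2)] by simp
  then have "str_map X' A.n' (FM (Res VBun_str X' X g) (n, h) (m, k) u) (A.cmp_map z) = upair x (vec_code (u (pt_plot (g x)) 0 *\<^sub>v v))"
   using z A.cmp_map_upair[OF z(2-4)] A.res.pt_plot_Obj[OF z(2)] by (simp add: str_map_def A.push_pt_plot)
  ultimately show ?thesis using True by (simp add: compose_def)
 qed (simp add: compose_def)
 then show "Cmp (VBun_cat X') (FO (comp_func (pb_func X' g) (str_func X)) (n, h)) (FO (comp_func (pb_func X' g) (str_func X)) (m, k))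
   (FO (comp_func (str_func X') (Res VBun_str X' X g)) (m, k)) (Sq str_trans X' X g (m, k)) (FM (comp_func (pb_func X' g) (str_func X)) (n, h) (m, k) u) =
  Cmp (VBun_cat X') (FO (comp_func (pb_func X' g) (str_func X)) (n, h)) (FO (comp_func (str_func X') (Res VBun_str X' X g)) (n, h))
   (FO (comp_func (str_func X') (Res VBun_str X' X g)) (m, k)) (FM (comp_func (str_func X') (Res VBun_str X' X g)) (n, h) (m, k) u) (Sq str_trans X' X g (n, h))"
  unfolding sq sq' by (simp add: comp_func_def Cmp_VBun FOr FOr' fun_eq_iff del: VBun_str_simps)
qed

lemma str_trans_unit:
 assumes X: "X \<in> Obj Dfg" and nh: "(n, h) \<in> Str_obj X"
 shows "compose (str_pts X n) (flatten X (\<lambda>x\<in>pts X. x) (str_bundle X n h))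
   (\<lambda>e\<in>str_pts X n. upair (prj (str_bundle X n h) e) e) = (\<lambda>z\<in>str_pts X n. z)"
 by (auto simp: compose_def fun_eq_iff elim!: str_pts_cases)

lemma str_trans_comb:
 assumes X: "X \<in> Obj Dfg" "X' \<in> Obj Dfg" "X'' \<in> Obj Dfg" and f: "f \<in> dfl_hom X'' X'" and g: "g \<in> dfl_hom X' X"
  and nh: "(n, h) \<in> Str_obj X"
  and gx: "FO (Res VBun_str X' X g) (n, h) = (n', h')" and fgx: "FO (Res VBun_str X'' X' f) (n', h') = (n'', h'')"
 shows "compose (pts (pb_space X'' f (pb_bundle X' g (str_bundle X n h)))) (Sq str_trans X'' X (compose (pts X'') g f) (n, h))
   (Cmb VBun_Dfg X'' X' X f g (str_bundle X n h)) =
  compose (pts (pb_space X'' f (pb_bundle X' g (str_bundle X n h)))) (\<lambda>z\<in>str_pts X'' n''. z)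
   (compose (pts (pb_space X'' f (pb_bundle X' g (str_bundle X n h)))) (Sq str_trans X'' X' f (n', h'))
    (pb_map X'' f (pb_bundle X' g (str_bundle X n h)) (Sq str_trans X' X g (n, h))))"
proof -
 interpret A: strict_restriction X n h X' g using X nh g by (simp add: strict_restriction_def strict_object_def strict_restriction_axioms_def)
 have nh': "n' = A.n'" "h' = A.h'" using gx unfolding A.Res_eq by simp_all
 interpret A': strict_restriction X' n' h' X'' f
  using X A.restricted f by (simp add: strict_restriction_def strict_object_def strict_restriction_axioms_def nh' del: VBun_str_simps)
 have n'': "n'' = A'.n'" using fgx unfolding A'.Res_eq by simp
 show ?thesis
 proof (rule extensionalityI[of _ "pts (pb_space X'' f (pb_bundle X' g A.B))"])
  fix z assume z: "z \<in> pts (pb_space X'' f (pb_bundle X' g A.B))"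
  obtain x e where ze: "z = upair x (upair (f x) e)" "x \<in> pts X''" "f x \<in> pts X'" "e \<in> str_pts X n" "g (f x) = prj A.B e"
   using pb2_cases[OF z] by auto
  obtain v where e: "e = upair (g (f x)) (vec_code v)" "g (f x) \<in> pts X" "v \<in> carrier_vec (n (pt_plot (g (f x))))"
   using ze(4,5) by (auto elim!: str_pts_cases)
  have n1: "n' (pt_plot (f x)) = n (pt_plot (g (f x)))" unfolding nh' by (rule A.n'_pt[OF ze(3)])
  have n2: "n'' (pt_plot x) = n (pt_plot (g (f x)))" unfolding n'' by (rule trans[OF A'.n'_pt[OF ze(2)] n1])
  show "compose (pts (pb_space X'' f (pb_bundle X' g A.B))) (Sq str_trans X'' X (compose (pts X'') g f) (n, h)) (Cmb VBun_Dfg X'' X' X f g A.B) z =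
   compose (pts (pb_space X'' f (pb_bundle X' g A.B))) (\<lambda>z\<in>str_pts X'' n''. z)
   (compose (pts (pb_space X'' f (pb_bundle X' g A.B))) (Sq str_trans X'' X' f (n', h')) (pb_map X'' f (pb_bundle X' g A.B) (Sq str_trans X' X g (n, h)))) z"
   using z ze(2,3) e(2,3) n1 n2 by (simp add: compose_def ze(1) e(1))
 qed simp_all
qed

lemma str_trans_objectwise_equivalence:
 "objectwise_equivalence_op Dfg (as_pseudo (VBun_str :: ('u::universe dfl, 'u => 'u, 'u str_obj, 'u str_mor) diagram))
  (VBun_Dfg :: ('u dfl, 'u => 'u, 'u vbundle, 'u => 'u) pseudo) str_trans"
proof -
 have V: "Val (as_pseudo VBun_str) X = Str X" "Res (as_pseudo VBun_str) = Res VBun_str"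
  "Unt (as_pseudo VBun_str) X x = Id (Str X) x"
  "Cmb (as_pseudo VBun_str) X'' X' X f g x = Id (Str X'') (FO (Res VBun_str X'' X' f) (FO (Res VBun_str X' X g) x))"
  for X X' X'' f g x by (simp_all add: as_pseudo_def del: VBun_str_simps(2))
 have rest: "FO (Res VBun_str X' X g) x \<in> Str_obj X'"
  if "X' \<in> Obj Dfg" "X \<in> Obj Dfg" "g \<in> Hom Dfg X' X" "x \<in> Str_obj X" for X' X g x
  using is_functorD(3)[OF strict_functor_opD(3)[OF strict_functor_VBun_str that(1,2,3)], of x] that(4) by simp
 show ?thesis
  unfolding objectwise_equivalence_op_def pseudonatural_op_def Let_def V VBun_Dfg_simps(1,2) str_trans_simps(1)
 proof (intro conjI ballI, goal_cases)
  case 1 show ?case by (rule pseudofunctor_as_pseudo[OF strict_functor_VBun_str])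
 next
  case 2 show ?case by (rule pseudofunctor_VBun_Dfg)
 next
  case (3 X) then show ?case by (rule str_functor)
 next
  case (4 X' X g) then show ?case
   using str_square_natural[OF 4(1,2)] by (simp add: Hom_Dfg del: VBun_str_simps(2))
 next
  case (5 X x)
  then obtain n h where nh: "x = (n, h)" and x': "(n, h) \<in> Str_obj X" by (cases x) auto
  show ?case
   unfolding nh str_func_simps str_map_Id[OF 5(1) x'] using str_trans_unit[OF 5(1) x'] by (simp add: Cmp_VBun Id_Dfg del: VBun_str_simps(2))
 next
  case (6 X'' X' X f g x)
  then obtain n h where nh: "x = (n, h)" and x': "(n, h) \<in> Str_obj X" by (cases x) auto
  obtain n' h' where nh': "FO (Res VBun_str X' X g) (n, h) = (n', h')" by (cases "FO (Res VBun_str X' X g) (n, h)")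
  obtain n'' h'' where nh'': "FO (Res VBun_str X'' X' f) (n', h') = (n'', h'')" by (cases "FO (Res VBun_str X'' X' f) (n', h')")
  have x'': "(n'', h'') \<in> Str_obj X''"
   using rest[OF 6(1,2,4) rest[OF 6(2,3,5) x']] by (simp only: nh' nh'')
  show ?case
   unfolding nh nh' nh'' str_func_simps str_map_Id[OF 6(1) x''] pb_func_simps Cmp_VBun Cmp_Dfg pb_bundle_simps(1)
   by (rule str_trans_comb[OF 6(3,2,1) 6(4,5)[unfolded Hom_Dfg] x' nh' nh''])
 next
  case (7 X) then show ?case by (rule str_equivalence)
 qed
qed

section \<open>Descent data as transport of fibres\<close>

lemma is_category_VBun_Inv:
 assumes "vector_bundle X E" "vector_bundle X E'" "inverse_arrows (VBun_cat X) E E' u w"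
 shows "Inv (VBun_cat X) E E' u = w"
 by (rule Inv_eqI[OF is_category_VBun _ _ assms(3)]) (use assms in \<open>simp_all add: Obj_VBun\<close>)

locale kernel_pair =
 fixes Y X :: "'u::universe dfl" and \<pi> :: "'u => 'u"
 assumes Y: "Y \<in> Obj Dfg" and X: "X \<in> Obj Dfg" and \<pi>: "\<pi> \<in> dfl_hom Y X"
begin

abbreviation Y2 where "Y2 \<equiv> fib2 Y \<pi>"
abbreviation Y3 where "Y3 \<equiv> fib3 Y \<pi>"
abbreviation p1 where "p1 \<equiv> pr1 Y \<pi>"
abbreviation p2 where "p2 \<equiv> pr2 Y \<pi>"

abbreviation dobj where "dobj \<equiv> descent_obj VBun_Dfg Y \<pi>"
abbreviation dhom where "dhom \<equiv> descent_hom VBun_Dfg Y \<pi>"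
abbreviation dcat where "dcat \<equiv> descent_cat VBun_Dfg Y \<pi>"
abbreviation DF where "DF \<equiv> descent_functor VBun_Dfg Y X \<pi>"

lemma dY: "diffeological_space Y" by (rule Dfg_diffeological[OF Y])
lemma dX: "diffeological_space X" by (rule Dfg_diffeological[OF X])

lemma Y2: "Y2 \<in> Obj Dfg" unfolding fib2_def by (rule fibre_prod_Dfg[OF Y Y])
lemma Y3: "Y3 \<in> Obj Dfg" unfolding fib3_def by (rule fibre_prod_Dfg[OF Y2 Y])
lemma dY2: "diffeological_space Y2" by (rule Dfg_diffeological[OF Y2])
lemma dY3: "diffeological_space Y3" by (rule Dfg_diffeological[OF Y3])

lemma Y2_pts [simp]: "upair y z \<in> pts Y2 \<longleftrightarrow> y \<in> pts Y \<and> z \<in> pts Y \<and> \<pi> y = \<pi> z"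
 by (simp add: fib2_def)

lemma Y3_pts [simp]: "upair (upair x y) z \<in> pts Y3 \<longleftrightarrow> x \<in> pts Y \<and> y \<in> pts Y \<and> z \<in> pts Y \<and> \<pi> x = \<pi> y \<and> \<pi> y = \<pi> z"
 by (auto simp: fib3_def)

lemma Y2_cases:
 assumes "t \<in> pts Y2"
 obtains y z where "t = upair y z" "y \<in> pts Y" "z \<in> pts Y" "\<pi> y = \<pi> z"
 using assms unfolding fib2_def by (rule fibre_prod_cases)

lemma Y3_cases:
 assumes "t \<in> pts Y3"
 obtains x y z where "t = upair (upair x y) z" "x \<in> pts Y" "y \<in> pts Y" "z \<in> pts Y" "\<pi> x = \<pi> y" "\<pi> y = \<pi> z"
proof -
 obtain s z where s: "t = upair s z" "s \<in> pts Y2" "z \<in> pts Y" "\<pi> (usnd s) = \<pi> z"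
  using assms unfolding fib3_def by (rule fibre_prod_cases)
 from s(2) obtain x y where "s = upair x y" "x \<in> pts Y" "y \<in> pts Y" "\<pi> x = \<pi> y" by (rule Y2_cases)
 with s that show ?thesis by simp
qed

lemma p1_simp [simp]: "y \<in> pts Y ==> z \<in> pts Y ==> \<pi> y = \<pi> z ==> p1 (upair y z) = y"
 by (simp add: pr1_def)

lemma p2_simp [simp]: "y \<in> pts Y ==> z \<in> pts Y ==> \<pi> y = \<pi> z ==> p2 (upair y z) = z"
 by (simp add: pr2_def)

lemma p1: "p1 \<in> dfl_hom Y2 Y" and p2: "p2 \<in> dfl_hom Y2 Y"
 unfolding pr1_def pr2_def fib2_def by (rule fibre_prod_proj[OF dY dY])+

lemma Y2_pair_plot:
 assumes "(\<lambda>y\<in>c. \<alpha> y) \<in> plots Y c" "(\<lambda>y\<in>c. b y) \<in> plots Y c" "\<And>y. y \<in> c ==> \<pi> (\<alpha> y) = \<pi> (b y)"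
 shows "(\<lambda>y\<in>c. upair (\<alpha> y) (b y)) \<in> plots Y2 c"
 unfolding fib2_def by (rule fibre_prod_pair_plot[OF dY dY]) (use assms in auto)

lemma Y3_homs: "pr12 Y \<pi> \<in> dfl_hom Y3 Y2" "pr23 Y \<pi> \<in> dfl_hom Y3 Y2" "pr13 Y \<pi> \<in> dfl_hom Y3 Y2"
proof -
 have r: "(\<lambda>t\<in>pts Y3. usnd t) \<in> dfl_hom Y3 Y" and "(\<lambda>t\<in>pts Y3. ufst t) \<in> dfl_hom Y3 Y2"
  unfolding fib3_def by (rule fibre_prod_proj[OF dY2 dY])+
 then show 12: "pr12 Y \<pi> \<in> dfl_hom Y3 Y2" by (simp add: pr12_def)
 note q = dfl_hom_compose[OF dY3 12 dY2 p1] dfl_hom_compose[OF dY3 12 dY2 p2]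
 have "(\<lambda>t\<in>pts Y3. upair (compose (pts Y3) p2 (pr12 Y \<pi>) t) ((\<lambda>t\<in>pts Y3. usnd t) t)) \<in> dfl_hom Y3 Y2"
  unfolding fib2_def by (rule fibre_prod_pairing[OF dY3 dY dY q(2) r]) (auto simp: pr12_def compose_def elim!: Y3_cases)
 moreover have "(\<lambda>t\<in>pts Y3. upair (compose (pts Y3) p1 (pr12 Y \<pi>) t) ((\<lambda>t\<in>pts Y3. usnd t) t)) \<in> dfl_hom Y3 Y2"
  unfolding fib2_def by (rule fibre_prod_pairing[OF dY3 dY dY q(1) r]) (auto simp: pr12_def compose_def elim!: Y3_cases)
 moreover have "(\<lambda>t\<in>pts Y3. upair (compose (pts Y3) p2 (pr12 Y \<pi>) t) ((\<lambda>t\<in>pts Y3. usnd t) t)) = pr23 Y \<pi>"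
  "(\<lambda>t\<in>pts Y3. upair (compose (pts Y3) p1 (pr12 Y \<pi>) t) ((\<lambda>t\<in>pts Y3. usnd t) t)) = pr13 Y \<pi>"
  by (auto simp: fun_eq_iff pr12_def pr13_def pr23_def compose_def elim!: Y3_cases)
 ultimately show "pr23 Y \<pi> \<in> dfl_hom Y3 Y2" "pr13 Y \<pi> \<in> dfl_hom Y3 Y2" by simp_all
qed

lemma vb_p1: "vector_bundle Y E ==> vector_bundle Y2 (pb_bundle Y2 p1 E)"
 and vb_p2: "vector_bundle Y E ==> vector_bundle Y2 (pb_bundle Y2 p2 E)"
 by (rule pb_bundle_vector_bundle[OF _ Y2 p1], assumption) (rule pb_bundle_vector_bundle[OF _ Y2 p2], assumption)

text \<open>The transport of \<open>e\<close> to the fibre over \<open>y\<close> given by a gluing.\<close>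

definition move :: "'u vbundle => ('u => 'u) => 'u => 'u => 'u" where
 "move E \<alpha> y e = usnd (\<alpha> (upair (upair (prj E e) y) e))"

lemma pb_p1_cases:
 assumes "w \<in> pts (pb_space Y2 p1 E)"
 obtains z e where "w = upair (upair (prj E e) z) e" "prj E e \<in> pts Y" "z \<in> pts Y" "\<pi> (prj E e) = \<pi> z" "e \<in> pts (tot E)"
proof -
 obtain t e where te: "w = upair t e" "t \<in> pts Y2" "e \<in> pts (tot E)" "p1 t = prj E e" using assms by (rule pb_cases)
 from te(2) obtain y z where "t = upair y z" "y \<in> pts Y" "z \<in> pts Y" "\<pi> y = \<pi> z" by (rule Y2_cases)
 with te that show ?thesis by simp
qed

lemma gluing_upair:
 assumes E: "vector_bundle Y E" and \<alpha>: "\<alpha> \<in> bundle_hom Y2 (pb_bundle Y2 p1 E) (pb_bundle Y2 p2 E)"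
  and e: "e \<in> pts (tot E)" and z: "z \<in> pts Y" "\<pi> (prj E e) = \<pi> z"
 shows "\<alpha> (upair (upair (prj E e) z) e) = upair (upair (prj E e) z) (move E \<alpha> z e)"
  "move E \<alpha> z e \<in> pts (tot E)" "prj E (move E \<alpha> z e) = z"
proof -
 let ?w = "upair (upair (prj E e) z) e"
 note y = vector_bundleD(8)[OF E e]
 have w: "?w \<in> pts (tot (pb_bundle Y2 p1 E))" using e z y by simp
 note D = bundle_homD(2,3)[OF \<alpha> vb_p1[OF E] w]
 have "\<alpha> ?w \<in> pts (pb_space Y2 p2 E)" using D(1) by simp
 then obtain t e' where te: "\<alpha> ?w = upair t e'" "t \<in> pts Y2" "e' \<in> pts (tot E)" "p2 t = prj E e'" by (rule pb_cases)
 have t: "t = upair (prj E e) z" using D(2) te e z y by simp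
 show "\<alpha> ?w = upair (upair (prj E e) z) (move E \<alpha> z e)" "move E \<alpha> z e \<in> pts (tot E)" "prj E (move E \<alpha> z e) = z"
  using te z y by (simp_all add: t move_def)
qed

text \<open>The coherence isomorphisms only rearrange the base points, so they disappear from the formula.\<close>

lemma pulled_gluing_eq:
 assumes E: "vector_bundle Y E" and \<alpha>: "\<alpha> \<in> bundle_hom Y2 (pb_bundle Y2 p1 E) (pb_bundle Y2 p2 E)"
  and r: "r \<in> dfl_hom Y3 Y2"
 shows "pulled_gluing VBun_Dfg Y \<pi> r E \<alpha> =
  (\<lambda>z\<in>pts (pb_space Y3 (compose (pts Y3) p1 r) E). upair (ufst z) (usnd (\<alpha> (upair (r (ufst z)) (usnd z)))))"
proof -
 note inv = comb_inverse_arrows[OF E Y2 Y3 p1 r]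
 have q: "compose (pts Y3) p1 r \<in> dfl_hom Y3 Y" by (rule dfl_hom_compose[OF dY3 r dY2 p1])
 have I: "Inv (VBun_cat Y3) (pb_bundle Y3 r (pb_bundle Y2 p1 E)) (pb_bundle Y3 (compose (pts Y3) p1 r) E)
   (flatten Y3 r (pb_bundle Y2 p1 E)) =
  (\<lambda>z\<in>pts (pb_space Y3 (compose (pts Y3) p1 r) E). upair (ufst z) (upair (r (ufst z)) (usnd z)))"
  by (rule is_category_VBun_Inv[OF pb_bundle_vector_bundle[OF vb_p1[OF E] Y3 r] pb_bundle_vector_bundle[OF E Y3 q] inv])
 have "pulled_gluing VBun_Dfg Y \<pi> r E \<alpha> =
  compose (pts (pb_space Y3 (compose (pts Y3) p1 r) E)) (flatten Y3 r (pb_bundle Y2 p2 E))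
   (compose (pts (pb_space Y3 (compose (pts Y3) p1 r) E)) (pb_map Y3 r (pb_bundle Y2 p1 E) \<alpha>)
    (\<lambda>z\<in>pts (pb_space Y3 (compose (pts Y3) p1 r) E). upair (ufst z) (upair (r (ufst z)) (usnd z))))"
  unfolding pulled_gluing_def Let_def VBun_Dfg_simps pb_func_simps Cmp_Dfg I Cmp_VBun pb_bundle_simps(1) ..
 also have "\<dots> = (\<lambda>z\<in>pts (pb_space Y3 (compose (pts Y3) p1 r) E). upair (ufst z) (usnd (\<alpha> (upair (r (ufst z)) (usnd z)))))"
 proof (rule extensionalityI[of _ "pts (pb_space Y3 (compose (pts Y3) p1 r) E)"])
  fix z assume zz: "z \<in> pts (pb_space Y3 (compose (pts Y3) p1 r) E)"
  then obtain t e where z: "z = upair t e" "t \<in> pts Y3" "e \<in> pts (tot E)" "compose (pts Y3) p1 r t = prj E e" by (rule pb_cases)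
  have rt: "r t \<in> pts Y2" "p1 (r t) = prj E e" using dfl_hom_pts[OF r z(2)] z by (auto simp: compose_def)
  have w: "upair (r t) e \<in> pts (tot (pb_bundle Y2 p1 E))" using z rt by simp
  note D = bundle_homD(2,3)[OF \<alpha> vb_p1[OF E] w]
  have 1: "r t = prj (pb_bundle Y2 p1 E) (upair r' e)" if "r t = r'" for r' using that rt z by simp
  have 2: "r t = prj (pb_bundle Y2 p2 E) (\<alpha> (upair (r t) e))" using D(2) rt z by simp
  show "compose (pts (pb_space Y3 (compose (pts Y3) p1 r) E)) (flatten Y3 r (pb_bundle Y2 p2 E))
   (compose (pts (pb_space Y3 (compose (pts Y3) p1 r) E)) (pb_map Y3 r (pb_bundle Y2 p1 E) \<alpha>)
    (\<lambda>z\<in>pts (pb_space Y3 (compose (pts Y3) p1 r) E). upair (ufst z) (upair (r (ufst z)) (usnd z)))) z =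
   (\<lambda>z\<in>pts (pb_space Y3 (compose (pts Y3) p1 r) E). upair (ufst z) (usnd (\<alpha> (upair (r (ufst z)) (usnd z))))) z"
   using zz D 2 z rt w by (simp add: compose_def)
 qed simp_all
 finally show ?thesis .
qed

lemma Y3_projections:
 "compose (pts Y3) p1 (pr12 Y \<pi>) = (\<lambda>t\<in>pts Y3. ufst (ufst t))" "compose (pts Y3) p1 (pr13 Y \<pi>) = (\<lambda>t\<in>pts Y3. ufst (ufst t))"
 "compose (pts Y3) p1 (pr23 Y \<pi>) = (\<lambda>t\<in>pts Y3. usnd (ufst t))"
 by (auto simp: compose_def fun_eq_iff pr12_def pr13_def pr23_def elim!: Y3_cases)

lemma Y3_projection_simps [simp]:
 assumes "x \<in> pts Y" "y \<in> pts Y" "z \<in> pts Y" "\<pi> x = \<pi> y" "\<pi> y = \<pi> z"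
 shows "pr12 Y \<pi> (upair (upair x y) z) = upair x y" "pr13 Y \<pi> (upair (upair x y) z) = upair x z"
  "pr23 Y \<pi> (upair (upair x y) z) = upair y z"
 using assms by (simp_all add: pr12_def pr13_def pr23_def)

text \<open>The cocycle condition over \<open>(y\<^sub>1, y\<^sub>2, y\<^sub>3)\<close>, evaluated at a vector over \<open>y\<^sub>1\<close>.\<close>

lemma descent_obj_iff:
 "(E, \<alpha>) \<in> dobj \<longleftrightarrow> vector_bundle Y E \<and>
   \<alpha> \<in> Iso (VBun_cat Y2) (pb_bundle Y2 p1 E) (pb_bundle Y2 p2 E) \<and>
   (\<forall>e\<in>pts (tot E). \<forall>y\<in>pts Y. \<forall>z\<in>pts Y. \<pi> (prj E e) = \<pi> y \<and> \<pi> y = \<pi> z --> move E \<alpha> z (move E \<alpha> y e) = move E \<alpha> z e)"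
proof -
 let ?q1 = "\<lambda>t\<in>pts Y3. ufst (ufst t)"
 let ?q2 = "\<lambda>t\<in>pts Y3. usnd (ufst t)"
 have "pulled_gluing VBun_Dfg Y \<pi> (pr13 Y \<pi>) E \<alpha> =
   compose (pts (pb_space Y3 ?q1 E)) (pulled_gluing VBun_Dfg Y \<pi> (pr23 Y \<pi>) E \<alpha>) (pulled_gluing VBun_Dfg Y \<pi> (pr12 Y \<pi>) E \<alpha>) \<longleftrightarrow>
  (\<forall>e\<in>pts (tot E). \<forall>y\<in>pts Y. \<forall>z\<in>pts Y. \<pi> (prj E e) = \<pi> y \<and> \<pi> y = \<pi> z --> move E \<alpha> z (move E \<alpha> y e) = move E \<alpha> z e)"
  (is "?L = ?R \<longleftrightarrow> ?P")
  if E: "vector_bundle Y E" and iso: "\<alpha> \<in> Iso (VBun_cat Y2) (pb_bundle Y2 p1 E) (pb_bundle Y2 p2 E)"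
 proof -
  have \<alpha>: "\<alpha> \<in> bundle_hom Y2 (pb_bundle Y2 p1 E) (pb_bundle Y2 p2 E)" using iso by (auto simp: Iso_def inverse_arrows_def Hom_VBun)
  note pg = pulled_gluing_eq[OF E \<alpha> Y3_homs(1)] pulled_gluing_eq[OF E \<alpha> Y3_homs(2)] pulled_gluing_eq[OF E \<alpha> Y3_homs(3)]
  note g = gluing_upair[OF E \<alpha>]
  have val: "?L (upair (upair (upair (prj E e) y) z) e) = upair (upair (upair (prj E e) y) z) (move E \<alpha> z e)"
   "?R (upair (upair (upair (prj E e) y) z) e) = upair (upair (upair (prj E e) y) z) (move E \<alpha> z (move E \<alpha> y e))"
   if e: "e \<in> pts (tot E)" and y: "y \<in> pts Y" "z \<in> pts Y" "\<pi> (prj E e) = \<pi> y" "\<pi> y = \<pi> z" for e y z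
  proof -
   note x = vector_bundleD(8)[OF E e]
   have py: "prj E (move E \<alpha> y e) = y" "move E \<alpha> y e \<in> pts (tot E)" using g(2,3)[OF e y(1,3)] by auto
   show "?L (upair (upair (upair (prj E e) y) z) e) = upair (upair (upair (prj E e) y) z) (move E \<alpha> z e)"
    using e y x g(1)[OF e y(2)] by (simp add: pg Y3_projections)
   show "?R (upair (upair (upair (prj E e) y) z) e) = upair (upair (upair (prj E e) y) z) (move E \<alpha> z (move E \<alpha> y e))"
    using e y x g(1)[OF e y(1,3)] g(1)[OF py(2) y(2)] py by (simp add: pg Y3_projections compose_def)
  qed
  show ?thesis
  proof
   assume eq: "?L = ?R"
   show ?P
   proof (intro ballI impI)
    fix e y z assume "e \<in> pts (tot E)" "y \<in> pts Y" "z \<in> pts Y" "\<pi> (prj E e) = \<pi> y \<and> \<pi> y = \<pi> z"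
    then show "move E \<alpha> z (move E \<alpha> y e) = move E \<alpha> z e"
     using val[of e y z] fun_cong[OF eq, of "upair (upair (upair (prj E e) y) z) e"] by simp
   qed
  next
   assume P: ?P
   show "?L = ?R"
   proof (rule extensionalityI[of _ "pts (pb_space Y3 ?q1 E)"])
    fix w assume "w \<in> pts (pb_space Y3 ?q1 E)"
    then obtain t e where w: "w = upair t e" "t \<in> pts Y3" "e \<in> pts (tot E)" "?q1 t = prj E e" by (rule pb_cases)
    from w(2) obtain x y z where t: "t = upair (upair x y) z" "x \<in> pts Y" "y \<in> pts Y" "z \<in> pts Y" "\<pi> x = \<pi> y" "\<pi> y = \<pi> z"
     by (rule Y3_cases)
    have x: "x = prj E e" using w t by simp
    show "?L w = ?R w" using val[OF w(3) t(3,4) t(5)[unfolded x] t(6)] P w(3) t unfolding w(1) t(1) x by simp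
   qed (simp_all add: pg Y3_projections)
  qed
 qed
 then show ?thesis
  unfolding descent_obj_def Let_def VBun_Dfg_simps pb_func_simps Cmp_Dfg Cmp_VBun pb_bundle_simps(1) Y3_projections
  by (auto simp: Obj_VBun)
qed

lemma descent_hom_iff:
 assumes a: "(E, \<alpha>) \<in> dobj" and b: "(E', \<alpha>') \<in> dobj"
 shows "u \<in> dhom (E, \<alpha>) (E', \<alpha>') \<longleftrightarrow> u \<in> bundle_hom Y E E' \<and>
  (\<forall>e\<in>pts (tot E). \<forall>z\<in>pts Y. \<pi> (prj E e) = \<pi> z --> move E' \<alpha>' z (u e) = u (move E \<alpha> z e))"
proof -
 have E: "vector_bundle Y E" "vector_bundle Y E'"
  and \<alpha>: "\<alpha> \<in> bundle_hom Y2 (pb_bundle Y2 p1 E) (pb_bundle Y2 p2 E)" "\<alpha>' \<in> bundle_hom Y2 (pb_bundle Y2 p1 E') (pb_bundle Y2 p2 E')"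
  using a b by (auto simp: descent_obj_iff Iso_def inverse_arrows_def Hom_VBun)
 have "compose (pts (pb_space Y2 p1 E)) \<alpha>' (pb_map Y2 p1 E u) = compose (pts (pb_space Y2 p1 E)) (pb_map Y2 p2 E u) \<alpha> \<longleftrightarrow>
  (\<forall>e\<in>pts (tot E). \<forall>z\<in>pts Y. \<pi> (prj E e) = \<pi> z --> move E' \<alpha>' z (u e) = u (move E \<alpha> z e))" (is "?L = ?R \<longleftrightarrow> ?P")
  if u: "u \<in> bundle_hom Y E E'"
 proof -
  note uD = bundle_homD[OF u E(1)]
  have val: "?L (upair (upair (prj E e) z) e) = upair (upair (prj E e) z) (move E' \<alpha>' z (u e))"
   "?R (upair (upair (prj E e) z) e) = upair (upair (prj E e) z) (u (move E \<alpha> z e))"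
   if e: "e \<in> pts (tot E)" and z: "z \<in> pts Y" "\<pi> (prj E e) = \<pi> z" for e z
  proof -
   note x = vector_bundleD(8)[OF E(1) e] and g = gluing_upair[OF E(1) \<alpha>(1) e z]
   note g' = gluing_upair[OF E(2) \<alpha>(2) uD(2)[OF e] z(1)]
   show "?L (upair (upair (prj E e) z) e) = upair (upair (prj E e) z) (move E' \<alpha>' z (u e))"
    using e z x g'(1) uD(3)[OF e] by (simp add: compose_def)
   show "?R (upair (upair (prj E e) z) e) = upair (upair (prj E e) z) (u (move E \<alpha> z e))"
    using e z x g by (simp add: compose_def)
  qed
  show ?thesis
  proof
   assume eq: "?L = ?R"
   show ?P
   proof (intro ballI impI)
    fix e z assume "e \<in> pts (tot E)" "z \<in> pts Y" "\<pi> (prj E e) = \<pi> z"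
    then show "move E' \<alpha>' z (u e) = u (move E \<alpha> z e)"
     using val[of e z] fun_cong[OF eq, of "upair (upair (prj E e) z) e"] by simp
   qed
  next
   assume P: ?P
   show "?L = ?R"
   proof (rule extensionalityI[of _ "pts (pb_space Y2 p1 E)"])
    fix w assume "w \<in> pts (pb_space Y2 p1 E)"
    then obtain z e where w: "w = upair (upair (prj E e) z) e" "z \<in> pts Y" "\<pi> (prj E e) = \<pi> z" "e \<in> pts (tot E)" by (rule pb_p1_cases)
    show "?L w = ?R w" using val[OF w(4,2,3)] P w unfolding w(1) by simp
   qed simp_all
  qed
 qed
 then show ?thesis
  unfolding descent_hom_def Let_def VBun_Dfg_simps pb_func_simps Cmp_VBun pb_bundle_simps(1)
  by (auto simp: Hom_VBun)
qed

end

locale descent_datum = kernel_pair Y X \<pi> for Y X :: "'u::universe dfl" and \<pi> +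
 fixes E :: "'u vbundle" and \<alpha> :: "'u => 'u"
 assumes datum: "(E, \<alpha>) \<in> dobj"
begin

abbreviation mv where "mv \<equiv> move E \<alpha>"

lemma E: "vector_bundle Y E" and iso: "\<alpha> \<in> Iso (VBun_cat Y2) (pb_bundle Y2 p1 E) (pb_bundle Y2 p2 E)"
 and mv_mv: "e \<in> pts (tot E) ==> y \<in> pts Y ==> z \<in> pts Y ==> \<pi> (prj E e) = \<pi> y ==> \<pi> y = \<pi> z ==> mv z (mv y e) = mv z e"
 using datum by (auto simp: descent_obj_iff)

lemma \<alpha>: "\<alpha> \<in> bundle_hom Y2 (pb_bundle Y2 p1 E) (pb_bundle Y2 p2 E)"
 using iso by (auto simp: Iso_def inverse_arrows_def Hom_VBun)

lemmas vE = vector_bundleD[OF E]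
lemmas \<alpha>_upair = gluing_upair(1)[OF E \<alpha>] and mv_pts = gluing_upair(2)[OF E \<alpha>] and mv_prj = gluing_upair(3)[OF E \<alpha>]

text \<open>The cocycle condition over \<open>(y, y, y)\<close> makes the transport from \<open>y\<close> to itself idempotent, and it is
injective.\<close>

lemma mv_id:
 assumes e: "e \<in> pts (tot E)"
 shows "mv (prj E e) e = e"
proof -
 let ?x = "prj E e"
 note x = vE(8)[OF e]
 note a = \<alpha>_upair[OF e x refl] and m = mv_pts[OF e x refl] mv_prj[OF e x refl]
 obtain b where "inverse_arrows (VBun_cat Y2) (pb_bundle Y2 p1 E) (pb_bundle Y2 p2 E) \<alpha> b" using iso by (auto simp: Iso_def)
 then have b\<alpha>: "compose (pts (pb_space Y2 p1 E)) b \<alpha> = (\<lambda>w\<in>pts (pb_space Y2 p1 E). w)"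
  by (simp add: inverse_arrows_def Cmp_VBun Id_VBun)
 have inv: "b (\<alpha> w) = w" if "w \<in> pts (pb_space Y2 p1 E)" for w using fun_cong[OF b\<alpha>, of w] that by (simp add: compose_def)
 have "\<alpha> (upair (upair ?x ?x) (mv ?x e)) = \<alpha> (upair (upair ?x ?x) e)"
  using \<alpha>_upair[OF m(1) x, unfolded m(2)] mv_mv[OF e x x refl refl] a by simp
 then have "b (\<alpha> (upair (upair ?x ?x) (mv ?x e))) = b (\<alpha> (upair (upair ?x ?x) e))" by simp
 then show ?thesis using inv[of "upair (upair ?x ?x) (mv ?x e)"] inv[of "upair (upair ?x ?x) e"] e x m by simp
qed

lemma mv_add:
 assumes e: "e \<in> pts (tot E)" "e' \<in> pts (tot E)" "prj E e = prj E e'" and z: "z \<in> pts Y" "\<pi> (prj E e) = \<pi> z"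
 shows "mv z (vadd E e e') = vadd E (mv z e) (mv z e')"
proof -
 let ?t = "upair (prj E e) z"
 note x = vE(8)[OF e(1)] and cl = bundle_closed(1)[OF E e]
 have w: "upair ?t e \<in> pts (tot (pb_bundle Y2 p1 E))" "upair ?t e' \<in> pts (tot (pb_bundle Y2 p1 E))" using e z x by simp_all
 have "prj (pb_bundle Y2 p1 E) (upair ?t e) = prj (pb_bundle Y2 p1 E) (upair ?t e')" using e z x by simp
 from bundle_homD(4)[OF \<alpha> vb_p1[OF E] w this]
 have "\<alpha> (upair ?t (vadd E e e')) = vadd (pb_bundle Y2 p2 E) (\<alpha> (upair ?t e)) (\<alpha> (upair ?t e'))" by simp
 then show ?thesis
  using \<alpha>_upair[OF e(1) z] \<alpha>_upair[OF e(2) z(1)] \<alpha>_upair[of "vadd E e e'", OF _ z(1)] cl e(3) z(2) by simp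
qed

lemma mv_smult:
 assumes e: "e \<in> pts (tot E)" and z: "z \<in> pts Y" "\<pi> (prj E e) = \<pi> z"
 shows "mv z (vsmult E r e) = vsmult E r (mv z e)"
proof -
 let ?t = "upair (prj E e) z"
 note x = vE(8)[OF e(1)] and cl = bundle_closed(2)[OF E e]
 have w: "upair ?t e \<in> pts (tot (pb_bundle Y2 p1 E))" using e z x by simp_all
 from bundle_homD(5)[OF \<alpha> vb_p1[OF E] w]
 have "\<alpha> (upair ?t (vsmult E r e)) = vsmult (pb_bundle Y2 p2 E) r (\<alpha> (upair ?t e))" by simp
 then show ?thesis using \<alpha>_upair[OF e(1) z] \<alpha>_upair[of "vsmult E r e", OF _ z(1)] cl z(2) by simp
qed

lemma mv_plot:
 assumes q: "(\<lambda>y\<in>c. q y) \<in> plots (tot E) c" and \<psi>: "(\<lambda>y\<in>c. \<psi> y) \<in> plots Y c" and eq: "\<And>y. y \<in> c ==> \<pi> (prj E (q y)) = \<pi> (\<psi> y)"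
 shows "(\<lambda>y\<in>c. mv (\<psi> y) (q y)) \<in> plots (tot E) c"
proof -
 have b: "(\<lambda>y\<in>c. prj E (q y)) \<in> plots Y c" by (rule restrict_comp_plot[OF vE(4,5) q])
 have t: "(\<lambda>y\<in>c. upair (prj E (q y)) (\<psi> y)) \<in> plots Y2 c" by (rule Y2_pair_plot[OF b \<psi> eq])
 have pts: "q y \<in> pts (tot E)" "\<psi> y \<in> pts Y" if "y \<in> c" for y
  using dfl_plots_pts[OF vE(4) q that] dfl_plots_pts[OF dY \<psi> that] that by simp_all
 have w: "(\<lambda>y\<in>c. upair (upair (prj E (q y)) (\<psi> y)) (q y)) \<in> plots (pb_space Y2 p1 E) c"
  by (rule pb_space_pair_plot[OF E dY2 _ t q]) (use pts vE(8) eq in simp)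
 have "(\<lambda>y\<in>c. \<alpha> (upair (upair (prj E (q y)) (\<psi> y)) (q y))) \<in> plots (pb_space Y2 p2 E) c"
  using restrict_comp_plot[OF vector_bundleD(4)[OF vb_p1[OF E]] bundle_homD(1)[OF \<alpha> vb_p1[OF E]]] w by simp
 from pb_proj2[OF E dY2 this] show ?thesis unfolding move_def by (simp cong: restrict_cong)
qed

end

context kernel_pair
begin

lemma descent_cat_simps [simp]:
 "Obj (descent_cat F Y \<pi>) = descent_obj F Y \<pi>" "Hom (descent_cat F Y \<pi>) = descent_hom F Y \<pi>"
 "Id dcat (E, \<alpha>) = (\<lambda>e\<in>pts (tot E). e)"
 "Cmp dcat (E, \<alpha>) (E', \<alpha>') (E'', \<alpha>'') v u = compose (pts (tot E)) v u"
 by (simp_all add: descent_cat_def Id_VBun Cmp_VBun)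

lemma datumI: "(E, \<alpha>) \<in> dobj ==> descent_datum Y X \<pi> E \<alpha>"
 by (simp add: descent_datum_def descent_datum_axioms_def kernel_pair_axioms)

lemma is_category_descent: "is_category dcat"
 unfolding is_category_def
proof (intro conjI ballI; clarify?)
 fix E \<alpha> assume "(E, \<alpha>) \<in> Obj dcat"
 then have a: "(E, \<alpha>) \<in> dobj" by simp
 interpret A: descent_datum Y X \<pi> E \<alpha> by (rule datumI[OF a])
 show "Id dcat (E, \<alpha>) \<in> Hom dcat (E, \<alpha>) (E, \<alpha>)"
  using bundle_hom_id[OF A.E] A.mv_pts by (simp add: descent_hom_iff[OF a a])
 fix E' \<alpha>' u assume "(E', \<alpha>') \<in> Obj dcat" and "u \<in> Hom dcat (E, \<alpha>) (E', \<alpha>')"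
 then have a': "(E', \<alpha>') \<in> dobj" and u: "u \<in> dhom (E, \<alpha>) (E', \<alpha>')" by simp_all
 interpret A': descent_datum Y X \<pi> E' \<alpha>' by (rule datumI[OF a'])
 note uh = u[unfolded descent_hom_iff[OF a a']]
 then have ub: "u \<in> bundle_hom Y E E'" ..
 show "Cmp dcat (E, \<alpha>) (E, \<alpha>) (E', \<alpha>') u (Id dcat (E, \<alpha>)) = u"
  "Cmp dcat (E, \<alpha>) (E', \<alpha>') (E', \<alpha>') (Id dcat (E', \<alpha>')) u = u"
  using is_categoryD(3,4)[OF is_category_VBun[of Y], of E E' u] ub A.E A'.E by (simp_all add: Obj_VBun Hom_VBun Id_VBun Cmp_VBun)
 fix E'' \<alpha>'' v assume "(E'', \<alpha>'') \<in> Obj dcat" and "v \<in> Hom dcat (E', \<alpha>') (E'', \<alpha>'')"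
 then have a'': "(E'', \<alpha>'') \<in> dobj" and v: "v \<in> dhom (E', \<alpha>') (E'', \<alpha>'')" by simp_all
 note vh = v[unfolded descent_hom_iff[OF a' a'']]
 then have vb: "v \<in> bundle_hom Y E' E''" ..
 note uD = bundle_homD(2,3)[OF ub A.E]
 show "Cmp dcat (E, \<alpha>) (E', \<alpha>') (E'', \<alpha>'') v u \<in> Hom dcat (E, \<alpha>) (E'', \<alpha>'')"
  using bundle_hom_compose[OF A.E A'.E ub vb] conjunct2[OF uh] conjunct2[OF vh] uD A.mv_pts
  by (simp add: descent_hom_iff[OF a a''] compose_def)
 fix E3 \<alpha>3 w assume "(E3, \<alpha>3) \<in> Obj dcat"
 show "Cmp dcat (E, \<alpha>) (E', \<alpha>') (E3, \<alpha>3) (Cmp dcat (E', \<alpha>') (E'', \<alpha>'') (E3, \<alpha>3) w v) u =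
  Cmp dcat (E, \<alpha>) (E'', \<alpha>'') (E3, \<alpha>3) w (Cmp dcat (E, \<alpha>) (E', \<alpha>') (E'', \<alpha>'') v u)"
  using uD by (auto simp: compose_def fun_eq_iff)
qed

definition can_gluing :: "'u vbundle => 'u => 'u" where
 "can_gluing E = (\<lambda>w\<in>pts (pb_space Y2 p1 (pb_bundle Y \<pi> E)). upair (ufst w) (upair (usnd (ufst w)) (usnd (usnd w))))"

lemma \<pi>p: "compose (pts Y2) \<pi> p2 = compose (pts Y2) \<pi> p1"
 by (auto simp: compose_def fun_eq_iff elim!: Y2_cases)

text \<open>For a pulled back bundle the coherence isomorphisms compose to the gluing that changes the point of \<open>Y\<close>
and keeps the vector.\<close>

lemma canonical:
 assumes E: "vector_bundle X E"
 shows "FO DF E = (pb_bundle Y \<pi> E, can_gluing E)"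
  "can_gluing E \<in> Iso (VBun_cat Y2) (pb_bundle Y2 p1 (pb_bundle Y \<pi> E)) (pb_bundle Y2 p2 (pb_bundle Y \<pi> E))"
proof -
 let ?P = "pb_bundle Y \<pi> E" and ?D = "pb_bundle Y2 (compose (pts Y2) \<pi> p1) E"
 have P: "vector_bundle Y ?P" by (rule pb_bundle_vector_bundle[OF E Y \<pi>])
 have D: "vector_bundle Y2 ?D" by (rule pb_bundle_vector_bundle[OF E Y2 dfl_hom_compose[OF dY2 p1 dY \<pi>]])
 note i1 = comb_inverse_arrows[OF E Y Y2 \<pi> p1] and i2 = comb_inverse_arrows[OF E Y Y2 \<pi> p2, unfolded \<pi>p]
 let ?c1 = "\<lambda>z\<in>pts (pb_space Y2 p1 ?P). upair (ufst z) (usnd (usnd z))"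
 let ?c2 = "\<lambda>z\<in>pts (pb_space Y2 (compose (pts Y2) \<pi> p1) E). upair (ufst z) (upair (p2 (ufst z)) (usnd z))"
 have I: "Inv (VBun_cat Y2) (pb_bundle Y2 p2 ?P) ?D (flatten Y2 p2 ?P) = ?c2"
  by (rule is_category_VBun_Inv[OF vb_p2[OF P] D i2])
 have can: "can_gluing E = compose (pts (pb_space Y2 p1 ?P)) ?c2 ?c1"
 proof (rule extensionalityI[of _ "pts (pb_space Y2 p1 ?P)"])
  fix w assume w: "w \<in> pts (pb_space Y2 p1 ?P)"
  then obtain z e where e: "w = upair (upair (prj ?P e) z) e" "prj ?P e \<in> pts Y" "z \<in> pts Y" "\<pi> (prj ?P e) = \<pi> z" "e \<in> pts (tot ?P)" by (rule pb_p1_cases)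
  have "e \<in> pts (pb_space Y \<pi> E)" using e(5) by simp
  then obtain y e' where e': "e = upair y e'" "y \<in> pts Y" "e' \<in> pts (tot E)" "\<pi> y = prj E e'" by (rule pb_cases)
  show "can_gluing E w = compose (pts (pb_space Y2 p1 ?P)) ?c2 ?c1 w"
   using w e e' by (simp add: can_gluing_def compose_def)
 qed (simp_all add: can_gluing_def)
 have "inverse_arrows (VBun_cat Y2) (pb_bundle Y2 p1 ?P) (pb_bundle Y2 p2 ?P)
   (Cmp (VBun_cat Y2) (pb_bundle Y2 p1 ?P) ?D (pb_bundle Y2 p2 ?P) ?c2 ?c1)
   (Cmp (VBun_cat Y2) (pb_bundle Y2 p2 ?P) ?D (pb_bundle Y2 p1 ?P)
    (\<lambda>z\<in>pts (pb_space Y2 (compose (pts Y2) \<pi> p1) E). upair (ufst z) (upair (p1 (ufst z)) (usnd z)))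
    (flatten Y2 p2 ?P))"
  by (rule inverse_arrows_compose[OF is_category_VBun _ _ _ i1 inverse_arrows_sym[OF i2]])
   (simp_all add: Obj_VBun vb_p1[OF P] vb_p2[OF P] D)
 then show "can_gluing E \<in> Iso (VBun_cat Y2) (pb_bundle Y2 p1 ?P) (pb_bundle Y2 p2 ?P)"
  unfolding Iso_def by (auto simp: Cmp_VBun can)
 show "FO DF E = (?P, can_gluing E)"
  unfolding descent_functor_def Let_def VBun_Dfg_simps pb_func_simps Cmp_Dfg I Cmp_VBun pb_bundle_simps(1) can func.simps ..
qed

lemma descent_functor_FM [simp]: "FM DF E E' u = pb_map Y \<pi> E u"
 by (simp add: descent_functor_def Let_def)

lemma can_move:
 assumes E: "vector_bundle X E" and e: "y \<in> pts Y" "e \<in> pts (tot E)" "\<pi> y = prj E e" and z: "z \<in> pts Y" "\<pi> y = \<pi> z"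
 shows "move (pb_bundle Y \<pi> E) (can_gluing E) z (upair y e) = upair z e"
 using e z by (simp add: move_def can_gluing_def)

lemma can_datum:
 assumes E: "vector_bundle X E"
 shows "(pb_bundle Y \<pi> E, can_gluing E) \<in> dobj"
 unfolding descent_obj_iff
 using pb_bundle_vector_bundle[OF E Y \<pi>] canonical(2)[OF E] can_move[OF E] by (auto elim!: pb_cases)

lemma descent_hom_can:
 assumes E: "vector_bundle X E" and b: "(E', \<alpha>') \<in> dobj"
 shows "u \<in> dhom (pb_bundle Y \<pi> E, can_gluing E) (E', \<alpha>') \<longleftrightarrow> u \<in> bundle_hom Y (pb_bundle Y \<pi> E) E' \<and>
  (\<forall>e\<in>pts (tot E). \<forall>y\<in>pts Y. \<forall>z\<in>pts Y. \<pi> y = prj E e \<and> \<pi> y = \<pi> z --> move E' \<alpha>' z (u (upair y e)) = u (upair z e))"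
 unfolding descent_hom_iff[OF can_datum[OF E] b] using can_move[OF E] by (auto elim!: pb_cases)

lemma descent_functor_functor: "is_functor (VBun_cat X) dcat DF"
 unfolding is_functor_def
proof (intro conjI ballI is_category_VBun is_category_descent)
 note pF = is_functorD[OF pb_functor[OF X Y \<pi>]]
 fix E assume "E \<in> Obj (VBun_cat X)"
 then have E: "vector_bundle X E" by (simp add: Obj_VBun)
 show "FO DF E \<in> Obj dcat" by (simp add: canonical(1)[OF E] can_datum[OF E])
 show "FM DF E E (Id (VBun_cat X) E) = Id dcat (FO DF E)"
  using pF(5)[of E] E by (simp add: canonical(1)[OF E] Obj_VBun) (simp add: Id_VBun)
 fix E' u assume "E' \<in> Obj (VBun_cat X)" and "u \<in> Hom (VBun_cat X) E E'"
 then have E': "vector_bundle X E'" and u: "u \<in> bundle_hom X E E'" by (simp_all add: Obj_VBun Hom_VBun)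
 note uD = bundle_homD[OF u E]
 show "FM DF E E' u \<in> Hom dcat (FO DF E) (FO DF E')"
 proof -
  have "move (pb_bundle Y \<pi> E') (can_gluing E') z (pb_map Y \<pi> E u (upair y e)) = pb_map Y \<pi> E u (upair z e)"
   if "e \<in> pts (tot E)" "y \<in> pts Y" "z \<in> pts Y" "\<pi> y = prj E e" "\<pi> y = \<pi> z" for e y z
   using can_move[OF E' that(2), of "u e" z] that uD(2,3)[OF that(1)] by simp
  then show ?thesis
   unfolding canonical(1)[OF E] canonical(1)[OF E'] descent_cat_simps descent_functor_FM descent_hom_can[OF E can_datum[OF E']]
   using pb_map_bundle_hom[OF E E' u Y \<pi>] by blast
 qed
 fix E'' v assume "E'' \<in> Obj (VBun_cat X)" and "v \<in> Hom (VBun_cat X) E' E''"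
 then have E'': "vector_bundle X E''" and v: "v \<in> bundle_hom X E' E''" by (simp_all add: Obj_VBun Hom_VBun)
 show "FM DF E E'' (Cmp (VBun_cat X) E E' E'' v u) =
   Cmp dcat (FO DF E) (FO DF E') (FO DF E'')
    (FM DF E' E'' v) (FM DF E E' u)"
  unfolding canonical(1)[OF E] canonical(1)[OF E'] canonical(1)[OF E''] descent_cat_simps descent_functor_FM
  using pF(6)[of E E' E'' u v] E E' E'' u v by (simp add: Obj_VBun Hom_VBun Cmp_VBun)
qed

end

section \<open>Descent along a subduction\<close>

locale subducted = kernel_pair Y X \<pi> for Y X :: "'u::universe dfl" and \<pi> +
 assumes lifts: "\<phi> \<in> plots X c ==> \<exists>K. dgop_covering c K \<and>
  (\<forall>c' f. (c', f) \<in> K --> (\<exists>\<psi>\<in>plots Y c'. \<forall>y\<in>c'. \<pi> (\<psi> y) = \<phi> (f y)))"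
begin

lemma \<pi>_surj:
 assumes x: "x \<in> pts X"
 obtains y where "y \<in> pts Y" "\<pi> y = x"
proof -
 obtain K where K: "dgop_covering (RN 0) K" "\<forall>c' f. (c', f) \<in> K --> (\<exists>\<psi>\<in>plots Y c'. \<forall>y\<in>c'. \<pi> (\<psi> y) = (\<lambda>_\<in>RN 0. x) (f y))"
  using lifts[OF dfl_plots_point[OF dX x]] by blast
 have "(0::rinf) \<in> RN 0" by (simp add: RN_0)
 from dgop_coveringD(4)[OF K(1) this] obtain c' f where cf: "(c', f) \<in> K" "0 \<in> f ` c'" by blast
 then obtain t where t: "t \<in> c'" "f t = 0" by auto
 obtain \<psi> where \<psi>: "\<psi> \<in> plots Y c'" "\<forall>y\<in>c'. \<pi> (\<psi> y) = (\<lambda>_\<in>RN 0. x) (f y)" using K(2) cf(1) by blast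
 show ?thesis by (rule that[of "\<psi> t"]) (use \<psi> t dfl_plots_pts[OF dY \<psi>(1)] in "auto simp: RN_0")
qed

definition sec :: "'u => 'u" where
 "sec x = (SOME y. y \<in> pts Y \<and> \<pi> y = x)"

lemma sec: "x \<in> pts X ==> sec x \<in> pts Y" "x \<in> pts X ==> \<pi> (sec x) = x"
 unfolding sec_def by (rule someI2_ex[where Q="\<lambda>y. y \<in> pts Y"]; use \<pi>_surj in blast)
  (rule someI2_ex[where Q="\<lambda>y. \<pi> y = x"]; use \<pi>_surj in blast)

lemma \<pi>_pts: "y \<in> pts Y ==> \<pi> y \<in> pts X" by (rule dfl_hom_pts[OF \<pi>])

text \<open>Smoothness over a plot of \<open>X\<close> can be tested where the plot lifts to \<open>Y\<close>.\<close>

lemma smooth_on_lifts: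
 assumes A: "diffeological_space A" and b: "b \<in> c \<rightarrow>\<^sub>E pts A" and \<phi>: "\<phi> \<in> plots X c"
  and loc: "\<And>c' f \<psi>. c' \<in> Obj Cart ==> smooth_map c' c f ==> \<psi> \<in> plots Y c' ==> (\<And>y. y \<in> c' ==> \<pi> (\<psi> y) = \<phi> (f y)) ==>
   (\<lambda>y\<in>c'. b (f y)) \<in> plots A c'"
 shows "b \<in> plots A c"
proof -
 obtain K where K: "dgop_covering c K" "\<forall>c' f. (c', f) \<in> K --> (\<exists>\<psi>\<in>plots Y c'. \<forall>y\<in>c'. \<pi> (\<psi> y) = \<phi> (f y))"
  using lifts[OF \<phi>] by blast
 show ?thesis
 proof (rule dfl_plots_sheaf[OF A b K(1)])
  fix c' f assume cf: "(c', f) \<in> K"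
  obtain \<psi> where \<psi>: "\<psi> \<in> plots Y c'" "\<forall>y\<in>c'. \<pi> (\<psi> y) = \<phi> (f y)" using K(2) cf by blast
  have "smooth_map c' c f" using dgop_coveringD(3)[OF K(1) cf] by (auto simp: open_embedding_def Hom_Cart_iff)
  from loc[OF dgop_coveringD(2)[OF K(1) cf] this \<psi>(1)] \<psi>(2) show "compose c' b f \<in> plots A c'" by (simp add: compose_def)
 qed
qed

lemma pb_map_faithful:
 assumes E: "vector_bundle X E" and E': "vector_bundle X E'" and u: "u \<in> bundle_hom X E E'" "u' \<in> bundle_hom X E E'"
  and eq: "pb_map Y \<pi> E u = pb_map Y \<pi> E u'"
 shows "u = u'"
proof (rule bundle_hom_eqI[OF u])
 fix e assume e: "e \<in> pts (tot E)"
 note x = vector_bundleD(8)[OF E e]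
 show "u e = u' e" using fun_cong[OF eq, of "upair (sec (prj E e)) e"] e sec[OF x] by simp
qed

text \<open>Compatibility with the canonical gluings says that \<open>w\<close> acts on the vector component in the same way at
all points of \<open>Y\<close> with a given image. The resulting map \<open>u\<close> is smooth since it is so after lifting.\<close>

lemma pb_map_full:
 assumes E: "vector_bundle X E" and E': "vector_bundle X E'"
  and w: "w \<in> dhom (pb_bundle Y \<pi> E, can_gluing E) (pb_bundle Y \<pi> E', can_gluing E')"
 obtains u where "u \<in> bundle_hom X E E'" "pb_map Y \<pi> E u = w"
proof -
 let ?P = "pb_bundle Y \<pi> E" and ?P' = "pb_bundle Y \<pi> E'"
 note vE = vector_bundleD[OF E] and vE' = vector_bundleD[OF E']
 have P: "vector_bundle Y ?P" "vector_bundle Y ?P'" by (rule pb_bundle_vector_bundle[OF E Y \<pi>], rule pb_bundle_vector_bundle[OF E' Y \<pi>])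
 have wb: "w \<in> bundle_hom Y ?P ?P'"
  and wc: "\<And>e y z. e \<in> pts (tot E) ==> y \<in> pts Y ==> z \<in> pts Y ==> \<pi> y = prj E e ==> \<pi> y = \<pi> z ==>
   move ?P' (can_gluing E') z (w (upair y e)) = w (upair z e)"
  using w unfolding descent_hom_can[OF E can_datum[OF E']] by blast+
 note wD = bundle_homD[OF wb P(1)]
 define u where "u = (\<lambda>e\<in>pts (tot E). usnd (w (upair (sec (prj E e)) e)))"
 have wv: "w (upair y e) = upair y (usnd (w (upair y e)))" "usnd (w (upair y e)) \<in> pts (tot E')" "prj E' (usnd (w (upair y e))) = \<pi> y"
  if e: "e \<in> pts (tot E)" and y: "y \<in> pts Y" "\<pi> y = prj E e" for y e
 proof -
  have m: "upair y e \<in> pts (tot ?P)" using e y by simp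
  have "w (upair y e) \<in> pts (pb_space Y \<pi> E')" using wD(2)[OF m] by simp
  then obtain y' e' where e': "w (upair y e) = upair y' e'" "y' \<in> pts Y" "e' \<in> pts (tot E')" "\<pi> y' = prj E' e'" by (rule pb_cases)
  have "y' = y" using wD(3)[OF m] e' e y by simp
  then show "w (upair y e) = upair y (usnd (w (upair y e)))" "usnd (w (upair y e)) \<in> pts (tot E')" "prj E' (usnd (w (upair y e))) = \<pi> y"
   using e' by simp_all
 qed
 have wu: "w (upair y e) = upair y (u e)" if e: "e \<in> pts (tot E)" and y: "y \<in> pts Y" "\<pi> y = prj E e" for y e
 proof -
  let ?s = "sec (prj E e)"
  note s = sec[OF vE(8)[OF e]]
  note a = wv[OF e s]
  have "move ?P' (can_gluing E') y (upair ?s (u e)) = upair y (u e)"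
   by (rule can_move[OF E']) (use a e s y in \<open>simp_all add: u_def\<close>)
  moreover have "upair ?s (u e) = w (upair ?s e)" using a(1) e by (simp add: u_def)
  ultimately show ?thesis using wc[OF e s(1) y(1) s(2)] s(2) y(2) by simp
 qed
 have up: "u e \<in> pts (tot E')" "prj E' (u e) = prj E e" if e: "e \<in> pts (tot E)" for e
  using wv(2,3)[OF e sec[OF vE(8)[OF e]]] sec(2)[OF vE(8)[OF e]] e by (simp_all add: u_def)
 have "u \<in> bundle_hom X E E'"
 proof (rule bundle_homI)
  show "u \<in> dfl_hom (tot E) (tot E')"
  proof (rule dfl_homI[OF vE(4)])
   show "u \<in> pts (tot E) \<rightarrow>\<^sub>E pts (tot E')" using up(1) by (auto simp: u_def)
   fix c b assume c: "c \<in> Obj Cart" and b: "b \<in> plots (tot E) c"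
   note bp = dfl_plots_pts[OF vE(4) b]
   show "(\<lambda>y\<in>c. u (b y)) \<in> plots (tot E') c"
   proof (rule smooth_on_lifts[OF vE'(4) _ dfl_hom_plots[OF vE(4,5) b]])
    show "(\<lambda>y\<in>c. u (b y)) \<in> c \<rightarrow>\<^sub>E pts (tot E')" using up(1) bp by auto
    fix c' f \<psi> assume c': "c' \<in> Obj Cart" and f: "smooth_map c' c f" and \<psi>: "\<psi> \<in> plots Y c'"
     and eq: "\<And>y. y \<in> c' ==> \<pi> (\<psi> y) = (\<lambda>y\<in>c. prj E (b y)) (f y)"
    have fc: "f y \<in> c" if "y \<in> c'" for y using smooth_map_image[OF f that] .
    have \<psi>': "(\<lambda>y\<in>c'. \<psi> y) \<in> plots Y c'" using \<psi> dfl_plots_PiE[OF dY \<psi>] by (simp add: PiE_restrict)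
    have bf: "(\<lambda>y\<in>c'. b (f y)) \<in> plots (tot E) c'" by (rule dfl_plots_compose[OF vE(4) b c' f])
    have "(\<lambda>y\<in>c'. upair (\<psi> y) (b (f y))) \<in> plots (pb_space Y \<pi> E) c'"
     by (rule pb_space_pair_plot[OF E dY _ \<psi>' bf]) (use eq fc in simp)
    from restrict_comp_plot[OF vector_bundleD(4)[OF P(1)] wD(1)] this
    have "(\<lambda>y\<in>c'. w (upair (\<psi> y) (b (f y)))) \<in> plots (pb_space Y \<pi> E') c'" by simp
    from pb_proj2[OF E' dY this] have "(\<lambda>y\<in>c'. usnd (w (upair (\<psi> y) (b (f y))))) \<in> plots (tot E') c'" by (simp cong: restrict_cong)
    moreover have "usnd (w (upair (\<psi> y) (b (f y)))) = u (b (f y))" if "y \<in> c'" for y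
     using wu[OF bp[OF fc[OF that]] dfl_plots_pts[OF dY \<psi> that]] eq[OF that] fc[OF that] by simp
    ultimately show "(\<lambda>y\<in>c'. (\<lambda>y\<in>c. u (b y)) (f y)) \<in> plots (tot E') c'" using fc by (simp cong: restrict_cong)
   qed
  qed
  show "u (vadd E e e') = vadd E' (u e) (u e')" if e: "e \<in> pts (tot E)" "e' \<in> pts (tot E)" "prj E e = prj E e'" for e e'
  proof -
   let ?s = "sec (prj E e)"
   note s = sec[OF vE(8)[OF e(1)]] and cl = bundle_closed(1)[OF E e]
   have m: "upair ?s e \<in> pts (tot ?P)" "upair ?s e' \<in> pts (tot ?P)" using e s by simp_all
   have "prj ?P (upair ?s e) = prj ?P (upair ?s e')" using e s by simp
   from wD(4)[OF m this] have "w (upair ?s (vadd E e e')) = vadd ?P' (w (upair ?s e)) (w (upair ?s e'))" by simp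
   then show ?thesis using wu[OF e(1) s] wu[OF e(2) s(1)] wu[of "vadd E e e'" ?s] cl e(3) s by simp
  qed
  show "u (vsmult E r e) = vsmult E' r (u e)" if e: "e \<in> pts (tot E)" for r e
  proof -
   let ?s = "sec (prj E e)"
   note s = sec[OF vE(8)[OF e(1)]] and cl = bundle_closed(2)[OF E e]
   have m: "upair ?s e \<in> pts (tot ?P)" using e s by simp_all
   from wD(5)[OF m] have "w (upair ?s (vsmult E r e)) = vsmult ?P' r (w (upair ?s e))" by simp
   then show ?thesis using wu[OF e(1) s] wu[of "vsmult E r e" ?s] cl s by simp
  qed
 qed (rule up(2))
 moreover have "pb_map Y \<pi> E u = w"
 proof (rule extensionalityI[of _ "pts (pb_space Y \<pi> E)"])
  show "w \<in> extensional (pts (pb_space Y \<pi> E))" using dfl_hom_PiE[OF wD(1)] by (auto simp: PiE_def)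
  show "pb_map Y \<pi> E u z = w z" if z: "z \<in> pts (pb_space Y \<pi> E)" for z
   using z wu by (auto elim!: pb_cases)
 qed (simp add: pb_map_def)
 ultimately show ?thesis by (rule that)
qed

end

lemma subduction_subducted:
 assumes "subduction Y X \<pi>"
 shows "subducted Y X \<pi>"
proof
 show "Y \<in> Obj Dfg" "X \<in> Obj Dfg" "\<pi> \<in> dfl_hom Y X" using assms by (auto simp: subduction_def Hom_Dfg)
 fix \<phi> c assume \<phi>: "\<phi> \<in> plots X c"
 then have "c \<in> Obj Cart" using dfl_plots_Cart[OF Dfg_diffeological \<phi>] assms by (auto simp: subduction_def)
 then obtain K where K: "dgop_covering c K" "\<forall>(c', f)\<in>K. \<exists>\<psi>\<in>plots Y c'. compose c' \<pi> \<psi> = compose c' \<phi> f"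
  using assms \<phi> by (fastforce simp: subduction_def)
 have "\<exists>\<psi>\<in>plots Y c'. \<forall>y\<in>c'. \<pi> (\<psi> y) = \<phi> (f y)" if "(c', f) \<in> K" for c' f
 proof -
  obtain \<psi> where \<psi>: "\<psi> \<in> plots Y c'" "compose c' \<pi> \<psi> = compose c' \<phi> f" using K(2) \<open>(c', f) \<in> K\<close> by blast
  have "\<pi> (\<psi> y) = \<phi> (f y)" if "y \<in> c'" for y using fun_cong[OF \<psi>(2), of y] that by (simp add: compose_def)
  with \<psi>(1) show ?thesis by blast
 qed
 with K(1) show "\<exists>K. dgop_covering c K \<and> (\<forall>c' f. (c', f) \<in> K --> (\<exists>\<psi>\<in>plots Y c'. \<forall>y\<in>c'. \<pi> (\<psi> y) = \<phi> (f y)))" by blast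
qed

locale descended = subducted Y X \<pi> + descent_datum Y X \<pi> E \<alpha>
 for Y X :: "'u::universe dfl" and \<pi> and E :: "'u vbundle" and \<alpha> :: "'u => 'u"
begin

definition D :: "'u set" where
 "D = {e \<in> pts (tot E). prj E e = sec (\<pi> (prj E e))}"

text \<open>The descended bundle: fibres of \<open>E\<close> at the chosen points. As the choice is not smooth, the plots are
described by their transports along all smooth families \<open>\<psi>\<close> of points of \<open>Y\<close>, over all reparametrisations
\<open>g\<close> since \<open>\<psi>\<close> may exist only locally.\<close>

definition desc :: "'u vbundle" where
 "desc = \<lparr>
   tot = \<lparr> pts = D,
    plots = \<lambda>c. {b. c \<in> Obj Cart \<and> b \<in> c \<rightarrow>\<^sub>E D \<and> (\<lambda>y\<in>c. \<pi> (prj E (b y))) \<in> plots X c \<and>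
     (\<forall>c' g \<psi>. c' \<in> Obj Cart --> smooth_map c' c g --> \<psi> \<in> plots Y c' --> (\<forall>y\<in>c'. \<pi> (\<psi> y) = \<pi> (prj E (b (g y)))) -->
      (\<lambda>y\<in>c'. mv (\<psi> y) (b (g y))) \<in> plots (tot E) c')} \<rparr>,
   prj = \<lambda>e\<in>D. \<pi> (prj E e), vadd = vadd E, vsmult = vsmult E, vzero = \<lambda>x. vzero E (sec x) \<rparr>"

lemma desc_simps [simp]:
 "pts (tot desc) = D" "vadd desc = vadd E" "vsmult desc = vsmult E" "vzero desc x = vzero E (sec x)"
 "e \<in> D ==> prj desc e = \<pi> (prj E e)"
 by (simp_all add: desc_def)

lemma DD: "e \<in> D ==> e \<in> pts (tot E)" "e \<in> D ==> prj E e \<in> pts Y" "e \<in> D ==> \<pi> (prj E e) \<in> pts X"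
 "e \<in> D ==> sec (\<pi> (prj E e)) = prj E e"
 using vE(8) \<pi>_pts by (auto simp: D_def)

lemma D_iff: "x \<in> pts X ==> e \<in> pts (tot E) ==> prj E e = sec x ==> e \<in> D"
 by (simp add: D_def sec(2))

lemma desc_plots:
 "b \<in> plots (tot desc) c \<longleftrightarrow> c \<in> Obj Cart \<and> b \<in> c \<rightarrow>\<^sub>E D \<and> (\<lambda>y\<in>c. \<pi> (prj E (b y))) \<in> plots X c \<and>
   (\<forall>c' g \<psi>. c' \<in> Obj Cart --> smooth_map c' c g --> \<psi> \<in> plots Y c' --> (\<forall>y\<in>c'. \<pi> (\<psi> y) = \<pi> (prj E (b (g y)))) -->
    (\<lambda>y\<in>c'. mv (\<psi> y) (b (g y))) \<in> plots (tot E) c')"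
 by (simp add: desc_def)

lemma desc_plotsD:
 assumes "b \<in> plots (tot desc) c"
 shows "c \<in> Obj Cart" "b \<in> c \<rightarrow>\<^sub>E D" "y \<in> c ==> b y \<in> D" "(\<lambda>y\<in>c. \<pi> (prj E (b y))) \<in> plots X c"
  "c' \<in> Obj Cart ==> smooth_map c' c g ==> \<psi> \<in> plots Y c' ==> (\<And>y. y \<in> c' ==> \<pi> (\<psi> y) = \<pi> (prj E (b (g y)))) ==>
   (\<lambda>y\<in>c'. mv (\<psi> y) (b (g y))) \<in> plots (tot E) c'"
 using assms unfolding desc_plots by (auto dest: PiE_mem)

lemma desc_plotsI:
 assumes "c \<in> Obj Cart" "b \<in> c \<rightarrow>\<^sub>E D" "(\<lambda>y\<in>c. \<pi> (prj E (b y))) \<in> plots X c"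
  "\<And>c' g \<psi>. c' \<in> Obj Cart ==> smooth_map c' c g ==> \<psi> \<in> plots Y c' ==> (\<And>y. y \<in> c' ==> \<pi> (\<psi> y) = \<pi> (prj E (b (g y)))) ==>
   (\<lambda>y\<in>c'. mv (\<psi> y) (b (g y))) \<in> plots (tot E) c'"
 shows "b \<in> plots (tot desc) c"
 using assms unfolding desc_plots by blast

lemma plot_restrict: "diffeological_space A ==> \<psi> \<in> plots A c ==> (\<lambda>y\<in>c. \<psi> y) \<in> plots A c"
 using dfl_plots_PiE[of A \<psi> c] by (simp add: PiE_restrict)

text \<open>For the sheaf condition, a lift \<open>\<psi>\<close> over the whole domain is restricted to neighbourhoods that map into
single members of the covering.\<close>

lemma diffeological_desc: "diffeological_space (tot desc)"
 unfolding diffeological_space_def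
proof (intro conjI allI ballI impI)
 show "plots (tot desc) c = {}" if "c \<notin> Obj Cart" for c using that by (auto simp: desc_plots)
 show "plots (tot desc) c \<subseteq> c \<rightarrow>\<^sub>E pts (tot desc)" for c by (auto simp: desc_plots)
 show "plots (tot desc) (RN 0) = RN 0 \<rightarrow>\<^sub>E pts (tot desc)"
 proof (intro equalityI subsetI)
  fix q assume q: "q \<in> RN 0 \<rightarrow>\<^sub>E pts (tot desc)"
  then have b0: "q 0 \<in> D" by (auto simp: RN_0)
  have eq: "q y = q 0" if "y \<in> RN 0" for y using that by (simp add: RN_0)
  have "(\<lambda>_\<in>RN 0. q 0) \<in> plots (tot E) (RN 0)" by (rule dfl_plots_point[OF vE(4) DD(1)[OF b0]])
  show "q \<in> plots (tot desc) (RN 0)"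
  proof (rule desc_plotsI[OF RN_in_Cart])
   show "q \<in> RN 0 \<rightarrow>\<^sub>E D" using q by simp
   show "(\<lambda>y\<in>RN 0. \<pi> (prj E (q y))) \<in> plots X (RN 0)"
    using dfl_plots_point[OF dX DD(3)[OF b0]] eq by (simp cong: restrict_cong)
   fix c' g \<psi> assume c': "c' \<in> Obj Cart" and g: "smooth_map c' (RN 0) g" and \<psi>: "\<psi> \<in> plots Y c'"
    and p: "\<And>y. y \<in> c' ==> \<pi> (\<psi> y) = \<pi> (prj E (q (g y)))"
   have g0: "g y \<in> RN 0" if "y \<in> c'" for y using smooth_map_image[OF g that] .
   have "(\<lambda>y\<in>c'. (\<lambda>_\<in>RN 0. q 0) (g y)) \<in> plots (tot E) c'"
    by (rule dfl_plots_compose[OF vE(4) _ c' g]) fact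
   then have "(\<lambda>y\<in>c'. q (g y)) \<in> plots (tot E) c'" using g0 eq by (simp cong: restrict_cong)
   then show "(\<lambda>y\<in>c'. mv (\<psi> y) (q (g y))) \<in> plots (tot E) c'"
    by (rule mv_plot[OF _ plot_restrict[OF dY \<psi>] p[symmetric]])
  qed
 qed (simp add: desc_plots)
 show "compose c' q f \<in> plots (tot desc) c'" if c': "c' \<in> Obj Cart" and ff: "f \<in> Hom Cart c' c" and b: "q \<in> plots (tot desc) c" for c c' f q
 proof -
  have f: "smooth_map c' c f" using ff by (simp add: Hom_Cart_iff)
  note bD = desc_plotsD[OF b] and fc = smooth_map_image[OF f]
  show ?thesis
  proof (rule desc_plotsI[OF c'])
   show "compose c' q f \<in> c' \<rightarrow>\<^sub>E D" using bD(3) fc by (auto simp: compose_def)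
   show "(\<lambda>y\<in>c'. \<pi> (prj E (compose c' q f y))) \<in> plots X c'"
    using dfl_plots_compose[OF dX bD(4) c' f] fc by (simp add: compose_def cong: restrict_cong)
   fix c'' g \<psi> assume c'': "c'' \<in> Obj Cart" and g: "smooth_map c'' c' g" and \<psi>: "\<psi> \<in> plots Y c''"
    and p: "\<And>y. y \<in> c'' ==> \<pi> (\<psi> y) = \<pi> (prj E (compose c' q f (g y)))"
   note gc = smooth_map_image[OF g]
   have "(\<lambda>y\<in>c''. mv (\<psi> y) (q (f (g y)))) \<in> plots (tot E) c''"
    by (rule bD(5)[OF c'' smooth_map_compose[OF Cart_locally_bounded[OF c''] g f] \<psi>]) (use p gc in "simp add: compose_def")
   then show "(\<lambda>y\<in>c''. mv (\<psi> y) (compose c' q f (g y))) \<in> plots (tot E) c''" using gc by (simp add: compose_def cong: restrict_cong)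
  qed
 qed
 fix c K q assume q: "q \<in> c \<rightarrow>\<^sub>E pts (tot desc)" and K: "dgop_covering c K \<and> (\<forall>(c', f)\<in>K. compose c' q f \<in> plots (tot desc) c')"
 then have cov: "dgop_covering c K" and loc: "\<And>c' f. (c', f) \<in> K ==> compose c' q f \<in> plots (tot desc) c'" by auto
 have qD: "q y \<in> D" if "y \<in> c" for y using q that by auto
 have f: "smooth_map c' c f" "c' \<in> Obj Cart" if "(c', f) \<in> K" for c' f
  using dgop_coveringD(2,3)[OF cov that] by (auto simp: open_embedding_def Hom_Cart_iff)
 show "q \<in> plots (tot desc) c"
 proof (rule desc_plotsI[OF dgop_coveringD(1)[OF cov]])
  show "q \<in> c \<rightarrow>\<^sub>E D" using q by simp
  show "(\<lambda>y\<in>c. \<pi> (prj E (q y))) \<in> plots X c"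
  proof (rule dfl_plots_sheaf[OF dX _ cov])
   fix c' f assume cf: "(c', f) \<in> K"
   show "compose c' (\<lambda>y\<in>c. \<pi> (prj E (q y))) f \<in> plots X c'"
    using desc_plotsD(4)[OF loc[OF cf]] smooth_map_image[OF f(1)[OF cf]] by (simp add: compose_def cong: restrict_cong)
  qed (use qD DD(3) in auto)
  fix c'' g \<psi> assume c'': "c'' \<in> Obj Cart" and g: "smooth_map c'' c g" and \<psi>: "\<psi> \<in> plots Y c''"
   and p: "\<And>y. y \<in> c'' ==> \<pi> (\<psi> y) = \<pi> (prj E (q (g y)))"
  note gc = smooth_map_image[OF g]
  have mvp: "mv (\<psi> y) (q (g y)) \<in> pts (tot E)" if "y \<in> c''" for y
   by (rule mv_pts[OF DD(1)[OF qD[OF gc[OF that]]] dfl_plots_pts[OF dY \<psi> that] p[OF that, symmetric]])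
  show "(\<lambda>y\<in>c''. mv (\<psi> y) (q (g y))) \<in> plots (tot E) c''"
  proof (rule dfl_plots_local[OF vE(4) _ c''])
   fix y assume y: "y \<in> c''"
   obtain c' f where cf: "(c', f) \<in> K" "g y \<in> f ` c'" using dgop_coveringD(4)[OF cov gc[OF y]] by blast
   have e: "diffeo c' (f ` c') f" and op: "openin (subtopology Rinf c) (f ` c')"
    using dgop_coveringD(3)[OF cov cf(1)] by (auto simp: open_embedding_def)
   obtain f' where f': "smooth_map (f ` c') c' f'" "\<forall>y\<in>f ` c'. f (f' y) = y" using e unfolding diffeo_def by blast
   obtain V0 where V0: "openin Rinf V0" "f ` c' = V0 \<inter> c" using op by (auto simp: openin_subtopology)
   obtain W where W: "openin Rinf W" "\<And>x. x \<in> c'' ==> x \<in> W \<longleftrightarrow> g x \<in> V0" using smooth_map_preimage[OF g V0(1)] by blast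
   have "restrict (\<lambda>y\<in>c''. mv (\<psi> y) (q (g y))) c0 \<in> plots (tot E) c0" if c0: "c0 \<in> Obj Cart" and sub: "c0 \<subseteq> c'' \<inter> W" for c0
   proof -
    have gf: "g x \<in> f ` c'" if x: "x \<in> c0" for x
    proof -
     have "x \<in> c''" "x \<in> W" using x sub by auto
     then show ?thesis using W(2)[of x] V0(2) gc[of x] by simp
    qed
    have g0: "smooth_map c0 (f ` c') g" by (rule smooth_map_subset[OF g _ gf]) (use sub in auto)
    have g1: "smooth_map c0 c' (\<lambda>x. f' (g x))" by (rule smooth_map_compose[OF Cart_locally_bounded[OF c0] g0 f'(1)])
    note g1c = smooth_map_image[OF g1]
    have \<psi>0: "(\<lambda>x\<in>c0. \<psi> x) \<in> plots Y c0"
     by (rule dfl_plots_compose[OF dY \<psi> c0 smooth_map_id]) (use sub in auto)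
    have b: "compose c' q f (f' (g x)) = q (g x)" if "x \<in> c0" for x
     using g1c[OF that] bspec[OF f'(2) gf[OF that]] by (simp add: compose_def)
    have "(\<lambda>x\<in>c0. mv ((\<lambda>x\<in>c0. \<psi> x) x) (compose c' q f (f' (g x)))) \<in> plots (tot E) c0"
     by (rule desc_plotsD(5)[OF loc[OF cf(1)] c0 g1 \<psi>0]) (use b p sub in auto)
    moreover have "restrict (\<lambda>y\<in>c''. mv (\<psi> y) (q (g y))) c0 = (\<lambda>x\<in>c0. mv ((\<lambda>x\<in>c0. \<psi> x) x) (compose c' q f (f' (g x))))"
     using sub b by (auto simp: fun_eq_iff)
    ultimately show ?thesis by simp
   qed
   moreover have "y \<in> W" using W(2)[OF y] cf(2) V0(2) by auto
   ultimately show "\<exists>W. openin Rinf W \<and> y \<in> W \<and> (\<forall>c0\<in>Obj Cart. c0 \<subseteq> c'' \<inter> W -->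
     restrict (\<lambda>y\<in>c''. mv (\<psi> y) (q (g y))) c0 \<in> plots (tot E) c0)" using W(1) by blast
  qed (use mvp in auto)
 qed
qed

lemma fibre_desc: "x \<in> pts X ==> fibre desc x = fibre E (sec x)"
proof -
 assume x: "x \<in> pts X"
 have "e \<in> D \<and> prj desc e = x \<longleftrightarrow> e \<in> pts (tot E) \<and> prj E e = sec x" for e
  using D_iff[OF x, of e] DD(1,4)[of e] sec(2)[OF x] by (cases "e \<in> D") auto
 then show ?thesis by (simp add: fibre_def)
qed

lemma mv_linear:
 assumes y: "y \<in> pts Y" and z: "z \<in> pts Y" "\<pi> y = \<pi> z"
 shows "mv z \<in> linear_maps (fibre E y) (fibre E z)" "bij_betw (mv z) (carrier (fibre E y)) (carrier (fibre E z))"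
proof -
 show "mv z \<in> linear_maps (fibre E y) (fibre E z)"
  using mv_pts[OF _ z(1)] mv_prj[OF _ z(1)] mv_add[OF _ _ _ z(1)] mv_smult[OF _ z(1)] z(2) by (auto simp: linear_maps_fibre)
 show "bij_betw (mv z) (carrier (fibre E y)) (carrier (fibre E z))"
 proof (rule bij_betwI[where g="mv y"])
  show "mv z \<in> carrier (fibre E y) \<rightarrow> carrier (fibre E z)" using mv_pts[OF _ z(1)] mv_prj[OF _ z(1)] z(2) by (auto simp: fibre_in_pts)
  show "mv y \<in> carrier (fibre E z) \<rightarrow> carrier (fibre E y)" using mv_pts[OF _ y] mv_prj[OF _ y] z(2) by (auto simp: fibre_in_pts)
  show "mv y (mv z e) = e" if "e \<in> carrier (fibre E y)" for e
  proof -
   have e: "e \<in> pts (tot E)" "prj E e = y" using that by (auto simp: fibre_in_pts)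
   have "mv y (mv z e) = mv y e" by (rule mv_mv[OF e(1) z(1) y]) (simp_all add: e(2) z(2))
   then show ?thesis using mv_id[OF e(1)] unfolding e(2) by simp
  qed
  show "mv z (mv y e) = e" if "e \<in> carrier (fibre E z)" for e
  proof -
   have e: "e \<in> pts (tot E)" "prj E e = z" using that by (auto simp: fibre_in_pts)
   have "mv z (mv y e) = mv z e" by (rule mv_mv[OF e(1) y z(1)]) (simp_all add: e(2) z(2))
   then show ?thesis using mv_id[OF e(1)] unfolding e(2) by simp
  qed
 qed
qed

text \<open>Transport a frame of \<open>E\<close> along a lift to the chosen points. The transports cancel when the frame is tested
along a lift.\<close>

lemma desc_frame:
 assumes s: "trivialises E U \<psi> k s"
  and \<psi>: "\<And>y. y \<in> U ==> \<psi> y \<in> pts Y" "\<And>y. y \<in> U ==> \<pi> (\<psi> y) = \<phi> y"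
  and lift: "\<And>c q. c \<in> Obj Cart ==> smooth_map c U q ==> (\<lambda>y\<in>c. \<psi> (q y)) \<in> plots Y c"
 shows "trivialises desc U \<phi> k (\<lambda>y v. mv (sec (\<phi> y)) (s y v))"
 unfolding trivialises_def
proof (intro conjI ballI allI impI)
 have \<phi>: "\<phi> y \<in> pts X" if "y \<in> U" for y using \<pi>_pts[OF \<psi>(1)[OF that]] \<psi>(2)[OF that] by simp
 fix y assume y: "y \<in> U"
 note l = mv_linear[OF \<psi>(1)[OF y] sec(1)[OF \<phi>[OF y]]] 
 have e: "\<pi> (\<psi> y) = \<pi> (sec (\<phi> y))" using \<psi>(2)[OF y] sec(2)[OF \<phi>[OF y]] by simp
 show "(\<lambda>v. mv (sec (\<phi> y)) (s y v)) \<in> linear_maps (cvec k) (fibre desc (\<phi> y))"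
  unfolding fibre_desc[OF \<phi>[OF y]] by (rule linear_maps_compose[OF trivialisesD(1)[OF s y] l(1)[OF e]])
 show "bij_betw (\<lambda>v. mv (sec (\<phi> y)) (s y v)) (carrier_vec k) (carrier (fibre desc (\<phi> y)))"
  unfolding fibre_desc[OF \<phi>[OF y]] using bij_betw_trans[OF trivialisesD(2)[OF s y] l(2)[OF e]] by (simp add: comp_def)
next
 fix c q and v :: "rinf => complex Matrix.vec"
 assume c: "c \<in> Obj Cart" and q: "smooth_map c U q" and v: "\<forall>y\<in>c. v y \<in> carrier_vec k"
 have \<phi>: "\<phi> y \<in> pts X" if "y \<in> U" for y using \<pi>_pts[OF \<psi>(1)[OF that]] \<psi>(2)[OF that] by simp
 note qU = smooth_map_image[OF q]
 let ?w = "\<lambda>y\<in>c. mv (sec (\<phi> (q y))) (s (q y) (v y))"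
 have sp: "s (q y) (v y) \<in> pts (tot E)" "prj E (s (q y) (v y)) = \<psi> (q y)" if y: "y \<in> c" for y
  using trivialises_fibre[OF s qU[OF y], of "v y"] v y by (auto simp: fibre_in_pts)
 have sc: "\<pi> (prj E (s (q y) (v y))) = \<pi> (sec (\<phi> (q y)))" if y: "y \<in> c" for y
  using sp(2)[OF y] \<psi>(2)[OF qU[OF y]] sec(2)[OF \<phi>[OF qU[OF y]]] by simp
 have wD: "?w y \<in> D" "\<pi> (prj E (?w y)) = \<phi> (q y)" if y: "y \<in> c" for y
  using mv_pts[OF sp(1)[OF y] sec(1)[OF \<phi>[OF qU[OF y]]] sc[OF y]] mv_prj[OF sp(1)[OF y] sec(1)[OF \<phi>[OF qU[OF y]]] sc[OF y]]
   D_iff[OF \<phi>[OF qU[OF y]]] y sec(2)[OF \<phi>[OF qU[OF y]]] by simp_all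
 have mvb: "mv z (?w y) = mv z (s (q y) (v y))" if y: "y \<in> c" and z: "z \<in> pts Y" "\<pi> z = \<phi> (q y)" for y z
  using mv_mv[OF sp(1)[OF y] sec(1)[OF \<phi>[OF qU[OF y]]] z(1) sc[OF y]] sec(2)[OF \<phi>[OF qU[OF y]]] y z by simp
 show "?w \<in> plots (tot desc) c \<longleftrightarrow> smooth_vec c k v"
 proof
  assume b: "?w \<in> plots (tot desc) c"
  have "(\<lambda>y\<in>c. mv ((\<lambda>y\<in>c. \<psi> (q y)) y) (?w y)) \<in> plots (tot E) c"
   by (rule desc_plotsD(5)[OF b c smooth_map_id[OF subset_refl] lift[OF c q]])
    (use wD(2) \<psi>(2) qU in simp)
  moreover have "mv (\<psi> (q y)) (?w y) = s (q y) (v y)" if y: "y \<in> c" for y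
   using mvb[OF y \<psi>[OF qU[OF y]]] mv_id[OF sp(1)[OF y]] sp(2)[OF y] by simp
  ultimately have "(\<lambda>y\<in>c. s (q y) (v y)) \<in> plots (tot E) c" by (simp cong: restrict_cong)
  then show "smooth_vec c k v" using trivialisesD(3)[OF s c q, of v] v by simp
 next
  assume sv: "smooth_vec c k v"
  have pl: "(\<lambda>y\<in>c. s (q y) (v y)) \<in> plots (tot E) c" using trivialisesD(3)[OF s c q, of v] v sv by simp
  show "?w \<in> plots (tot desc) c"
  proof (rule desc_plotsI[OF c])
   show "?w \<in> c \<rightarrow>\<^sub>E D" using wD(1) by auto
   have "(\<lambda>y\<in>c. \<pi> (\<psi> (q y))) \<in> plots X c" by (rule restrict_comp_plot[OF dY \<pi> lift[OF c q]])
   then show "(\<lambda>y\<in>c. \<pi> (prj E (?w y))) \<in> plots X c" using wD(2) \<psi>(2) qU by (simp cong: restrict_cong)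
   fix c' g \<kappa> assume c': "c' \<in> Obj Cart" and g: "smooth_map c' c g" and \<kappa>: "\<kappa> \<in> plots Y c'"
    and p: "\<And>y. y \<in> c' ==> \<pi> (\<kappa> y) = \<pi> (prj E (?w (g y)))"
   note gc = smooth_map_image[OF g]
   have p': "\<pi> (\<kappa> y) = \<phi> (q (g y))" if "y \<in> c'" for y using p[OF that] wD(2)[OF gc[OF that]] by simp
   have "(\<lambda>y\<in>c'. (\<lambda>y\<in>c. s (q y) (v y)) (g y)) \<in> plots (tot E) c'" by (rule dfl_plots_compose[OF vE(4) pl c' g])
   then have "(\<lambda>y\<in>c'. s (q (g y)) (v (g y))) \<in> plots (tot E) c'" using gc by (simp cong: restrict_cong)
   then have "(\<lambda>y\<in>c'. mv (\<kappa> y) (s (q (g y)) (v (g y)))) \<in> plots (tot E) c'"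
    by (rule mv_plot[OF _ plot_restrict[OF dY \<kappa>]]) (use p' sp(2) \<psi>(2) qU gc in simp)
   moreover have "mv (\<kappa> y) (?w (g y)) = mv (\<kappa> y) (s (q (g y)) (v (g y)))" if "y \<in> c'" for y
    by (rule mvb[OF gc[OF that] dfl_plots_pts[OF dY \<kappa> that] p'[OF that]])
   ultimately show "(\<lambda>y\<in>c'. mv (\<kappa> y) (?w (g y))) \<in> plots (tot E) c'" by (simp cong: restrict_cong)
  qed
 qed
qed

text \<open>A subduction provides frames locally, and these give a frame over the whole plot.\<close>

lemma vector_bundle_desc: "vector_bundle X desc"
 unfolding vector_bundle_iff
proof (intro conjI ballI allI impI X)
 have "small D" by (rule small_subset[of "pts (tot E)"]) (use vE(2) DD(1) in "auto simp: Obj_Dfg")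
 then show "tot desc \<in> Obj Dfg" by (simp add: Obj_Dfg diffeological_desc)
 show "prj desc \<in> dfl_hom (tot desc) X"
 proof (rule dfl_homI[OF diffeological_desc])
  show "prj desc \<in> pts (tot desc) \<rightarrow>\<^sub>E pts X" using DD(3) by (auto simp: desc_def)
  fix c b assume b: "b \<in> plots (tot desc) c"
  show "(\<lambda>y\<in>c. prj desc (b y)) \<in> plots X c" using desc_plotsD(3,4)[OF b] by (simp cong: restrict_cong)
 qed
 show "vectorspace class_ring (fibre desc x)" if "x \<in> pts X" for x
  unfolding fibre_desc[OF that] by (rule vE(6)[OF sec(1)[OF that]])
 fix c \<phi> assume \<phi>: "\<phi> \<in> plots X c"
 have c: "c \<in> Obj Cart" by (rule dfl_plots_Cart[OF dX \<phi>])
 obtain K where K: "dgop_covering c K" "\<forall>c' f. (c', f) \<in> K --> (\<exists>\<psi>\<in>plots Y c'. \<forall>y\<in>c'. \<pi> (\<psi> y) = \<phi> (f y))"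
  using lifts[OF \<phi>] by blast
 show "\<exists>k s. trivialises desc c \<phi> k s"
 proof (rule locally_trivial_imp_trivial[OF diffeological_desc c])
  fix y assume y: "y \<in> c"
  obtain c' f where cf: "(c', f) \<in> K" "y \<in> f ` c'" using dgop_coveringD(4)[OF K(1) y] by blast
  obtain \<psi> where \<psi>: "\<psi> \<in> plots Y c'" "\<forall>y\<in>c'. \<pi> (\<psi> y) = \<phi> (f y)" using K(2) cf(1) by blast
  have e: "diffeo c' (f ` c') f" and op: "openin (subtopology Rinf c) (f ` c')"
   using dgop_coveringD(3)[OF K(1) cf(1)] by (auto simp: open_embedding_def)
  obtain f' where f': "smooth_map (f ` c') c' f'" "\<forall>y\<in>f ` c'. f (f' y) = y" using e unfolding diffeo_def by blast
  obtain V0 where V0: "openin Rinf V0" "f ` c' = V0 \<inter> c" using op by (auto simp: openin_subtopology)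
  note f'c = smooth_map_image[OF f'(1)]
  obtain k s where s: "trivialises E c' \<psi> k s" using vE(7)[OF \<psi>(1)] by blast
  have "trivialises desc (f ` c') \<phi> k (\<lambda>y v. mv (sec (\<phi> y)) (s (f' y) v))"
  proof (rule desc_frame[OF trivialises_pull[OF s f'(1)]])
   show "\<psi> (f' y) \<in> pts Y" if "y \<in> f ` c'" for y by (rule dfl_plots_pts[OF dY \<psi>(1) f'c[OF that]])
   show "\<pi> (\<psi> (f' y)) = \<phi> y" if "y \<in> f ` c'" for y using bspec[OF \<psi>(2) f'c[OF that]] bspec[OF f'(2) that] by simp
   show "(\<lambda>y\<in>c0. \<psi> (f' (q y))) \<in> plots Y c0" if "c0 \<in> Obj Cart" "smooth_map c0 (f ` c') q" for c0 q
    by (rule dfl_plots_compose[OF dY \<psi>(1) that(1) smooth_map_compose[OF Cart_locally_bounded[OF that(1)] that(2) f'(1)]])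
  qed
  moreover have "c \<inter> V0 = f ` c'" using V0(2) by auto
  ultimately show "\<exists>W k s. openin Rinf W \<and> y \<in> W \<and> trivialises desc (c \<inter> W) \<phi> k s"
   using V0 cf(2) by (intro exI[of _ V0]) auto
 qed
qed

text \<open>The isomorphism from the pullback of the descended bundle to \<open>E\<close> moves a vector from the chosen point to
the given point. Its inverse respects the gluings since it does.\<close>

lemma desc_effective:
 "\<exists>u w. inverse_arrows dcat (pb_bundle Y \<pi> desc, can_gluing desc) (E, \<alpha>) u w"
proof -
 let ?P = "pb_bundle Y \<pi> desc"
 have P: "vector_bundle Y ?P" by (rule pb_bundle_vector_bundle[OF vector_bundle_desc Y \<pi>])
 define u where "u = (\<lambda>z\<in>pts (pb_space Y \<pi> desc). mv (ufst z) (usnd z))"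
 have u: "u (upair y e) = mv y e" if "y \<in> pts Y" "e \<in> D" "\<pi> y = prj desc e" for y e
  using that by (simp add: u_def)
 have "\<exists>w. inverse_arrows (VBun_cat Y) ?P E u w"
 proof (rule frames_inverse_arrows[OF P E])
  fix c \<psi> assume \<psi>: "\<psi> \<in> plots Y c"
  note \<psi>p = dfl_plots_pts[OF dY \<psi>]
  obtain k s where s: "trivialises E c \<psi> k s" using vE(7)[OF \<psi>] by blast
  define t where "t = (\<lambda>y v. mv (sec ((\<lambda>y\<in>c. \<pi> (\<psi> y)) y)) (s y v))"
  have t: "trivialises desc c (\<lambda>y\<in>c. \<pi> (\<psi> y)) k t"
   unfolding t_def by (rule desc_frame[OF s \<psi>p]) (simp_all add: dfl_plots_compose[OF dY \<psi>])
  have "u (upair (\<psi> y) (t y v)) = s y v" if y: "y \<in> c" and v: "v \<in> carrier_vec k" for y v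
  proof -
   have sp: "s y v \<in> pts (tot E)" "prj E (s y v) = \<psi> y" using trivialises_fibre[OF s y v] by (auto simp: fibre_in_pts)
   have "t y v \<in> D" "prj desc (t y v) = \<pi> (\<psi> y)" using trivialises_fibre[OF t y v] y by (auto simp: fibre_in_pts)
   then have "u (upair (\<psi> y) (t y v)) = mv (\<psi> y) (t y v)" using u[OF \<psi>p[OF y]] by simp
   also have "\<dots> = mv (\<psi> y) (s y v)"
    using mv_mv[OF sp(1) _ \<psi>p[OF y], of "sec (\<pi> (\<psi> y))"] sec[OF \<pi>_pts[OF \<psi>p[OF y]]] sp(2) y by (simp add: t_def)
   finally show ?thesis using mv_id[OF sp(1)] unfolding sp(2) by simp
  qed
  with pb_frame[OF vector_bundle_desc Y \<psi> t] s
  show "\<exists>k s s'. trivialises ?P c \<psi> k s \<and> trivialises E c \<psi> k s' \<and> (\<forall>y\<in>c. \<forall>v\<in>carrier_vec k. u (s y v) = s' y v)" by blast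
 qed (simp add: u_def)
 then obtain w where inv: "inverse_arrows (VBun_cat Y) ?P E u w" by blast
 then have ub: "u \<in> bundle_hom Y ?P E" and wb: "w \<in> bundle_hom Y E ?P"
  and wu: "\<And>z. z \<in> pts (tot ?P) ==> w (u z) = z" and uw: "\<And>e. e \<in> pts (tot E) ==> u (w e) = e"
  unfolding inverse_arrows_def Hom_VBun Cmp_VBun Id_VBun by (auto simp: compose_def fun_eq_iff split: if_splits)
 note can = can_datum[OF vector_bundle_desc] and uD = bundle_homD[OF ub P] and wD = bundle_homD[OF wb E]
 have uc: "mv z (u e) = u (move ?P (can_gluing desc) z e)" if e: "e \<in> pts (tot ?P)" and z: "z \<in> pts Y" "\<pi> (prj ?P e) = \<pi> z" for e z
 proof -
  have "e \<in> pts (pb_space Y \<pi> desc)" using e by simp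
  then obtain y d where d: "e = upair y d" "y \<in> pts Y" "d \<in> D" "\<pi> y = prj desc d" by (auto elim!: pb_cases)
  have yz: "\<pi> y = \<pi> z" using d z by simp
  have "move ?P (can_gluing desc) z e = upair z d" unfolding d(1) by (rule can_move[OF vector_bundle_desc d(2) _ d(4) z(1) yz]) (use d in simp)
  then show ?thesis using d u[of y d] u[of z d] mv_mv[OF DD(1)[OF d(3)] d(2) z(1) _ yz] yz z(1) by simp
 qed
 then have "u \<in> dhom (?P, can_gluing desc) (E, \<alpha>)"
  unfolding descent_hom_iff[OF can datum] using ub by blast
 moreover have "w \<in> dhom (E, \<alpha>) (?P, can_gluing desc)"
  unfolding descent_hom_iff[OF datum can]
 proof (intro conjI wb ballI impI)
  fix e z assume e: "e \<in> pts (tot E)" and z: "z \<in> pts Y" "\<pi> (prj E e) = \<pi> z"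
  interpret C: descent_datum Y X \<pi> ?P "can_gluing desc" by (rule datumI[OF can])
  have "\<pi> (prj ?P (w e)) = \<pi> z" using wD(3)[OF e] z(2) by simp
  note m = C.mv_pts[OF wD(2)[OF e] z(1) this] and c = uc[OF wD(2)[OF e] z(1) this]
  show "move ?P (can_gluing desc) z (w e) = w (mv z e)" using c wu[OF m] uw[OF e] by simp
 qed
 ultimately have "inverse_arrows dcat (?P, can_gluing desc) (E, \<alpha>) u w"
  using inv by (simp add: inverse_arrows_def Cmp_VBun Id_VBun)
 then show ?thesis by blast
qed

end

theorem descent_equivalence:
 assumes "subduction Y X \<pi>"
 shows "is_equivalence (VBun_cat X) (descent_cat VBun_Dfg Y \<pi>) (descent_functor VBun_Dfg Y X \<pi>)"
proof -
 interpret S: subducted Y X \<pi> by (rule subduction_subducted[OF assms])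
 show ?thesis
 proof (rule fully_faithful_ess_surj_equivalence[OF S.descent_functor_functor])
  fix E E' assume "E \<in> Obj (VBun_cat X)" "E' \<in> Obj (VBun_cat X)"
  then have E: "vector_bundle X E" and E': "vector_bundle X E'" by (simp_all add: Obj_VBun)
  show "bij_betw (FM S.DF E E') (Hom (VBun_cat X) E E')
    (Hom S.dcat (FO S.DF E) (FO S.DF E'))"
  proof (rule bij_betw_imageI)
   show "inj_on (FM S.DF E E') (Hom (VBun_cat X) E E')"
    by (rule inj_onI) (use S.pb_map_faithful[OF E E'] in "simp add: Hom_VBun")
   show "FM S.DF E E' ` Hom (VBun_cat X) E E' =
    Hom S.dcat (FO S.DF E) (FO S.DF E')"
   proof
    show "FM S.DF E E' ` Hom (VBun_cat X) E E' \<subseteq>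
     Hom S.dcat (FO S.DF E) (FO S.DF E')"
     using is_functorD(4)[OF S.descent_functor_functor, of E E'] E E' by (auto simp: Obj_VBun)
    show "Hom S.dcat (FO S.DF E) (FO S.DF E') \<subseteq>
     FM S.DF E E' ` Hom (VBun_cat X) E E'"
    proof
     fix w assume "w \<in> Hom S.dcat (FO S.DF E) (FO S.DF E')"
     then have "w \<in> S.dhom (pb_bundle Y \<pi> E, S.can_gluing E) (pb_bundle Y \<pi> E', S.can_gluing E')"
      by (simp add: S.canonical(1)[OF E] S.canonical(1)[OF E'])
     then obtain u where "u \<in> bundle_hom X E E'" "pb_map Y \<pi> E u = w" by (rule S.pb_map_full[OF E E'])
     then show "w \<in> FM S.DF E E' ` Hom (VBun_cat X) E E'" by (auto simp: Hom_VBun)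
    qed
   qed
  qed
 next
  fix a assume "a \<in> Obj S.dcat"
  then obtain E \<alpha> where a: "a = (E, \<alpha>)" and d: "(E, \<alpha>) \<in> S.dobj" by (cases a) auto
  interpret A: descended Y X \<pi> E \<alpha>
   by (rule descended.intro[OF S.subducted_axioms S.datumI[OF d]])
  show "\<exists>x\<in>Obj (VBun_cat X). \<exists>e e'. inverse_arrows S.dcat (FO S.DF x) a e e'"
   unfolding a using A.desc_effective A.vector_bundle_desc
   by (intro bexI[of _ A.desc]) (simp_all add: Obj_VBun S.canonical(1))
 qed
qed

theorem theorem1p3:
 shows "pseudofunctor_op Dfg (VBun_Dfg :: ('u::universe dfl, 'u \<Rightarrow> 'u, 'u vbundle, 'u \<Rightarrow> 'u) pseudo) \<and>
  strict_functor_op Dfg (VBun_str :: ('u dfl, 'u \<Rightarrow> 'u, 'u str_obj, 'u str_mor) diagram) \<and>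
  (\<exists>A. objectwise_equivalence_op Dfg
    (as_pseudo (VBun_str :: ('u dfl, 'u \<Rightarrow> 'u, 'u str_obj, 'u str_mor) diagram))
    (VBun_Dfg :: ('u dfl, 'u \<Rightarrow> 'u, 'u vbundle, 'u \<Rightarrow> 'u) pseudo) A) \<and>
  (\<forall>(Y :: 'u dfl) X \<pi>. subduction Y X \<pi> \<longrightarrow>
    is_equivalence (Val VBun_Dfg X) (descent_cat VBun_Dfg Y \<pi>) (descent_functor VBun_Dfg Y X \<pi>))"
proof (intro conjI allI impI)
 show "pseudofunctor_op Dfg (VBun_Dfg :: ('u dfl, 'u => 'u, 'u vbundle, 'u => 'u) pseudo)" by (rule pseudofunctor_VBun_Dfg)
 show "strict_functor_op Dfg (VBun_str :: ('u dfl, 'u => 'u, 'u str_obj, 'u str_mor) diagram)" by (rule strict_functor_VBun_str)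
 show "\<exists>A. objectwise_equivalence_op Dfg (as_pseudo (VBun_str :: ('u dfl, 'u => 'u, 'u str_obj, 'u str_mor) diagram))
   (VBun_Dfg :: ('u dfl, 'u => 'u, 'u vbundle, 'u => 'u) pseudo) A"
  using str_trans_objectwise_equivalence by blast
 show "is_equivalence (Val VBun_Dfg X) (descent_cat VBun_Dfg Y \<pi>) (descent_functor VBun_Dfg Y X \<pi>)"
  if "subduction Y X \<pi>" for Y X :: "'u dfl" and \<pi>
  using descent_equivalence[OF that] by simp
qed

end
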